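(* For each $e \in S^{d-1}$ there exist a real number $\tilde{\varphi}(e)$ depending only on $\mathbb{P}$ and an event $\tilde{\Omega}_{e} \in \Sigma_{e}$ with $\mathbb{P}(\tilde{\Omega}_{e}) = 1$ such that for every $\omega \in \tilde{\Omega}_{e}$ and every $\kappa > 0$, \begin{align*} \tilde{\varphi}(e) &= \lim_{R \to \infty} R^{1-d} \tilde{\varphi}^{\omega}_{\infty}(e,Q(0,R)) = \lim_{h \to \infty} \limsup_{R \to \infty} R^{1-d} \tilde{\varphi}^{\omega}(e,Q(0,R),h) \\ &= \lim_{h \to \infty} \liminf_{R \to \infty} R^{1-d} \tilde{\varphi}^{\omega}(e,Q(0,R),h) = \lim_{R \to \infty} R^{1-d} \tilde{\varphi}^{\omega}(e,Q(0,R),\kappa R), \end{align*} all limits existing.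
   Context: Setting: $d \geq 1$, $\lambda,\Lambda \in (0,\infty)$; $\mathscr{F}_{d}(\lambda,\Lambda)$ is the set of continuous $\varphi : S^{d-1} \to [0,\infty)$ with $\sqrt{\lambda} \leq \varphi \leq \sqrt{\Lambda}$ and convex one-homogeneous extension, with the Borel $\sigma$-algebra of the sup norm. $(\Omega,\mathscr{B},\mathbb{P})$ is a probability space with measurable $\Phi : \Omega \to \mathscr{F}_{d}(\lambda,\Lambda)$ and a jointly measurable group action $\tau : \mathbb{R}^{d} \times \Omega \to \Omega$ ($\tau_{x+y} = \tau_{x}\circ\tau_{y}$, $\tau_{0} = \mathrm{Id}$) preserving $\mathbb{P}$ and ergodic (events invariant under all $\tau_{x}$ have probability $0$ or $1$). $\varphi^{\omega}(x,p) = \|p\|\Phi^{\tau_{x}\omega}(p/\|p\|)$ for $p \neq 0$, $\varphi^{\omega}(x,0)=0$. $W : [-1,1] \to [0,\infty)$ is continuous with zero set $\{-1,1\}$. For open $A \subseteq \mathbb{R}^{d}$ and $u \in H^{1}_{\mathrm{loc}}(A)$ with $-1 \le u \le 1$, $\mathcal{F}^{\omega}(u;A) = \int_{A} \left(\frac{1}{2}\varphi^{\omega}(x,Du)^{2} + W(u)\right) dx$. Fix a smooth $q : \mathbb{R} \to [-1,1]$ with $\int_{\mathbb{R}} (\frac{\Lambda}{2} q'(s)^{2} + W(q(s)))\,ds < \infty$ and $\lim_{s \to \pm\infty} q(s) = \pm 1$. For $e \in S^{d-1}$ let $q_{e}(y) = q(\langle y, e\rangle)$. Fix for each $e$ a linear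 isometry $O_{e} : \mathbb{R}^{d-1} \to \mathbb{R}^{d}$ onto $\langle e \rangle^{\perp}$, and for $A \subseteq \mathbb{R}^{d-1}$, $B \subseteq \mathbb{R}$ set $A \oplus_{e} B = \{O_{e}(a) + b e : a \in A, b \in B\}$. Fix an orthonormal basis $e_{1},\dots,e_{d-1}$ of $\mathbb{R}^{d-1}$ and let $Q(y,r) = \{x \in \mathbb{R}^{d-1} : \max_{i} |\langle x - y, e_{i}\rangle| < r/2\}$. For $e \in S^{d-1}$, bounded open $A \subseteq \mathbb{R}^{d-1}$ and $h > 0$: $\tilde{\varphi}^{\omega}(e,A,h) = \inf\{ \mathcal{F}^{\omega}(u; A \oplus_{e}(-h,h)) : u \in H^{1}(A\oplus_{e}(-h,h);[-1,1]),\ u - q_{e} \in H^{1}_{0}(A \oplus_{e}(-h,h))\}$ and $\tilde{\varphi}^{\omega}_{\infty}(e,A) = \min\{ \mathcal{F}^{\omega}(u; A \oplus_{e} \mathbb{R}) : u \in H^{1}_{\mathrm{loc}}(A\oplus_{e}\mathbb{R}),\ -1 \leq u \leq 1,\ u - q_{e} \in H^{1}_{0}(A \oplus_{e} \mathbb{R})\}$. $\Sigma_{e}$ is the sub-$\sigma$-algebra of $\mathscr{B}$ generated by events $E$ with $\tau_{x}^{-1}(E) = E$ for all $x \in \langle e \rangle^{\perp}$. *)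

theory Defs
  imports "HOL-Analysis.Analysis" "HOL-Probability.Probability"
begin

coinductive smooth_fn :: "('a::real_normed_vector \<Rightarrow> real) \<Rightarrow> bool" where
  "(\<forall>x. f differentiable (at x)) \<Longrightarrow>
   (\<forall>v. smooth_fn (\<lambda>x. frechet_derivative f (at x) v)) \<Longrightarrow> smooth_fn f"

definition tsupport :: "('a::real_normed_vector \<Rightarrow> real) \<Rightarrow> 'a set" where
  "tsupport f = closure {x. f x \<noteq> 0}"

definition test_fn :: "'a::euclidean_space set \<Rightarrow> ('a \<Rightarrow> real) \<Rightarrow> bool" where
  "test_fn A \<psi> \<longleftrightarrow> smooth_fn \<psi> \<and> compact (tsupport \<psi>) \<and> tsupport \<psi> \<subseteq> A"

definition grad_fn :: "('a::euclidean_space \<Rightarrow> real) \<Rightarrow> 'a \<Rightarrow> 'a" where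
  "grad_fn \<psi> x = (\<Sum>b\<in>Basis. frechet_derivative \<psi> (at x) b *\<^sub>R b)"

definition L2loc :: "'a::euclidean_space set \<Rightarrow> ('a \<Rightarrow> real) \<Rightarrow> bool" where
  "L2loc A f \<longleftrightarrow> (\<lambda>x. indicator A x * f x) \<in> borel_measurable lebesgue \<and>
     (\<forall>K. compact K \<and> K \<subseteq> A \<longrightarrow> integrable lebesgue (\<lambda>x. indicator K x * (f x)\<^sup>2))"

definition L2loc_vec :: "'a::euclidean_space set \<Rightarrow> ('a \<Rightarrow> 'a) \<Rightarrow> bool" where
  "L2loc_vec A G \<longleftrightarrow> (\<lambda>x. indicator A x *\<^sub>R G x) \<in> borel_measurable lebesgue \<and>
     (\<forall>K. compact K \<and> K \<subseteq> A \<longrightarrow> integrable lebesgue (\<lambda>x. indicator K x * (norm (G x))\<^sup>2))"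

definition weak_grad :: "'a::euclidean_space set \<Rightarrow> ('a \<Rightarrow> real) \<Rightarrow> ('a \<Rightarrow> 'a) \<Rightarrow> bool" where
  "weak_grad A u G \<longleftrightarrow> (\<forall>\<psi> v. test_fn A \<psi> \<longrightarrow>
      integral\<^sup>L lebesgue (\<lambda>x. indicator A x * u x * frechet_derivative \<psi> (at x) v)
      = - integral\<^sup>L lebesgue (\<lambda>x. indicator A x * (G x \<bullet> v) * \<psi> x))"

definition H1loc :: "'a::euclidean_space set \<Rightarrow> ('a \<Rightarrow> real) \<Rightarrow> ('a \<Rightarrow> 'a) \<Rightarrow> bool" where
  "H1loc A u G \<longleftrightarrow> L2loc A u \<and> L2loc_vec A G \<and> weak_grad A u G"

definition H1 :: "'a::euclidean_space set \<Rightarrow> ('a \<Rightarrow> real) \<Rightarrow> ('a \<Rightarrow> 'a) \<Rightarrow> bool" where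
  "H1 A u G \<longleftrightarrow> H1loc A u G \<and>
     integrable lebesgue (\<lambda>x. indicator A x * (u x)\<^sup>2) \<and>
     integrable lebesgue (\<lambda>x. indicator A x * (norm (G x))\<^sup>2)"

definition H10 :: "'a::euclidean_space set \<Rightarrow> ('a \<Rightarrow> real) \<Rightarrow> ('a \<Rightarrow> 'a) \<Rightarrow> bool" where
  "H10 A w G \<longleftrightarrow> H1 A w G \<and> (\<exists>\<psi>s. (\<forall>n. test_fn A (\<psi>s n)) \<and>
     (\<lambda>n. integral\<^sup>L lebesgue (\<lambda>x. indicator A x *
          ((w x - \<psi>s n x)\<^sup>2 + (norm (G x - grad_fn (\<psi>s n) x))\<^sup>2))) \<longlonglongrightarrow> 0)"

text \<open>Elements are represented by their (unique) convex one-homogeneous extension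
  to the whole space; the restriction to the unit sphere is the function of the paper.\<close>
definition Fclass :: "real \<Rightarrow> real \<Rightarrow> ('d::euclidean_space \<Rightarrow> real) set" where
  "Fclass lam Lam = {\<psi>. continuous_on (sphere 0 1) \<psi> \<and> convex_on UNIV \<psi> \<and>
      (\<forall>p t. t \<ge> 0 \<longrightarrow> \<psi> (t *\<^sub>R p) = t * \<psi> p) \<and>
      (\<forall>p\<in>sphere 0 1. sqrt lam \<le> \<psi> p \<and> \<psi> p \<le> sqrt Lam)}"

definition supdist :: "('d::euclidean_space \<Rightarrow> real) \<Rightarrow> ('d \<Rightarrow> real) \<Rightarrow> real" where
  "supdist f g = (SUP p\<in>sphere 0 1. \<bar>f p - g p\<bar>)"

definition Fopen :: "real \<Rightarrow> real \<Rightarrow> ('d::euclidean_space \<Rightarrow> real) set set" where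
  "Fopen lam Lam = {U. U \<subseteq> Fclass lam Lam \<and>
      (\<forall>f\<in>U. \<exists>\<epsilon>>0. \<forall>g\<in>Fclass lam Lam. supdist f g < \<epsilon> \<longrightarrow> g \<in> U)}"

definition Fmeas :: "real \<Rightarrow> real \<Rightarrow> ('d::euclidean_space \<Rightarrow> real) measure" where
  "Fmeas lam Lam = sigma (Fclass lam Lam) (Fopen lam Lam)"

text \<open>B e plays the role of the images O_e(e_1), ..., O_e(e_{d-1}) of the fixed
  orthonormal basis of R^{d-1}: an orthonormal basis of the orthogonal complement of e.
  cyl B e R h = Q(0,R) (+)_e (-h,h), cyl_inf B e R = Q(0,R) (+)_e R.\<close>
definition cyl :: "('d::euclidean_space \<Rightarrow> 'd set) \<Rightarrow> 'd \<Rightarrow> real \<Rightarrow> real \<Rightarrow> 'd set" where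
  "cyl B e R h = {x. (\<forall>b\<in>B e. \<bar>x \<bullet> b\<bar> < R / 2) \<and> \<bar>x \<bullet> e\<bar> < h}"

definition cyl_inf :: "('d::euclidean_space \<Rightarrow> 'd set) \<Rightarrow> 'd \<Rightarrow> real \<Rightarrow> 'd set" where
  "cyl_inf B e R = {x. \<forall>b\<in>B e. \<bar>x \<bullet> b\<bar> < R / 2}"

definition energy :: "('w \<Rightarrow> 'd \<Rightarrow> real) \<Rightarrow> ('d \<Rightarrow> 'w \<Rightarrow> 'w) \<Rightarrow> (real \<Rightarrow> real) \<Rightarrow> 'w
     \<Rightarrow> 'd::euclidean_space set \<Rightarrow> ('d \<Rightarrow> real) \<Rightarrow> ('d \<Rightarrow> 'd) \<Rightarrow> ennreal" where
  "energy \<Phi> \<tau> W \<omega> A u G =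
     (\<integral>\<^sup>+ x. ennreal (indicator A x * (1/2 * (\<Phi> (\<tau> x \<omega>) (G x))\<^sup>2 + W (u x))) \<partial>lebesgue)"

definition phi_fin :: "('w \<Rightarrow> 'd \<Rightarrow> real) \<Rightarrow> ('d \<Rightarrow> 'w \<Rightarrow> 'w) \<Rightarrow> (real \<Rightarrow> real) \<Rightarrow> (real \<Rightarrow> real)
     \<Rightarrow> ('d::euclidean_space \<Rightarrow> 'd set) \<Rightarrow> 'w \<Rightarrow> 'd \<Rightarrow> real \<Rightarrow> real \<Rightarrow> ennreal" where
  "phi_fin \<Phi> \<tau> W q B \<omega> e R h =
     (let D = cyl B e R h in
      INF uG \<in> {(u, G). H1 D u G \<and> (\<forall>x\<in>D. -1 \<le> u x \<and> u x \<le> 1) \<and>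
                 H10 D (\<lambda>x. u x - q (x \<bullet> e)) (\<lambda>x. G x - deriv q (x \<bullet> e) *\<^sub>R e)}.
        energy \<Phi> \<tau> W \<omega> D (fst uG) (snd uG))"

definition phi_inf :: "('w \<Rightarrow> 'd \<Rightarrow> real) \<Rightarrow> ('d \<Rightarrow> 'w \<Rightarrow> 'w) \<Rightarrow> (real \<Rightarrow> real) \<Rightarrow> (real \<Rightarrow> real)
     \<Rightarrow> ('d::euclidean_space \<Rightarrow> 'd set) \<Rightarrow> 'w \<Rightarrow> 'd \<Rightarrow> real \<Rightarrow> ennreal" where
  "phi_inf \<Phi> \<tau> W q B \<omega> e R =
     (let D = cyl_inf B e R in
      INF uG \<in> {(u, G). H1loc D u G \<and> (\<forall>x\<in>D. -1 \<le> u x \<and> u x \<le> 1) \<and>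
                 H10 D (\<lambda>x. u x - q (x \<bullet> e)) (\<lambda>x. G x - deriv q (x \<bullet> e) *\<^sub>R e)}.
        energy \<Phi> \<tau> W \<omega> D (fst uG) (snd uG))"

definition Sigma_e :: "'w measure \<Rightarrow> ('d::euclidean_space \<Rightarrow> 'w \<Rightarrow> 'w) \<Rightarrow> 'd \<Rightarrow> 'w set set" where
  "Sigma_e M \<tau> e = sigma_sets (space M)
     {E \<in> sets M. \<forall>x. x \<bullet> e = 0 \<longrightarrow> \<tau> x -` E \<inter> space M = E}"

end

theory Submission
  imports Defs "HOL-Computational_Algebra.Polynomial"
begin

text \<open>
  On a cube the cell energy is subadditive up to the energy of the planar profile on the uncovered
  part, so a multiparameter subadditive ergodic theorem for the translations orthogonal to \<open>e\<close>
  applies, both to the infinite cylinder and to cylinders of finite height. The upper bound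
  \<open>\<integral> limsup \<le> inf\<close> comes from averaging over a grid of cells; the lower bound on the liminf from
  a Vitali covering by cubes of small energy. The action orthogonal to \<open>e\<close> need not be ergodic, but
  the limsup for the infinite cylinder is also invariant under translations along \<open>e\<close>: bending
  the boundary profile near the lateral boundary costs only a surface term. Ergodicity of the full
  action then forces the limit to be the infimum of the normalised mean energies. Finite and infinite
  heights differ, uniformly in the size of the cube, by the tail energy of \<open>q\<close>.
\<close>

section \<open>Limits inferior and superior\<close>

lemma ennreal_add_le: "ennreal (a + b) \<le> ennreal a + ennreal b"
proof (cases "0 \<le> a \<and> 0 \<le> b")
  case False
  then have "a + b \<le> a \<or> a + b \<le> b" by linarith
  then show ?thesis by (meson add_increasing add_increasing2 ennreal_leI zero_le)
qed (simp add: ennreal_plus)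

lemma Limsup_ennreal_add_le:
  fixes f g :: "'a \<Rightarrow> ennreal"
  shows "Limsup F (\<lambda>x. f x + g x) \<le> Limsup F f + Limsup F g"
proof (cases "Limsup F f + Limsup F g = \<top>")
  case False
  then obtain a b where ab: "Limsup F f = ennreal a" "Limsup F g = ennreal b"
    by (metis ennreal_cases ennreal_add_eq_top)
  show ?thesis
  proof (rule ennreal_le_epsilon)
    fix \<epsilon> :: real assume \<epsilon>: "0 < \<epsilon>"
    have less: "r < r + ennreal (\<epsilon> / 2)" if "r \<noteq> \<top>" for r
      using that \<epsilon> by (cases r) (auto simp: ennreal_less_iff simp flip: ennreal_plus)
    have "\<forall>\<^sub>F x in F. f x < Limsup F f + ennreal (\<epsilon> / 2)" "\<forall>\<^sub>F x in F. g x < Limsup F g + ennreal (\<epsilon> / 2)"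
      using ab \<epsilon> by (auto intro!: Limsup_lessD less)
    then have "\<forall>\<^sub>F x in F. f x + g x \<le> (Limsup F f + ennreal (\<epsilon> / 2)) + (Limsup F g + ennreal (\<epsilon> / 2))"
      by eventually_elim (intro add_mono less_imp_le)
    moreover have "(Limsup F f + ennreal (\<epsilon> / 2)) + (Limsup F g + ennreal (\<epsilon> / 2))
      = Limsup F f + Limsup F g + ennreal \<epsilon>"
      using \<epsilon> by (simp add: ac_simps flip: ennreal_plus)
    ultimately show "Limsup F (\<lambda>x. f x + g x) \<le> Limsup F f + Limsup F g + ennreal \<epsilon>"
      by (intro Limsup_bounded) simp
  qed
qed (simp only: top_greatest)

lemma Limsup_le_Limsup_comp:
  fixes f r :: "'a \<Rightarrow> ennreal" and g :: "'b \<Rightarrow> ennreal"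
  assumes k: "filterlim k G F" and eventually_le: "\<forall>\<^sub>F x in F. f x \<le> g (k x) + r x" and r: "(r \<longlongrightarrow> 0) F"
  shows "Limsup F f \<le> Limsup G g"
  unfolding Limsup_le_iff
proof (intro allI impI)
  fix y assume "Limsup G g < y"
  then obtain z where z: "Limsup G g < z" "z < y" using dense by blast
  have "((\<lambda>x. z + r x) \<longlongrightarrow> z + 0) F" by (intro tendsto_intros r)
  then have "\<forall>\<^sub>F x in F. z + r x < y" using z(2) by (intro order_tendstoD) auto
  with eventually_le eventually_compose_filterlim[OF Limsup_lessD[OF z(1)] k] show "\<forall>\<^sub>F x in F. f x < y"
    by eventually_elim (meson add_right_mono less_imp_le order_le_less_trans)
qed

lemma Liminf_comp_le_Liminf:
  fixes f r :: "'a \<Rightarrow> ennreal" and g :: "'b \<Rightarrow> ennreal"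
  assumes k: "filterlim k G F" and eventually_le: "\<forall>\<^sub>F x in F. g (k x) \<le> f x + r x" and r: "(r \<longlongrightarrow> 0) F"
  shows "Liminf G g \<le> Liminf F f"
  unfolding le_Liminf_iff
proof (intro allI impI)
  fix y assume "y < Liminf G g"
  then obtain z where z: "z < Liminf G g" "y < z" using dense by blast
  have "((\<lambda>x. y + r x) \<longlongrightarrow> y + 0) F" by (intro tendsto_intros r)
  then have "\<forall>\<^sub>F x in F. y + r x < z" using z(2) by (intro order_tendstoD) auto
  with eventually_le eventually_compose_filterlim[OF less_LiminfD[OF z(1)] k] show "\<forall>\<^sub>F x in F. y < f x"
    by eventually_elim (meson add_right_mono leI less_imp_le order_less_irrefl order_le_less_trans order_trans)
qed

lemma nn_integral_limsup_eq_INF: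
  fixes F :: "nat \<Rightarrow> 'a \<Rightarrow> ennreal"
  assumes [measurable]: "\<And>N. F N \<in> borel_measurable M" and fin: "(\<integral>\<^sup>+x. (SUP N. F N x) \<partial>M) < \<infinity>"
  shows "(\<integral>\<^sup>+x. limsup (\<lambda>N. F N x) \<partial>M) = (INF m. \<integral>\<^sup>+x. (SUP N\<in>{m..}. F N x) \<partial>M)"
  unfolding limsup_INF_SUP
proof (rule nn_integral_monotone_convergence_INF_decseq[where i=0])
  show "decseq (\<lambda>m x. SUP N\<in>{m..}. F N x)" by (intro decseq_SucI le_funI SUP_subset_mono) auto
qed (use fin in \<open>simp_all add: atLeast_0\<close>)

lemma positive_part_tendsto_0_if_limsup_le:
  fixes y :: "nat \<Rightarrow> real"
  assumes "limsup (\<lambda>N. ennreal (y N)) \<le> ennreal \<gamma>" and \<gamma>: "0 \<le> \<gamma>"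
  shows "(\<lambda>N. max 0 (y N - \<gamma>)) \<longlonglongrightarrow> 0"
proof (rule tendstoI)
  fix \<epsilon> :: real assume \<epsilon>: "0 < \<epsilon>"
  then have "limsup (\<lambda>N. ennreal (y N)) < ennreal (\<gamma> + \<epsilon>)"
    using \<gamma> by (intro order_le_less_trans[OF assms(1)] ennreal_lessI) auto
  then have "\<forall>\<^sub>F N in sequentially. ennreal (y N) < ennreal (\<gamma> + \<epsilon>)" by (rule Limsup_lessD)
  then show "\<forall>\<^sub>F N in sequentially. dist (max 0 (y N - \<gamma>)) 0 < \<epsilon>"
  proof eventually_elim
    case (elim N)
    then have "y N < \<gamma> + \<epsilon>" by (rule contrapos_pp) (simp only: not_less ennreal_leI)
    then show ?case using \<epsilon> by (simp add: max_def)
  qed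
qed

section \<open>Ergodic averages\<close>

definition birkhoff_sum :: "('a \<Rightarrow> 'a) \<Rightarrow> ('a \<Rightarrow> real) \<Rightarrow> nat \<Rightarrow> 'a \<Rightarrow> real" where
  "birkhoff_sum T f N x = (\<Sum>i<N. f ((T ^^ i) x))"

lemma birkhoff_sum_add: "birkhoff_sum T f (m + n) x = birkhoff_sum T f m x + birkhoff_sum T f n ((T ^^ m) x)"
proof -
  have "(T ^^ (m + i)) x = (T ^^ i) ((T ^^ m) x)" for i by (metis add.commute comp_apply funpow_add)
  then show ?thesis by (induction n) (simp_all add: birkhoff_sum_def)
qed

lemma birkhoff_sum_nonneg: "(\<And>i. 0 \<le> f ((T ^^ i) x)) \<Longrightarrow> 0 \<le> birkhoff_sum T f N x"
  by (simp add: birkhoff_sum_def sum_nonneg)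

lemma birkhoff_sum_ge_if_blocks:
  assumes nonneg: "\<And>i. 0 \<le> g ((T ^^ i) x)" and a: "0 \<le> a"
    and block: "\<And>i. \<exists>n\<in>{1..K}. real n * a \<le> birkhoff_sum T g n ((T ^^ i) x)"
  shows "(real m - real K) * a \<le> birkhoff_sum T g m x"
  using nonneg block
proof (induction m arbitrary: x rule: less_induct)
  case (less m x)
  show ?case
  proof (cases "m \<le> K")
    case True
    then have "(real m - real K) * a \<le> 0" using a by (simp add: mult_nonpos_nonneg)
    also have "0 \<le> birkhoff_sum T g m x" by (intro birkhoff_sum_nonneg less.prems(1))
    finally show ?thesis .
  next
    case False
    obtain n where n: "1 \<le> n" "n \<le> K" "real n * a \<le> birkhoff_sum T g n x"
      using less.prems(2)[of 0] by auto
    have orbit: "(T ^^ i) ((T ^^ n) x) = (T ^^ (i + n)) x" for i by (simp add: funpow_add)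
    have "(real (m - n) - real K) * a \<le> birkhoff_sum T g (m - n) ((T ^^ n) x)"
      by (rule less.IH; (unfold orbit, rule less.prems)?) (use n(1) False in simp)
    then have "(real m - real K) * a \<le> birkhoff_sum T g n x + birkhoff_sum T g (m - n) ((T ^^ n) x)"
      using n False by (simp add: of_nat_diff algebra_simps)
    then show ?thesis using birkhoff_sum_add[of T g n "m - n" x] n False by simp
  qed
qed

lemma limsup_birkhoff_average_le_shift:
  assumes nonneg: "\<And>i. 0 \<le> f ((T ^^ i) x)"
  shows "limsup (\<lambda>N. ennreal (birkhoff_sum T f N x / real N))
    \<le> limsup (\<lambda>N. ennreal (birkhoff_sum T f N (T x) / real N))"
proof (rule Limsup_le_Limsup_comp[OF filterlim_minus_const_nat_at_top[of 1]])
  have shifted: "birkhoff_sum T f (Suc N) x / real (Suc N)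
    \<le> birkhoff_sum T f N (T x) / real N + f x / real (Suc N)" for N
  proof (cases "N = 0")
    case False
    have "0 \<le> birkhoff_sum T f N (T x)"
      using nonneg[of "Suc _"] by (intro birkhoff_sum_nonneg) (simp add: funpow_swap1)
    then have "birkhoff_sum T f N (T x) / real (Suc N) \<le> birkhoff_sum T f N (T x) / real N"
      using False by (intro divide_left_mono) auto
    moreover have "birkhoff_sum T f (Suc N) x = f x + birkhoff_sum T f N (T x)"
      using birkhoff_sum_add[of T f 1 N x] by (simp add: birkhoff_sum_def)
    ultimately show ?thesis by (simp add: add_divide_distrib)
  qed (simp add: birkhoff_sum_def)
  show "\<forall>\<^sub>F N in sequentially. ennreal (birkhoff_sum T f N x / real N)
      \<le> ennreal (birkhoff_sum T f (N - 1) (T x) / real (N - 1)) + ennreal (f x / real N)"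
    using eventually_gt_at_top[of 0]
  proof eventually_elim
    case (elim N)
    then show ?case using order_trans[OF ennreal_leI[OF shifted[of "N - 1"]] ennreal_add_le] by simp
  qed
  show "(\<lambda>N. ennreal (f x / real N)) \<longlonglongrightarrow> 0"
    using tendsto_ennrealI[OF lim_const_over_n[of "f x"]] by simp
qed

lemma (in prob_space) integrable_if_bounded:
  fixes f :: "'a \<Rightarrow> real"
  assumes "f \<in> borel_measurable M" "\<And>x. x \<in> space M \<Longrightarrow> 0 \<le> f x \<and> f x \<le> C"
  shows "integrable M f"
  using assms by (intro integrable_const_bound[of _ C]) (auto intro!: AE_I2)

locale measure_preserving = prob_space M for M :: "'a measure" +
  fixes T :: "'a \<Rightarrow> 'a"
  assumes T_measurable: "T \<in> M \<rightarrow>\<^sub>M M" and distr_T: "distr M M T = M"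
begin

lemma funpow_measurable [measurable]: "T ^^ i \<in> M \<rightarrow>\<^sub>M M"
  using T_measurable by (rule measurable_compose_n)

lemma funpow_space: "x \<in> space M \<Longrightarrow> (T ^^ i) x \<in> space M"
  by (rule measurable_space[OF funpow_measurable])

lemma distr_funpow: "distr M M (T ^^ i) = M"
proof (induction i)
  case 0
  show ?case using distr_id[of M] by (simp add: id_def)
next
  case (Suc i)
  have "distr M M (T ^^ Suc i) = distr (distr M M (T ^^ i)) M T"
    using distr_distr[OF T_measurable funpow_measurable[of i]] by simp
  then show ?case using Suc distr_T by (simp add: comp_def)
qed

lemma birkhoff_sum_measurable [measurable]:
  "f \<in> borel_measurable M \<Longrightarrow> birkhoff_sum T f N \<in> borel_measurable M"
  unfolding birkhoff_sum_def
  by (intro borel_measurable_sum measurable_compose[OF funpow_measurable])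

lemma
  assumes f: "integrable M f"
  shows integrable_birkhoff_sum: "integrable M (birkhoff_sum T f N)"
    and integral_birkhoff_sum: "(\<integral>x. birkhoff_sum T f N x \<partial>M) = real N * (\<integral>x. f x \<partial>M)"
proof -
  have [measurable]: "f \<in> borel_measurable M" using f by simp
  have "integrable M (\<lambda>x. f ((T ^^ i) x))" "(\<integral>x. f ((T ^^ i) x) \<partial>M) = (\<integral>x. f x \<partial>M)" for i
    using integrable_distr_eq[of "T ^^ i" M M f] integral_distr[of "T ^^ i" M M f] distr_funpow[of i] f by auto
  then show "integrable M (birkhoff_sum T f N)" "(\<integral>x. birkhoff_sum T f N x \<partial>M) = real N * (\<integral>x. f x \<partial>M)"
    unfolding birkhoff_sum_def by simp_all
qed

lemma integral_le_if_birkhoff_sum_ge: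
  assumes h: "integrable M h" and g: "integrable M g"
    and birkhoff_sum_ge: "\<And>m x. x \<in> space M \<Longrightarrow> (real m - real K) * h x \<le> birkhoff_sum T g m x"
  shows "(\<integral>x. h x \<partial>M) \<le> (\<integral>x. g x \<partial>M)"
proof (rule LIMSEQ_le_const2)
  have "(\<lambda>m. (1 - real K / real m) * (\<integral>x. h x \<partial>M)) \<longlonglongrightarrow> (1 - 0) * (\<integral>x. h x \<partial>M)"
    by (intro tendsto_intros lim_const_over_n)
  then show "(\<lambda>m. (1 - real K / real m) * (\<integral>x. h x \<partial>M)) \<longlonglongrightarrow> (\<integral>x. h x \<partial>M)" by simp
  have "(real m - real K) * (\<integral>x. h x \<partial>M) \<le> real m * (\<integral>x. g x \<partial>M)" for m
  proof -
    have "(\<integral>x. (real m - real K) * h x \<partial>M) \<le> (\<integral>x. birkhoff_sum T g m x \<partial>M)"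
      using birkhoff_sum_ge
      by (intro integral_mono integrable_mult_right h integrable_birkhoff_sum g)
    then show ?thesis by (simp add: integral_birkhoff_sum g)
  qed
  then show "\<exists>m0. \<forall>m\<ge>m0. (1 - real K / real m) * (\<integral>x. h x \<partial>M) \<le> (\<integral>x. g x \<partial>M)"
    by (intro exI[of _ 1]) (simp add: field_simps)
qed

text \<open>Raising \<open>f\<close> to its upper bound on \<open>A\<close>, every point starts a block of length at most \<open>K\<close>
  on which the average is at least \<open>h\<close>.\<close>

lemma integral_le_if_blocks_outside:
  assumes f [measurable]: "f \<in> borel_measurable M" and h [measurable]: "h \<in> borel_measurable M"
    and f_bounds: "\<And>x. x \<in> space M \<Longrightarrow> 0 \<le> f x \<and> f x \<le> C"
    and h_bounds: "\<And>x. x \<in> space M \<Longrightarrow> 0 \<le> h x \<and> h x \<le> C"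
    and h_T: "\<And>x. x \<in> space M \<Longrightarrow> h x \<le> h (T x)"
    and A [measurable]: "A \<in> sets M" and K: "1 \<le> K"
    and block: "\<And>x. x \<in> space M - A \<Longrightarrow> \<exists>n\<in>{1..K}. real n * h x \<le> birkhoff_sum T f n x"
  shows "(\<integral>x. h x \<partial>M) \<le> (\<integral>x. f x \<partial>M) + C * measure M A"
proof -
  have C: "0 \<le> C" using f_bounds not_empty by (meson ex_in_conv order_trans)
  have f_int: "integrable M f" by (rule integrable_if_bounded[OF f f_bounds])
  define g where "g x = f x + C * indicator A x" for x
  have indicator_int: "integrable M (\<lambda>x. C * indicator A x :: real)"
    by (auto simp: emeasure_eq_measure)
  then have g_int: "integrable M g" unfolding g_def using f_int by simp
  have f_le_g: "f x \<le> g x" for x using C by (simp add: g_def indicator_def)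
  have g_block: "\<exists>n\<in>{1..K}. real n * h x \<le> birkhoff_sum T g n x" if x: "x \<in> space M" for x
  proof (cases "x \<in> A")
    case True
    then have "real 1 * h x \<le> birkhoff_sum T g 1 x"
      using f_bounds[OF x] h_bounds[OF x] by (simp add: birkhoff_sum_def g_def)
    then show ?thesis using K by (intro bexI[of _ 1]) auto
  next
    case False
    then obtain n where "n \<in> {1..K}" "real n * h x \<le> birkhoff_sum T f n x" using block x by blast
    moreover have "birkhoff_sum T f n x \<le> birkhoff_sum T g n x"
      unfolding birkhoff_sum_def by (intro sum_mono f_le_g)
    ultimately show ?thesis by (meson order_trans)
  qed
  have h_funpow: "h x \<le> h ((T ^^ i) x)" if "x \<in> space M" for x i
  proof (induction i)
    case (Suc i)
    then show ?case using h_T[OF funpow_space[OF that, of i]] by simp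
  qed simp
  have "(real m - real K) * h x \<le> birkhoff_sum T g m x" if x: "x \<in> space M" for m x
  proof (rule birkhoff_sum_ge_if_blocks)
    fix i
    show "0 \<le> g ((T ^^ i) x)"
      using f_bounds[OF funpow_space[OF x, of i]] f_le_g[of "(T ^^ i) x"] by linarith
    have "real n * h x \<le> real n * h ((T ^^ i) x)" for n
      using h_funpow[OF x] by (intro mult_left_mono) auto
    then show "\<exists>n\<in>{1..K}. real n * h x \<le> birkhoff_sum T g n ((T ^^ i) x)"
      using g_block[OF funpow_space[OF x, of i]] by (meson order_trans)
  qed (use h_bounds[OF x] in simp)
  then have "(\<integral>x. h x \<partial>M) \<le> (\<integral>x. g x \<partial>M)"
    using g_int by (intro integral_le_if_birkhoff_sum_ge integrable_if_bounded[OF h h_bounds])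
  also have "\<dots> = (\<integral>x. f x \<partial>M) + C * measure M A"
    unfolding g_def using f_int indicator_int by (subst Bochner_Integration.integral_add) auto
  finally show ?thesis .
qed

lemma integral_le_if_some_birkhoff_sum_ge:
  assumes f [measurable]: "f \<in> borel_measurable M" and h [measurable]: "h \<in> borel_measurable M"
    and f_bounds: "\<And>x. x \<in> space M \<Longrightarrow> 0 \<le> f x \<and> f x \<le> C"
    and h_bounds: "\<And>x. x \<in> space M \<Longrightarrow> 0 \<le> h x \<and> h x \<le> C"
    and h_T: "\<And>x. x \<in> space M \<Longrightarrow> h x \<le> h (T x)"
    and some: "\<And>x. x \<in> space M \<Longrightarrow> \<exists>n\<ge>1. real n * h x \<le> birkhoff_sum T f n x"
  shows "(\<integral>x. h x \<partial>M) \<le> (\<integral>x. f x \<partial>M)"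
proof -
  define bad where "bad K = {x \<in> space M. \<forall>n\<in>{1..K}. birkhoff_sum T f n x < real n * h x}" for K
  have [measurable]: "bad K \<in> sets M" for K unfolding bad_def by measurable
  have "(\<lambda>K. measure M (bad K)) \<longlonglongrightarrow> measure M (\<Inter>K. bad K)"
    by (intro finite_Lim_measure_decseq) (auto simp: decseq_def bad_def)
  moreover have "\<exists>K. x \<notin> bad K" for x
  proof (cases "x \<in> space M")
    case True
    then obtain n where "1 \<le> n" "real n * h x \<le> birkhoff_sum T f n x" using some by blast
    then have "x \<notin> bad n" unfolding bad_def by (auto simp: not_less intro!: bexI[of _ n])
    then show ?thesis ..
  qed (simp add: bad_def)
  then have "(\<Inter>K. bad K) = {}" by blast
  ultimately have "(\<lambda>K. (\<integral>x. f x \<partial>M) + C * measure M (bad K)) \<longlonglongrightarrow> (\<integral>x. f x \<partial>M) + C * 0"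
    by (intro tendsto_intros) simp
  moreover have "(\<integral>x. h x \<partial>M) \<le> (\<integral>x. f x \<partial>M) + C * measure M (bad K)" if "1 \<le> K" for K
  proof (rule integral_le_if_blocks_outside[OF f h f_bounds h_bounds h_T _ that])
    show "\<exists>n\<in>{1..K}. real n * h x \<le> birkhoff_sum T f n x" if "x \<in> space M - bad K" for x
      using that by (auto simp: bad_def not_less)
  qed measurable
  ultimately show ?thesis by (intro LIMSEQ_le_const[of _ "\<integral>x. f x \<partial>M"]) auto
qed

lemma birkhoff_average_le:
  assumes x: "x \<in> space M" and f_le: "\<And>x. x \<in> space M \<Longrightarrow> f x \<le> C" and C: "0 \<le> C"
  shows "birkhoff_sum T f N x / real N \<le> C"
proof -
  have "birkhoff_sum T f N x \<le> real N * C"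
    using sum_bounded_above[of "{..<N}" "\<lambda>i. f ((T ^^ i) x)" C] f_le funpow_space[OF x]
    by (simp add: birkhoff_sum_def)
  then show ?thesis using C by (cases "N = 0") (auto simp: field_simps)
qed

lemma exists_birkhoff_sum_ge_if_less_limsup:
  assumes "ennreal a < limsup (\<lambda>N. ennreal (birkhoff_sum T f N x / real N))"
  shows "\<exists>n\<ge>1. real n * a \<le> birkhoff_sum T f n x"
proof (rule ccontr)
  assume "\<not> ?thesis"
  then have "birkhoff_sum T f n x < a * real n" if "1 \<le> n" for n
    using that by (metis mult.commute not_le)
  then have "birkhoff_sum T f n x / real n \<le> a" if "1 \<le> n" for n
    using that by (simp add: divide_le_eq less_imp_le)
  then have "limsup (\<lambda>N. ennreal (birkhoff_sum T f N x / real N)) \<le> ennreal a"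
    by (intro Limsup_bounded eventually_mono[OF eventually_ge_at_top[of 1]] ennreal_leI)
  then show False using assms by simp
qed

lemma integral_le_if_le_limsup_average:
  assumes f [measurable]: "f \<in> borel_measurable M" and F [measurable]: "F \<in> borel_measurable M"
    and f_bounds: "\<And>x. x \<in> space M \<Longrightarrow> 0 \<le> f x \<and> f x \<le> C"
    and F_bounds: "\<And>x. x \<in> space M \<Longrightarrow> 0 \<le> F x \<and> F x \<le> C"
    and F_T: "\<And>x. x \<in> space M \<Longrightarrow> F x \<le> F (T x)"
    and F_le: "\<And>x. x \<in> space M \<Longrightarrow> ennreal (F x) \<le> limsup (\<lambda>N. ennreal (birkhoff_sum T f N x / real N))"
  shows "(\<integral>x. F x \<partial>M) \<le> (\<integral>x. f x \<partial>M)"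
proof (rule field_le_epsilon)
  fix \<epsilon> :: real assume \<epsilon>: "0 < \<epsilon>"
  have C: "0 \<le> C" using f_bounds not_empty by (meson ex_in_conv order_trans)
  have F_int: "integrable M F" by (rule integrable_if_bounded[OF F F_bounds])
  have some: "\<exists>n\<ge>1. real n * max 0 (F x - \<epsilon>) \<le> birkhoff_sum T f n x" if x: "x \<in> space M" for x
  proof (cases "F x \<le> \<epsilon>")
    case True
    then show ?thesis using f_bounds[OF x] by (intro exI[of _ 1]) (simp add: birkhoff_sum_def)
  next
    case False
    then have "ennreal (max 0 (F x - \<epsilon>)) < ennreal (F x)" using \<epsilon> by (simp add: ennreal_less_iff)
    then show ?thesis
      by (intro exists_birkhoff_sum_ge_if_less_limsup order_less_le_trans[OF _ F_le[OF x]])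
  qed
  have "(\<integral>x. max 0 (F x - \<epsilon>) \<partial>M) \<le> (\<integral>x. f x \<partial>M)"
  proof (rule integral_le_if_some_birkhoff_sum_ge[OF f _ f_bounds _ _ some])
    fix x assume "x \<in> space M"
    then show "0 \<le> max 0 (F x - \<epsilon>) \<and> max 0 (F x - \<epsilon>) \<le> C" "max 0 (F x - \<epsilon>) \<le> max 0 (F (T x) - \<epsilon>)"
      using F_bounds[of x] F_T[of x] \<epsilon> C by auto
  qed measurable
  moreover have "(\<integral>x. F x - \<epsilon> \<partial>M) \<le> (\<integral>x. max 0 (F x - \<epsilon>) \<partial>M)"
    using F_int by (intro integral_mono) auto
  ultimately show "(\<integral>x. F x \<partial>M) \<le> (\<integral>x. f x \<partial>M) + \<epsilon>" using F_int by (simp add: prob_space)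
qed

lemma nn_integral_limsup_average_le:
  assumes f [measurable]: "f \<in> borel_measurable M" and f_bounds: "\<And>x. x \<in> space M \<Longrightarrow> 0 \<le> f x \<and> f x \<le> C"
  shows "(\<integral>\<^sup>+x. limsup (\<lambda>N. ennreal (birkhoff_sum T f N x / real N)) \<partial>M) \<le> (\<integral>\<^sup>+x. ennreal (f x) \<partial>M)"
  (is "(\<integral>\<^sup>+x. ?L x \<partial>M) \<le> _")
proof -
  have C: "0 \<le> C" using f_bounds not_empty by (meson ex_in_conv order_trans)
  define F where "F x = enn2real (?L x)" for x
  have [measurable]: "F \<in> borel_measurable M" unfolding F_def by measurable
  have L_le: "?L x \<le> ennreal C" if "x \<in> space M" for x
    using f_bounds C that
    by (intro Limsup_bounded always_eventually allI ennreal_leI birkhoff_average_le) auto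
  have F: "?L x = ennreal (F x)" if "x \<in> space M" for x
    unfolding F_def
    using L_le[OF that] by (intro ennreal_enn2real[symmetric]) (simp add: order_le_less_trans)
  have F_nonneg: "0 \<le> F x" for x by (simp add: F_def)
  have F_bounds: "0 \<le> F x \<and> F x \<le> C" if "x \<in> space M" for x
    using L_le[OF that] C F_nonneg unfolding F[OF that] by (simp add: ennreal_le_iff)
  have F_T: "F x \<le> F (T x)" if x: "x \<in> space M" for x
  proof -
    have "?L x \<le> ?L (T x)"
      using f_bounds funpow_space[OF x] by (intro limsup_birkhoff_average_le_shift) blast
    then show ?thesis using funpow_space[OF x, of 1] by (simp add: F x ennreal_le_iff F_nonneg)
  qed
  have F_int: "integrable M F" by (rule integrable_if_bounded[OF _ F_bounds]) measurable
  have F_le: "(\<integral>x. F x \<partial>M) \<le> (\<integral>x. f x \<partial>M)"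
    by (rule integral_le_if_le_limsup_average[OF f _ f_bounds]) (measurable, simp_all add: F F_bounds F_T)
  have "(\<integral>\<^sup>+x. ?L x \<partial>M) = (\<integral>\<^sup>+x. ennreal (F x) \<partial>M)" by (intro nn_integral_cong F)
  also have "\<dots> = ennreal (\<integral>x. F x \<partial>M)" using F_nonneg by (intro nn_integral_eq_integral F_int) simp
  also have "\<dots> \<le> ennreal (\<integral>x. f x \<partial>M)" by (rule ennreal_leI[OF F_le])
  also have "\<dots> = (\<integral>\<^sup>+x. ennreal (f x) \<partial>M)"
    by (rule nn_integral_eq_integral[symmetric, OF integrable_if_bounded[OF f f_bounds]]) (simp_all add: f_bounds)
  finally show ?thesis .
qed

end

lemma sum_symmetric_int_interval:
  "(\<Sum>i\<in>{-int N..<int N}. g i) = (\<Sum>i<N. g (int i)) + (\<Sum>i<N. g (- 1 - int i))" for g :: "int \<Rightarrow> real"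
proof (induction N)
  case (Suc N)
  have "{-int (Suc N)..<int (Suc N)} = insert (- 1 - int N) (insert (int N) {-int N..<int N})"
    by auto
  then show ?case using Suc by simp
qed simp

locale integer_action = prob_space M for M :: "'a measure" +
  fixes U :: "int \<Rightarrow> 'a \<Rightarrow> 'a"
  assumes U_measurable [measurable]: "\<And>i. U i \<in> M \<rightarrow>\<^sub>M M" and distr_U: "\<And>i. distr M M (U i) = M"
    and U_add: "\<And>i j x. x \<in> space M \<Longrightarrow> U (i + j) x = U i (U j x)"
    and U_0: "\<And>x. x \<in> space M \<Longrightarrow> U 0 x = x"
begin

lemma U_space: "x \<in> space M \<Longrightarrow> U i x \<in> space M"
  by (rule measurable_space[OF U_measurable])

lemma U_funpow: "x \<in> space M \<Longrightarrow> (U s ^^ i) x = U (s * int i) x"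
  by (induction i) (simp_all add: U_0 U_add[symmetric] distrib_left)

lemma two_sided_average_eq_birkhoff_averages:
  assumes "x \<in> space M"
  shows "(\<Sum>i\<in>{-int N..<int N}. f (U i x)) / (2 * real N)
    = birkhoff_sum (U 1) (\<lambda>x. f x / 2) N x / real N
    + birkhoff_sum (U (- 1)) (\<lambda>x. f (U (- 1) x) / 2) N x / real N"
  using assms
  by (simp add: sum_symmetric_int_interval birkhoff_sum_def U_funpow U_add[symmetric] add_divide_distrib
      flip: sum_divide_distrib)

lemma nn_integral_limsup_two_sided_average_le:
  assumes f [measurable]: "f \<in> borel_measurable M" and f_bounds: "\<And>x. x \<in> space M \<Longrightarrow> 0 \<le> f x \<and> f x \<le> C"
  shows "(\<integral>\<^sup>+x. limsup (\<lambda>N. ennreal ((\<Sum>i\<in>{-int N..<int N}. f (U i x)) / (2 * real N))) \<partial>M)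
    \<le> (\<integral>\<^sup>+x. ennreal (f x) \<partial>M)"
proof -
  interpret forward: measure_preserving M "U 1" by unfold_locales (simp_all add: distr_U)
  interpret backward: measure_preserving M "U (- 1)" by unfold_locales (simp_all add: distr_U)
  let ?g = "\<lambda>x. f (U (- 1) x) / 2"
  let ?a = "\<lambda>N x. ennreal (birkhoff_sum (U 1) (\<lambda>x. f x / 2) N x / real N)"
    and ?b = "\<lambda>N x. ennreal (birkhoff_sum (U (- 1)) ?g N x / real N)"
  have [measurable]: "?g \<in> borel_measurable M" by measurable
  have "(\<integral>\<^sup>+x. limsup (\<lambda>N. ennreal ((\<Sum>i\<in>{-int N..<int N}. f (U i x)) / (2 * real N))) \<partial>M)
      \<le> (\<integral>\<^sup>+x. limsup (\<lambda>N. ?a N x + ?b N x) \<partial>M)"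
    by (intro nn_integral_mono Limsup_mono always_eventually allI)
        (simp add: two_sided_average_eq_birkhoff_averages ennreal_add_le)
  also have "\<dots> \<le> (\<integral>\<^sup>+x. limsup (\<lambda>N. ?a N x) + limsup (\<lambda>N. ?b N x) \<partial>M)"
    by (intro nn_integral_mono Limsup_ennreal_add_le)
  also have "\<dots> = (\<integral>\<^sup>+x. limsup (\<lambda>N. ?a N x) \<partial>M) + (\<integral>\<^sup>+x. limsup (\<lambda>N. ?b N x) \<partial>M)"
    by (intro nn_integral_add) measurable
  also have "\<dots> \<le> (\<integral>\<^sup>+x. ennreal (f x / 2) \<partial>M) + (\<integral>\<^sup>+x. ennreal (?g x) \<partial>M)"
    by (intro add_mono forward.nn_integral_limsup_average_le[of _ "C / 2"]
            backward.nn_integral_limsup_average_le[of _ "C / 2"]) (auto simp: f_bounds U_space)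
  also have "(\<integral>\<^sup>+x. ennreal (?g x) \<partial>M) = (\<integral>\<^sup>+x. ennreal (f x / 2) \<partial>M)"
    using nn_integral_distr[of "U (- 1)" M M "\<lambda>x. ennreal (f x / 2)"] distr_U[of "- 1"] by simp
  also have "(\<integral>\<^sup>+x. ennreal (f x / 2) \<partial>M) + (\<integral>\<^sup>+x. ennreal (f x / 2) \<partial>M) = (\<integral>\<^sup>+x. ennreal (f x) \<partial>M)"
    by (subst nn_integral_add[symmetric]) (auto intro!: nn_integral_cong simp: f_bounds simp flip: ennreal_plus)
  finally show ?thesis .
qed

text \<open>Because the averaged functions may depend on the length of the average, this form can be
  iterated over several commuting directions.\<close>

lemma nn_integral_limsup_two_sided_average_seq_le:
  assumes F [measurable]: "\<And>N. F N \<in> borel_measurable M" and F_le: "\<And>N x. x \<in> space M \<Longrightarrow> F N x \<le> C"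
  shows "(\<integral>\<^sup>+x. limsup (\<lambda>N. ennreal ((\<Sum>i\<in>{-int N..<int N}. F N (U i x)) / (2 * real N))) \<partial>M)
    \<le> (\<integral>\<^sup>+x. limsup (\<lambda>N. ennreal (F N x)) \<partial>M)"
proof -
  have sup_le: "(SUP N\<in>I. ennreal (F N x)) \<le> ennreal (max 0 C)" if "x \<in> space M" for I x
    using F_le[OF that] by (intro SUP_least ennreal_leI) (simp add: le_max_iff_disj)
  have "(\<integral>\<^sup>+x. limsup (\<lambda>N. ennreal ((\<Sum>i\<in>{-int N..<int N}. F N (U i x)) / (2 * real N))) \<partial>M)
      \<le> (\<integral>\<^sup>+x. (SUP N\<in>{m..}. ennreal (F N x)) \<partial>M)" for m
  proof -
    define H where "H x = enn2real (SUP N\<in>{m..}. ennreal (F N x))" for x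
    have [measurable]: "H \<in> borel_measurable M" unfolding H_def by measurable
    have H: "ennreal (H x) = (SUP N\<in>{m..}. ennreal (F N x))" if "x \<in> space M" for x
      unfolding H_def
      using sup_le[OF that, of "{m..}"] by (intro ennreal_enn2real) (simp add: order_le_less_trans)
    have H_bounds: "0 \<le> H x \<and> H x \<le> max 0 C" if "x \<in> space M" for x
      using sup_le[OF that, of "{m..}"] H[OF that] by (simp add: H_def flip: ennreal_le_iff)
    have F_le_H: "F N x \<le> H x" if "x \<in> space M" "m \<le> N" for N x
    proof -
      have "ennreal (F N x) \<le> ennreal (H x)"
        unfolding H[OF that(1)] using that by (intro SUP_upper) auto
      then show ?thesis using H_bounds[OF that(1)] by (simp add: ennreal_le_iff)
    qed
    have "(\<integral>\<^sup>+x. limsup (\<lambda>N. ennreal ((\<Sum>i\<in>{-int N..<int N}. F N (U i x)) / (2 * real N))) \<partial>M)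
        \<le> (\<integral>\<^sup>+x. limsup (\<lambda>N. ennreal ((\<Sum>i\<in>{-int N..<int N}. H (U i x)) / (2 * real N))) \<partial>M)"
      by (intro nn_integral_mono Limsup_mono eventually_mono[OF eventually_ge_at_top[of m]] ennreal_leI
            divide_right_mono sum_mono F_le_H U_space) auto
    also have "\<dots> \<le> (\<integral>\<^sup>+x. ennreal (H x) \<partial>M)"
      using H_bounds by (intro nn_integral_limsup_two_sided_average_le) auto
    finally show ?thesis by (simp add: H cong: nn_integral_cong)
  qed
  then have "(\<integral>\<^sup>+x. limsup (\<lambda>N. ennreal ((\<Sum>i\<in>{-int N..<int N}. F N (U i x)) / (2 * real N))) \<partial>M)
      \<le> (INF m. \<integral>\<^sup>+x. (SUP N\<in>{m..}. ennreal (F N x)) \<partial>M)"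
    by (intro INF_greatest)
  also have "\<dots> = (\<integral>\<^sup>+x. limsup (\<lambda>N. ennreal (F N x)) \<partial>M)"
  proof (rule nn_integral_limsup_eq_INF[symmetric])
    have "(\<integral>\<^sup>+x. (SUP N. ennreal (F N x)) \<partial>M) \<le> (\<integral>\<^sup>+x. ennreal (max 0 C) \<partial>M)"
      by (intro nn_integral_mono sup_le)
    then show "(\<integral>\<^sup>+x. (SUP N. ennreal (F N x)) \<partial>M) < \<infinity>"
      by (simp add: emeasure_space_1 order_le_less_trans)
  qed measurable
  finally show ?thesis .
qed

end

lemma sum_PiE_insert:
  fixes f :: "('i \<Rightarrow> 'j) \<Rightarrow> real"
  assumes "b \<notin> S" "finite S" "\<And>b. finite (D b)"
  shows "(\<Sum>a\<in>PiE (insert b S) D. f a) = (\<Sum>i\<in>D b. \<Sum>a\<in>PiE S D. f (a(b := i)))"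
proof -
  have "(\<Sum>a\<in>PiE (insert b S) D. f a) = (\<Sum>p\<in>D b \<times> PiE S D. f ((snd p)(b := fst p)))"
    unfolding PiE_insert_eq
    by (subst sum.reindex) (use inj_combinator[OF assms(1), of D] in \<open>auto simp: case_prod_unfold\<close>)
  also have "\<dots> = (\<Sum>i\<in>D b. \<Sum>a\<in>PiE S D. f (a(b := i)))"
    using assms by (subst sum.cartesian_product) (simp add: case_prod_unfold)
  finally show ?thesis .
qed

definition grid :: "'i set \<Rightarrow> nat \<Rightarrow> ('i \<Rightarrow> int) set" where
  "grid B N = PiE B (\<lambda>_. {-int N..<int N})"

lemma finite_grid: "finite B \<Longrightarrow> finite (grid B N)"
  by (simp add: grid_def finite_PiE)

lemma card_grid: "finite B \<Longrightarrow> real (card (grid B N)) = (2 * real N) ^ card B"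
  by (simp add: grid_def card_PiE power_mult_distrib nat_mult_distrib)

locale lattice_action = prob_space M for M :: "'w measure" +
  fixes T :: "('i \<Rightarrow> int) \<Rightarrow> 'w \<Rightarrow> 'w" and B :: "'i set"
  assumes finite_B: "finite B"
    and T_measurable [measurable]: "\<And>z. T z \<in> M \<rightarrow>\<^sub>M M" and distr_T: "\<And>z. distr M M (T z) = M"
    and T_add: "\<And>z z' x. x \<in> space M \<Longrightarrow> T (\<lambda>b. z b + z' b) x = T z (T z' x)"
    and T_cong: "\<And>z z' x. x \<in> space M \<Longrightarrow> (\<And>b. b \<in> B \<Longrightarrow> z b = z' b) \<Longrightarrow> T z x = T z' x"
    and T_0: "\<And>x. x \<in> space M \<Longrightarrow> T (\<lambda>_. 0) x = x"
begin

lemma T_space: "x \<in> space M \<Longrightarrow> T z x \<in> space M"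
  using measurable_space[OF T_measurable] .

lemma nn_integral_T:
  assumes [measurable]: "f \<in> borel_measurable M"
  shows "(\<integral>\<^sup>+x. f (T z x) \<partial>M) = (\<integral>\<^sup>+x. f x \<partial>M)"
  using nn_integral_distr[of "T z" M M f] distr_T[of z] by simp

lemma
  fixes f :: "'w \<Rightarrow> real"
  assumes f: "integrable M f"
  shows integrable_T: "integrable M (\<lambda>x. f (T z x))"
    and integral_sum_T: "(\<integral>x. (\<Sum>a\<in>S. f (T (h a) x)) \<partial>M) = real (card S) * (\<integral>x. f x \<partial>M)"
proof -
  have [measurable]: "f \<in> borel_measurable M" using f by simp
  have int: "integrable M (\<lambda>x. f (T z x))" for z
    using integrable_distr_eq[of "T z" M M f] distr_T[of z] f by simp
  then show "integrable M (\<lambda>x. f (T z x))" .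
  have "(\<integral>x. f (T z x) \<partial>M) = (\<integral>x. f x \<partial>M)" for z
    using integral_distr[of "T z" M M f] distr_T[of z] by simp
  then show "(\<integral>x. (\<Sum>a\<in>S. f (T (h a) x)) \<partial>M) = real (card S) * (\<integral>x. f x \<partial>M)"
    using int by (simp add: Bochner_Integration.integral_sum)
qed

lemma integer_action_coordinate: "integer_action M (\<lambda>i. T (\<lambda>b'. if b' = b then s * i else 0))"
proof
  fix i j x assume x: "x \<in> space M"
  show "T (\<lambda>b'. if b' = b then s * (i + j) else 0) x
      = T (\<lambda>b'. if b' = b then s * i else 0) (T (\<lambda>b'. if b' = b then s * j else 0) x)"
    unfolding T_add[OF x, symmetric] by (rule T_cong[OF x]) (simp add: distrib_left)
next
  fix x assume x: "x \<in> space M"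
  have "T (\<lambda>b'. if b' = b then s * 0 else 0) x = T (\<lambda>_. 0) x" by (rule T_cong[OF x]) simp
  then show "T (\<lambda>b'. if b' = b then s * 0 else 0) x = x" by (simp add: T_0[OF x])
qed (simp_all add: distr_T)

definition box_average :: "'i set \<Rightarrow> int \<Rightarrow> ('w \<Rightarrow> real) \<Rightarrow> nat \<Rightarrow> 'w \<Rightarrow> real" where
  "box_average S s f N x = (\<Sum>a\<in>grid S N. f (T (\<lambda>b. if b \<in> S then s * a b else 0) x)) / (2 * real N) ^ card S"

lemma box_average_measurable [measurable]:
  "f \<in> borel_measurable M \<Longrightarrow> box_average S s f N \<in> borel_measurable M"
  unfolding box_average_def
  by (intro borel_measurable_divide borel_measurable_sum borel_measurable_const measurable_compose[OF T_measurable])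

lemma box_average_le:
  assumes "finite S" and x: "x \<in> space M" and f: "\<And>x. x \<in> space M \<Longrightarrow> f x \<le> C" and C: "0 \<le> C"
  shows "box_average S s f N x \<le> C"
proof -
  have "(\<Sum>a\<in>grid S N. f (T (\<lambda>b. if b \<in> S then s * a b else 0) x)) \<le> real (card (grid S N)) * C"
    by (intro sum_bounded_above f T_space x)
  then have "box_average S s f N x \<le> real (card (grid S N)) * C / real (card (grid S N))"
    unfolding box_average_def card_grid[OF assms(1)] by (rule divide_right_mono) simp
  also have "\<dots> \<le> C" using C by (cases "card (grid S N) = 0") auto
  finally show ?thesis .
qed

lemma box_average_insert:
  assumes "finite S" "b \<notin> S" and x: "x \<in> space M"
  shows "box_average (insert b S) s f N x
    = (\<Sum>i\<in>{-int N..<int N}. box_average S s f N (T (\<lambda>b'. if b' = b then s * i else 0) x)) / (2 * real N)"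
proof -
  have "T (\<lambda>b'. if b' \<in> insert b S then s * (a(b := i)) b' else 0) x
      = T (\<lambda>b'. if b' \<in> S then s * a b' else 0) (T (\<lambda>b'. if b' = b then s * i else 0) x)" for a i
    unfolding T_add[OF x, symmetric] using assms(2) by (intro T_cong x) auto
  then show ?thesis using assms
    by (simp add: box_average_def grid_def sum_PiE_insert sum_divide_distrib[symmetric])
qed

lemma nn_integral_limsup_box_average_le:
  assumes f [measurable]: "f \<in> borel_measurable M" and f_bounds: "\<And>x. x \<in> space M \<Longrightarrow> 0
    \<le> f x \<and> f x \<le> C" and "finite S"
  shows "(\<integral>\<^sup>+x. limsup (\<lambda>N. ennreal (box_average S s f N x)) \<partial>M) \<le> (\<integral>\<^sup>+x. ennreal (f x) \<partial>M)"
  using assms(3)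
proof (induction S rule: finite_induct)
  case empty
  show ?case by (simp add: box_average_def grid_def T_0 Limsup_const cong: nn_integral_cong)
next
  case (insert b S)
  interpret coordinate: integer_action M "\<lambda>i. T (\<lambda>b'. if b' = b then s * i else 0)"
    by (rule integer_action_coordinate)
  have "0 \<le> C" using f_bounds not_empty by (meson ex_in_conv order_trans)
  have insert_eq: "(\<integral>\<^sup>+x. limsup (\<lambda>N. ennreal (box_average (insert b S) s f N x)) \<partial>M)
      = (\<integral>\<^sup>+x. limsup (\<lambda>N. ennreal ((\<Sum>i\<in>{-int N..<int N}.
          box_average S s f N (T (\<lambda>b'. if b' = b then s * i else 0) x)) / (2 * real N))) \<partial>M)"
    by (intro nn_integral_cong) (simp only: box_average_insert insert.hyps not_False_eq_True)
  have "(\<integral>\<^sup>+x. limsup (\<lambda>N. ennreal ((\<Sum>i\<in>{-int N..<int N}.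
          box_average S s f N (T (\<lambda>b'. if b' = b then s * i else 0) x)) / (2 * real N))) \<partial>M)
      \<le> (\<integral>\<^sup>+x. limsup (\<lambda>N. ennreal (box_average S s f N x)) \<partial>M)"
  proof (rule coordinate.nn_integral_limsup_two_sided_average_seq_le[where C=C])
    show "box_average S s f N \<in> borel_measurable M" for N by (rule box_average_measurable[OF f])
    show "box_average S s f N x \<le> C" if "x \<in> space M" for N x
      by (rule box_average_le[OF insert.hyps(1) that _ \<open>0 \<le> C\<close>]) (simp add: f_bounds)
  qed
  then show ?case unfolding insert_eq using insert.IH by (rule order_trans)
qed

end

section \<open>Subadditive processes\<close>

lemma add_mult_diff_divide:
  fixes a b :: real
  shows "b \<noteq> 0 \<Longrightarrow> (x + K * (b - a)) / b = x / b + K * (1 - a / b)"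
    "a \<noteq> 0 \<Longrightarrow> (x + K * (b - a)) / a = x / a + K * (b / a - 1)"
  by (simp_all add: field_simps)

text \<open>A pair \<open>(z, r)\<close> stands for the cube with centre \<open>z\<close> and side length \<open>2 * r\<close>.\<close>

definition separated_cubes :: "'i set \<Rightarrow> ('i \<Rightarrow> int) \<times> nat \<Rightarrow> ('i \<Rightarrow> int) \<times> nat \<Rightarrow> bool" where
  "separated_cubes B = (\<lambda>(z, r) (z', r'). \<exists>b\<in>B. int (r + r') \<le> \<bar>z b - z' b\<bar>)"

definition cube_packing :: "'i set \<Rightarrow> nat \<Rightarrow> (('i \<Rightarrow> int) \<times> nat) set \<Rightarrow> bool" where
  "cube_packing B N I \<longleftrightarrow> finite I \<and> (\<forall>(z, r)\<in>I. 1 \<le> r \<and> (\<forall>b\<in>B. \<bar>z b\<bar> + int r \<le> int N)) \<and>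
      pairwise (separated_cubes B) I"

lemma separated_cubes_commute: "separated_cubes B p q \<longleftrightarrow> separated_cubes B q p"
  by (auto simp: separated_cubes_def add.commute abs_minus_commute)

lemma card_le_if_close:
  assumes B: "finite B" and G: "G \<subseteq> PiE B (\<lambda>_. UNIV)"
    and close: "\<And>y b. y \<in> G \<Longrightarrow> b \<in> B \<Longrightarrow> \<bar>z b - y b\<bar> < 2 * int r"
  shows "card G \<le> (4 * r) ^ card B"
proof -
  have "G \<subseteq> PiE B (\<lambda>b. {z b - 2 * int r <..< z b + 2 * int r})"
  proof
    fix y assume "y \<in> G"
    then show "y \<in> PiE B (\<lambda>b. {z b - 2 * int r <..< z b + 2 * int r})"
      using subsetD[OF G] close[of y] by (auto simp: PiE_iff abs_less_iff algebra_simps)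
  qed
  then have "card G \<le> card (PiE B (\<lambda>b. {z b - 2 * int r <..< z b + 2 * int r}))"
    using B by (intro card_mono finite_PiE) auto
  also have "\<dots> \<le> (\<Prod>b\<in>B. 4 * r)" unfolding card_PiE[OF B] by (intro prod_mono) auto
  finally show ?thesis by simp
qed

lemma vitali_lattice_cubes:
  fixes r :: "('i \<Rightarrow> int) \<Rightarrow> nat"
  assumes B: "finite B" and G: "finite G" "G \<subseteq> PiE B (\<lambda>_. UNIV)" and r: "\<And>z. z \<in> G \<Longrightarrow> 1 \<le> r z"
  shows "\<exists>I\<subseteq>G. pairwise (\<lambda>z z'. separated_cubes B (z, r z) (z', r z')) I \<and> card G
    \<le> (\<Sum>z\<in>I. (4 * r z) ^ card B)"
  using G r
proof (induction "card G" arbitrary: G rule: less_induct)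
  case less
  show ?case
  proof (cases "G = {}")
    case False
    have "Max (r ` G) \<in> r ` G" using less.prems(1) False by (intro Max_in) auto
    then obtain z where z: "z \<in> G" "r z = Max (r ` G)" by (metis imageE)
    then have r_le: "r y \<le> r z" if "y \<in> G" for y using that less.prems(1) by simp
    define G' where "G' = {y \<in> G. separated_cubes B (z, r z) (y, r y)}"
    have z_notin: "z \<notin> G'" using less.prems(3)[OF z(1)] by (auto simp: G'_def separated_cubes_def)
    then have "G' \<subset> G" using z(1) by (auto simp: G'_def)
    then have "card G' < card G" using less.prems(1) by (intro psubset_card_mono)
    then obtain I where I: "I \<subseteq> G'" "pairwise (\<lambda>z z'. separated_cubes B (z, r z) (z', r z')) I"
        and card_I: "card G' \<le> (\<Sum>z\<in>I. (4 * r z) ^ card B)"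
    proof (atomize_elim, rule less.hyps)
      show "finite G'" using less.prems(1) by (simp add: G'_def)
    qed (use less.prems \<open>G' \<subset> G\<close> in auto)
    have "card (G - G') \<le> (4 * r z) ^ card B"
    proof (rule card_le_if_close[OF B])
      fix y b assume "y \<in> G - G'" "b \<in> B"
      then have "\<bar>z b - y b\<bar> < int (r z + r y)" "r y \<le> r z"
        using r_le by (auto simp: G'_def separated_cubes_def)
      then show "\<bar>z b - y b\<bar> < 2 * int (r z)" by simp
    qed (use less.prems(2) in blast)
    moreover have "card G \<le> card G' + card (G - G')"
      using card_Un_le[of G' "G - G'"] \<open>G' \<subset> G\<close> by (simp add: Un_absorb1 psubset_imp_subset)
    moreover have "finite I" "z \<notin> I"
      using I(1) z_notin less.prems(1) by (auto simp: G'_def intro: finite_subset)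
    ultimately have "card G \<le> (\<Sum>z\<in>insert z I. (4 * r z) ^ card B)" using card_I by simp
    moreover have "pairwise (\<lambda>z z'. separated_cubes B (z, r z) (z', r z')) (insert z I)"
      using I by (auto simp: pairwise_insert G'_def separated_cubes_commute)
    moreover have "insert z I \<subseteq> G" using I(1) z(1) by (auto simp: G'_def)
    ultimately show ?thesis by blast
  qed auto
qed

lemma card_int_in_interval_le:
  fixes x y :: real
  assumes "x \<le> y"
  shows "real (card {a::int. x < a \<and> a < y}) \<le> y - x + 1"
proof -
  have "{a::int. x < a \<and> a < y} \<subseteq> {\<lfloor>x\<rfloor> + 1..\<lceil>y\<rceil> - 1}"
    by (auto simp: less_ceiling_iff floor_less_iff) linarith+
  then have "card {a::int. x < a \<and> a < y} \<le> card {\<lfloor>x\<rfloor> + 1..\<lceil>y\<rceil> - 1}"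
    by (intro card_mono) auto
  also have "\<dots> = nat (\<lceil>y\<rceil> - 1 - \<lfloor>x\<rfloor>)" by simp
  finally have "real (card {a::int. x < a \<and> a < y}) \<le> real (nat (\<lceil>y\<rceil> - 1 - \<lfloor>x\<rfloor>))" by simp
  also have "\<dots> \<le> y - x + 1" using assms by linarith
  finally show ?thesis .
qed

definition cell_centre :: "nat \<Rightarrow> ('i \<Rightarrow> int) \<Rightarrow> 'i \<Rightarrow> int" where
  "cell_centre k a = (\<lambda>b. int k * (2 * a b + 1))"

lemma inj_cell_centre: "1 \<le> k \<Longrightarrow> inj (cell_centre k)"
  by (auto simp: inj_on_def cell_centre_def fun_eq_iff)

lemma cell_centre_inside:
  assumes "a \<in> grid B j" "b \<in> B"
  shows "\<bar>cell_centre k a b\<bar> + int k \<le> int (2 * k * j)"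
proof -
  have "- int j \<le> a b" "a b + 1 \<le> int j" using assms by (auto simp: grid_def PiE_iff)
  then have "int k * (- int j) \<le> int k * a b" "int k * (a b + 1) \<le> int k * int j"
    by (intro mult_left_mono; simp)+
  then show ?thesis unfolding cell_centre_def by (auto simp: abs_if algebra_simps)
qed

lemma cells_separated:
  assumes "a \<in> grid B j" "a' \<in> grid B j" "a \<noteq> a'"
  shows "separated_cubes B (cell_centre k a, k) (cell_centre k a', k)"
proof -
  obtain b where b: "b \<in> B" "a b \<noteq> a' b"
    using PiE_ext[of a B _ a'] assms unfolding grid_def by blast
  have "cell_centre k a b - cell_centre k a' b = 2 * int k * (a b - a' b)"
    by (simp add: cell_centre_def algebra_simps)
  moreover have "2 * int k * 1 \<le> 2 * int k * \<bar>a b - a' b\<bar>" using b by (intro mult_left_mono) auto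
  ultimately show ?thesis using b by (auto simp: separated_cubes_def abs_mult intro!: bexI[of _ b])
qed

lemma
  fixes z :: int
  assumes k: "1 \<le> k"
  shows finite_cells_meeting_interval: "finite {a. \<bar>z - int k * (2 * a + 1)\<bar> < int (r + k)}" (is "finite ?A")
    and card_cells_meeting_interval_le:
      "real (card {a. \<bar>z - int k * (2 * a + 1)\<bar> < int (r + k)}) * (2 * real k) \<le> 2 * real r + 4 * real k"
proof -
  define lo hi where "lo = (real_of_int z - 2 * real k - real r) / (2 * real k)"
    and "hi = (real_of_int z + real r) / (2 * real k)"
  have set_eq: "?A = {a. lo < real_of_int a \<and> real_of_int a < hi}"
  proof (intro Collect_cong)
    fix a
    have "\<bar>z - int k * (2 * a + 1)\<bar> < int (r + k)
      \<longleftrightarrow> \<bar>real_of_int z - real k * (2 * real_of_int a + 1)\<bar> < real r + real k"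
      by (simp flip: of_int_less_iff[where 'a=real])
    then show "\<bar>z - int k * (2 * a + 1)\<bar> < int (r + k) \<longleftrightarrow> lo < real_of_int a \<and> real_of_int a < hi"
      using k
      unfolding lo_def hi_def
      by (auto simp: abs_less_iff divide_less_eq less_divide_eq algebra_simps)
  qed
  show "finite ?A" unfolding set_eq
    by (rule finite_subset[of _ "{\<lfloor>lo\<rfloor>..\<lceil>hi\<rceil>}"]) (auto simp: floor_le_iff le_ceiling_iff)
  have "lo \<le> hi" using k by (simp add: lo_def hi_def divide_right_mono)
  then have "real (card ?A) * (2 * real k) \<le> (hi - lo + 1) * (2 * real k)"
    unfolding set_eq by (intro mult_right_mono card_int_in_interval_le) auto
  also have "\<dots> = 2 * real r + 4 * real k" using k by (simp add: lo_def hi_def field_simps)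
  finally show "real (card ?A) * (2 * real k) \<le> 2 * real r + 4 * real k" .
qed

lemma card_cells_meeting_cube_le:
  assumes B: "finite B" and k: "1 \<le> k"
  shows "real (card {a \<in> grid B j. \<not> separated_cubes B (z, r) (cell_centre k a, k)}) * (2 * real k) ^ card B
    \<le> (2 * real r + 4 * real k) ^ card B"
proof -
  let ?A = "\<lambda>b. {a. \<bar>z b - int k * (2 * a + 1)\<bar> < int (r + k)}"
  have "{a \<in> grid B j. \<not> separated_cubes B (z, r) (cell_centre k a, k)} \<subseteq> PiE B ?A"
    by (auto simp: grid_def separated_cubes_def cell_centre_def not_le PiE_iff extensional_def)
  then have "real (card {a \<in> grid B j. \<not> separated_cubes B (z, r) (cell_centre k a, k)})
    \<le> real (card (PiE B ?A))"
    using B k by (intro of_nat_mono card_mono finite_PiE finite_cells_meeting_interval)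
  then have "real (card {a \<in> grid B j. \<not> separated_cubes B (z, r) (cell_centre k a, k)}) * (2 * real k) ^ card B
      \<le> (\<Prod>b\<in>B. real (card (?A b)) * (2 * real k))"
    by (simp add: card_PiE[OF B] prod.distrib mult_right_mono)
  also have "\<dots> \<le> (\<Prod>b\<in>B. 2 * real r + 4 * real k)"
    by (intro prod_mono conjI card_cells_meeting_interval_le k) auto
  finally show ?thesis by simp
qed

definition kept_cells :: "'i set \<Rightarrow> nat \<Rightarrow> nat \<Rightarrow> (('i \<Rightarrow> int) \<times> nat) set \<Rightarrow> ('i \<Rightarrow> int) set" where
  "kept_cells B k j I = {a \<in> grid B j. \<forall>q\<in>I. separated_cubes B q (cell_centre k a, k)}"

lemma cube_packing_kept_cells:
  assumes I: "cube_packing B (2 * k * j) I" and k: "1 \<le> k" and B: "finite B"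
  shows "cube_packing B (2 * k * j) (I \<union> (\<lambda>a. (cell_centre k a, k)) ` kept_cells B k j I)"
    (is "cube_packing B _ (I \<union> ?cells)")
  unfolding cube_packing_def
proof (intro conjI)
  have "kept_cells B k j I \<subseteq> grid B j" by (auto simp: kept_cells_def)
  then show "finite (I \<union> ?cells)"
    using I finite_grid[OF B] by (auto simp: cube_packing_def intro: finite_subset)
  show "\<forall>(z, r)\<in>I \<union> ?cells. 1 \<le> r \<and> (\<forall>b\<in>B. \<bar>z b\<bar> + int r \<le> int (2 * k * j))"
    using I k cell_centre_inside[of _ B j _ k] by (auto simp: cube_packing_def kept_cells_def)
  have mixed: "separated_cubes B p q" if "p \<in> I" "q \<in> ?cells" for p q
    using that by (auto simp: kept_cells_def)
  show "pairwise (separated_cubes B) (I \<union> ?cells)"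
  proof (rule pairwiseI)
    fix p q assume "p \<in> I \<union> ?cells" "q \<in> I \<union> ?cells" "p \<noteq> q"
    then consider (packing) "p \<in> I" "q \<in> I" | (packing_cell) "p \<in> I" "q \<in> ?cells"
      | (cell_packing) "p \<in> ?cells" "q \<in> I" | (cells) "p \<in> ?cells" "q \<in> ?cells" by blast
    then show "separated_cubes B p q"
    proof cases
      case packing
      then show ?thesis using I \<open>p \<noteq> q\<close> by (auto simp: cube_packing_def pairwise_def)
    next
      case cell_packing
      then show ?thesis using mixed separated_cubes_commute by blast
    next
      case cells
      then show ?thesis using cells_separated[of _ B j _ k] \<open>p \<noteq> q\<close> by (auto simp: kept_cells_def)
    qed (rule mixed)
  qed
qed

lemma uncovered_volume_le:
  assumes I: "finite I" and k: "1 \<le> k" and K: "1 \<le> K" "\<And>z r. (z, r) \<in> I \<Longrightarrow> K \<le> r" and B: "finite B"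
  shows "(2 * real (2 * k * j)) ^ card B - real (card (kept_cells B k j I)) * (2 * real k) ^ card B
    \<le> (1 + 2 * real k / real K) ^ card B * (\<Sum>(z, r)\<in>I. (2 * real r) ^ card B)"
proof -
  let ?n = "card B"
  define met where "met q = {a \<in> grid B j. \<not> separated_cubes B q (cell_centre k a, k)}" for q
  have "grid B j = kept_cells B k j I \<union> (\<Union>q\<in>I. met q)" by (auto simp: kept_cells_def met_def)
  then have "card (grid B j) \<le> card (kept_cells B k j I) + (\<Sum>q\<in>I. card (met q))"
    using card_Un_le[of "kept_cells B k j I" "\<Union>q\<in>I. met q"] card_UN_le[OF I, of met] by simp
  from of_nat_mono[OF this, where 'a=real]
  have "real (card (grid B j)) - real (card (kept_cells B k j I)) \<le> (\<Sum>q\<in>I. real (card (met q)))"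
    by (simp only: of_nat_add of_nat_sum)
  then have "(real (card (grid B j)) - real (card (kept_cells B k j I))) * (2 * real k) ^ ?n
      \<le> (\<Sum>q\<in>I. real (card (met q)) * (2 * real k) ^ ?n)"
    unfolding sum_distrib_right[symmetric] by (rule mult_right_mono) simp
  also have "\<dots> \<le> (\<Sum>(z, r)\<in>I. (1 + 2 * real k / real K) ^ ?n * (2 * real r) ^ ?n)"
  proof (rule sum_mono, clarify)
    fix z r assume in_I: "(z, r) \<in> I"
    have "4 * real k * 1 \<le> 4 * real k * (real r / real K)"
      using K(1) K(2)[OF in_I] by (intro mult_left_mono) auto
    then have "2 * real r + 4 * real k \<le> (1 + 2 * real k / real K) * (2 * real r)"
      by (simp add: field_simps)
    then have "(2 * real r + 4 * real k) ^ ?n \<le> (1 + 2 * real k / real K) ^ ?n * (2 * real r) ^ ?n"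
      unfolding power_mult_distrib[symmetric] by (intro power_mono) auto
    then show "real (card (met (z, r))) * (2 * real k) ^ ?n
      \<le> (1 + 2 * real k / real K) ^ ?n * (2 * real r) ^ ?n"
      unfolding met_def by (rule order_trans[OF card_cells_meeting_cube_le[OF B k]])
  qed
  also have "\<dots> = (1 + 2 * real k / real K) ^ ?n * (\<Sum>(z, r)\<in>I. (2 * real r) ^ ?n)"
    by (simp add: sum_distrib_left case_prod_unfold)
  finally have "((2 * real j) ^ ?n - real (card (kept_cells B k j I))) * (2 * real k) ^ ?n
      \<le> (1 + 2 * real k / real K) ^ ?n * (\<Sum>(z, r)\<in>I. (2 * real r) ^ ?n)"
    by (simp only: card_grid[OF B])
  moreover have "(2 * real (2 * k * j)) ^ ?n = (2 * real j) ^ ?n * (2 * real k) ^ ?n"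
    unfolding power_mult_distrib[symmetric] by (simp add: ac_simps)
  ultimately show ?thesis by (simp only: left_diff_distrib)
qed

locale subadditive_process = lattice_action M T B for M :: "'w measure" and T and B :: "'i set" +
  fixes X :: "nat \<Rightarrow> 'w \<Rightarrow> real" and c :: real
  assumes c_nonneg: "0 \<le> c"
    and X_measurable [measurable]: "\<And>N. X N \<in> borel_measurable M"
    and X_nonneg: "\<And>N x. x \<in> space M \<Longrightarrow> 0 \<le> X N x"
    and X_le: "\<And>N x. x \<in> space M \<Longrightarrow> X N x \<le> c * (2 * real N) ^ card B"
    and subadditive: "\<And>x N I. x \<in> space M \<Longrightarrow> cube_packing B N I \<Longrightarrow>
      X N x \<le> (\<Sum>(z, r)\<in>I. X r (T z x)) + c * ((2 * real N) ^ card B - (\<Sum>(z, r)\<in>I. (2 * real r) ^ card B))"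
begin

abbreviation vol :: "nat \<Rightarrow> real" where "vol N \<equiv> (2 * real N) ^ card B"

lemma X_integrable: "integrable M (X N)"
  using X_nonneg X_le by (intro integrable_if_bounded[of _ "c * vol N"]) auto

lemma X_mono:
  assumes "x \<in> space M" "1 \<le> N" "N \<le> N'"
  shows "X N' x \<le> X N x + c * (vol N' - vol N)"
  using subadditive[of x N' "{(\<lambda>_. 0, N)}"] assms by (simp add: cube_packing_def T_0)

lemma average_bounds: "x \<in> space M \<Longrightarrow> 0 \<le> X N x / vol N \<and> X N x / vol N \<le> c"
proof
  assume x: "x \<in> space M"
  have vol: "0 \<le> vol N" by simp
  show "0 \<le> X N x / vol N" by (rule divide_nonneg_nonneg[OF X_nonneg[OF x] vol])
  show "X N x / vol N \<le> c"
  proof (cases "vol N = 0")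
    case True
    show ?thesis unfolding True using c_nonneg by simp
  next
    case False
    then have "0 < vol N" using vol by linarith
    then show ?thesis using X_le[OF x] by (simp only: pos_divide_le_eq)
  qed
qed

lemma vol_mult: "vol (2 * k * j) = vol j * vol k"
  unfolding power_mult_distrib[symmetric] by (simp add: ac_simps)

lemma X_le_sum_cells:
  assumes x: "x \<in> space M" and k: "1 \<le> k"
  shows "X (2 * k * j) x \<le> (\<Sum>a\<in>grid B j. X k (T (cell_centre k a) x))"
proof -
  let ?I = "(\<lambda>a. (cell_centre k a, k)) ` grid B j"
  have inj: "inj_on (\<lambda>a. (cell_centre k a, k)) (grid B j)"
    using inj_cell_centre[OF k] by (auto simp: inj_on_def)
  have "cube_packing B (2 * k * j) ?I"
    using cube_packing_kept_cells[of B k j "{}"] k finite_B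
    by (simp add: cube_packing_def kept_cells_def)
  then have "X (2 * k * j) x \<le> (\<Sum>(z, r)\<in>?I. X r (T z x)) + c * (vol (2 * k * j) - (\<Sum>(z, r)\<in>?I. vol r))"
    by (rule subadditive[OF x])
  also have "(\<Sum>(z, r)\<in>?I. vol r) = vol (2 * k * j)"
    unfolding vol_mult card_grid[OF finite_B, of j, symmetric] by (simp add: sum.reindex[OF inj])
  finally show ?thesis by (simp add: sum.reindex[OF inj])
qed

lemma average_le_cell_average:
  assumes x: "x \<in> space M" and k: "1 \<le> k" and N: "2 * k \<le> N"
  defines "j \<equiv> N div (2 * k)"
  shows "X N x / vol N \<le> (\<Sum>a\<in>grid B j. X k (T (cell_centre k a) x)) / (vol j * vol k)
    + c * (1 - (1 - 2 * real k / real N) ^ card B)"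
proof -
  define S where "S = (\<Sum>a\<in>grid B j. X k (T (cell_centre k a) x))"
  define N0 where "N0 = 2 * k * j"
  have le_N: "N0 \<le> N" "N < N0 + 2 * k"
    using mult_div_mod_eq[of "2 * k" N] mod_less_divisor[of "2 * k" N] k
    unfolding N0_def j_def by linarith+
  have "1 \<le> N0" using N k by (simp add: N0_def j_def Suc_le_eq div_greater_zero_iff)
  then have pos: "0 < vol N0" "0 < vol N" using le_N(1) by simp_all
  have mono: "vol N0 \<le> vol N" using le_N(1) by (intro power_mono) auto
  have S_nonneg: "0 \<le> S" unfolding S_def by (intro sum_nonneg X_nonneg T_space x)
  have "vol N * (1 - 2 * real k / real N) ^ card B = (2 * real N - 4 * real k) ^ card B"
    unfolding power_mult_distrib[symmetric] using \<open>1 \<le> N0\<close> le_N(1)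
    by (intro arg_cong[where f="\<lambda>t. t ^ card B"]) (simp add: field_simps)
  also have "\<dots> \<le> vol N0" using N le_N(2) by (intro power_mono) auto
  finally have "(1 - 2 * real k / real N) ^ card B \<le> vol N0 / vol N"
    using pos by (simp only: pos_le_divide_eq mult.commute)
  then have "c * (1 - vol N0 / vol N) \<le> c * (1 - (1 - 2 * real k / real N) ^ card B)"
    using c_nonneg by (intro mult_left_mono diff_left_mono)
  moreover have "X N x / vol N \<le> (S + c * (vol N - vol N0)) / vol N"
    using X_mono[OF x \<open>1 \<le> N0\<close> le_N(1)] X_le_sum_cells[OF x k, of j] pos unfolding S_def N0_def
    by (intro divide_right_mono) linarith+
  moreover have "(S + c * (vol N - vol N0)) / vol N = S / vol N + c * (1 - vol N0 / vol N)"
    by (rule add_mult_diff_divide[OF less_imp_neq[OF pos(2), symmetric]])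
  moreover have "S / vol N \<le> S / vol N0" using pos mono S_nonneg by (intro divide_left_mono) auto
  ultimately show ?thesis unfolding S_def N0_def vol_mult by linarith
qed

lemma box_average_cells:
  assumes x: "x \<in> space M"
  shows "box_average B (2 * int k) (\<lambda>x. X k (T (\<lambda>_. int k) x) / vol k) j x
    = (\<Sum>a\<in>grid B j. X k (T (cell_centre k a) x)) / (vol j * vol k)"
proof -
  have "T (cell_centre k a) x = T (\<lambda>_. int k) (T (\<lambda>b. if b \<in> B then 2 * int k * a b else 0) x)"
    for a
    unfolding T_add[OF x, symmetric]
    by (rule T_cong[OF x]) (auto simp: cell_centre_def algebra_simps)
  then show ?thesis
    by (simp only: box_average_def sum_divide_distrib[symmetric] divide_divide_eq_left mult.commute[of "vol k" "vol j"])
qed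

lemma nn_integral_limsup_le:
  assumes k: "1 \<le> k"
  shows "(\<integral>\<^sup>+x. limsup (\<lambda>N. ennreal (X N x / vol N)) \<partial>M) \<le> (\<integral>\<^sup>+x. ennreal (X k x / vol k) \<partial>M)"
proof -
  let ?f = "\<lambda>x. X k (T (\<lambda>_. int k) x) / vol k"
  have "(\<integral>\<^sup>+x. limsup (\<lambda>N. ennreal (X N x / vol N)) \<partial>M)
      \<le> (\<integral>\<^sup>+x. limsup (\<lambda>j. ennreal (box_average B (2 * int k) ?f j x)) \<partial>M)"
  proof (intro nn_integral_mono Limsup_le_Limsup_comp[where k="\<lambda>N. N div (2 * k)"
        and r="\<lambda>N. ennreal (c * (1 - (1 - 2 * real k / real N) ^ card B))"])
    show "filterlim (\<lambda>N. N div (2 * k)) sequentially sequentially"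
      using k by (intro filterlim_at_top_div_const_nat) simp
    have "(\<lambda>N. c * (1 - (1 - 2 * real k / real N) ^ card B)) \<longlonglongrightarrow> c * (1 - (1 - 0) ^ card B)"
      by (intro tendsto_intros lim_const_over_n)
    from tendsto_ennrealI[OF this]
    show "(\<lambda>N. ennreal (c * (1 - (1 - 2 * real k / real N) ^ card B))) \<longlonglongrightarrow> 0" by simp
    fix x assume x: "x \<in> space M"
    show "\<forall>\<^sub>F N in sequentially. ennreal (X N x / vol N)
      \<le> ennreal (box_average B (2 * int k) ?f (N div (2 * k)) x)
        + ennreal (c * (1 - (1 - 2 * real k / real N) ^ card B))"
      using eventually_ge_at_top[of "2 * k"]
    proof eventually_elim
      case (elim N)
      show ?case
        using order_trans[OF ennreal_leI[OF average_le_cell_average[OF x k elim]] ennreal_add_le]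
        by (simp only: box_average_cells[OF x])
    qed
  qed
  also have "\<dots> \<le> (\<integral>\<^sup>+x. ennreal (?f x) \<partial>M)"
    using average_bounds T_space
    by (intro nn_integral_limsup_box_average_le[where C=c] finite_B) auto
  also have "\<dots> = (\<integral>\<^sup>+x. ennreal (X k x / vol k) \<partial>M)"
    by (rule nn_integral_T[where f="\<lambda>x. ennreal (X k x / vol k)"]) measurable
  finally show ?thesis .
qed

text \<open>The cells of side \<open>2 * k\<close> that avoid the packing cover the rest up to a fraction that is small
  when \<open>K\<close> is large compared with \<open>k\<close>.\<close>

lemma cost_of_uncovered_le:
  fixes k K j :: nat
  assumes I: "finite I" "\<And>z r. (z, r) \<in> I \<Longrightarrow> K \<le> r" and k: "1 \<le> k" and K: "1 \<le> K" and \<gamma>: "0 \<le> \<gamma>" "\<gamma> \<le> c"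
    and small: "c * ((1 + 2 * real k / real K) ^ card B - 1) \<le> \<epsilon>"
  defines "s \<equiv> \<Sum>(z, r)\<in>I. vol r" and "t \<equiv> real (card (kept_cells B k j I)) * vol k"
  shows "(c - \<gamma>) * (vol (2 * k * j) - (s + t)) \<le> \<epsilon> * s"
proof -
  define \<eta> where "\<eta> = (1 + 2 * real k / real K) ^ card B - 1"
  have nonneg: "0 \<le> \<eta>" "0 \<le> s" unfolding \<eta>_def s_def by (auto intro!: one_le_power sum_nonneg)
  have "vol (2 * k * j) - t \<le> (1 + 2 * real k / real K) ^ card B * s"
    unfolding s_def t_def by (intro uncovered_volume_le I k K finite_B)
  then have "vol (2 * k * j) - (s + t) \<le> \<eta> * s"
    unfolding \<eta>_def left_diff_distrib mult_1_left by linarith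
  then have "(c - \<gamma>) * (vol (2 * k * j) - (s + t)) \<le> (c - \<gamma>) * (\<eta> * s)"
    using \<gamma> by (intro mult_left_mono) auto
  also have "\<dots> \<le> c * \<eta> * s" using \<gamma> nonneg unfolding mult.assoc by (intro mult_right_mono) auto
  also have "\<dots> \<le> \<epsilon> * s" using small nonneg(2) unfolding \<eta>_def by (rule mult_right_mono)
  finally show ?thesis .
qed

lemma X_le_if_cheap_packing:
  fixes \<gamma> \<epsilon> :: real
  assumes x: "x \<in> space M" and k: "1 \<le> k" and K: "1 \<le> K" and \<gamma>: "0 \<le> \<gamma>" "\<gamma> \<le> c"
    and small: "c * ((1 + 2 * real k / real K) ^ card B - 1) \<le> \<epsilon> / 2"
    and I: "cube_packing B (2 * k * j) I" and radii: "\<And>z r. (z, r) \<in> I \<Longrightarrow> K \<le> r"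
    and cheap: "\<And>z r. (z, r) \<in> I \<Longrightarrow> X r (T z x) \<le> (\<gamma> - \<epsilon>) * vol r"
  shows "X (2 * k * j) x \<le> \<gamma> * vol (2 * k * j) - \<epsilon> / 2 * (\<Sum>(z, r)\<in>I. vol r)
    + (\<Sum>a\<in>grid B j. max 0 (X k (T (cell_centre k a) x) - \<gamma> * vol k))"
proof -
  let ?kept = "kept_cells B k j I" and ?cell = "\<lambda>a. (cell_centre k a, k)"
    and ?excess = "\<lambda>a. max 0 (X k (T (cell_centre k a) x) - \<gamma> * vol k)" and ?V = "vol (2 * k * j)"
  define s where "s = (\<Sum>(z, r)\<in>I. vol r)"
  define t where "t = real (card ?kept) * vol k"
  have "finite I" using I by (simp add: cube_packing_def)
  have "finite ?kept" using finite_grid[OF finite_B] by (simp add: kept_cells_def)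
  have inj: "inj_on ?cell ?kept" using inj_cell_centre[OF k] by (auto simp: inj_on_def)
  have disjoint: "I \<inter> ?cell ` ?kept = {}"
    using k by (force simp: kept_cells_def separated_cubes_def)
  have split: "(\<Sum>(z, r)\<in>I \<union> ?cell ` ?kept. g z r) = (\<Sum>(z, r)\<in>I. g z r) + (\<Sum>a\<in>?kept. g (cell_centre k a) k)"
    for g :: "_ \<Rightarrow> _ \<Rightarrow> real"
    using \<open>finite I\<close> \<open>finite ?kept\<close> disjoint
    by (subst sum.union_disjoint) (simp_all add: sum.reindex[OF inj])
  have "(\<Sum>(z, r)\<in>I. X r (T z x)) \<le> (\<gamma> - \<epsilon>) * s"
    unfolding s_def sum_distrib_left using cheap by (intro sum_mono) auto
  moreover have "(\<Sum>a\<in>?kept. X k (T (cell_centre k a) x)) \<le> \<gamma> * t + (\<Sum>a\<in>grid B j. ?excess a)"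
  proof -
    have "(\<Sum>a\<in>?kept. X k (T (cell_centre k a) x)) \<le> (\<Sum>a\<in>?kept. \<gamma> * vol k + ?excess a)"
      by (intro sum_mono) linarith
    also have "\<dots> = \<gamma> * t + (\<Sum>a\<in>?kept. ?excess a)" by (simp add: sum.distrib t_def)
    also have "(\<Sum>a\<in>?kept. ?excess a) \<le> (\<Sum>a\<in>grid B j. ?excess a)"
      by (intro sum_mono2 finite_grid finite_B) (auto simp: kept_cells_def)
    finally show ?thesis by simp
  qed
  moreover have "X (2 * k * j) x \<le> (\<Sum>(z, r)\<in>I. X r (T z x))
    + (\<Sum>a\<in>?kept. X k (T (cell_centre k a) x)) + c * (?V - (s + t))"
    using subadditive[OF x cube_packing_kept_cells[OF I k finite_B]]
    unfolding split by (simp only: s_def t_def sum_constant)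
  ultimately have "X (2 * k * j) x \<le> (\<gamma> - \<epsilon>) * s + \<gamma> * t + (\<Sum>a\<in>grid B j. ?excess a) + c * (?V - (s + t))"
    by linarith
  moreover have "(c - \<gamma>) * (?V - (s + t)) \<le> \<epsilon> / 2 * s"
    unfolding s_def t_def by (rule cost_of_uncovered_le[OF \<open>finite I\<close> radii k K \<gamma> small])
  ultimately show ?thesis unfolding s_def[symmetric] by (simp add: algebra_simps)
qed

definition low_average_set :: "real \<Rightarrow> nat \<Rightarrow> nat \<Rightarrow> 'w set" where
  "low_average_set a K K' = {x \<in> space M. \<exists>r\<in>{K..K'}. X r x \<le> a * vol r}"

lemma low_average_set_measurable [measurable]: "low_average_set a K K' \<in> sets M"
  unfolding low_average_set_def by measurable

lemma obtain_cheap_packing: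
  assumes K: "1 \<le> K" and K': "K' \<le> N"
  obtains I where "cube_packing B N I" "\<And>z r. (z, r) \<in> I \<Longrightarrow> K \<le> r"
    "\<And>z r. (z, r) \<in> I \<Longrightarrow> X r (T z x) \<le> a * vol r"
    "(\<Sum>z\<in>grid B (N - K'). indicator (low_average_set a K K') (T z x)) \<le> 2 ^ card B * (\<Sum>(z, r)\<in>I. vol r)"
proof -
  define G where "G = {z \<in> grid B (N - K'). T z x \<in> low_average_set a K K'}"
  have "\<forall>z\<in>G. \<exists>r. r \<in> {K..K'} \<and> X r (T z x) \<le> a * vol r" by (auto simp: G_def low_average_set_def)
  then obtain r where r: "\<And>z. z \<in> G \<Longrightarrow> r z \<in> {K..K'}" "\<And>z. z \<in> G \<Longrightarrow> X (r z) (T z x) \<le> a * vol (r z)"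
    by metis
  have r_pos: "1 \<le> r z" if "z \<in> G" for z using r(1)[OF that] K by simp
  have "finite G" using finite_grid[OF finite_B] by (simp add: G_def)
  moreover have "G \<subseteq> PiE B (\<lambda>_. UNIV)" by (auto simp: G_def grid_def)
  ultimately obtain J where J: "J \<subseteq> G" "pairwise (\<lambda>z z'. separated_cubes B (z, r z) (z', r z')) J"
      "card G \<le> (\<Sum>z\<in>J. (4 * r z) ^ card B)"
    using vitali_lattice_cubes[OF finite_B, of G r] r_pos by blast
  let ?I = "(\<lambda>z. (z, r z)) ` J"
  have "\<bar>z b\<bar> + int (r z) \<le> int N" if z: "z \<in> G" and b: "b \<in> B" for z b
  proof -
    have "z b \<in> {-int (N - K')..<int (N - K')}"
      using z b unfolding G_def grid_def by (intro PiE_mem[of z B]) auto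
    then have "\<bar>z b\<bar> \<le> int N - int K'"
      using K' by (simp only: atLeastLessThan_iff abs_le_iff of_nat_diff) linarith
    then show ?thesis using r(1)[OF z] by simp
  qed
  moreover have "finite ?I" "pairwise (separated_cubes B) ?I"
    using J(1,2) \<open>finite G\<close> by (auto simp: pairwise_def intro: finite_subset)
  ultimately have "cube_packing B N ?I" using J(1) r_pos by (auto simp: cube_packing_def)
  moreover have "(\<Sum>z\<in>grid B (N - K'). indicator (low_average_set a K K') (T z x))
    \<le> 2 ^ card B * (\<Sum>(z, r)\<in>?I. vol r)"
  proof -
    have "(\<Sum>z\<in>grid B (N - K'). indicator (low_average_set a K K') (T z x)) = real (card G)"
      using finite_grid[OF finite_B] by (simp add: indicator_def G_def sum.If_cases Int_def)
    also have "\<dots> \<le> real (\<Sum>z\<in>J. (4 * r z) ^ card B)" using J(3) by (rule of_nat_mono)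
    also have "\<dots> = 2 ^ card B * (\<Sum>z\<in>J. vol (r z))"
      unfolding sum_distrib_left power_mult_distrib[symmetric] by simp
    also have "(\<Sum>z\<in>J. vol (r z)) = (\<Sum>(z, r)\<in>?I. vol r)" by (simp add: sum.reindex inj_on_def)
    finally show ?thesis .
  qed
  ultimately show thesis using J(1) r by (intro that[of ?I]) auto
qed

lemma X_le_covering:
  fixes \<gamma> \<epsilon> :: real
  assumes x: "x \<in> space M" and k: "1 \<le> k" and K: "1 \<le> K" and \<gamma>: "0 \<le> \<gamma>" "\<gamma> \<le> c" and \<epsilon>: "0 < \<epsilon>"
    and small: "c * ((1 + 2 * real k / real K) ^ card B - 1) \<le> \<epsilon> / 2"
    and K': "K' \<le> 2 * k * j"
  shows "X (2 * k * j) x \<le> \<gamma> * vol (2 * k * j)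
    - \<epsilon> / 2 / 2 ^ card B * (\<Sum>z\<in>grid B (2 * k * j - K'). indicator (low_average_set (\<gamma> - \<epsilon>) K K') (T z x))
    + (\<Sum>a\<in>grid B j. max 0 (X k (T (cell_centre k a) x) - \<gamma> * vol k))"
proof -
  let ?hits = "\<Sum>z\<in>grid B (2 * k * j - K'). indicator (low_average_set (\<gamma> - \<epsilon>) K K') (T z x)"
  obtain I where I: "cube_packing B (2 * k * j) I" "\<And>z r. (z, r) \<in> I \<Longrightarrow> K \<le> r"
      "\<And>z r. (z, r) \<in> I \<Longrightarrow> X r (T z x) \<le> (\<gamma> - \<epsilon>) * vol r"
    and hits: "?hits \<le> 2 ^ card B * (\<Sum>(z, r)\<in>I. vol r)"
    using obtain_cheap_packing[OF K K'] by blast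
  from hits have "\<epsilon> / 2 / 2 ^ card B * ?hits \<le> \<epsilon> / 2 / 2 ^ card B * (2 ^ card B * (\<Sum>(z, r)\<in>I. vol r))"
    using \<epsilon> by (intro mult_left_mono) auto
  also have "\<dots> = \<epsilon> / 2 * (\<Sum>(z, r)\<in>I. vol r)" by simp
  finally show ?thesis using X_le_if_cheap_packing[OF x k K \<gamma> small I(1)] I(2,3) by fastforce
qed

lemma integral_excess_tendsto_0:
  assumes limsup_le: "AE x in M. limsup (\<lambda>N. ennreal (X N x / vol N)) \<le> ennreal \<gamma>" and \<gamma>: "0 \<le> \<gamma>"
  shows "(\<lambda>k. \<integral>x. max 0 (X k x / vol k - \<gamma>) \<partial>M) \<longlonglongrightarrow> 0"
proof -
  have "(\<lambda>k. \<integral>x. max 0 (X k x / vol k - \<gamma>) \<partial>M) \<longlonglongrightarrow> (\<integral>x. 0 \<partial>M)"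
  proof (rule integral_dominated_convergence[where w="\<lambda>_. c"])
    show "AE x in M. (\<lambda>k. max 0 (X k x / vol k - \<gamma>)) \<longlonglongrightarrow> 0"
      using limsup_le by eventually_elim (rule positive_part_tendsto_0_if_limsup_le[OF _ \<gamma>])
    show "AE x in M. norm (max 0 (X k x / vol k - \<gamma>)) \<le> c" for k
    proof (rule AE_I2)
      fix x assume "x \<in> space M"
      from average_bounds[OF this, of k] show "norm (max 0 (X k x / vol k - \<gamma>)) \<le> c"
        using \<gamma> c_nonneg by simp
    qed
  qed auto
  then show ?thesis by simp
qed

context
  fixes \<gamma> :: real
  assumes \<gamma>_nonneg: "0 \<le> \<gamma>" and \<gamma>_le_mean: "\<And>k. 1 \<le> k \<Longrightarrow> \<gamma> * vol k \<le> (\<integral>x. X k x \<partial>M)"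
begin

lemma \<gamma>_le_c: "\<gamma> \<le> c"
proof -
  have "\<gamma> * vol 1 \<le> (\<integral>x. X 1 x \<partial>M)" by (rule \<gamma>_le_mean) simp
  also have "\<dots> \<le> (\<integral>x. c * vol 1 \<partial>M)" by (intro integral_mono X_integrable integrable_const X_le)
  finally show ?thesis by (simp add: prob_space)
qed

lemma measure_low_average_set_mult_le:
  assumes k: "1 \<le> k" and K: "1 \<le> K" and \<epsilon>: "0 < \<epsilon>" and j: "1 \<le> j" "K' \<le> 2 * k * j"
    and small: "c * ((1 + 2 * real k / real K) ^ card B - 1) \<le> \<epsilon> / 2"
  shows "\<epsilon> / 2 / 2 ^ card B * (vol (2 * k * j - K') * measure M (low_average_set (\<gamma> - \<epsilon>) K K'))
    \<le> vol (2 * k * j) * (\<integral>x. max 0 (X k x / vol k - \<gamma>) \<partial>M)"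
proof -
  let ?N = "2 * k * j" and ?A = "low_average_set (\<gamma> - \<epsilon>) K K'" and ?b = "\<epsilon> / 2 / 2 ^ card B"
    and ?excess = "\<lambda>x. max 0 (X k x - \<gamma> * vol k)"
  let ?hits = "\<lambda>x. \<Sum>z\<in>grid B (?N - K'). indicator ?A (T z x) :: real"
    and ?rest = "\<lambda>x. \<Sum>a\<in>grid B j. ?excess (T (cell_centre k a) x)"
  have A_int: "integrable M (indicator ?A :: _ \<Rightarrow> real)"
    by (intro integrable_real_indicator) (auto simp: emeasure_eq_measure)
  have excess_int: "integrable M ?excess"
    by (intro Bochner_Integration.integrable_max Bochner_Integration.integrable_diff X_integrable integrable_const)
  have hits_int: "integrable M ?hits"
    by (intro Bochner_Integration.integrable_sum integrable_T[OF A_int])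
  have rest_int: "integrable M ?rest"
    by (intro Bochner_Integration.integrable_sum integrable_T[OF excess_int])
  have integral_combination: "(\<integral>x. a - b * f x + g x \<partial>M) = a - b * (\<integral>x. f x \<partial>M) + (\<integral>x. g x \<partial>M)"
    if "integrable M f" "integrable M g" for a b and f g :: "_ \<Rightarrow> real"
    using that by (simp add: prob_space)
  have excess_eq: "?excess x = vol k * max 0 (X k x / vol k - \<gamma>)" for x
  proof -
    have "max 0 (X k x - \<gamma> * p) = p * max 0 (X k x / p - \<gamma>)" if "0 < p" for p
      using that by (simp add: max_def field_simps)
    then show ?thesis using k by simp
  qed
  have "\<gamma> * vol ?N \<le> (\<integral>x. X ?N x \<partial>M)" using k j(1) by (intro \<gamma>_le_mean) simp
  also have "\<dots> \<le> (\<integral>x. \<gamma> * vol ?N - ?b * ?hits x + ?rest x \<partial>M)"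
    by (intro integral_mono X_integrable hits_int rest_int Bochner_Integration.integrable_add Bochner_Integration.integrable_diff
        integrable_mult_right integrable_const X_le_covering k K \<gamma>_nonneg \<gamma>_le_c \<epsilon> small j)
  also have "\<dots> = \<gamma> * vol ?N - ?b * (\<integral>x. ?hits x \<partial>M) + (\<integral>x. ?rest x \<partial>M)"
    by (rule integral_combination[OF hits_int rest_int])
  also have "(\<integral>x. ?hits x \<partial>M) = vol (?N - K') * measure M ?A"
    unfolding integral_sum_T[OF A_int] card_grid[OF finite_B] by simp
  also have "(\<integral>x. ?rest x \<partial>M) = vol ?N * (\<integral>x. max 0 (X k x / vol k - \<gamma>) \<partial>M)"
    unfolding integral_sum_T[OF excess_int] card_grid[OF finite_B] vol_mult
    by (simp only: excess_eq integral_mult_right_zero mult.assoc)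
  finally show ?thesis by simp
qed

lemma measure_low_average_set_le:
  assumes k: "1 \<le> k" and K: "1 \<le> K" and \<epsilon>: "0 < \<epsilon>"
    and small: "c * ((1 + 2 * real k / real K) ^ card B - 1) \<le> \<epsilon> / 2"
  shows "\<epsilon> / 2 / 2 ^ card B * measure M (low_average_set (\<gamma> - \<epsilon>) K K') \<le> (\<integral>x. max 0 (X k x / vol k - \<gamma>) \<partial>M)"
    (is "?b * ?m \<le> ?\<delta>")
proof (rule LIMSEQ_le_const2)
  let ?ratio = "\<lambda>j. (1 - real K' / (2 * real k) / real j) ^ card B"
  have "(\<lambda>j. ?b * ?m * ?ratio j) \<longlonglongrightarrow> ?b * ?m * (1 - 0) ^ card B"
    by (intro tendsto_intros lim_const_over_n)
  then show "(\<lambda>j. ?b * ?m * ?ratio j) \<longlonglongrightarrow> ?b * ?m" by simp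
  have "?b * ?m * ?ratio j \<le> ?\<delta>" if j: "max 1 K' \<le> j" for j
  proof -
    have K'_le: "K' \<le> 2 * k * j" using j k by (cases k) auto
    have "vol (2 * k * j) * ?ratio j = vol (2 * k * j - K')"
      unfolding power_mult_distrib[symmetric] using K'_le k j
      by (intro arg_cong[where f="\<lambda>t. t ^ card B"]) (simp add: of_nat_diff field_simps)
    moreover have "?b * (vol (2 * k * j - K') * ?m) \<le> vol (2 * k * j) * ?\<delta>"
      using j by (intro measure_low_average_set_mult_le k K \<epsilon> small K'_le) simp
    ultimately have "vol (2 * k * j) * (?b * ?m * ?ratio j) \<le> vol (2 * k * j) * ?\<delta>"
      by (simp only: ac_simps)
    moreover have "0 < vol (2 * k * j)" using k j by simp
    ultimately show ?thesis by (rule mult_left_le_imp_le)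
  qed
  then show "\<exists>J. \<forall>j\<ge>J. ?b * ?m * ?ratio j \<le> ?\<delta>" by blast
qed

lemma liminf_less_subset_low_average_sets:
  assumes "1 \<le> K"
  shows "{x \<in> space M. liminf (\<lambda>N. ennreal (X N x / vol N)) < ennreal a} \<subseteq> (\<Union>K'. low_average_set a K K')"
proof
  fix x assume "x \<in> {x \<in> space M. liminf (\<lambda>N. ennreal (X N x / vol N)) < ennreal a}"
  then have x: "x \<in> space M" and less: "liminf (\<lambda>N. ennreal (X N x / vol N)) < ennreal a" by auto
  have "\<exists>N\<ge>K. ennreal (X N x / vol N) < ennreal a"
  proof (rule ccontr)
    assume "\<not> ?thesis"
    then have "\<forall>\<^sub>F N in sequentially. ennreal a \<le> ennreal (X N x / vol N)"
      unfolding eventually_sequentially by (meson leI)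
    from Liminf_bounded[OF this] show False using less by simp
  qed
  then obtain N where N: "K \<le> N" "ennreal (X N x / vol N) < ennreal a" by blast
  then have "X N x / vol N < a" using average_bounds[OF x, of N] by (simp only: ennreal_less_iff)
  moreover have "0 < vol N" using N(1) assms by simp
  ultimately have "X N x \<le> a * vol N" by (simp only: pos_divide_less_eq less_imp_le)
  then show "x \<in> (\<Union>K'. low_average_set a K K')"
    using x N(1) unfolding low_average_set_def by (intro UN_I[of N]) auto
qed

lemma measure_liminf_less_le:
  assumes \<epsilon>: "0 < \<epsilon>" and k: "1 \<le> k"
  shows "\<epsilon> / 2 / 2 ^ card B * measure M {x \<in> space M. liminf (\<lambda>N. ennreal (X N x / vol N)) < ennreal (\<gamma> - \<epsilon>)}
    \<le> (\<integral>x. max 0 (X k x / vol k - \<gamma>) \<partial>M)" (is "?b * measure M ?L \<le> ?\<delta>")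
proof -
  have "(\<lambda>K. c * ((1 + 2 * real k / real K) ^ card B - 1)) \<longlonglongrightarrow> c * ((1 + 0) ^ card B - 1)"
    by (intro tendsto_intros lim_const_over_n)
  then have "\<forall>\<^sub>F K in sequentially. c * ((1 + 2 * real k / real K) ^ card B - 1) < \<epsilon> / 2"
    using \<epsilon> by (intro order_tendstoD(2)) auto
  then have "\<forall>\<^sub>F K in sequentially. c * ((1 + 2 * real k / real K) ^ card B - 1) < \<epsilon> / 2 \<and> 1 \<le> K"
    using eventually_ge_at_top[of 1] by (rule eventually_conj)
  then obtain K where K: "c * ((1 + 2 * real k / real K) ^ card B - 1) < \<epsilon> / 2" "1 \<le> K"
    by (auto simp: eventually_sequentially)
  let ?A = "low_average_set (\<gamma> - \<epsilon>) K"
  have "(\<lambda>K'. measure M (?A K')) \<longlonglongrightarrow> measure M (\<Union>K'. ?A K')"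
  proof (rule finite_Lim_measure_incseq)
    show "incseq ?A" unfolding low_average_set_def incseq_def by force
  qed auto
  then have "(\<lambda>K'. ?b * measure M (?A K')) \<longlonglongrightarrow> ?b * measure M (\<Union>K'. ?A K')"
    by (rule tendsto_mult_left)
  then have "?b * measure M (\<Union>K'. ?A K') \<le> ?\<delta>"
    by (rule LIMSEQ_le_const2) (use measure_low_average_set_le[OF k K(2) \<epsilon> less_imp_le[OF K(1)]] in blast)
  moreover have "measure M ?L \<le> measure M (\<Union>K'. ?A K')"
    by (intro finite_measure_mono liminf_less_subset_low_average_sets K(2)) auto
  then have "?b * measure M ?L \<le> ?b * measure M (\<Union>K'. ?A K')" using \<epsilon> by (intro mult_left_mono) auto
  ultimately show ?thesis by linarith
qed

lemma AE_liminf_ge: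
  assumes limsup_le: "AE x in M. limsup (\<lambda>N. ennreal (X N x / vol N)) \<le> ennreal \<gamma>"
  shows "AE x in M. ennreal \<gamma> \<le> liminf (\<lambda>N. ennreal (X N x / vol N))"
proof -
  have "AE x in M. ennreal (\<gamma> - \<epsilon>) \<le> liminf (\<lambda>N. ennreal (X N x / vol N))" if \<epsilon>: "0 < \<epsilon>" for \<epsilon>
  proof -
    let ?L = "{x \<in> space M. liminf (\<lambda>N. ennreal (X N x / vol N)) < ennreal (\<gamma> - \<epsilon>)}"
    have "\<epsilon> / 2 / 2 ^ card B * measure M ?L \<le> 0"
      by (rule LIMSEQ_le_const[OF integral_excess_tendsto_0[OF limsup_le \<gamma>_nonneg]])
          (use measure_liminf_less_le[OF \<epsilon>] in blast)
    moreover have "0 < \<epsilon> / 2 / 2 ^ card B" using \<epsilon> by simp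
    ultimately have "measure M ?L \<le> 0"
      using mult_pos_pos[of "\<epsilon> / 2 / 2 ^ card B" "measure M ?L"] by linarith
    then have "measure M ?L = 0" using measure_nonneg[of M ?L] by linarith
    moreover have "?L \<in> sets M" by measurable
    ultimately have "AE x in M. x \<notin> ?L"
      by (intro AE_not_in) (simp add: null_sets_def emeasure_eq_measure)
    then show ?thesis by (rule AE_mp) (auto intro!: AE_I2 simp: not_less)
  qed
  then have "AE x in M. \<forall>m::nat. ennreal (\<gamma> - 1 / Suc m) \<le> liminf (\<lambda>N. ennreal (X N x / vol N))"
    by (simp add: AE_all_countable)
  then show ?thesis
  proof eventually_elim
    case (elim x)
    have "(\<lambda>m. ennreal (\<gamma> - 1 / Suc m)) \<longlonglongrightarrow> ennreal (\<gamma> - 0)"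
      by (intro tendsto_ennrealI tendsto_diff tendsto_const LIMSEQ_Suc[OF lim_const_over_n])
    then have "ennreal (\<gamma> - 0) \<le> liminf (\<lambda>N. ennreal (X N x / vol N))"
      by (rule LIMSEQ_le_const2) (use elim in auto)
    then show ?case by simp
  qed
qed

end

end

section \<open>Smooth functions\<close>

lemma smooth_fnD:
  assumes "smooth_fn f"
  shows "f differentiable (at x)" "smooth_fn (\<lambda>x. frechet_derivative f (at x) v)"
  using assms by (auto elim: smooth_fn.cases)

lemma smooth_fn_has_derivative:
  "smooth_fn f \<Longrightarrow> (f has_derivative frechet_derivative f (at x)) (at x)"
  using smooth_fnD(1) frechet_derivative_works by blast

lemma smooth_fn_continuous: "smooth_fn f \<Longrightarrow> continuous_on A f"
  using smooth_fn_has_derivative has_derivative_continuous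
  by (metis continuous_at_imp_continuous_on)

lemma smooth_fn_derivative_continuous:
  "smooth_fn f \<Longrightarrow> continuous_on A (\<lambda>x. frechet_derivative f (at x) v)"
  by (rule smooth_fn_continuous[OF smooth_fnD(2)])

abbreviation fderiv :: "('a::real_normed_vector \<Rightarrow> real) \<Rightarrow> 'a \<Rightarrow> 'a \<Rightarrow> real" where
  "fderiv f x \<equiv> frechet_derivative f (at x)"

text \<open>Smooth functions are closed under the operations below because the inductive closure under
  these operations is stable under directional derivatives.\<close>

inductive smooth_closure :: "('a::real_normed_vector \<Rightarrow> real) \<Rightarrow> bool" where
  base: "smooth_fn f \<Longrightarrow> smooth_closure f"
| add: "smooth_closure f \<Longrightarrow> smooth_closure g \<Longrightarrow> smooth_closure (\<lambda>x. f x + g x)"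
| mult: "smooth_closure f \<Longrightarrow> smooth_closure g \<Longrightarrow> smooth_closure (\<lambda>x. f x * g x)"
| comp: "smooth_fn (p :: real \<Rightarrow> real) \<Longrightarrow> smooth_closure g \<Longrightarrow> smooth_closure (\<lambda>x. p (g x))"

lemma smooth_closure_derivative:
  assumes "smooth_closure f"
  shows "\<exists>D. (\<forall>x. (f has_derivative D x) (at x)) \<and> (\<forall>v. smooth_closure (\<lambda>x. D x v))"
  using assms
proof induction
  case (base f)
  then show ?case
    by (intro exI[of _ "\<lambda>x. fderiv f x"])
        (auto intro: smooth_fn_has_derivative smooth_closure.base smooth_fnD(2))
next
  case (add f g)
  then obtain D E where D: "\<And>x. (f has_derivative D x) (at x)" "\<And>v. smooth_closure (\<lambda>x. D x v)"
    and E: "\<And>x. (g has_derivative E x) (at x)" "\<And>v. smooth_closure (\<lambda>x. E x v)" by blast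
  show ?case
    by (intro exI[of _ "\<lambda>x v. D x v + E x v"] conjI allI has_derivative_add D E smooth_closure.add)
next
  case (mult f g)
  then obtain D E where D: "\<And>x. (f has_derivative D x) (at x)" "\<And>v. smooth_closure (\<lambda>x. D x v)"
    and E: "\<And>x. (g has_derivative E x) (at x)" "\<And>v. smooth_closure (\<lambda>x. E x v)" by blast
  show ?case
    by (intro exI[of _ "\<lambda>x v. f x * E x v + D x v * g x"] conjI allI has_derivative_mult D E
        smooth_closure.add smooth_closure.mult mult.hyps)
next
  case (comp p g)
  then obtain D where D: "\<And>x. (g has_derivative D x) (at x)" "\<And>v. smooth_closure (\<lambda>x. D x v)"
    by blast
  have p_derivative: "(p has_derivative (\<lambda>v. v * fderiv p y 1)) (at y)" for y
  proof -
    have derivative: "(p has_derivative fderiv p y) (at y)"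
      by (rule smooth_fn_has_derivative[OF comp.hyps(1)])
    have "fderiv p y v = v * fderiv p y 1" for v
      using linear_scale[OF has_derivative_linear[OF derivative], of v 1] by simp
    then have "fderiv p y = (\<lambda>v. v * fderiv p y 1)" by (rule ext)
    then show ?thesis using derivative by simp
  qed
  show ?case
  proof (intro exI[of _ "\<lambda>x v. D x v * fderiv p (g x) 1"] conjI allI)
    show "((\<lambda>x. p (g x)) has_derivative (\<lambda>v. D x v * fderiv p (g x) 1)) (at x)" for x
      using has_derivative_compose[OF D(1) p_derivative] .
    show "smooth_closure (\<lambda>x. D x v * fderiv p (g x) 1)" for v
      by (intro smooth_closure.mult D(2) smooth_closure.comp[OF smooth_fnD(2)] comp.hyps)
  qed
qed

lemma smooth_fn_coinduct_family:
  assumes "f \<in> \<F>"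
    and "\<And>f. f \<in> \<F> \<Longrightarrow> \<exists>D. (\<forall>x. (f has_derivative D x) (at x)) \<and> (\<forall>v. (\<lambda>x. D x v) \<in> \<F>)"
  shows "smooth_fn f"
  using assms(1)
proof (coinduction arbitrary: f)
  case smooth_fn
  obtain D where D: "\<And>x. (f has_derivative D x) (at x)" "\<And>v. (\<lambda>x. D x v) \<in> \<F>"
    using assms(2)[OF smooth_fn] by blast
  have "fderiv f x = D x" for x by (rule frechet_derivative_at[OF D(1), symmetric])
  then show ?case using D by (auto simp: differentiable_def)
qed

lemma smooth_fn_if_closure: "smooth_closure f \<Longrightarrow> smooth_fn f"
  by (rule smooth_fn_coinduct_family[where \<F>="Collect smooth_closure"]) (auto dest: smooth_closure_derivative)

lemma smooth_fn_const: "smooth_fn (\<lambda>_. c)"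
  by (rule smooth_fn_coinduct_family[where \<F>="range (\<lambda>c _. c)"])
      (auto intro!: exI[of _ "\<lambda>_ _. 0"])

lemma smooth_fn_inner: "smooth_fn (\<lambda>x. x \<bullet> a)"
proof (rule smooth_fn_coinduct_family[where \<F>="insert (\<lambda>x. x \<bullet> a) (range (\<lambda>c _. c))"])
  fix f assume "f \<in> insert (\<lambda>x. x \<bullet> a) (range (\<lambda>c _. c))"
  then show "\<exists>D. (\<forall>x. (f has_derivative D x) (at x)) \<and> (\<forall>v. (\<lambda>x. D x v) \<in> insert (\<lambda>x. x \<bullet> a) (range (\<lambda>c _. c)))"
  proof
    assume f: "f = (\<lambda>x. x \<bullet> a)"
    show ?thesis unfolding f
      by (intro exI[of _ "\<lambda>x v. v \<bullet> a"]) (auto intro!: derivative_eq_intros)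
  qed (auto intro!: exI[of _ "\<lambda>_ _. 0"])
qed simp

lemma smooth_fn_add: "smooth_fn f \<Longrightarrow> smooth_fn g \<Longrightarrow> smooth_fn (\<lambda>x. f x + g x)"
  by (rule smooth_fn_if_closure, rule smooth_closure.add) (rule smooth_closure.base; assumption)+

lemma smooth_fn_mult: "smooth_fn f \<Longrightarrow> smooth_fn g \<Longrightarrow> smooth_fn (\<lambda>x. f x * g x)"
  by (rule smooth_fn_if_closure, rule smooth_closure.mult) (rule smooth_closure.base; assumption)+

lemma smooth_fn_comp: "smooth_fn (p :: real \<Rightarrow> real) \<Longrightarrow> smooth_fn g \<Longrightarrow> smooth_fn (\<lambda>x. p (g x))"
  by (rule smooth_fn_if_closure, rule smooth_closure.comp, assumption) (rule smooth_closure.base; assumption)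

lemma smooth_fn_diff: "smooth_fn f \<Longrightarrow> smooth_fn g \<Longrightarrow> smooth_fn (\<lambda>x. f x - g x)"
  using smooth_fn_add[of f "\<lambda>x. (-1) * g x"] smooth_fn_mult[OF smooth_fn_const, of g "-1"] by simp

lemma smooth_fn_prod:
  "finite I \<Longrightarrow> (\<And>i. i \<in> I \<Longrightarrow> smooth_fn (f i)) \<Longrightarrow> smooth_fn (\<lambda>x. \<Prod>i\<in>I. f i x)"
proof (induction I rule: finite_induct)
  case (insert i I)
  then show ?case using smooth_fn_mult[of "f i" "\<lambda>x. \<Prod>i\<in>I. f i x"] by simp
qed (simp add: smooth_fn_const)

lemma smooth_fn_translate:
  assumes "smooth_fn f"
  shows "smooth_fn (\<lambda>x. f (x + y))"
proof (rule smooth_fn_coinduct_family[where \<F>="(\<lambda>f x. f (x + y)) ` {f. smooth_fn f}"])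
  fix g assume "g \<in> (\<lambda>f x. f (x + y)) ` {f. smooth_fn f}"
  then obtain f where f: "smooth_fn f" "g = (\<lambda>x. f (x + y))" by blast
  have "(g has_derivative fderiv f (x + y)) (at x)" for x
    unfolding f(2)
    using has_derivative_compose[OF has_derivative_add_const[OF has_derivative_ident] smooth_fn_has_derivative[OF f(1)], of y x UNIV]
    by simp
  then show "\<exists>D. (\<forall>x. (g has_derivative D x) (at x)) \<and> (\<forall>v. (\<lambda>x. D x v) \<in> (\<lambda>f x. f (x + y)) ` {f. smooth_fn f})"
    using smooth_fnD(2)[OF f(1)]
    by (intro exI[of _ "\<lambda>x. fderiv f (x + y)"]) (auto simp: image_iff)
qed (use assms in auto)

definition bump_poly :: "real poly \<Rightarrow> real \<Rightarrow> real" where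
  "bump_poly P x = (if x \<le> 0 then 0 else poly P (1 / x) * exp (- (1 / x)))"

lemma poly_exp_decay: "((\<lambda>y::real. poly P y * exp (- y)) \<longlongrightarrow> 0) at_top"
proof -
  have "((\<lambda>y::real. \<Sum>i\<le>degree P. coeff P i * (y ^ i / exp y)) \<longlongrightarrow> (\<Sum>i\<le>degree P. coeff P i * 0)) at_top"
    by (intro tendsto_sum tendsto_mult tendsto_const tendsto_power_div_exp_0)
  then show ?thesis
    by (simp add: poly_altdef sum_distrib_right exp_minus divide_inverse mult.assoc)
qed

lemma bump_poly_has_derivative:
  "(bump_poly P has_real_derivative bump_poly (monom 1 2 * (P - pderiv P)) x) (at x)"
proof -
  consider (neg) "x < 0" | (pos) "x > 0" | (zero) "x = 0" by linarith
  then show ?thesis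
  proof cases
    case neg
    have "eventually (\<lambda>y. y \<in> {..<0}) (nhds x)" using neg by (intro eventually_nhds_in_open) auto
    then have "eventually (\<lambda>y. bump_poly P y = 0) (nhds x)"
      by eventually_elim (simp add: bump_poly_def)
    then show ?thesis using neg by (subst DERIV_cong_ev[OF refl _ refl]) (auto simp: bump_poly_def)
  next
    case pos
    have "eventually (\<lambda>y. y \<in> {0<..}) (nhds x)" using pos by (intro eventually_nhds_in_open) auto
    then have bump_poly_eq: "eventually (\<lambda>y. bump_poly P y = poly P (1 / y) * exp (- (1 / y))) (nhds x)"
      by eventually_elim (simp add: bump_poly_def)
    have "((\<lambda>y. poly P (1 / y) * exp (- (1 / y))) has_real_derivative
        bump_poly (monom 1 2 * (P - pderiv P)) x) (at x)"
      using pos by (auto intro!: derivative_eq_intros DERIV_chain2[OF poly_DERIV]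
        simp: bump_poly_def poly_monom field_simps power2_eq_square)
    then show ?thesis using DERIV_cong_ev[OF refl bump_poly_eq refl] by blast
  next
    case zero
    have "((\<lambda>y. bump_poly P y / y) \<longlongrightarrow> 0) (at 0)"
      unfolding filterlim_at_split
    proof
      show "((\<lambda>y. bump_poly P y / y) \<longlongrightarrow> 0) (at_left 0)"
        by (rule tendsto_eventually)
            (auto simp: eventually_at_filter bump_poly_def intro!: always_eventually)
      have "((\<lambda>y. poly (monom 1 1 * P) (inverse y) * exp (- inverse y)) \<longlongrightarrow> 0) (at_right 0)"
        by (rule filterlim_compose[OF poly_exp_decay filterlim_inverse_at_top_right])
      moreover have "eventually (\<lambda>y. poly (monom 1 1 * P) (inverse y) * exp (- inverse y) = bump_poly P y / y) (at_right 0)"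
        by (auto simp: eventually_at_filter bump_poly_def poly_monom field_simps intro!: always_eventually)
      ultimately show "((\<lambda>y. bump_poly P y / y) \<longlongrightarrow> 0) (at_right 0)"
        by (rule Lim_transform_eventually)
    qed
    then show ?thesis unfolding zero by (simp add: DERIV_def bump_poly_def)
  qed
qed

lemma smooth_fn_bump_poly: "smooth_fn (bump_poly P)"
proof (rule smooth_fn_coinduct_family[where \<F>="range (\<lambda>(P, c) x. bump_poly P x * c)"])
  show "bump_poly P \<in> range (\<lambda>(P, c) x. bump_poly P x * c)"
    by (intro image_eqI[of _ _ "(P, 1)"]) auto
  fix f assume "f \<in> range (\<lambda>(P, c) x. bump_poly P x * c)"
  then obtain P c where f: "f = (\<lambda>x. bump_poly P x * c)" by auto
  let ?Q = "monom 1 2 * (P - pderiv P)"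
  have "(f has_derivative (\<lambda>v. bump_poly ?Q x * (c * v))) (at x)" for x
    unfolding f
    using has_derivative_mult_left[OF bump_poly_has_derivative[of P x, unfolded has_field_derivative_def], of c]
    by (simp add: ac_simps)
  then show "\<exists>D. (\<forall>x. (f has_derivative D x) (at x)) \<and> (\<forall>v. (\<lambda>x. D x v) \<in> range (\<lambda>(P, c) x. bump_poly P x * c))"
    by (intro exI[of _ "\<lambda>x v. bump_poly ?Q x * (c * v)"]) (auto simp: image_iff intro!: exI[of _ ?Q])
qed

definition smooth_step :: "real \<Rightarrow> real" where
  "smooth_step t = exp (exp 1) * bump_poly 1 (exp (- 1) - bump_poly 1 (1 - t))"

lemma smooth_fn_smooth_step: "smooth_fn smooth_step"
proof -
  have smooth_id: "smooth_fn (\<lambda>t::real. t)" using smooth_fn_inner[of "1::real"] by simp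
  show ?thesis unfolding smooth_step_def[abs_def]
    by (intro smooth_fn_mult smooth_fn_const smooth_fn_comp[OF smooth_fn_bump_poly] smooth_fn_diff smooth_id)
qed

lemma smooth_step_eq_0: "t \<le> 0 \<Longrightarrow> smooth_step t = 0"
proof -
  assume "t \<le> 0"
  then have "1 / (1 - t) \<le> 1" by (simp add: divide_le_eq)
  then have "exp (- 1) \<le> bump_poly 1 (1 - t)" using \<open>t \<le> 0\<close> by (simp add: bump_poly_def)
  then show ?thesis by (simp add: smooth_step_def bump_poly_def)
qed

lemma smooth_step_eq_1: "1 \<le> t \<Longrightarrow> smooth_step t = 1"
proof -
  assume "1 \<le> t"
  moreover have "1 / exp (-1) = exp (1::real)" by (simp add: exp_minus divide_inverse)
  ultimately show ?thesis by (simp add: smooth_step_def bump_poly_def flip: exp_add)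
qed

lemma smooth_step_bounds: "0 \<le> smooth_step t" "smooth_step t \<le> 1"
proof -
  have bump_nonneg: "0 \<le> bump_poly 1 s" for s by (simp add: bump_poly_def)
  show "0 \<le> smooth_step t" unfolding smooth_step_def using bump_nonneg by simp
  let ?s = "exp (- 1) - bump_poly 1 (1 - t)"
  have "bump_poly 1 ?s \<le> exp (- exp 1)"
  proof (cases "?s \<le> 0")
    case False
    have "exp 1 \<le> 1 / ?s"
    proof -
      have "?s \<le> exp (-1)" using bump_nonneg by simp
      then have "1 / exp (-1) \<le> 1 / ?s" using False by (intro divide_left_mono) auto
      then show ?thesis by (simp add: exp_minus divide_inverse)
    qed
    then show ?thesis using False by (simp add: bump_poly_def)
  qed (simp add: bump_poly_def)
  then have "smooth_step t \<le> exp (exp 1) * exp (- exp 1)"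
    unfolding smooth_step_def by (intro mult_left_mono) auto
  then show "smooth_step t \<le> 1" by (simp flip: exp_add)
qed

lemma smooth_fn_has_real_derivative:
  fixes f :: "real \<Rightarrow> real"
  assumes "smooth_fn f"
  shows "(f has_real_derivative deriv f x) (at x)"
  using smooth_fnD(1)[OF assms] by (metis DERIV_deriv_iff_real_differentiable)

lemma smooth_fn_deriv:
  fixes f :: "real \<Rightarrow> real"
  assumes "smooth_fn f"
  shows "smooth_fn (deriv f)"
proof -
  have "deriv f = (\<lambda>x. fderiv f x 1)"
  proof
    fix x
    have "fderiv f x = (*) (deriv f x)"
      using smooth_fn_has_real_derivative[OF assms, of x] unfolding has_field_derivative_def
      by (rule frechet_derivative_at[symmetric])
    then show "deriv f x = fderiv f x 1" by simp
  qed
  then show ?thesis using smooth_fnD(2)[OF assms, of 1] by simp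
qed

lemma smooth_step_deriv_eq_0: "t \<notin> {0..1} \<Longrightarrow> deriv smooth_step t = 0"
proof -
  assume t: "t \<notin> {0..1}"
  obtain c U where U: "open U" "t \<in> U" "\<And>s. s \<in> U \<Longrightarrow> smooth_step s = c"
  proof (cases "t < 0")
    case True
    then show ?thesis by (intro that[of "{..<0}" 0]) (auto simp: smooth_step_eq_0)
  next
    case False
    then show ?thesis using t by (intro that[of "{1<..}" 1]) (auto simp: smooth_step_eq_1)
  qed
  have "((\<lambda>_. c) has_real_derivative deriv smooth_step t) (at t)"
    by (rule has_field_derivative_transform_within_open[OF smooth_fn_has_real_derivative[OF smooth_fn_smooth_step] U(1,2)]) (rule U(3))
  then show ?thesis by (rule DERIV_unique[OF _ DERIV_const])
qed

lemma smooth_step_deriv_bound: "\<exists>L. \<forall>t. \<bar>deriv smooth_step t\<bar> \<le> L"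
proof -
  have "compact (deriv smooth_step ` {0..1})"
    by (intro compact_continuous_image smooth_fn_continuous smooth_fn_deriv smooth_fn_smooth_step) auto
  then obtain L where "\<forall>y\<in>deriv smooth_step ` {0..1}. norm y \<le> L"
    using compact_imp_bounded bounded_iff by metis
  then have "\<bar>deriv smooth_step t\<bar> \<le> max 0 L" for t
    using smooth_step_deriv_eq_0[of t] by (cases "t \<in> {0..1}") (auto intro: max.coboundedI2)
  then show ?thesis by (intro exI allI)
qed

lemma smooth_fn_borel_measurable [measurable_dest]:
  "smooth_fn f \<Longrightarrow> f \<in> borel_measurable borel"
  by (intro borel_measurable_continuous_onI smooth_fn_continuous)

lemma frechet_derivative_mult_smooth:
  assumes "smooth_fn f" "smooth_fn g"
  shows "fderiv (\<lambda>x. f x * g x) x v = f x * fderiv g x v + fderiv f x v * g x"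
  using frechet_derivative_at[OF has_derivative_mult[OF smooth_fn_has_derivative[OF assms(1)] smooth_fn_has_derivative[OF assms(2)]], symmetric]
  by simp

lemma frechet_derivative_outside_tsupport:
  assumes "x \<notin> tsupport f"
  shows "fderiv f x v = 0" "f x = 0"
proof -
  have open_complement: "open (- tsupport f)" unfolding tsupport_def by auto
  have vanishes: "f y = 0" if "y \<in> - tsupport f" for y
    using that closure_subset[of "{x. f x \<noteq> 0}"] unfolding tsupport_def by auto
  show "f x = 0" using vanishes assms by simp
  have "(f has_derivative (\<lambda>_. 0)) (at x)"
    by (rule has_derivative_transform_within_open[OF has_derivative_const[of 0] open_complement])
        (use assms vanishes in auto)
  then show "fderiv f x v = 0" by (simp add: frechet_derivative_at[symmetric])
qed

lemma tsupport_subsetI: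
  assumes "closed K" "\<And>x. x \<notin> K \<Longrightarrow> f x = 0"
  shows "tsupport f \<subseteq> K"
  unfolding tsupport_def using assms by (intro closure_minimal) auto

lemma compact_tsupportI:
  assumes "compact K" "\<And>x. x \<notin> K \<Longrightarrow> f x = 0"
  shows "compact (tsupport f)"
  using compact_Int_closed[of K "tsupport f"] tsupport_subsetI[OF compact_imp_closed[OF assms(1)] assms(2)] assms(1)
  by (simp add: tsupport_def Int_absorb1)

lemma test_fnI:
  assumes "smooth_fn \<psi>" "compact K" "K \<subseteq> D" "\<And>x. x \<notin> K \<Longrightarrow> \<psi> x = 0"
  shows "test_fn D \<psi>"
  unfolding test_fn_def
  using assms(1) compact_tsupportI[OF assms(2,4)] subset_trans[OF tsupport_subsetI[OF compact_imp_closed[OF assms(2)] assms(4)] assms(3)]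
  by simp

lemma closed_tsupport: "closed (tsupport f)" by (simp add: tsupport_def)

lemma grad_fn_inner:
  assumes "smooth_fn \<psi>"
  shows "grad_fn \<psi> x \<bullet> v = fderiv \<psi> x v"
proof -
  have lin: "linear (fderiv \<psi> x)"
    by (rule has_derivative_linear[OF smooth_fn_has_derivative[OF assms]])
  have "fderiv \<psi> x v = fderiv \<psi> x (\<Sum>b\<in>Basis. (v \<bullet> b) *\<^sub>R b)"
    by (simp add: euclidean_representation)
  also have "\<dots> = (\<Sum>b\<in>Basis. (v \<bullet> b) * fderiv \<psi> x b)"
    by (simp add: linear_sum[OF lin] linear_scale[OF lin])
  finally have fderiv_expansion: "fderiv \<psi> x v = (\<Sum>b\<in>Basis. (v \<bullet> b) * fderiv \<psi> x b)" .
  show ?thesis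
    unfolding fderiv_expansion grad_fn_def inner_sum_left
    by (intro sum.cong refl) (simp add: inner_commute)
qed

lemma grad_fn_eqI:
  assumes "(\<psi> has_derivative (\<lambda>v. g \<bullet> v)) (at x)"
  shows "grad_fn \<psi> x = g"
  using frechet_derivative_at[OF assms, symmetric]
  by (simp add: grad_fn_def euclidean_representation)

lemma smooth_fn_has_derivative_grad:
  assumes "smooth_fn \<psi>"
  shows "(\<psi> has_derivative (\<lambda>v. grad_fn \<psi> x \<bullet> v)) (at x)"
  using smooth_fn_has_derivative[OF assms] unfolding grad_fn_inner[OF assms] .

lemma grad_fn_continuous: "smooth_fn \<psi> \<Longrightarrow> continuous_on A (grad_fn \<psi>)"
  unfolding grad_fn_def[abs_def] by (intro continuous_intros smooth_fn_derivative_continuous)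

lemma grad_fn_outside_tsupport: "x \<notin> tsupport \<psi> \<Longrightarrow> grad_fn \<psi> x = 0"
  by (simp add: grad_fn_def frechet_derivative_outside_tsupport)

lemma grad_fn_add:
  assumes "smooth_fn f" "smooth_fn g"
  shows "grad_fn (\<lambda>x. f x + g x) x = grad_fn f x + grad_fn g x"
  by (rule grad_fn_eqI)
      (use has_derivative_add[OF smooth_fn_has_derivative_grad[OF assms(1)] smooth_fn_has_derivative_grad[OF assms(2)]]
      in \<open>simp add: inner_add_left\<close>)

lemma grad_fn_mult:
  assumes "smooth_fn f" "smooth_fn g"
  shows "grad_fn (\<lambda>x. f x * g x) x = f x *\<^sub>R grad_fn g x + g x *\<^sub>R grad_fn f x"
  by (rule grad_fn_eqI)
      (use has_derivative_mult[OF smooth_fn_has_derivative_grad[OF assms(1)] smooth_fn_has_derivative_grad[OF assms(2)]]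
      in \<open>simp add: inner_add_left mult.commute\<close>)

lemma grad_fn_comp:
  fixes p :: "real \<Rightarrow> real"
  assumes p: "smooth_fn p" and g: "smooth_fn g"
  shows "grad_fn (\<lambda>x. p (g x)) x = deriv p (g x) *\<^sub>R grad_fn g x"
proof (rule grad_fn_eqI)
  have "(p has_derivative (*) (deriv p (g x))) (at (g x))"
    using smooth_fn_has_real_derivative[OF p] by (simp add: has_field_derivative_def)
  from has_derivative_compose[OF smooth_fn_has_derivative_grad[OF g] this]
  show "((\<lambda>x. p (g x)) has_derivative (\<bullet>) (deriv p (g x) *\<^sub>R grad_fn g x)) (at x)"
    by (rule has_derivative_eq_rhs) (simp add: fun_eq_iff)
qed

lemma grad_fn_translate:
  assumes "smooth_fn \<psi>"
  shows "grad_fn (\<lambda>x. \<psi> (x + y)) x = grad_fn \<psi> (x + y)"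
proof (rule grad_fn_eqI)
  have "((\<lambda>x. x + y) has_derivative (\<lambda>v. v)) (at x)" by (auto intro!: derivative_eq_intros)
  from has_derivative_compose[OF this smooth_fn_has_derivative_grad[OF assms]]
  show "((\<lambda>x. \<psi> (x + y)) has_derivative (\<bullet>) (grad_fn \<psi> (x + y))) (at x)" .
qed

lemma integral_lborel_translate:
  fixes f :: "'a::euclidean_space \<Rightarrow> real"
  assumes "f \<in> borel_measurable borel"
  shows "(\<integral>x. f (x + a) \<partial>lborel) = (\<integral>x. f x \<partial>lborel)"
proof -
  have "(\<integral>x. f x \<partial>lborel) = (\<integral>x. f x \<partial>distr lborel borel ((+) a))"
    by (simp add: lborel_distr_plus)
  also have "\<dots> = (\<integral>x. f (a + x) \<partial>lborel)" using assms by (subst integral_distr) auto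
  finally show ?thesis by (simp add: add.commute)
qed

lemma integrable_compact_support:
  fixes f :: "'a::euclidean_space \<Rightarrow> real"
  assumes f: "continuous_on UNIV f" and K: "compact K" and zero: "\<And>x. x \<notin> K \<Longrightarrow> f x = 0"
  shows "integrable lborel f" "integrable lebesgue f"
proof -
  have "(\<lambda>x. indicator K x *\<^sub>R f x) = f" using zero by (auto simp: fun_eq_iff indicator_def)
  then show "integrable lborel f"
    using borel_integrable_compact[OF K continuous_on_subset[OF f]] by simp
  then show "integrable lebesgue f"
    using borel_measurable_continuous_onI[OF f] by (simp add: integrable_completion)
qed

lemma continuous_compact_support_bounded:
  fixes f :: "'a::euclidean_space \<Rightarrow> real"
  assumes "continuous_on UNIV f" "compact K" "\<And>x. x \<notin> K \<Longrightarrow> f x = 0"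
  shows "\<exists>C\<ge>0. \<forall>x. \<bar>f x\<bar> \<le> C"
proof -
  have "compact (f ` K)"
    using assms by (intro compact_continuous_image continuous_on_subset[OF assms(1)]) auto
  then obtain C where C: "\<forall>y\<in>f ` K. norm y \<le> C" using compact_imp_bounded bounded_iff by metis
  show ?thesis
  proof (intro exI[of _ "max 0 C"] conjI allI)
    fix x show "\<bar>f x\<bar> \<le> max 0 C"
      using C assms(3)[of x] by (cases "x \<in> K") (auto intro: max.coboundedI2)
  qed simp
qed

lemma smooth_fn_line_derivative:
  assumes "smooth_fn f"
  shows "((\<lambda>s. f (x + s *\<^sub>R v)) has_real_derivative fderiv f (x + s *\<^sub>R v) v) (at s)"
proof -
  have "((\<lambda>s. x + s *\<^sub>R v) has_derivative (\<lambda>h. h *\<^sub>R v)) (at s)"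
    by (auto intro!: derivative_eq_intros)
  from has_derivative_compose[OF this smooth_fn_has_derivative[OF assms]]
  have "((\<lambda>s. f (x + s *\<^sub>R v)) has_derivative (\<lambda>h. fderiv f (x + s *\<^sub>R v) (h *\<^sub>R v))) (at s)" .
  moreover have "fderiv f y (h *\<^sub>R v) = fderiv f y v * h" for y h
    using linear_scale[OF has_derivative_linear[OF smooth_fn_has_derivative[OF assms]], of y h v]
    by simp
  ultimately show ?thesis unfolding has_field_derivative_def by simp
qed

lemma smooth_fn_difference_quotient_le:
  assumes f: "smooth_fn f" and C: "\<And>y. \<bar>fderiv f y v\<bar> \<le> C" and h: "0 < h"
  shows "\<bar>(f (x + h *\<^sub>R v) - f x) / h\<bar> \<le> C"
proof -
  have "\<exists>s>0. s < h \<and> f (x + h *\<^sub>R v) - f (x + 0 *\<^sub>R v) = (h - 0) * fderiv f (x + s *\<^sub>R v) v"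
    by (rule MVT2[OF h smooth_fn_line_derivative[OF f]])
  then show ?thesis using C h by (auto simp: abs_mult)
qed

lemma smooth_fn_difference_quotient_tendsto:
  assumes "smooth_fn f"
  shows "(\<lambda>n. (f (x + (1 / real (Suc n)) *\<^sub>R v) - f x) / (1 / real (Suc n))) \<longlonglongrightarrow> fderiv f x v"
proof (rule filterlim_compose[where g="\<lambda>h. (f (x + h *\<^sub>R v) - f x) / h"])
  show "((\<lambda>h. (f (x + h *\<^sub>R v) - f x) / h) \<longlongrightarrow> fderiv f x v) (at 0)"
    using smooth_fn_line_derivative[OF assms, of x v 0] by (simp add: DERIV_def)
  show "filterlim (\<lambda>n. 1 / real (Suc n)) (at 0) sequentially"
    unfolding filterlim_at using LIMSEQ_Suc[OF lim_const_over_n[of 1]] by simp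
qed

lemma integral_difference_quotient_eq_0:
  fixes f :: "'a::euclidean_space \<Rightarrow> real"
  assumes f: "smooth_fn f" and K: "compact (tsupport f)"
  shows "(\<integral>x. (f (x + a) - f x) / h \<partial>lborel) = 0"
proof -
  have f_int: "integrable lborel f"
    by (rule integrable_compact_support(1)[OF smooth_fn_continuous[OF f] K]) (rule frechet_derivative_outside_tsupport(2))
  have "integrable lborel (\<lambda>x. f (x + a))"
  proof (rule integrable_compact_support(1)[OF smooth_fn_continuous[OF smooth_fn_translate[OF f]]])
    show "compact ((\<lambda>x. x - a) ` tsupport f)"
      by (intro compact_continuous_image continuous_intros K)
    show "f (x + a) = 0" if "x \<notin> (\<lambda>x. x - a) ` tsupport f" for x
      using that
      by (intro frechet_derivative_outside_tsupport(2)) (auto simp: image_iff dest!: bspec[of _ _ "x + a"])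
  qed
  then show ?thesis
    using f_int integral_lborel_translate[OF smooth_fn_borel_measurable[OF f]] by simp
qed

lemma integral_frechet_derivative_eq_0:
  fixes f :: "'a::euclidean_space \<Rightarrow> real"
  assumes f: "smooth_fn f" and K: "compact (tsupport f)"
  shows "(\<integral>x. fderiv f x v \<partial>lborel) = 0"
proof -
  have deriv_cont: "continuous_on UNIV (\<lambda>x. fderiv f x v)"
    by (rule smooth_fn_derivative_continuous[OF f])
  obtain C where C: "0 \<le> C" "\<And>x. \<bar>fderiv f x v\<bar> \<le> C"
    using continuous_compact_support_bounded[OF deriv_cont K frechet_derivative_outside_tsupport(1)]
    by auto
  define K' where "K' = (\<lambda>(x, s). x - s *\<^sub>R v) ` (tsupport f \<times> {0..1::real})"
  have K': "compact K'" unfolding K'_def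
    by (intro compact_continuous_image compact_Times K) (auto simp: case_prod_unfold intro!: continuous_intros)
  have vanishes: "f (x + s *\<^sub>R v) = 0" if "x \<notin> K'" "s \<in> {0..1}" for x s
  proof (rule frechet_derivative_outside_tsupport(2)[where f=f], rule notI)
    assume "x + s *\<^sub>R v \<in> tsupport f"
    then have "x \<in> K'"
      unfolding K'_def using that(2) by (intro image_eqI[of _ _ "(x + s *\<^sub>R v, s)"]) auto
    with that(1) show False ..
  qed
  define g where "g n x = (f (x + (1 / real (Suc n)) *\<^sub>R v) - f x) / (1 / real (Suc n))" for n x
  have "(\<integral>x. g n x \<partial>lborel) = 0" for n
    unfolding g_def by (rule integral_difference_quotient_eq_0[OF f K])
  moreover have "(\<lambda>n. \<integral>x. g n x \<partial>lborel) \<longlonglongrightarrow> (\<integral>x. fderiv f x v \<partial>lborel)"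
  proof (rule integral_dominated_convergence[where w="\<lambda>x. C * indicator K' x"])
    show "integrable lborel (\<lambda>x. C * indicator K' x :: real)"
      using emeasure_compact_finite[OF K'] borel_compact[OF K']
      by (intro integrable_mult_right integrable_real_indicator) auto
    show "g n \<in> borel_measurable lborel" for n
      using smooth_fn_borel_measurable[OF f] smooth_fn_borel_measurable[OF smooth_fn_translate[OF f]] by (simp add: g_def[abs_def])
    have "norm (g n x) \<le> C * indicator K' x" for n x
    proof (cases "x \<in> K'")
      case True
      then show ?thesis
        using smooth_fn_difference_quotient_le[OF f C(2), of "1 / real (Suc n)" x]
        by (simp add: g_def)
    next
      case False
      then show ?thesis
        using vanishes[OF False, of 0] vanishes[OF False, of "1 / real (Suc n)"]
        by (simp add: g_def)
    qed
    then show "AE x in lborel. norm (g n x) \<le> C * indicator K' x" for n by simp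
    show "AE x in lborel. (\<lambda>n. g n x) \<longlonglongrightarrow> fderiv f x v"
      unfolding g_def by (intro AE_I2 smooth_fn_difference_quotient_tendsto f)
  qed (use borel_measurable_continuous_onI[OF deriv_cont] in simp)
  ultimately show ?thesis using LIMSEQ_unique[OF _ tendsto_const] by simp
qed

lemma tsupport_mult_subset: "tsupport (\<lambda>x. f x * g x) \<subseteq> tsupport g"
  unfolding tsupport_def by (intro closure_mono) auto

lemma compact_tsupport_mult: "compact (tsupport g) \<Longrightarrow> compact (tsupport (\<lambda>x. f x * g x))"
  using compact_Int_closed[of "tsupport g" "tsupport (\<lambda>x. f x * g x)"] tsupport_mult_subset[of f g]
  by (simp add: closed_tsupport Int_absorb1)

lemma weak_grad_smooth:
  fixes u :: "'a::euclidean_space \<Rightarrow> real"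
  assumes u: "smooth_fn u"
  shows "weak_grad D u (grad_fn u)"
  unfolding weak_grad_def
proof (intro allI impI)
  fix \<phi> :: "'a \<Rightarrow> real" and v assume "test_fn D \<phi>"
  then have \<phi>: "smooth_fn \<phi>" "compact (tsupport \<phi>)" "tsupport \<phi> \<subseteq> D" by (auto simp: test_fn_def)
  have vanish: "\<phi> x = 0" "fderiv \<phi> x v = 0" if "x \<notin> tsupport \<phi>" for x
    using frechet_derivative_outside_tsupport[OF that] by auto
  have restrict: "indicator D x * u x * fderiv \<phi> x v = u x * fderiv \<phi> x v"
      "indicator D x * (grad_fn u x \<bullet> v) * \<phi> x = fderiv u x v * \<phi> x" for x
    using vanish[of x] \<phi>(3) by (auto simp: indicator_def grad_fn_inner[OF u])
  have cont: "continuous_on UNIV (\<lambda>x. u x * fderiv \<phi> x v)" "continuous_on UNIV (\<lambda>x. fderiv u x v * \<phi> x)"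
    by (intro continuous_intros smooth_fn_continuous smooth_fn_derivative_continuous u \<phi>)+
  have "0 = (\<integral>x. fderiv (\<lambda>x. u x * \<phi> x) x v \<partial>lborel)"
    by (rule integral_frechet_derivative_eq_0[symmetric]) (intro smooth_fn_mult u \<phi> compact_tsupport_mult)+
  also have "\<dots> = (\<integral>x. u x * fderiv \<phi> x v \<partial>lborel) + (\<integral>x. fderiv u x v * \<phi> x \<partial>lborel)"
    unfolding frechet_derivative_mult_smooth[OF u \<phi>(1)] using vanish
    by (intro Bochner_Integration.integral_add integrable_compact_support(1)[OF _ \<phi>(2)] cont) simp_all
  finally have "(\<integral>x. u x * fderiv \<phi> x v \<partial>lborel) = - (\<integral>x. fderiv u x v * \<phi> x \<partial>lborel)" by simp
  then show "(\<integral>x. indicator D x * u x * fderiv \<phi> x v \<partial>lebesgue)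
    = - (\<integral>x. indicator D x * (grad_fn u x \<bullet> v) * \<phi> x \<partial>lebesgue)"
    unfolding restrict
    using cont[THEN borel_measurable_continuous_onI] by (simp add: integral_completion)
qed

section \<open>Sobolev functions\<close>

definition H1_measurable :: "'a::euclidean_space set \<Rightarrow> ('a \<Rightarrow> real) \<Rightarrow> ('a \<Rightarrow> 'a) \<Rightarrow> bool" where
  "H1_measurable D w G \<longleftrightarrow> (\<lambda>x. indicator D x * w x) \<in> borel_measurable lebesgue \<and>
      (\<lambda>x. indicator D x *\<^sub>R G x) \<in> borel_measurable lebesgue"

definition H1_norm_sq :: "'a::euclidean_space set \<Rightarrow> ('a \<Rightarrow> real) \<Rightarrow> ('a \<Rightarrow> 'a) \<Rightarrow> ennreal" where
  "H1_norm_sq D w G = (\<integral>\<^sup>+x. ennreal (indicator D x * ((w x)\<^sup>2 + (norm (G x))\<^sup>2)) \<partial>lebesgue)"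

lemma H1_measurable_subset:
  assumes "H1_measurable D w G" "K \<in> sets lebesgue" "K \<subseteq> D"
  shows "H1_measurable K w G"
proof -
  have restrict: "indicator K x * w x = indicator K x * (indicator D x * w x)"
    "indicator K x *\<^sub>R G x = indicator K x *\<^sub>R (indicator D x *\<^sub>R G x)" for x
    using assms(3) by (auto simp: indicator_def)
  have [measurable]: "(\<lambda>x. indicator D x * w x) \<in> borel_measurable lebesgue"
    "(\<lambda>x. indicator D x *\<^sub>R G x) \<in> borel_measurable lebesgue" "K \<in> sets lebesgue"
    using assms by (auto simp: H1_measurable_def)
  show ?thesis unfolding H1_measurable_def restrict by (intro conjI; measurable)
qed

lemma H1_measurable_sq:
  assumes "H1_measurable D w G"
  shows "(\<lambda>x. indicator D x * (w x)\<^sup>2) \<in> borel_measurable lebesgue"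
    "(\<lambda>x. indicator D x * (norm (G x))\<^sup>2) \<in> borel_measurable lebesgue"
    "(\<lambda>x. indicator D x * ((w x)\<^sup>2 + (norm (G x))\<^sup>2)) \<in> borel_measurable lebesgue"
proof -
  have [measurable]: "(\<lambda>x. indicator D x * w x) \<in> borel_measurable lebesgue"
      "(\<lambda>x. indicator D x *\<^sub>R G x) \<in> borel_measurable lebesgue"
    using assms by (auto simp: H1_measurable_def)
  have square: "indicator D x * (w x)\<^sup>2 = (indicator D x * w x)\<^sup>2"
      "indicator D x * (norm (G x))\<^sup>2 = (norm (indicator D x *\<^sub>R G x))\<^sup>2" for x
    by (cases "x \<in> D"; simp)+
  show w: "(\<lambda>x. indicator D x * (w x)\<^sup>2) \<in> borel_measurable lebesgue" unfolding square by measurable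
  show G: "(\<lambda>x. indicator D x * (norm (G x))\<^sup>2) \<in> borel_measurable lebesgue"
    unfolding square by measurable
  show "(\<lambda>x. indicator D x * ((w x)\<^sup>2 + (norm (G x))\<^sup>2)) \<in> borel_measurable lebesgue"
    unfolding distrib_left by (intro borel_measurable_add w G)
qed

lemma H1_measurable_add:
  assumes "H1_measurable D w G" "H1_measurable D w' G'"
  shows "H1_measurable D (\<lambda>x. w x + w' x) (\<lambda>x. G x + G' x)"
  using assms
  unfolding H1_measurable_def distrib_left scaleR_right_distrib
  by (auto intro: borel_measurable_add)

lemma H1_measurable_diff:
  assumes "H1_measurable D w G" "H1_measurable D w' G'"
  shows "H1_measurable D (\<lambda>x. w x - w' x) (\<lambda>x. G x - G' x)"
  using assms
  unfolding H1_measurable_def right_diff_distrib scaleR_right_diff_distrib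
  by (auto intro: borel_measurable_diff)

lemma H1_measurable_smooth:
  assumes "D \<in> sets lebesgue" "smooth_fn \<psi>"
  shows "H1_measurable D \<psi> (grad_fn \<psi>)"
  unfolding H1_measurable_def
proof
  have [measurable]: "\<psi> \<in> borel_measurable lebesgue" "grad_fn \<psi> \<in> borel_measurable lebesgue" "D \<in> sets lebesgue"
    using assms smooth_fn_continuous[of \<psi> UNIV] grad_fn_continuous[of \<psi> UNIV]
    by (auto intro!: measurable_completion simp: borel_measurable_continuous_onI)
  show "(\<lambda>x. indicator D x * \<psi> x) \<in> borel_measurable lebesgue" by measurable
  show "(\<lambda>x. indicator D x *\<^sub>R grad_fn \<psi> x) \<in> borel_measurable lebesgue" by measurable
qed

lemma sq_add_le: "(a + b)\<^sup>2 \<le> 2 * a\<^sup>2 + 2 * (b::real)\<^sup>2"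
  using sum_squares_bound[of a b] by (simp add: power2_sum)

lemma norm_sq_add_le: "(norm (a + b))\<^sup>2 \<le> 2 * (norm a)\<^sup>2 + 2 * (norm b)\<^sup>2"
proof -
  have "(norm (a + b))\<^sup>2 \<le> (norm a + norm b)\<^sup>2" by (intro power_mono norm_triangle_ineq) auto
  also have "\<dots> \<le> 2 * (norm a)\<^sup>2 + 2 * (norm b)\<^sup>2" by (rule sq_add_le)
  finally show ?thesis .
qed

lemma H1_norm_sq_add_le:
  assumes "H1_measurable D w G" "H1_measurable D w' G'"
  shows "H1_norm_sq D (\<lambda>x. w x + w' x) (\<lambda>x. G x + G' x) \<le> 2 * H1_norm_sq D w G + 2 * H1_norm_sq D w' G'"
proof -
  have "H1_norm_sq D (\<lambda>x. w x + w' x) (\<lambda>x. G x + G' x)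
    \<le> (\<integral>\<^sup>+x. 2 * ennreal (indicator D x * ((w x)\<^sup>2 + (norm (G x))\<^sup>2)) + 2 * ennreal (indicator D x * ((w' x)\<^sup>2 + (norm (G' x))\<^sup>2)) \<partial>lebesgue)"
    unfolding H1_norm_sq_def
  proof (rule nn_integral_mono)
    fix x
    have "(w x + w' x)\<^sup>2 + (norm (G x + G' x))\<^sup>2
      \<le> 2 * ((w x)\<^sup>2 + (norm (G x))\<^sup>2) + 2 * ((w' x)\<^sup>2 + (norm (G' x))\<^sup>2)"
      using sq_add_le[of "w x" "w' x"] norm_sq_add_le[of "G x" "G' x"] by simp
    then have "ennreal (indicator D x * ((w x + w' x)\<^sup>2 + (norm (G x + G' x))\<^sup>2))
        \<le> ennreal (2 * (indicator D x * ((w x)\<^sup>2 + (norm (G x))\<^sup>2)) + 2 * (indicator D x * ((w' x)\<^sup>2 + (norm (G' x))\<^sup>2)))"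
      by (intro ennreal_leI) (cases "x \<in> D"; simp)
    also have "\<dots> = 2 * ennreal (indicator D x * ((w x)\<^sup>2 + (norm (G x))\<^sup>2))
      + 2 * ennreal (indicator D x * ((w' x)\<^sup>2 + (norm (G' x))\<^sup>2))"
      by (subst ennreal_plus) (auto simp: ennreal_mult')
    finally show "ennreal (indicator D x * ((w x + w' x)\<^sup>2 + (norm (G x + G' x))\<^sup>2)) \<le> \<dots>" .
  qed
  also have "\<dots> = 2 * H1_norm_sq D w G + 2 * H1_norm_sq D w' G'"
    unfolding H1_norm_sq_def using H1_measurable_sq(3)[OF assms(1)] H1_measurable_sq(3)[OF assms(2)]
    by (subst nn_integral_add) (auto simp: nn_integral_cmult)
  finally show ?thesis .
qed

lemma H1_norm_sq_diff_le:
  assumes "H1_measurable D w G" "H1_measurable D w' G'"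
  shows "H1_norm_sq D (\<lambda>x. w x - w' x) (\<lambda>x. G x - G' x) \<le> 2 * H1_norm_sq D w G + 2 * H1_norm_sq D w' G'"
  using H1_norm_sq_add_le[OF assms(1), of "\<lambda>x. - w' x" "\<lambda>x. - G' x"] assms(2)
  by (simp add: H1_measurable_def H1_norm_sq_def)

lemma H1_norm_sq_mono: "D \<subseteq> D' \<Longrightarrow> H1_norm_sq D w G \<le> H1_norm_sq D' w G"
  unfolding H1_norm_sq_def
  by (intro nn_integral_mono ennreal_leI mult_right_mono) (auto simp: indicator_def)

lemma H1_norm_sq_eq_integral:
  assumes "H1_measurable D w G"
  shows "enn2real (H1_norm_sq D w G) = (\<integral>x. indicator D x * ((w x)\<^sup>2 + (norm (G x))\<^sup>2) \<partial>lebesgue)"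
  unfolding H1_norm_sq_def
  using H1_measurable_sq(3)[OF assms] by (subst integral_eq_nn_integral) auto

lemma H1_norm_sq_finite_iff:
  assumes meas: "H1_measurable D w G"
  shows "H1_norm_sq D w G < \<infinity> \<longleftrightarrow> integrable lebesgue (\<lambda>x. indicator D x * (w x)\<^sup>2) \<and>
      integrable lebesgue (\<lambda>x. indicator D x * (norm (G x))\<^sup>2)"
    and "H1_norm_sq D w G < \<infinity> \<longleftrightarrow> integrable lebesgue (\<lambda>x. indicator D x * ((w x)\<^sup>2 + (norm (G x))\<^sup>2))"
proof -
  show sum: "H1_norm_sq D w G < \<infinity> \<longleftrightarrow> integrable lebesgue (\<lambda>x. indicator D x * ((w x)\<^sup>2 + (norm (G x))\<^sup>2))"
    using H1_measurable_sq(3)[OF meas] by (simp add: H1_norm_sq_def integrable_iff_bounded)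
  have summand: "integrable lebesgue (\<lambda>x. indicator D x * f x)"
    if "integrable lebesgue (\<lambda>x. indicator D x * ((w x)\<^sup>2 + (norm (G x))\<^sup>2))"
      "(\<lambda>x. indicator D x * f x) \<in> borel_measurable lebesgue" "\<And>x. 0 \<le> f x \<and> f x \<le> (w x)\<^sup>2 + (norm (G x))\<^sup>2"
    for f :: "'a \<Rightarrow> real"
    by (rule Bochner_Integration.integrable_bound[OF that(1,2)]) (use that(3) in \<open>auto intro!: AE_I2 simp: indicator_def\<close>)
  have "integrable lebesgue (\<lambda>x. indicator D x * (w x)\<^sup>2) \<and> integrable lebesgue (\<lambda>x. indicator D x * (norm (G x))\<^sup>2)"
    if "integrable lebesgue (\<lambda>x. indicator D x * ((w x)\<^sup>2 + (norm (G x))\<^sup>2))"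
    using summand[OF that H1_measurable_sq(1)[OF meas]] summand[OF that H1_measurable_sq(2)[OF meas]] by simp
  then show "H1_norm_sq D w G < \<infinity> \<longleftrightarrow> integrable lebesgue (\<lambda>x. indicator D x * (w x)\<^sup>2) \<and>
      integrable lebesgue (\<lambda>x. indicator D x * (norm (G x))\<^sup>2)"
    unfolding sum by (auto simp: distrib_left)
qed

lemma H1_norm_sq_smooth_finite:
  assumes D: "bounded D" and p: "smooth_fn p"
  shows "H1_norm_sq D p (grad_fn p) < \<infinity>"
proof -
  let ?f = "\<lambda>x. (p x)\<^sup>2 + (norm (grad_fn p x))\<^sup>2"
  have "continuous_on (closure D) ?f"
    by (intro continuous_intros smooth_fn_continuous grad_fn_continuous p)
  then have "integrable lborel (\<lambda>x. indicator (closure D) x *\<^sub>R ?f x)"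
    using D by (intro borel_integrable_compact) (auto simp: compact_closure)
  then have "(\<integral>\<^sup>+x. ennreal (norm (indicator (closure D) x *\<^sub>R ?f x)) \<partial>lborel) < \<infinity>"
    by (simp only: integrable_iff_bounded)
  then have "H1_norm_sq (closure D) p (grad_fn p) < \<infinity>"
    by (simp add: H1_norm_sq_def nn_integral_completion abs_mult)
  then show ?thesis by (rule order_le_less_trans[OF H1_norm_sq_mono[OF closure_subset]])
qed

lemma H1_norm_sq_test_fn_finite:
  assumes "test_fn D \<psi>"
  shows "H1_norm_sq D \<psi> (grad_fn \<psi>) < \<infinity>"
proof -
  have "H1_norm_sq D \<psi> (grad_fn \<psi>) \<le> H1_norm_sq (tsupport \<psi>) \<psi> (grad_fn \<psi>)"
    unfolding H1_norm_sq_def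
    by (intro nn_integral_mono ennreal_leI)
      (auto simp: indicator_def grad_fn_outside_tsupport frechet_derivative_outside_tsupport(2))
  also have "\<dots> < \<infinity>"
    using assms by (intro H1_norm_sq_smooth_finite compact_imp_bounded) (auto simp: test_fn_def)
  finally show ?thesis .
qed

lemma H1loc_iff:
  "H1loc D w G \<longleftrightarrow> H1_measurable D w G \<and> (\<forall>K. compact K \<and> K \<subseteq> D \<longrightarrow> H1_norm_sq K w G < \<infinity>) \<and> weak_grad D w G"
proof -
  have "H1_norm_sq K w G < \<infinity> \<longleftrightarrow> integrable lebesgue (\<lambda>x. indicator K x * (w x)\<^sup>2) \<and>
      integrable lebesgue (\<lambda>x. indicator K x * (norm (G x))\<^sup>2)"
      if "H1_measurable D w G" "compact K" "K \<subseteq> D" for K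
    using that
    by (intro H1_norm_sq_finite_iff(1) H1_measurable_subset[OF that(1)]) (simp_all add: borel_compact)
  then have local: "(\<forall>K. compact K \<and> K \<subseteq> D \<longrightarrow> H1_norm_sq K w G < \<infinity>) \<longleftrightarrow>
      (\<forall>K. compact K \<and> K \<subseteq> D \<longrightarrow> integrable lebesgue (\<lambda>x. indicator K x * (w x)\<^sup>2)) \<and>
      (\<forall>K. compact K \<and> K \<subseteq> D \<longrightarrow> integrable lebesgue (\<lambda>x. indicator K x * (norm (G x))\<^sup>2))"
    if "H1_measurable D w G" using that by (simp only: all_conj_distrib imp_conjR cong: imp_cong)
  show ?thesis
  proof (cases "H1_measurable D w G")
    case True
    show ?thesis unfolding local[OF True] H1loc_def L2loc_def L2loc_vec_def
      using True by (simp add: H1_measurable_def)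
  next
    case False
    then show ?thesis by (auto simp: H1loc_def L2loc_def L2loc_vec_def H1_measurable_def)
  qed
qed

lemma H1_iff:
  "H1 D w G \<longleftrightarrow> H1_measurable D w G \<and> H1_norm_sq D w G < \<infinity> \<and> weak_grad D w G"
proof -
  have "H1_norm_sq K w G < \<infinity>" if "H1_norm_sq D w G < \<infinity>" "K \<subseteq> D" for K
    by (rule order_le_less_trans[OF H1_norm_sq_mono[OF that(2)] that(1)])
  then show ?thesis unfolding H1_def H1loc_iff using H1_norm_sq_finite_iff(1)[of D w G] by auto
qed

lemma weighted_pairing_le:
  fixes a b t p :: real and G v :: "'a::euclidean_space"
  assumes t: "0 < t"
  shows "\<bar>a * b\<bar> + \<bar>(G \<bullet> v) * p\<bar> \<le> (t * (a\<^sup>2 + (norm G)\<^sup>2) + (b\<^sup>2 + (norm v * \<bar>p\<bar>)\<^sup>2) / t) / 2"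
proof -
  have weighted: "\<bar>x * y\<bar> \<le> (t * x\<^sup>2 + y\<^sup>2 / t) / 2" for x y :: real
  proof -
    have "0 \<le> (t * \<bar>x\<bar> - \<bar>y\<bar>)\<^sup>2 / t" using t by simp
    then show ?thesis
      using t
      by (simp add: power2_diff power_mult_distrib field_simps abs_mult power2_eq_square[of t])
  qed
  have "\<bar>(G \<bullet> v) * p\<bar> \<le> \<bar>norm G * (norm v * \<bar>p\<bar>)\<bar>"
    using Cauchy_Schwarz_ineq2[of G v] by (simp add: abs_mult mult_right_mono mult.assoc[symmetric])
  then show ?thesis
    using weighted[of a b] weighted[of "norm G" "norm v * \<bar>p\<bar>"]
    by (simp add: algebra_simps add_divide_distrib)
qed

lemma weak_pairing_measurable:
  assumes \<phi>: "smooth_fn \<phi>" and w: "H1_measurable D w G"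
  shows "(\<lambda>x. indicator D x * w x * fderiv \<phi> x v) \<in> borel_measurable lebesgue"
    "(\<lambda>x. indicator D x * (G x \<bullet> v) * \<phi> x) \<in> borel_measurable lebesgue"
proof -
  have [measurable]: "(\<lambda>x. indicator D x * w x) \<in> borel_measurable lebesgue"
      "(\<lambda>x. indicator D x *\<^sub>R G x) \<in> borel_measurable lebesgue" "(\<lambda>x. fderiv \<phi> x v) \<in> borel_measurable lebesgue"
      "\<phi> \<in> borel_measurable lebesgue"
    using w smooth_fn_continuous[OF \<phi>, of UNIV] smooth_fn_derivative_continuous[OF \<phi>, of UNIV v]
    by (auto intro!: measurable_completion simp: H1_measurable_def borel_measurable_continuous_onI)
  show "(\<lambda>x. indicator D x * w x * fderiv \<phi> x v) \<in> borel_measurable lebesgue" by measurable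
  have "(\<lambda>x. ((indicator D x *\<^sub>R G x) \<bullet> v) * \<phi> x) \<in> borel_measurable lebesgue" by measurable
  then show "(\<lambda>x. indicator D x * (G x \<bullet> v) * \<phi> x) \<in> borel_measurable lebesgue" by simp
qed

lemma weak_pairing_density_le:
  fixes G :: "'a::euclidean_space \<Rightarrow> 'a"
  assumes "tsupport \<phi> \<subseteq> D" and t: "0 < t"
  shows "\<bar>indicator D x * w x * fderiv \<phi> x v\<bar> + \<bar>indicator D x * (G x \<bullet> v) * \<phi> x\<bar>
    \<le> (t * (indicator (tsupport \<phi>) x * ((w x)\<^sup>2 + (norm (G x))\<^sup>2)) + ((fderiv \<phi> x v)\<^sup>2 + (norm v * \<bar>\<phi> x\<bar>)\<^sup>2) / t) / 2"
proof (cases "x \<in> tsupport \<phi>")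
  case True
  then show ?thesis
    using weighted_pairing_le[OF t, of "w x" "fderiv \<phi> x v" "G x" v "\<phi> x"] assms(1) by auto
next
  case False
  then show ?thesis using t by (simp add: frechet_derivative_outside_tsupport)
qed

lemma
  assumes \<phi>: "test_fn D \<phi>" and w_meas: "H1_measurable D w G" and fin: "H1_norm_sq (tsupport \<phi>) w G < \<infinity>"
  shows weak_pairing_integrable: "integrable lebesgue (\<lambda>x. indicator D x * w x * fderiv \<phi> x v)"
      "integrable lebesgue (\<lambda>x. indicator D x * (G x \<bullet> v) * \<phi> x)"
    and weak_pairing_le: "0 < t \<Longrightarrow> \<bar>(\<integral>x. indicator D x * w x * fderiv \<phi> x v \<partial>lebesgue) +
      (\<integral>x. indicator D x * (G x \<bullet> v) * \<phi> x \<partial>lebesgue)\<bar>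
      \<le> (t * enn2real (H1_norm_sq (tsupport \<phi>) w G) + (\<integral>x. (fderiv \<phi> x v)\<^sup>2 + (norm v * \<bar>\<phi> x\<bar>)\<^sup>2 \<partial>lebesgue) / t) / 2"
proof -
  let ?K = "tsupport \<phi>" and ?a = "\<lambda>x. indicator D x * w x * fderiv \<phi> x v" and ?b = "\<lambda>x. indicator D x * (G x \<bullet> v) * \<phi> x"
    and ?h = "\<lambda>x. indicator (tsupport \<phi>) x * ((w x)\<^sup>2 + (norm (G x))\<^sup>2)" and ?f = "\<lambda>x. (fderiv \<phi> x v)\<^sup>2 + (norm v * \<bar>\<phi> x\<bar>)\<^sup>2"
  have test: "smooth_fn \<phi>" "compact ?K" "?K \<subseteq> D" using \<phi> by (auto simp: test_fn_def)
  have mK: "H1_measurable ?K w G"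
    using test(2,3) by (intro H1_measurable_subset[OF w_meas]) (simp_all add: borel_compact)
  have f_int: "integrable lebesgue ?f"
    by (rule integrable_compact_support(2)[OF _ test(2)])
      (intro continuous_intros smooth_fn_continuous smooth_fn_derivative_continuous test, simp add: frechet_derivative_outside_tsupport)
  have h_int: "integrable lebesgue ?h" using fin by (simp only: H1_norm_sq_finite_iff(2)[OF mK])
  have bound_int: "integrable lebesgue (\<lambda>x. (t * ?h x + ?f x / t) / 2)" for t
    by (intro integrable_divide Bochner_Integration.integrable_add integrable_mult_right h_int f_int)
  note bound = weak_pairing_density_le[OF test(3), where v=v] and meas = weak_pairing_measurable[OF test(1) w_meas, of v]
  have le_one: "norm (?a x) \<le> norm ((1 * ?h x + ?f x / 1) / 2)" "norm (?b x) \<le> norm ((1 * ?h x + ?f x / 1) / 2)" for x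
    using bound[of 1 x w G] unfolding real_norm_def by linarith+
  show a_int: "integrable lebesgue ?a"
    by (rule Bochner_Integration.integrable_bound[OF bound_int[of 1] meas(1)]) (rule AE_I2, rule le_one)
  show b_int: "integrable lebesgue ?b"
    by (rule Bochner_Integration.integrable_bound[OF bound_int[of 1] meas(2)]) (rule AE_I2, rule le_one)
  assume t: "0 < t"
  have "\<bar>(\<integral>x. ?a x \<partial>lebesgue) + (\<integral>x. ?b x \<partial>lebesgue)\<bar> = norm (\<integral>x. ?a x + ?b x \<partial>lebesgue)"
    by (simp add: Bochner_Integration.integral_add[OF a_int b_int])
  also have "\<dots> \<le> (\<integral>x. (t * ?h x + ?f x / t) / 2 \<partial>lebesgue)"
  proof (rule Bochner_Integration.integral_norm_bound_integral)
    show "norm (?a x + ?b x) \<le> (t * ?h x + ?f x / t) / 2" for x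
      using order_trans[OF abs_triangle_ineq bound[OF t]] by simp
  qed (intro Bochner_Integration.integrable_add a_int b_int, rule bound_int)
  also have "\<dots> = (t * enn2real (H1_norm_sq ?K w G) + (\<integral>x. ?f x \<partial>lebesgue) / t) / 2"
    using h_int f_int unfolding H1_norm_sq_eq_integral[OF mK] by simp
  finally show "\<bar>(\<integral>x. ?a x \<partial>lebesgue) + (\<integral>x. ?b x \<partial>lebesgue)\<bar>
      \<le> (t * enn2real (H1_norm_sq ?K w G) + (\<integral>x. ?f x \<partial>lebesgue) / t) / 2" .
qed

lemma H1loc_add:
  assumes "H1loc D w G" "H1loc D w' G'"
  shows "H1loc D (\<lambda>x. w x + w' x) (\<lambda>x. G x + G' x)"
proof -
  have meas: "H1_measurable D w G" "H1_measurable D w' G'"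
    and fin: "\<And>K. compact K \<Longrightarrow> K \<subseteq> D \<Longrightarrow> H1_norm_sq K w G < \<infinity>" "\<And>K. compact K \<Longrightarrow> K \<subseteq> D \<Longrightarrow> H1_norm_sq K w' G' < \<infinity>"
    and weak: "weak_grad D w G" "weak_grad D w' G'"
    using assms[unfolded H1loc_iff] by blast+
  have "H1_norm_sq K (\<lambda>x. w x + w' x) (\<lambda>x. G x + G' x) < \<infinity>" if K: "compact K" "K \<subseteq> D" for K
  proof -
    have "K \<in> sets lebesgue" using borel_compact[OF K(1)] by simp
    from H1_norm_sq_add_le[OF meas[THEN H1_measurable_subset, OF this K(2)]]
    have "H1_norm_sq K (\<lambda>x. w x + w' x) (\<lambda>x. G x + G' x) \<le> 2 * H1_norm_sq K w G + 2 * H1_norm_sq K w' G'" .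
    also have "\<dots> < \<infinity>" using fin[OF K] by (simp add: ennreal_mult_less_top)
    finally show ?thesis .
  qed
  moreover have "weak_grad D (\<lambda>x. w x + w' x) (\<lambda>x. G x + G' x)"
    unfolding weak_grad_def
  proof (intro allI impI)
    fix \<phi> :: "'a \<Rightarrow> real" and v assume \<phi>: "test_fn D \<phi>"
    then have "compact (tsupport \<phi>)" "tsupport \<phi> \<subseteq> D" by (auto simp: test_fn_def)
    note int = weak_pairing_integrable[OF \<phi> meas(1) fin(1)[OF this], of v] weak_pairing_integrable[OF \<phi> meas(2) fin(2)[OF this], of v]
    have sum_w: "(\<integral>x. indicator D x * (w x + w' x) * fderiv \<phi> x v \<partial>lebesgue)
        = (\<integral>x. indicator D x * w x * fderiv \<phi> x v \<partial>lebesgue)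
        + (\<integral>x. indicator D x * w' x * fderiv \<phi> x v \<partial>lebesgue)"
      unfolding distrib_left distrib_right by (rule Bochner_Integration.integral_add[OF int(1,3)])
    have sum_G: "(\<integral>x. indicator D x * ((G x + G' x) \<bullet> v) * \<phi> x \<partial>lebesgue)
        = (\<integral>x. indicator D x * (G x \<bullet> v) * \<phi> x \<partial>lebesgue) + (\<integral>x. indicator D x * (G' x \<bullet> v) * \<phi> x \<partial>lebesgue)"
      unfolding inner_add_left distrib_left distrib_right
      by (rule Bochner_Integration.integral_add[OF int(2,4)])
    show "(\<integral>x. indicator D x * (w x + w' x) * fderiv \<phi> x v \<partial>lebesgue)
        = - (\<integral>x. indicator D x * ((G x + G' x) \<bullet> v) * \<phi> x \<partial>lebesgue)"
      unfolding sum_w sum_G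
      using weak[unfolded weak_grad_def, rule_format, OF \<phi>, of v] by (simp only: minus_add_distrib)
  qed
  ultimately show ?thesis using H1_measurable_add[OF meas] by (simp add: H1loc_iff)
qed

lemma H1_add:
  assumes H1: "H1 D w G" "H1 D w' G'"
  shows "H1 D (\<lambda>x. w x + w' x) (\<lambda>x. G x + G' x)"
proof -
  have "H1_norm_sq D (\<lambda>x. w x + w' x) (\<lambda>x. G x + G' x) \<le> 2 * H1_norm_sq D w G + 2 * H1_norm_sq D w' G'"
    using H1 by (intro H1_norm_sq_add_le) (auto simp: H1_iff)
  also have "\<dots> < \<infinity>" using H1 by (simp add: H1_iff ennreal_mult_less_top)
  finally have "H1_norm_sq D (\<lambda>x. w x + w' x) (\<lambda>x. G x + G' x) < \<infinity>" .
  moreover have "H1_measurable D (\<lambda>x. w x + w' x) (\<lambda>x. G x + G' x)"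
    using H1 by (intro H1_measurable_add) (auto simp: H1_iff)
  moreover have "H1loc D (\<lambda>x. w x + w' x) (\<lambda>x. G x + G' x)"
    using H1 by (intro H1loc_add) (auto simp: H1_def)
  ultimately show ?thesis unfolding H1_def using H1_norm_sq_finite_iff(1) by blast
qed

lemma H1loc_smooth: "D \<in> sets lebesgue \<Longrightarrow> smooth_fn p \<Longrightarrow> H1loc D p (grad_fn p)"
  unfolding H1loc_iff
  by (intro conjI allI impI H1_measurable_smooth H1_norm_sq_smooth_finite weak_grad_smooth compact_imp_bounded) auto

lemma H1_smooth:
  "D \<in> sets lebesgue \<Longrightarrow> smooth_fn p \<Longrightarrow> H1_norm_sq D p (grad_fn p) < \<infinity> \<Longrightarrow> H1 D p (grad_fn p)"
  by (simp add: H1_iff H1_measurable_smooth weak_grad_smooth)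

lemma weak_pairing_le_distance:
  assumes \<phi>: "test_fn D \<phi>" and w: "H1_measurable D w G" "H1_norm_sq D w G < \<infinity>"
    and w': "H1_measurable D w' G'" "H1_norm_sq D w' G' < \<infinity>" "weak_grad D w' G'" and t: "0 < t"
    and diff_finite: "H1_norm_sq D (\<lambda>x. w x - w' x) (\<lambda>x. G x - G' x) < \<infinity>"
  shows "\<bar>(\<integral>x. indicator D x * w x * fderiv \<phi> x v \<partial>lebesgue)
    + (\<integral>x. indicator D x * (G x \<bullet> v) * \<phi> x \<partial>lebesgue)\<bar>
    \<le> (t * enn2real (H1_norm_sq D (\<lambda>x. w x - w' x) (\<lambda>x. G x - G' x))
        + (\<integral>x. (fderiv \<phi> x v)\<^sup>2 + (norm v * \<bar>\<phi> x\<bar>)\<^sup>2 \<partial>lebesgue) / t) / 2"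
proof -
  let ?K = "tsupport \<phi>" and ?C = "\<integral>x. (fderiv \<phi> x v)\<^sup>2 + (norm v * \<bar>\<phi> x\<bar>)\<^sup>2 \<partial>lebesgue"
    and ?pair = "\<lambda>w G. (\<integral>x. indicator D x * w x * fderiv \<phi> x v \<partial>lebesgue)
      + (\<integral>x. indicator D x * (G x \<bullet> v) * \<phi> x \<partial>lebesgue)"
  have K: "?K \<subseteq> D" using \<phi> by (simp add: test_fn_def)
  have finite_on_K: "H1_norm_sq ?K w G < \<infinity>" if "H1_norm_sq D w G < \<infinity>" for w G
    by (rule order_le_less_trans[OF H1_norm_sq_mono[OF K] that])
  note int = weak_pairing_integrable[OF \<phi> w(1) finite_on_K[OF w(2)], of v]
    weak_pairing_integrable[OF \<phi> w'(1) finite_on_K[OF w'(2)], of v]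
  have diff_w: "(\<integral>x. indicator D x * (w x - w' x) * fderiv \<phi> x v \<partial>lebesgue)
      = (\<integral>x. indicator D x * w x * fderiv \<phi> x v \<partial>lebesgue) - (\<integral>x. indicator D x * w' x * fderiv \<phi> x v \<partial>lebesgue)"
    unfolding right_diff_distrib left_diff_distrib
    by (rule Bochner_Integration.integral_diff[OF int(1,3)])
  have diff_G: "(\<integral>x. indicator D x * ((G x - G' x) \<bullet> v) * \<phi> x \<partial>lebesgue)
      = (\<integral>x. indicator D x * (G x \<bullet> v) * \<phi> x \<partial>lebesgue) - (\<integral>x. indicator D x * (G' x \<bullet> v) * \<phi> x \<partial>lebesgue)"
    unfolding inner_diff_left right_diff_distrib left_diff_distrib
    by (rule Bochner_Integration.integral_diff[OF int(2,4)])
  have pair_eq: "?pair w G = ?pair (\<lambda>x. w x - w' x) (\<lambda>x. G x - G' x)"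
    unfolding diff_w diff_G w'(3)[unfolded weak_grad_def, rule_format, OF \<phi>, of v] by simp
  have "\<bar>?pair w G\<bar> \<le> (t * enn2real (H1_norm_sq ?K (\<lambda>x. w x - w' x) (\<lambda>x. G x - G' x)) + ?C / t) / 2"
    unfolding pair_eq
    by (rule weak_pairing_le[OF \<phi> H1_measurable_diff[OF w(1) w'(1)] finite_on_K[OF diff_finite] t])
  also have "\<dots> \<le> (t * enn2real (H1_norm_sq D (\<lambda>x. w x - w' x) (\<lambda>x. G x - G' x)) + ?C / t) / 2"
    using t diff_finite
    by (intro divide_right_mono add_right_mono mult_left_mono enn2real_mono H1_norm_sq_mono K) auto
  finally show ?thesis .
qed

lemma weak_grad_limit:
  fixes \<psi> :: "nat \<Rightarrow> 'a::euclidean_space \<Rightarrow> real"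
  assumes meas: "H1_measurable D w G" and fin: "H1_norm_sq D w G < \<infinity>"
    and \<psi>: "\<And>n. H1 D (\<psi> n) (G' n)" and lim: "(\<lambda>n. H1_norm_sq D (\<lambda>x. w x - \<psi> n x) (\<lambda>x. G x - G' n x)) \<longlonglongrightarrow> 0"
  shows "weak_grad D w G"
  unfolding weak_grad_def
proof (intro allI impI)
  fix \<phi> :: "'a \<Rightarrow> real" and v assume \<phi>: "test_fn D \<phi>"
  let ?pair = "\<lambda>w G. (\<integral>x. indicator D x * w x * fderiv \<phi> x v \<partial>lebesgue)
    + (\<integral>x. indicator D x * (G x \<bullet> v) * \<phi> x \<partial>lebesgue)"
    and ?C = "\<integral>x. (fderiv \<phi> x v)\<^sup>2 + (norm v * \<bar>\<phi> x\<bar>)\<^sup>2 \<partial>lebesgue"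
    and ?s = "\<lambda>n. H1_norm_sq D (\<lambda>x. w x - \<psi> n x) (\<lambda>x. G x - G' n x)"
  have meas\<psi>: "H1_measurable D (\<psi> n) (G' n)" and fin\<psi>: "H1_norm_sq D (\<psi> n) (G' n) < \<infinity>" and weak\<psi>: "weak_grad D (\<psi> n) (G' n)" for n
    using \<psi>[of n] by (auto simp: H1_iff)
  have pair_le: "\<bar>?pair w G\<bar> \<le> (t * enn2real (?s n) + ?C / t) / 2" if "0 < t" "?s n < \<infinity>" for t n
    by (rule weak_pairing_le_distance[OF \<phi> meas fin meas\<psi> fin\<psi> weak\<psi> that])
  have "(\<lambda>n. enn2real (?s n)) \<longlonglongrightarrow> 0" using tendsto_enn2real[OF lim[folded ennreal_0]] by simp
  then have bound_lim: "(\<lambda>n. (t * enn2real (?s n) + ?C / t) / 2) \<longlonglongrightarrow> (t * 0 + ?C / t) / 2" for t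
    by (intro tendsto_divide tendsto_add tendsto_mult tendsto_const) simp_all
  have eventually_finite: "\<forall>\<^sub>F n in sequentially. ?s n < \<infinity>" using lim by (rule order_tendstoD) simp
  have bound: "\<bar>?pair w G\<bar> \<le> ?C / 2 / t" if "0 < t" for t
  proof -
    have "\<bar>?pair w G\<bar> \<le> (t * 0 + ?C / t) / 2"
      by (rule tendsto_lowerbound[OF bound_lim]) (rule eventually_mono[OF eventually_finite], rule pair_le[OF that], assumption, simp)
    then show ?thesis by (simp add: mult.commute)
  qed
  have "\<bar>?pair w G\<bar> \<le> ?C / 2 / real (Suc n)" for n by (rule bound) simp
  then have "\<bar>?pair w G\<bar> \<le> 0"
    by (intro LIMSEQ_le_const[OF LIMSEQ_Suc[OF lim_const_over_n[of "?C / 2"]]]) blast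
  then show "(\<integral>x. indicator D x * w x * fderiv \<phi> x v \<partial>lebesgue)
    = - (\<integral>x. indicator D x * (G x \<bullet> v) * \<phi> x \<partial>lebesgue)" by simp
qed

lemma H10I:
  assumes D: "open D" and meas: "H1_measurable D w G" and \<psi>: "\<And>n. test_fn D (\<psi> n)"
    and lim: "(\<lambda>n. H1_norm_sq D (\<lambda>x. w x - \<psi> n x) (\<lambda>x. G x - grad_fn (\<psi> n) x)) \<longlonglongrightarrow> 0"
  shows "H10 D w G"
proof -
  have D': "D \<in> sets lebesgue" using D by (simp add: borel_open)
  have smooth: "smooth_fn (\<psi> n)" for n using \<psi> by (simp add: test_fn_def)
  have meas\<psi>: "H1_measurable D (\<psi> n) (grad_fn (\<psi> n))" for n
    by (rule H1_measurable_smooth[OF D' smooth])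
  let ?s = "\<lambda>n. H1_norm_sq D (\<lambda>x. w x - \<psi> n x) (\<lambda>x. G x - grad_fn (\<psi> n) x)"
  have "\<forall>\<^sub>F n in sequentially. ?s n < \<infinity>" using lim by (rule order_tendstoD) simp
  then obtain n where "?s n < \<infinity>" by (auto simp: eventually_sequentially)
  have "H1_norm_sq D w G \<le> 2 * ?s n + 2 * H1_norm_sq D (\<psi> n) (grad_fn (\<psi> n))"
    using H1_norm_sq_add_le[OF H1_measurable_diff[OF meas meas\<psi>] meas\<psi>, of n n] by simp
  also have "\<dots> < \<infinity>"
    using \<open>?s n < \<infinity>\<close> H1_norm_sq_test_fn_finite[OF \<psi>, of n] by (simp add: ennreal_mult_less_top)
  finally have fin: "H1_norm_sq D w G < \<infinity>" .
  have "weak_grad D w G"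
    by (rule weak_grad_limit[OF meas fin H1_smooth[OF D' smooth H1_norm_sq_test_fn_finite[OF \<psi>]] lim])
  then have "H1 D w G" using meas fin by (simp add: H1_iff)
  moreover have "(\<lambda>n. \<integral>x. indicator D x * ((w x - \<psi> n x)\<^sup>2 + (norm (G x - grad_fn (\<psi> n) x))\<^sup>2) \<partial>lebesgue) \<longlonglongrightarrow> 0"
    using tendsto_enn2real[OF lim[folded ennreal_0]]
    by (simp add: H1_norm_sq_eq_integral H1_measurable_diff[OF meas meas\<psi>])
  ultimately show ?thesis unfolding H10_def using \<psi> by blast
qed

lemma H10D:
  assumes "H10 D w G"
  shows "H1_measurable D w G" "H1_norm_sq D w G < \<infinity>"
  using assms by (auto simp: H10_def H1_iff)

lemma H10_obtain_approximation:
  assumes D: "open D" and w: "H10 D w G"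
  obtains \<psi> where "\<And>n. test_fn D (\<psi> n)" "(\<lambda>n. H1_norm_sq D (\<lambda>x. w x - \<psi> n x) (\<lambda>x. G x - grad_fn (\<psi> n) x)) \<longlonglongrightarrow> 0"
proof -
  obtain \<psi> where \<psi>: "\<And>n. test_fn D (\<psi> n)" and
    lim: "(\<lambda>n. \<integral>x. indicator D x * ((w x - \<psi> n x)\<^sup>2 + (norm (G x - grad_fn (\<psi> n) x))\<^sup>2) \<partial>lebesgue) \<longlonglongrightarrow> 0"
    using w unfolding H10_def by blast
  let ?s = "\<lambda>n. H1_norm_sq D (\<lambda>x. w x - \<psi> n x) (\<lambda>x. G x - grad_fn (\<psi> n) x)"
  have \<psi>_meas: "H1_measurable D (\<psi> n) (grad_fn (\<psi> n))" for n
    using \<psi>[of n] D by (intro H1_measurable_smooth) (auto simp: test_fn_def borel_open)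
  have "?s n < \<infinity>" for n
    using H10D(2)[OF w] H1_norm_sq_test_fn_finite[OF \<psi>, of n]
    by (intro order_le_less_trans[OF H1_norm_sq_diff_le[OF H10D(1)[OF w] \<psi>_meas]]) (simp add: ennreal_mult_less_top)
  then have "?s n = ennreal (\<integral>x. indicator D x * ((w x - \<psi> n x)\<^sup>2 + (norm (G x - grad_fn (\<psi> n) x))\<^sup>2) \<partial>lebesgue)" for n
    using H1_norm_sq_eq_integral[OF H1_measurable_diff[OF H10D(1)[OF w] \<psi>_meas]]
    by (metis ennreal_enn2real infinity_ennreal_def)
  then have "?s \<longlonglongrightarrow> 0" using tendsto_ennrealI[OF lim] by (simp only: ennreal_0)
  then show thesis by (rule that[OF \<psi>])
qed

lemma tendsto_0_le_ennreal:
  fixes f g :: "nat \<Rightarrow> ennreal"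
  assumes "\<And>n. f n \<le> c * g n" "c < \<infinity>" "g \<longlonglongrightarrow> 0"
  shows "f \<longlonglongrightarrow> 0"
proof (rule tendsto_sandwich[OF _ _ tendsto_const])
  have "(\<lambda>n. c * g n) \<longlonglongrightarrow> c * 0" using assms(2,3) by (intro ennreal_tendsto_cmult) auto
  then show "(\<lambda>n. c * g n) \<longlonglongrightarrow> 0" by simp
qed (use assms in auto)

lemma H10_extend:
  assumes D: "open D" "open D'" "D' \<subseteq> D" and w: "H10 D' w G"
  shows "H10 D (\<lambda>x. indicator D' x * w x) (\<lambda>x. indicator D' x *\<^sub>R G x)"
proof -
  obtain \<psi> where \<psi>: "\<And>n. test_fn D' (\<psi> n)" and
    lim: "(\<lambda>n. H1_norm_sq D' (\<lambda>x. w x - \<psi> n x) (\<lambda>x. G x - grad_fn (\<psi> n) x)) \<longlonglongrightarrow> 0"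
    using H10_obtain_approximation[OF D(2) w] by blast
  show ?thesis
  proof (rule H10I[OF D(1)])
    have "indicator D x * (indicator D' x * w x) = indicator D' x * w x"
        "indicator D x *\<^sub>R (indicator D' x *\<^sub>R G x) = indicator D' x *\<^sub>R G x" for x
      using D(3) by (auto simp: indicator_def)
    then show "H1_measurable D (\<lambda>x. indicator D' x * w x) (\<lambda>x. indicator D' x *\<^sub>R G x)"
      using H10D(1)[OF w] by (simp only: H1_measurable_def)
    show "test_fn D (\<psi> n)" for n using \<psi>[of n] D(3) by (auto simp: test_fn_def)
    have "\<psi> n x = 0 \<and> grad_fn (\<psi> n) x = 0" if "x \<notin> D'" for n x
      using \<psi>[of n] that grad_fn_outside_tsupport[of x "\<psi> n"] frechet_derivative_outside_tsupport(2)[of x "\<psi> n"]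
      by (auto simp: test_fn_def)
    then have "H1_norm_sq D (\<lambda>x. indicator D' x * w x - \<psi> n x) (\<lambda>x. indicator D' x *\<^sub>R G x - grad_fn (\<psi> n) x)
        = H1_norm_sq D' (\<lambda>x. w x - \<psi> n x) (\<lambda>x. G x - grad_fn (\<psi> n) x)" for n
      unfolding H1_norm_sq_def using D(3) by (intro nn_integral_cong) (auto simp: indicator_def)
    then show "(\<lambda>n. H1_norm_sq D (\<lambda>x. indicator D' x * w x - \<psi> n x) (\<lambda>x. indicator D' x *\<^sub>R G x - grad_fn (\<psi> n) x)) \<longlonglongrightarrow> 0"
      using lim by simp
  qed
qed

lemma H10_add:
  assumes D: "open D" and w: "H10 D w G" and w': "H10 D w' G'"
  shows "H10 D (\<lambda>x. w x + w' x) (\<lambda>x. G x + G' x)"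
proof -
  obtain \<psi> where \<psi>: "\<And>n. test_fn D (\<psi> n)" and
    lim: "(\<lambda>n. H1_norm_sq D (\<lambda>x. w x - \<psi> n x) (\<lambda>x. G x - grad_fn (\<psi> n) x)) \<longlonglongrightarrow> 0" (is "?s \<longlonglongrightarrow> 0")
    using H10_obtain_approximation[OF D w] by blast
  obtain \<psi>' where \<psi>': "\<And>n. test_fn D (\<psi>' n)" and
    lim': "(\<lambda>n. H1_norm_sq D (\<lambda>x. w' x - \<psi>' n x) (\<lambda>x. G' x - grad_fn (\<psi>' n) x)) \<longlonglongrightarrow> 0" (is "?s' \<longlonglongrightarrow> 0")
    using H10_obtain_approximation[OF D w'] by blast
  have smooth: "smooth_fn (\<psi> n)" "smooth_fn (\<psi>' n)" for n using \<psi> \<psi>' by (auto simp: test_fn_def)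
  have diff_meas: "H1_measurable D (\<lambda>x. w x - \<psi> n x) (\<lambda>x. G x - grad_fn (\<psi> n) x)"
    "H1_measurable D (\<lambda>x. w' x - \<psi>' n x) (\<lambda>x. G' x - grad_fn (\<psi>' n) x)" for n
    using D
    by (auto intro!: H1_measurable_diff H1_measurable_smooth smooth H10D(1)[OF w] H10D(1)[OF w'] simp: borel_open)
  show ?thesis
  proof (rule H10I[OF D H1_measurable_add[OF H10D(1)[OF w] H10D(1)[OF w']]])
    show "test_fn D (\<lambda>x. \<psi> n x + \<psi>' n x)" for n
    proof (rule test_fnI)
      show "compact (tsupport (\<psi> n) \<union> tsupport (\<psi>' n))" "tsupport (\<psi> n) \<union> tsupport (\<psi>' n) \<subseteq> D"
        using \<psi>[of n] \<psi>'[of n] by (auto simp: test_fn_def)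
      show "\<psi> n x + \<psi>' n x = 0" if "x \<notin> tsupport (\<psi> n) \<union> tsupport (\<psi>' n)" for x
        using that by (simp add: frechet_derivative_outside_tsupport(2))
    qed (rule smooth_fn_add[OF smooth])
    show "(\<lambda>n. H1_norm_sq D (\<lambda>x. w x + w' x - (\<psi> n x + \<psi>' n x)) (\<lambda>x. G x + G' x - grad_fn (\<lambda>x. \<psi> n x + \<psi>' n x) x)) \<longlonglongrightarrow> 0"
    proof (rule tendsto_0_le_ennreal[where c=2 and g="\<lambda>n. ?s n + ?s' n"])
      show "H1_norm_sq D (\<lambda>x. w x + w' x - (\<psi> n x + \<psi>' n x)) (\<lambda>x. G x + G' x - grad_fn (\<lambda>x. \<psi> n x + \<psi>' n x) x) \<le> 2 * (?s n + ?s' n)" for n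
      proof -
        have "w x + w' x - (\<psi> n x + \<psi>' n x) = (w x - \<psi> n x) + (w' x - \<psi>' n x)"
            "G x + G' x - grad_fn (\<lambda>x. \<psi> n x + \<psi>' n x) x
            = (G x - grad_fn (\<psi> n) x) + (G' x - grad_fn (\<psi>' n) x)" for x
          by (simp_all add: grad_fn_add[OF smooth])
        then show ?thesis using H1_norm_sq_add_le[OF diff_meas, of n n] by (simp only: distrib_left)
      qed
      show "(\<lambda>n. ?s n + ?s' n) \<longlonglongrightarrow> 0" using tendsto_add[OF lim lim'] by simp
    qed simp
  qed
qed

lemma product_rule_sq_le:
  fixes A H :: "'a::real_inner"
  assumes a: "\<bar>a\<bar> \<le> M" and H: "norm H \<le> L"
  shows "(a * s)\<^sup>2 + (norm (a *\<^sub>R A + s *\<^sub>R H))\<^sup>2 \<le> (2 * M\<^sup>2 + 2 * L\<^sup>2) * (s\<^sup>2 + (norm A)\<^sup>2)"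
proof -
  have sq_le: "a\<^sup>2 \<le> M\<^sup>2" using power_mono[OF a, of 2] by simp
  have H2: "(norm H)\<^sup>2 \<le> L\<^sup>2" using H by (intro power_mono) auto
  have "(norm (a *\<^sub>R A + s *\<^sub>R H))\<^sup>2 \<le> 2 * (norm (a *\<^sub>R A))\<^sup>2 + 2 * (norm (s *\<^sub>R H))\<^sup>2"
    by (rule norm_sq_add_le)
  also have "\<dots> = 2 * (a\<^sup>2 * (norm A)\<^sup>2) + 2 * ((norm H)\<^sup>2 * s\<^sup>2)" by (simp add: power_mult_distrib)
  finally have "(a * s)\<^sup>2 + (norm (a *\<^sub>R A + s *\<^sub>R H))\<^sup>2
    \<le> a\<^sup>2 * s\<^sup>2 + (2 * (a\<^sup>2 * (norm A)\<^sup>2) + 2 * ((norm H)\<^sup>2 * s\<^sup>2))"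
    by (simp add: power_mult_distrib)
  also have "\<dots> \<le> M\<^sup>2 * s\<^sup>2 + (2 * (M\<^sup>2 * (norm A)\<^sup>2) + 2 * (L\<^sup>2 * s\<^sup>2))"
    by (intro add_mono mult_left_mono mult_right_mono sq_le H2) auto
  also have "\<dots> \<le> (2 * M\<^sup>2 + 2 * L\<^sup>2) * (s\<^sup>2 + (norm A)\<^sup>2)"
    using zero_le_mult_iff[of "M\<^sup>2" "s\<^sup>2"] zero_le_mult_iff[of "L\<^sup>2" "(norm A)\<^sup>2"]
    by (simp add: algebra_simps)
  finally show ?thesis .
qed

lemma H1_measurable_mult:
  assumes w: "H1_measurable D w G" and \<eta>: "smooth_fn \<eta>"
  shows "H1_measurable D (\<lambda>x. \<eta> x * w x) (\<lambda>x. \<eta> x *\<^sub>R G x + w x *\<^sub>R grad_fn \<eta> x)"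
proof -
  have [measurable]: "\<eta> \<in> borel_measurable lebesgue" "grad_fn \<eta> \<in> borel_measurable lebesgue"
      "(\<lambda>x. indicator D x * w x) \<in> borel_measurable lebesgue" "(\<lambda>x. indicator D x *\<^sub>R G x) \<in> borel_measurable lebesgue"
    using smooth_fn_continuous[OF \<eta>, of UNIV] grad_fn_continuous[OF \<eta>, of UNIV] w
    by (auto intro!: measurable_completion simp: borel_measurable_continuous_onI H1_measurable_def)
  have "(\<lambda>x. \<eta> x * (indicator D x * w x)) \<in> borel_measurable lebesgue"
      "(\<lambda>x. \<eta> x *\<^sub>R (indicator D x *\<^sub>R G x) + (indicator D x * w x) *\<^sub>R grad_fn \<eta> x) \<in> borel_measurable lebesgue" by measurable
  then show ?thesis by (simp add: H1_measurable_def scaleR_add_right ac_simps)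
qed

lemma H1_norm_sq_mult_le:
  assumes w: "H1_measurable D w G" and D': "D' \<subseteq> D" and \<eta>: "\<And>x. \<bar>\<eta> x\<bar> \<le> M" "\<And>x. norm (H x) \<le> L"
  shows "H1_norm_sq D' (\<lambda>x. \<eta> x * w x) (\<lambda>x. \<eta> x *\<^sub>R G x + w x *\<^sub>R H x)
    \<le> ennreal (2 * M\<^sup>2 + 2 * L\<^sup>2) * H1_norm_sq D w G"
proof -
  have "ennreal (indicator D' x * ((\<eta> x * w x)\<^sup>2 + (norm (\<eta> x *\<^sub>R G x + w x *\<^sub>R H x))\<^sup>2))
      \<le> ennreal ((2 * M\<^sup>2 + 2 * L\<^sup>2) * (indicator D x * ((w x)\<^sup>2 + (norm (G x))\<^sup>2)))" for x
    using product_rule_sq_le[OF \<eta>(1)[of x] \<eta>(2)[of x], of "w x" "G x"] D'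
    by (intro ennreal_leI) (auto simp: indicator_def)
  then have "H1_norm_sq D' (\<lambda>x. \<eta> x * w x) (\<lambda>x. \<eta> x *\<^sub>R G x + w x *\<^sub>R H x)
      \<le> (\<integral>\<^sup>+x. ennreal (2 * M\<^sup>2 + 2 * L\<^sup>2) * ennreal (indicator D x * ((w x)\<^sup>2 + (norm (G x))\<^sup>2)) \<partial>lebesgue)"
    unfolding H1_norm_sq_def
    by (intro nn_integral_mono) (simp only: ennreal_mult''[symmetric] indicator_pos_le add_nonneg_nonneg zero_le_power2 mult_nonneg_nonneg)
  also have "\<dots> = ennreal (2 * M\<^sup>2 + 2 * L\<^sup>2) * H1_norm_sq D w G"
    unfolding H1_norm_sq_def using H1_measurable_sq(3)[OF w] by (subst nn_integral_cmult) auto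
  finally show ?thesis .
qed

lemma H10_mult:
  assumes D: "open D" "open D'" "D' \<subseteq> D" and w: "H10 D w G"
    and \<eta>: "smooth_fn \<eta>" "\<And>x. \<bar>\<eta> x\<bar> \<le> M" "\<And>x. norm (grad_fn \<eta> x) \<le> L"
    and test: "\<And>\<psi>. test_fn D \<psi> \<Longrightarrow> test_fn D' (\<lambda>x. \<eta> x * \<psi> x)"
  shows "H10 D' (\<lambda>x. \<eta> x * w x) (\<lambda>x. \<eta> x *\<^sub>R G x + w x *\<^sub>R grad_fn \<eta> x)"
proof -
  have D': "D \<in> sets lebesgue" "D' \<in> sets lebesgue" using D by (auto simp: borel_open)
  note meas = H10D(1)[OF w]
  obtain \<psi> where \<psi>: "\<And>n. test_fn D (\<psi> n)" and
    lim: "(\<lambda>n. H1_norm_sq D (\<lambda>x. w x - \<psi> n x) (\<lambda>x. G x - grad_fn (\<psi> n) x)) \<longlonglongrightarrow> 0"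
    using H10_obtain_approximation[OF D(1) w] by blast
  have smooth: "smooth_fn (\<psi> n)" for n using \<psi> by (auto simp: test_fn_def)
  show ?thesis
  proof (rule H10I[OF D(2) H1_measurable_mult[OF H1_measurable_subset[OF meas D'(2) D(3)] \<eta>(1)] test[OF \<psi>]],
      rule tendsto_0_le_ennreal[OF _ _ lim])
    fix n
    let ?a = "\<lambda>x. w x - \<psi> n x" and ?A = "\<lambda>x. G x - grad_fn (\<psi> n) x"
    have "\<eta> x *\<^sub>R G x + w x *\<^sub>R grad_fn \<eta> x - grad_fn (\<lambda>x. \<eta> x * \<psi> n x) x
      = \<eta> x *\<^sub>R ?A x + ?a x *\<^sub>R grad_fn \<eta> x"
        "\<eta> x * w x - \<eta> x * \<psi> n x = \<eta> x * ?a x" for x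
      by (simp_all add: grad_fn_mult[OF \<eta>(1) smooth] algebra_simps)
    then show "H1_norm_sq D' (\<lambda>x. \<eta> x * w x - \<eta> x * \<psi> n x)
        (\<lambda>x. \<eta> x *\<^sub>R G x + w x *\<^sub>R grad_fn \<eta> x - grad_fn (\<lambda>x. \<eta> x * \<psi> n x) x)
        \<le> ennreal (2 * M\<^sup>2 + 2 * L\<^sup>2) * H1_norm_sq D ?a ?A"
      using H1_norm_sq_mult_le[OF H1_measurable_diff[OF meas H1_measurable_smooth[OF D'(1) smooth[of n]]] D(3) \<eta>(2,3)] by (simp only:)
  qed simp
qed

lemma lebesgue_translate:
  fixes y :: "'a::euclidean_space"
  shows "(\<lambda>x. x + y) \<in> lebesgue \<rightarrow>\<^sub>M lebesgue" "distr lebesgue lebesgue (\<lambda>x. x + y) = lebesgue"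
proof -
  have translation_eq: "(\<lambda>x. x + y) = (\<lambda>x. y + (\<Sum>j\<in>Basis. (1 * (x \<bullet> j)) *\<^sub>R j))"
    by (auto simp: euclidean_representation)
  show "(\<lambda>x. x + y) \<in> lebesgue \<rightarrow>\<^sub>M lebesgue"
    unfolding translation_eq by (rule lebesgue_affine_measurable) simp
  have "lebesgue = density (distr lebesgue lebesgue (\<lambda>x. x + y)) (\<lambda>_. (\<Prod>j\<in>(Basis::'a set). \<bar>1::real\<bar>))"
    unfolding translation_eq by (rule lebesgue_affine_euclidean[where c="\<lambda>_. 1"]) simp
  then show "distr lebesgue lebesgue (\<lambda>x. x + y) = lebesgue"
    by (simp add: density_1)
qed

lemma nn_integral_lebesgue_translate:
  assumes "f \<in> borel_measurable lebesgue"
  shows "(\<integral>\<^sup>+x. f (x + y) \<partial>lebesgue) = (\<integral>\<^sup>+x. f x \<partial>lebesgue)"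
  using nn_integral_distr[OF lebesgue_translate(1)[of y], of f] assms lebesgue_translate(2)[of y]
  by simp

lemma test_fn_translate:
  assumes "test_fn D \<psi>"
  shows "test_fn {x. x + y \<in> D} (\<lambda>x. \<psi> (x + y))"
proof (rule test_fnI)
  show "smooth_fn (\<lambda>x. \<psi> (x + y))" using assms by (simp add: test_fn_def smooth_fn_translate)
  show "compact ((\<lambda>x. x - y) ` tsupport \<psi>)" "(\<lambda>x. x - y) ` tsupport \<psi> \<subseteq> {x. x + y \<in> D}"
    using assms by (auto simp: test_fn_def compact_translation_subtract)
  show "\<psi> (x + y) = 0" if "x \<notin> (\<lambda>x. x - y) ` tsupport \<psi>" for x
    using that by (intro frechet_derivative_outside_tsupport(2)[where f=\<psi>]) (auto simp: image_iff)
qed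

lemma open_translate: "open D \<Longrightarrow> open {x. x + y \<in> D}" for D :: "'a::real_normed_vector set"
  using continuous_open_vimage[of D "\<lambda>x. x + y"] by (simp add: vimage_def continuous_intros)

lemma H1_norm_sq_translate:
  assumes "H1_measurable D w G"
  shows "H1_norm_sq {x. x + y \<in> D} (\<lambda>x. w (x + y)) (\<lambda>x. G (x + y)) = H1_norm_sq D w G"
  unfolding H1_norm_sq_def
  using nn_integral_lebesgue_translate[of "\<lambda>x. ennreal (indicator D x * ((w x)\<^sup>2 + (norm (G x))\<^sup>2))" y] H1_measurable_sq(3)[OF assms]
  by (simp add: indicator_def)

lemma H10_translate:
  assumes D: "open D" and w: "H10 D w G"
  shows "H10 {x. x + y \<in> D} (\<lambda>x. w (x + y)) (\<lambda>x. G (x + y))"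
proof -
  note wm = H10D(1)[OF w]
  obtain \<psi> where \<psi>: "\<And>n. test_fn D (\<psi> n)" and
    lim: "(\<lambda>n. H1_norm_sq D (\<lambda>x. w x - \<psi> n x) (\<lambda>x. G x - grad_fn (\<psi> n) x)) \<longlonglongrightarrow> 0"
    using H10_obtain_approximation[OF D w] by blast
  have smooth: "smooth_fn (\<psi> n)" for n using \<psi> by (auto simp: test_fn_def)
  show ?thesis
  proof (rule H10I[OF open_translate[OF D] _ test_fn_translate[OF \<psi>]])
    show "H1_measurable {x. x + y \<in> D} (\<lambda>x. w (x + y)) (\<lambda>x. G (x + y))"
      using wm measurable_compose[OF lebesgue_translate(1)[of y], of "\<lambda>x. indicator D x * w x" borel]
        measurable_compose[OF lebesgue_translate(1)[of y], of "\<lambda>x. indicator D x *\<^sub>R G x" borel]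
      by (simp add: H1_measurable_def indicator_def)
    have "H1_measurable D (\<lambda>x. w x - \<psi> n x) (\<lambda>x. G x - grad_fn (\<psi> n) x)" for n
      using D by (intro H1_measurable_diff wm H1_measurable_smooth smooth) (simp add: borel_open)
    from H1_norm_sq_translate[OF this, of y]
    show "(\<lambda>n. H1_norm_sq {x. x + y \<in> D} (\<lambda>x. w (x + y) - \<psi> n (x + y)) (\<lambda>x. G (x + y) - grad_fn (\<lambda>x. \<psi> n (x + y)) x)) \<longlonglongrightarrow> 0"
      using lim by (simp add: grad_fn_translate[OF smooth])
  qed
qed

lemma H10_smooth:
  fixes p :: "'a::euclidean_space \<Rightarrow> real"
  assumes D: "open D" and p: "smooth_fn p" and fin: "H1_norm_sq D p (grad_fn p) < \<infinity>"
    and \<eta>: "\<And>n. smooth_fn (\<eta> n)" "\<And>n x. \<bar>\<eta> n x\<bar> \<le> 1" "\<And>n x. norm (grad_fn (\<eta> n) x) \<le> L"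
    and test: "\<And>n. test_fn D (\<lambda>x. \<eta> n x * p x)"
    and exhaust: "\<And>x. \<forall>\<^sub>F n in sequentially. \<eta> n x = 1 \<and> grad_fn (\<eta> n) x = 0"
  shows "H10 D p (grad_fn p)"
proof -
  have D': "D \<in> sets lebesgue" using D by (simp add: borel_open)
  let ?f = "\<lambda>n x. indicator D x * ((p x - \<eta> n x * p x)\<^sup>2 + (norm (grad_fn p x - grad_fn (\<lambda>x. \<eta> n x * p x) x))\<^sup>2)"
    and ?h = "\<lambda>x. indicator D x * ((p x)\<^sup>2 + (norm (grad_fn p x))\<^sup>2)"
  have bound: "?f n x \<le> (2 * 2\<^sup>2 + 2 * L\<^sup>2) * ?h x" for n x
  proof -
    have "\<bar>1 - \<eta> n x\<bar> \<le> 2" using \<eta>(2)[of n x] by linarith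
    moreover have "norm (- grad_fn (\<eta> n) x) \<le> L" using \<eta>(3) by simp
    ultimately have "((1 - \<eta> n x) * p x)\<^sup>2
      + (norm ((1 - \<eta> n x) *\<^sub>R grad_fn p x + p x *\<^sub>R - grad_fn (\<eta> n) x))\<^sup>2
        \<le> (2 * 2\<^sup>2 + 2 * L\<^sup>2) * ((p x)\<^sup>2 + (norm (grad_fn p x))\<^sup>2)" by (rule product_rule_sq_le)
    moreover have "p x - \<eta> n x * p x = (1 - \<eta> n x) * p x" by (simp add: left_diff_distrib)
    moreover have "grad_fn p x - grad_fn (\<lambda>x. \<eta> n x * p x) x
      = (1 - \<eta> n x) *\<^sub>R grad_fn p x + p x *\<^sub>R - grad_fn (\<eta> n) x"
      by (simp add: grad_fn_mult[OF \<eta>(1) p] scaleR_left_diff_distrib)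
    ultimately show ?thesis by (simp only: indicator_def) simp
  qed
  have "(\<lambda>n. \<integral>\<^sup>+x. ennreal (?f n x) \<partial>lebesgue) \<longlonglongrightarrow> (\<integral>\<^sup>+(x::'a). 0 \<partial>lebesgue)"
  proof (rule nn_integral_dominated_convergence[where w="\<lambda>x. ennreal (2 * 2\<^sup>2 + 2 * L\<^sup>2) * ennreal (?h x)"])
    show "(\<lambda>x. ennreal (?f n x)) \<in> borel_measurable lebesgue" for n
      using H1_measurable_sq(3)[OF H1_measurable_diff[OF H1_measurable_smooth[OF D' p] H1_measurable_smooth[OF D' smooth_fn_mult[OF \<eta>(1) p]]]]
      by simp
    have [measurable]: "?h \<in> borel_measurable lebesgue"
      by (rule H1_measurable_sq(3)[OF H1_measurable_smooth[OF D' p]])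
    show "(\<integral>\<^sup>+x. ennreal (2 * 2\<^sup>2 + 2 * L\<^sup>2) * ennreal (?h x) \<partial>lebesgue) < \<infinity>"
      using fin by (subst nn_integral_cmult) (auto simp: H1_norm_sq_def ennreal_mult_less_top)
    show "(\<lambda>x. ennreal (2 * 2\<^sup>2 + 2 * L\<^sup>2) * ennreal (?h x)) \<in> borel_measurable lebesgue"
      by measurable
    show "AE x in lebesgue. ennreal (?f n x) \<le> ennreal (2 * 2\<^sup>2 + 2 * L\<^sup>2) * ennreal (?h x)" for n
      using ennreal_leI[OF bound]
      by (intro AE_I2, subst ennreal_mult[symmetric]) (simp_all only:, simp_all)
    show "AE x in lebesgue. (\<lambda>n. ennreal (?f n x)) \<longlonglongrightarrow> 0"
    proof (rule AE_I2, rule tendsto_eventually)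
      show "\<forall>\<^sub>F n in sequentially. ennreal (?f n x) = 0" for x
        using exhaust[of x] by eventually_elim (simp add: grad_fn_mult[OF \<eta>(1) p])
    qed
  qed simp
  then show ?thesis
    by (intro H10I[OF D H1_measurable_smooth[OF D' p] test]) (simp add: H1_norm_sq_def)
qed

lemma H10_zero:
  assumes "open D"
  shows "H10 D (\<lambda>_. 0) (\<lambda>_. 0)"
proof -
  have "grad_fn (\<lambda>_. 0) = (\<lambda>_. 0 :: 'a::euclidean_space)" by (simp add: grad_fn_def fun_eq_iff)
  moreover have "test_fn D (\<lambda>_. 0)" by (simp add: test_fn_def tsupport_def smooth_fn_const)
  ultimately show ?thesis
    using assms by (intro H10I[of _ _ _ "\<lambda>_ _. 0"]) (simp_all add: H1_measurable_def H1_norm_sq_def)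
qed

section \<open>Cylinders\<close>

locale frame =
  fixes e :: "'d::euclidean_space" and B :: "'d set"
  assumes norm_e: "norm e = 1" and finite_B: "finite B" and card_B: "card B = DIM('d) - 1"
    and B_norm: "\<And>b. b \<in> B \<Longrightarrow> norm b = 1" and B_e: "\<And>b. b \<in> B \<Longrightarrow> b \<bullet> e = 0"
    and B_orth: "\<And>b b'. b \<in> B \<Longrightarrow> b' \<in> B \<Longrightarrow> b \<noteq> b' \<Longrightarrow> b \<bullet> b' = 0"
begin

lemma e_inner_e [simp]: "e \<bullet> e = 1" using norm_e by (simp add: norm_eq_1)

lemma e_inner_B: "b \<in> B \<Longrightarrow> e \<bullet> b = 0" using B_e by (simp add: inner_commute)

lemma B_inner_B: "b \<in> B \<Longrightarrow> b' \<in> B \<Longrightarrow> b \<bullet> b' = (if b = b' then 1 else 0)"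
  using B_norm B_orth by (simp add: norm_eq_1)

lemma frame_expand: "x = (x \<bullet> e) *\<^sub>R e + (\<Sum>b\<in>B. (x \<bullet> b) *\<^sub>R b)"
proof -
  let ?C = "insert e B"
  have e_notin_B: "e \<notin> B" using B_e[of e] by auto
  have orth: "pairwise orthogonal ?C"
    unfolding pairwise_def orthogonal_def using B_e B_orth by (auto simp: inner_commute)
  have unit: "norm c = 1" if "c \<in> ?C" for c using that norm_e B_norm by auto
  then have "0 \<notin> ?C" by force
  then have ind: "independent ?C" by (rule pairwise_orthogonal_independent[OF orth])
  have "card ?C = DIM('d)" using finite_B e_notin_B card_B DIM_positive[where 'a='d] by simp
  then have "UNIV \<subseteq> span ?C"
    using card_ge_dim_independent[OF subset_UNIV ind] by (simp add: dim_UNIV)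
  then have "x \<in> span ?C" by blast
  then have "(\<Sum>c\<in>?C. (x \<bullet> c) *\<^sub>R c) = x"
    using finite_B unit by (intro orthonormal_basis_expand orth) auto
  then show ?thesis using finite_B e_notin_B by simp
qed

lemma norm_le_frame: "norm x \<le> \<bar>x \<bullet> e\<bar> + (\<Sum>b\<in>B. \<bar>x \<bullet> b\<bar>)"
proof -
  have "norm x = norm ((x \<bullet> e) *\<^sub>R e + (\<Sum>b\<in>B. (x \<bullet> b) *\<^sub>R b))" using frame_expand[of x] by simp
  also have "\<dots> \<le> norm ((x \<bullet> e) *\<^sub>R e) + norm (\<Sum>b\<in>B. (x \<bullet> b) *\<^sub>R b)" by (rule norm_triangle_ineq)
  also have "\<dots> \<le> \<bar>x \<bullet> e\<bar> + (\<Sum>b\<in>B. \<bar>x \<bullet> b\<bar>)"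
    using norm_e B_norm by (intro add_mono order_trans[OF norm_sum] sum_mono) auto
  finally show ?thesis .
qed

definition cylinder :: "'d \<Rightarrow> real \<Rightarrow> real set \<Rightarrow> 'd set" where
  "cylinder y \<rho> H = {x. (\<forall>b\<in>B. \<bar>(x - y) \<bullet> b\<bar> < \<rho>) \<and> x \<bullet> e \<in> H}"

abbreviation prism :: "'d \<Rightarrow> real \<Rightarrow> 'd set" where "prism y \<rho> \<equiv> cylinder y \<rho> UNIV"

lemma cylinder_eq_prism_Int: "cylinder y \<rho> H = prism y \<rho> \<inter> {x. x \<bullet> e \<in> H}"
  by (auto simp: cylinder_def)

lemma open_cylinder: "open H \<Longrightarrow> open (cylinder y \<rho> H)"
proof -
  assume "open H"
  then have "open {x. x \<bullet> e \<in> H}"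
    using continuous_open_vimage[of H "\<lambda>x. x \<bullet> e"] by (simp add: vimage_def continuous_intros)
  moreover have "open (\<Inter>b\<in>B. {x. \<bar>(x - y) \<bullet> b\<bar> < \<rho>})"
    using finite_B by (auto intro!: open_INT open_Collect_less continuous_intros)
  moreover have "cylinder y \<rho> H = (\<Inter>b\<in>B. {x. \<bar>(x - y) \<bullet> b\<bar> < \<rho>}) \<inter> {x. x \<bullet> e \<in> H}"
    by (auto simp: cylinder_def)
  ultimately show ?thesis by (simp only: open_Int)
qed

lemma cylinder_borel [measurable]: "H \<in> sets borel \<Longrightarrow> cylinder y \<rho> H \<in> sets borel"
proof -
  assume "H \<in> sets borel"
  then have "(\<lambda>x. x \<bullet> e) -` H \<inter> space borel \<in> sets borel"
    by (intro measurable_sets[of _ borel borel]) auto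
  then show ?thesis unfolding cylinder_eq_prism_Int[of y \<rho> H]
    by (intro sets.Int borel_open[OF open_cylinder]) (simp_all add: vimage_def)
qed

lemma cylinder_subset:
  assumes "\<And>b. b \<in> B \<Longrightarrow> \<bar>(y - y') \<bullet> b\<bar> + \<rho> \<le> \<rho>'" "H \<subseteq> H'"
  shows "cylinder y \<rho> H \<subseteq> cylinder y' \<rho>' H'"
proof
  fix x assume x: "x \<in> cylinder y \<rho> H"
  have "\<bar>(x - y') \<bullet> b\<bar> < \<rho>'" if b: "b \<in> B" for b
  proof -
    have "(x - y') \<bullet> b = (x - y) \<bullet> b + (y - y') \<bullet> b" by (simp add: inner_diff_left)
    then show ?thesis using assms(1)[OF b] x b by (auto simp: cylinder_def dest!: bspec[of B _ b])
  qed
  then show "x \<in> cylinder y' \<rho>' H'" using x assms(2) by (auto simp: cylinder_def)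
qed

lemma cylinder_disjoint:
  assumes "b \<in> B" "\<rho> + \<rho>' \<le> \<bar>(y - y') \<bullet> b\<bar>"
  shows "cylinder y \<rho> H \<inter> cylinder y' \<rho>' H' = {}"
proof (rule ccontr)
  assume "cylinder y \<rho> H \<inter> cylinder y' \<rho>' H' \<noteq> {}"
  then obtain x where "\<bar>(x - y) \<bullet> b\<bar> < \<rho>" "\<bar>(x - y') \<bullet> b\<bar> < \<rho>'"
    using assms(1) by (auto simp: cylinder_def)
  moreover have "(y - y') \<bullet> b = (x - y') \<bullet> b - (x - y) \<bullet> b" by (simp add: inner_diff_left)
  ultimately show False using assms(2) by linarith
qed

lemma cylinder_translate: "y \<bullet> e = 0 \<Longrightarrow> {x. x + y \<in> cylinder y' \<rho> H} = cylinder (y' - y) \<rho> H"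
  by (simp add: cylinder_def inner_add_left inner_diff_left algebra_simps)

lemma prism_translate_e: "x + t *\<^sub>R e \<in> prism y \<rho> \<longleftrightarrow> x \<in> prism y \<rho>"
  by (simp add: cylinder_def inner_add_left inner_diff_left e_inner_B)

lemma bounded_cylinder:
  assumes "bounded H"
  shows "bounded (cylinder 0 \<rho> H)"
proof -
  obtain h where h: "\<And>t. t \<in> H \<Longrightarrow> \<bar>t\<bar> \<le> h" using assms unfolding bounded_iff real_norm_def by blast
  show ?thesis unfolding bounded_iff
  proof (intro exI[of _ "h + (\<Sum>b\<in>B. \<rho>)"] ballI)
    fix x assume x: "x \<in> cylinder 0 \<rho> H"
    have "norm x \<le> \<bar>x \<bullet> e\<bar> + (\<Sum>b\<in>B. \<bar>x \<bullet> b\<bar>)" by (rule norm_le_frame)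
    also have "\<dots> \<le> h + (\<Sum>b\<in>B. \<rho>)"
      using x h by (intro add_mono sum_mono) (auto simp: cylinder_def intro: less_imp_le)
    finally show "norm x \<le> h + (\<Sum>b\<in>B. \<rho>)" .
  qed
qed

definition unit_slab :: "'d set" where "unit_slab = {x. - 1 \<le> x \<bullet> e \<and> x \<bullet> e \<le> 0}"

lemma unit_slab_borel [measurable]: "unit_slab \<in> sets borel"
  unfolding unit_slab_def by measurable

definition cross_volume :: "'d set \<Rightarrow> ennreal" where "cross_volume U = emeasure lborel (U \<inter> unit_slab)"

end

lemma nn_integral_lborel_translate:
  fixes f :: "'a::euclidean_space \<Rightarrow> ennreal"
  assumes "f \<in> borel_measurable borel"
  shows "(\<integral>\<^sup>+x. f (x + a) \<partial>lborel) = (\<integral>\<^sup>+x. f x \<partial>lborel)"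
  using nn_integral_distr[of "(+) a" lborel borel f] assms
  by (simp add: lborel_distr_plus add.commute)

context frame
begin

text \<open>Tonelli in the direction \<open>e\<close>, proved without coordinates: insert
  \<open>1 = \<integral> indicator {0..1} (t - x \<bullet> e) dt\<close>, exchange the integrals and shift \<open>x\<close> by \<open>t *\<^sub>R e\<close>.\<close>

lemma nn_integral_eq_cross_volume_mult:
  fixes F :: "real \<Rightarrow> ennreal" and g :: "'d \<Rightarrow> real"
  assumes F [measurable]: "F \<in> borel_measurable borel" and g [measurable]: "g \<in> borel_measurable borel"
    and U [measurable]: "U \<in> sets borel"
    and U_e: "\<And>x t. x + t *\<^sub>R e \<in> U \<longleftrightarrow> x \<in> U" and g_e: "\<And>x t. g (x + t *\<^sub>R e) = g x"
  shows "(\<integral>\<^sup>+x. indicator U x * F (x \<bullet> e + g x) \<partial>lborel) = cross_volume U * (\<integral>\<^sup>+t. F t \<partial>lborel)"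
proof -
  let ?i = "indicator {0..1} :: real \<Rightarrow> ennreal"
  have one: "(\<integral>\<^sup>+t. ?i (t - s) \<partial>lborel) = 1" for s
    using nn_integral_lborel_translate[of ?i "- s"] by simp
  have shift: "(\<integral>\<^sup>+x. indicator U x * F (x \<bullet> e + g x) * ?i (t - x \<bullet> e) \<partial>lborel)
      = (\<integral>\<^sup>+x. indicator U x * F (x \<bullet> e + t + g x) * ?i (- (x \<bullet> e)) \<partial>lborel)" for t
    by (subst nn_integral_lborel_translate[symmetric, of _ "t *\<^sub>R e"]) (use U_e in \<open>simp_all add: g_e inner_add_left indicator_def\<close>)
  have fibre: "(\<integral>\<^sup>+t. indicator U x * F (x \<bullet> e + t + g x) * ?i (- (x \<bullet> e)) \<partial>lborel)
      = (\<integral>\<^sup>+t. F t \<partial>lborel) * indicator (U \<inter> unit_slab) x" for x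
  proof -
    have "(\<integral>\<^sup>+t. indicator U x * F (x \<bullet> e + t + g x) * ?i (- (x \<bullet> e)) \<partial>lborel)
        = (\<integral>\<^sup>+t. indicator (U \<inter> unit_slab) x * F (t + (x \<bullet> e + g x)) \<partial>lborel)"
      by (intro nn_integral_cong) (auto simp: unit_slab_def indicator_def ac_simps)
    also have "\<dots> = indicator (U \<inter> unit_slab) x * (\<integral>\<^sup>+t. F t \<partial>lborel)"
      by (simp add: nn_integral_cmult nn_integral_lborel_translate)
    finally show ?thesis by (simp only: mult.commute)
  qed
  have "(\<integral>\<^sup>+x. indicator U x * F (x \<bullet> e + g x) \<partial>lborel)
      = (\<integral>\<^sup>+x. (\<integral>\<^sup>+t. indicator U x * F (x \<bullet> e + g x) * ?i (t - x \<bullet> e) \<partial>lborel) \<partial>lborel)"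
    by (simp add: nn_integral_cmult one)
  also have "\<dots> = (\<integral>\<^sup>+t. (\<integral>\<^sup>+x. indicator U x * F (x \<bullet> e + g x) * ?i (t - x \<bullet> e) \<partial>lborel) \<partial>lborel)"
    using lborel_pair.Fubini[of "\<lambda>p. indicator U (fst p) * F (fst p \<bullet> e + g (fst p)) * ?i (snd p - fst p \<bullet> e)"] by simp
  also have "\<dots> = (\<integral>\<^sup>+t. (\<integral>\<^sup>+x. indicator U x * F (x \<bullet> e + t + g x) * ?i (- (x \<bullet> e)) \<partial>lborel) \<partial>lborel)"
    by (simp only: shift)
  also have "\<dots> = (\<integral>\<^sup>+x. (\<integral>\<^sup>+t. indicator U x * F (x \<bullet> e + t + g x) * ?i (- (x \<bullet> e)) \<partial>lborel) \<partial>lborel)"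
    using lborel_pair.Fubini[of "\<lambda>p. indicator U (fst p) * F (fst p \<bullet> e + snd p + g (fst p)) * ?i (- (fst p \<bullet> e))"] by simp
  also have "\<dots> = (\<integral>\<^sup>+x. (\<integral>\<^sup>+t. F t \<partial>lborel) * indicator (U \<inter> unit_slab) x \<partial>lborel)"
    by (simp only: fibre)
  also have "\<dots> = cross_volume U * (\<integral>\<^sup>+t. F t \<partial>lborel)"
    unfolding cross_volume_def by (subst nn_integral_cmult_indicator) (auto simp: mult.commute)
  finally show ?thesis .
qed

lemma cross_volume_mono: "U \<subseteq> U' \<Longrightarrow> U' \<in> sets borel \<Longrightarrow> cross_volume U \<le> cross_volume U'"
  unfolding cross_volume_def by (intro emeasure_mono) auto

lemma cross_volume_translate:
  assumes "U \<in> sets borel" "y \<bullet> e = 0"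
  shows "cross_volume {x. x + y \<in> U} = cross_volume U"
proof -
  have "cross_volume U = emeasure (distr lborel borel ((+) y)) (U \<inter> unit_slab)"
    by (simp add: cross_volume_def lborel_distr_plus)
  also have "\<dots> = emeasure lborel ((+) y -` (U \<inter> unit_slab) \<inter> space lborel)"
    using assms by (intro emeasure_distr) auto
  also have "(+) y -` (U \<inter> unit_slab) \<inter> space lborel = {x. x + y \<in> U} \<inter> unit_slab"
    using assms(2) by (auto simp: unit_slab_def inner_add_left add.commute)
  finally show ?thesis by (simp add: cross_volume_def)
qed

lemma cross_volume_prism_eq: "y \<bullet> e = 0 \<Longrightarrow> cross_volume (prism y \<rho>) = cross_volume (prism 0 \<rho>)"
  using cross_volume_translate[of "prism y \<rho>" y] by (simp add: cylinder_translate)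

lemma cross_volume_prism_finite: "cross_volume (prism 0 \<rho>) < \<infinity>"
proof -
  have "prism 0 \<rho> \<inter> unit_slab = cylinder 0 \<rho> {-1..0}" by (auto simp: cylinder_def unit_slab_def)
  then show ?thesis
    unfolding cross_volume_def
    by (simp only: emeasure_bounded_finite bounded_cylinder bounded_closed_interval)
qed

definition lattice_point :: "('d \<Rightarrow> int) \<Rightarrow> 'd" where
  "lattice_point z = (\<Sum>b\<in>B. real_of_int (z b) *\<^sub>R b)"

lemma lattice_point_inner: "b \<in> B \<Longrightarrow> lattice_point z \<bullet> b = real_of_int (z b)"
  unfolding lattice_point_def
  using finite_B by (simp add: inner_sum_left B_inner_B if_distrib cong: if_cong)

lemma lattice_point_inner_e: "lattice_point z \<bullet> e = 0"
  unfolding lattice_point_def using B_e by (simp add: inner_sum_left)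

lemma lattice_point_add: "lattice_point (\<lambda>b. z b + z' b) = lattice_point z + lattice_point z'"
  by (simp add: lattice_point_def scaleR_add_left sum.distrib)

definition unit_cell :: "('d \<Rightarrow> int) \<Rightarrow> 'd set" where
  "unit_cell z = {x. \<forall>b\<in>B. real_of_int (z b) \<le> x \<bullet> b \<and> x \<bullet> b < real_of_int (z b) + 1}"

lemma unit_cell_borel [measurable]: "unit_cell z \<in> sets borel"
  unfolding unit_cell_def using countable_finite[OF finite_B] by measurable

definition unit_cross_volume :: real where
  "unit_cross_volume = enn2real (cross_volume (unit_cell (\<lambda>_. 0)))"

lemma cross_volume_unit_cell: "cross_volume (unit_cell z) = ennreal unit_cross_volume"
proof -
  have "{x. x + lattice_point z \<in> unit_cell z} = unit_cell (\<lambda>_. 0)"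
    by (auto simp: unit_cell_def inner_add_left lattice_point_inner)
  then have "cross_volume (unit_cell z) = cross_volume (unit_cell (\<lambda>_. 0))"
    using cross_volume_translate[OF unit_cell_borel lattice_point_inner_e, of z z] by simp
  moreover have "cross_volume (unit_cell (\<lambda>_. 0)) \<le> cross_volume (prism 0 2)"
    by (intro cross_volume_mono cylinder_borel) (auto simp: unit_cell_def cylinder_def abs_if)
  then have "cross_volume (unit_cell (\<lambda>_. 0)) < \<infinity>"
    using cross_volume_prism_finite by (rule order_le_less_trans)
  ultimately show ?thesis by (simp add: unit_cross_volume_def)
qed

definition half_open_prism :: "nat \<Rightarrow> 'd set" where
  "half_open_prism N = {x. \<forall>b\<in>B. - real N \<le> x \<bullet> b \<and> x \<bullet> b < real N}"

lemma half_open_prism_eq_UN: "half_open_prism N = (\<Union>z\<in>PiE B (\<lambda>_. {- int N..<int N}). unit_cell z)"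
proof (intro equalityI subsetI)
  fix x assume x: "x \<in> half_open_prism N"
  let ?z = "restrict (\<lambda>b. \<lfloor>x \<bullet> b\<rfloor>) B"
  have "\<lfloor>x \<bullet> b\<rfloor> \<in> {- int N..<int N}" if "b \<in> B" for b
    using x that by (simp add: half_open_prism_def le_floor_iff floor_less_iff)
  then have "?z \<in> PiE B (\<lambda>_. {- int N..<int N})" by (simp add: restrict_PiE_iff)
  moreover have "x \<in> unit_cell ?z" by (auto simp: unit_cell_def)
  ultimately show "x \<in> (\<Union>z\<in>PiE B (\<lambda>_. {- int N..<int N}). unit_cell z)" by blast
next
  fix x assume "x \<in> (\<Union>z\<in>PiE B (\<lambda>_. {- int N..<int N}). unit_cell z)"
  then obtain z where z: "z \<in> PiE B (\<lambda>_. {- int N..<int N})" "x \<in> unit_cell z" by blast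
  have "- real N \<le> x \<bullet> b \<and> x \<bullet> b < real N" if b: "b \<in> B" for b
  proof -
    have "- int N \<le> z b" "z b + 1 \<le> int N" using z(1) b by (auto simp: PiE_iff)
    then have "- real N \<le> real_of_int (z b)" "real_of_int (z b) + 1 \<le> real N" by linarith+
    moreover have "real_of_int (z b) \<le> x \<bullet> b" "x \<bullet> b < real_of_int (z b) + 1"
      using z(2) b by (auto simp: unit_cell_def)
    ultimately show ?thesis by linarith
  qed
  then show "x \<in> half_open_prism N" by (simp add: half_open_prism_def)
qed

lemma half_open_prism_borel [measurable]: "half_open_prism N \<in> sets borel"
  unfolding half_open_prism_def using countable_finite[OF finite_B] by measurable

lemma unit_cell_disjoint:
  assumes "b \<in> B" "z b \<noteq> z' b"
  shows "unit_cell z \<inter> unit_cell z' = {}"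
proof -
  have floor: "\<lfloor>x \<bullet> b\<rfloor> = z b" if "x \<in> unit_cell z" for x z
    using that assms(1) by (simp add: unit_cell_def floor_eq_iff)
  show ?thesis
  proof (rule Int_emptyI)
    fix x assume "x \<in> unit_cell z" "x \<in> unit_cell z'"
    from floor[OF this(1)] floor[OF this(2)] show False using assms(2) by simp
  qed
qed

lemma cross_volume_half_open_prism:
  "cross_volume (half_open_prism N) = ennreal (unit_cross_volume * (2 * real N) ^ card B)"
proof -
  let ?P = "PiE B (\<lambda>_. {- int N..<int N})"
  have "disjoint_family_on (\<lambda>z. unit_cell z \<inter> unit_slab) ?P"
    unfolding disjoint_family_on_def
  proof (intro ballI impI)
    fix z z' assume "z \<in> ?P" "z' \<in> ?P" "z \<noteq> z'"
    then obtain b where "b \<in> B" "z b \<noteq> z' b" using PiE_ext by blast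
    then have "unit_cell z \<inter> unit_cell z' = {}" by (rule unit_cell_disjoint)
    then show "(unit_cell z \<inter> unit_slab) \<inter> (unit_cell z' \<inter> unit_slab) = {}" by blast
  qed
  then have "emeasure lborel (\<Union>z\<in>?P. unit_cell z \<inter> unit_slab)
    = (\<Sum>z\<in>?P. emeasure lborel (unit_cell z \<inter> unit_slab))"
    using finite_B by (intro sum_emeasure[symmetric] finite_PiE) auto
  then have "cross_volume (half_open_prism N) = (\<Sum>z\<in>?P. cross_volume (unit_cell z))"
    by (simp add: cross_volume_def half_open_prism_eq_UN)
  also have "\<dots> = of_nat (card ?P) * ennreal unit_cross_volume" by (simp add: cross_volume_unit_cell)
  also have "card ?P = (2 * N) ^ card B"
    using finite_B by (simp add: card_PiE nat_mult_distrib power_mult_distrib)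
  finally show ?thesis
    by (simp add: ennreal_of_nat_eq_real_of_nat unit_cross_volume_def ennreal_mult' mult.commute)
qed

lemma cross_volume_prism: "cross_volume (prism 0 (real N))
  = ennreal (unit_cross_volume * (2 * real N) ^ card B)"
proof -
  have "AE x in lborel. x \<bullet> b \<noteq> - real N" if "b \<in> B" for b
  proof -
    have "b \<noteq> 0" using B_norm[OF that] by auto
    then have "{x. b \<bullet> x = - real N} \<in> null_sets lebesgue"
      by (simp add: negligible_hyperplane flip: negligible_iff_null_sets)
    moreover have "{x. x \<bullet> b = - real N} \<in> sets lborel" by measurable
    ultimately have "{x. x \<bullet> b = - real N} \<in> null_sets lborel"
      by (simp add: inner_commute null_sets_completion_iff)
    from AE_not_in[OF this] show ?thesis by simp
  qed
  then have "AE x in lborel. \<forall>b\<in>B. x \<bullet> b \<noteq> - real N" by (intro AE_finite_allI finite_B)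
  then have "AE x in lborel. x \<in> prism 0 (real N) \<inter> unit_slab \<longleftrightarrow> x \<in> half_open_prism N \<inter> unit_slab"
  proof eventually_elim
    case (elim x)
    have "\<bar>x \<bullet> b\<bar> < real N \<longleftrightarrow> - real N \<le> x \<bullet> b \<and> x \<bullet> b < real N" if "b \<in> B" for b
      using elim that by (auto simp: abs_less_iff order.order_iff_strict)
    then show ?case by (simp add: cylinder_def half_open_prism_def)
  qed
  then have "cross_volume (prism 0 (real N)) = cross_volume (half_open_prism N)"
    unfolding cross_volume_def by (rule emeasure_eq_AE) auto
  then show ?thesis by (simp only: cross_volume_half_open_prism)
qed

definition cross_section_volume :: "real \<Rightarrow> real" where
  "cross_section_volume \<rho> = enn2real (cross_volume (prism 0 \<rho>))"

lemma ennreal_cross_section_volume: "ennreal (cross_section_volume \<rho>) = cross_volume (prism 0 \<rho>)"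
  using cross_volume_prism_finite[of \<rho>] by (simp add: cross_section_volume_def)

lemma unit_cross_volume_nonneg: "0 \<le> unit_cross_volume"
  by (simp add: unit_cross_volume_def)

lemma cross_section_volume_nonneg: "0 \<le> cross_section_volume \<rho>"
  by (simp add: cross_section_volume_def)

lemma cross_section_volume_nat: "cross_section_volume (real N) = unit_cross_volume * (2 * real N) ^ card B"
  by (simp add: cross_section_volume_def cross_volume_prism unit_cross_volume_nonneg)

lemma cross_section_volume_mono: "\<rho> \<le> \<rho>' \<Longrightarrow> cross_section_volume \<rho> \<le> cross_section_volume \<rho>'"
  unfolding cross_section_volume_def using cross_volume_prism_finite[of \<rho>']
  by (intro enn2real_mono cross_volume_mono cylinder_subset) simp_all

end
section \<open>Integrands\<close>

lemma
  fixes lam Lam :: real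
  defines "F \<equiv> Fmeas lam Lam :: ('d::euclidean_space \<Rightarrow> real) measure"
  shows space_Fmeas: "space F = Fclass lam Lam"
    and sets_Fmeas: "sets F = sigma_sets (Fclass lam Lam) (Fopen lam Lam)"
proof -
  have "Fopen lam Lam \<subseteq> Pow (Fclass lam Lam :: ('d \<Rightarrow> real) set)" by (auto simp: Fopen_def)
  then show "space F = Fclass lam Lam" "sets F = sigma_sets (Fclass lam Lam) (Fopen lam Lam)"
    unfolding F_def Fmeas_def by (auto simp: space_measure_of sets_measure_of)
qed

lemma Fclass_polar:
  assumes "\<psi> \<in> Fclass lam Lam" "p \<noteq> 0"
  shows "\<psi> p = norm p * \<psi> (p /\<^sub>R norm p)" "p /\<^sub>R norm p \<in> sphere 0 1"
proof -
  have "\<psi> (norm p *\<^sub>R (p /\<^sub>R norm p)) = norm p * \<psi> (p /\<^sub>R norm p)"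
    using assms(1) unfolding Fclass_def by (blast intro: norm_ge_zero)
  then show "\<psi> p = norm p * \<psi> (p /\<^sub>R norm p)" using assms(2) by simp
  show "p /\<^sub>R norm p \<in> sphere 0 1" using assms(2) by simp
qed

lemma Fclass_0: "\<psi> \<in> Fclass lam Lam \<Longrightarrow> \<psi> 0 = 0"
proof -
  assume "\<psi> \<in> Fclass lam Lam"
  then have "\<psi> (0 *\<^sub>R 0) = 0 * \<psi> 0" unfolding Fclass_def by blast
  then show ?thesis by simp
qed

lemma Fclass_bounds:
  assumes "\<psi> \<in> Fclass lam Lam" "0 \<le> lam"
  shows "0 \<le> \<psi> p" "\<psi> p \<le> sqrt Lam * norm p"
proof -
  have "0 \<le> \<psi> p \<and> \<psi> p \<le> sqrt Lam * norm p"
  proof (cases "p = 0")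
    case False
    note polar = Fclass_polar[OF assms(1) False]
    have "sqrt lam \<le> \<psi> (p /\<^sub>R norm p)" "\<psi> (p /\<^sub>R norm p) \<le> sqrt Lam"
      using assms(1) polar(2) unfolding Fclass_def by blast+
    moreover have "0 \<le> sqrt lam" using assms(2) by simp
    ultimately have "0 \<le> \<psi> (p /\<^sub>R norm p)" "\<psi> (p /\<^sub>R norm p) \<le> sqrt Lam" by linarith+
    then have "0 \<le> norm p * \<psi> (p /\<^sub>R norm p)" "norm p * \<psi> (p /\<^sub>R norm p) \<le> norm p * sqrt Lam"
      by (auto intro!: mult_nonneg_nonneg mult_left_mono)
    then show ?thesis by (simp only: polar(1)[symmetric] mult.commute[of "norm p" "sqrt Lam"])
  qed (simp add: Fclass_0[OF assms(1)])
  then show "0 \<le> \<psi> p" "\<psi> p \<le> sqrt Lam * norm p" by auto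
qed

lemma Fclass_triangle:
  assumes "\<psi> \<in> Fclass lam Lam"
  shows "\<psi> (a + b) \<le> \<psi> a + \<psi> b"
proof -
  have convex: "convex_on UNIV \<psi>" and homogeneous: "\<And>t p. 0 \<le> t \<Longrightarrow> \<psi> (t *\<^sub>R p) = t * \<psi> p"
    using assms by (auto simp: Fclass_def)
  have "\<psi> ((1/2) *\<^sub>R a + (1/2) *\<^sub>R b) \<le> (1/2) * \<psi> a + (1/2) * \<psi> b"
    using convex_onD[OF convex, of "1/2" a b] by simp
  moreover have "\<psi> (2 *\<^sub>R ((1/2) *\<^sub>R a + (1/2) *\<^sub>R b)) = 2 * \<psi> ((1/2) *\<^sub>R a + (1/2) *\<^sub>R b)"
    by (rule homogeneous) simp
  moreover have "2 *\<^sub>R ((1/2) *\<^sub>R a + (1/2) *\<^sub>R b) = a + b" by (simp add: scaleR_add_right)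
  ultimately show ?thesis by simp
qed

lemma Fclass_diff_le_supdist:
  fixes f g :: "'d::euclidean_space \<Rightarrow> real"
  assumes f: "f \<in> Fclass lam Lam" and g: "g \<in> Fclass lam Lam" and lam: "0 \<le> lam"
  shows "\<bar>f p - g p\<bar> \<le> norm p * supdist f g"
proof (cases "p = 0")
  case False
  note polar_f = Fclass_polar[OF f False] note polar_g = Fclass_polar[OF g False]
  have "bdd_above ((\<lambda>p. \<bar>f p - g p\<bar>) ` sphere 0 1)"
  proof (rule bdd_aboveI2)
    fix u :: 'd assume "u \<in> sphere 0 1"
    then show "\<bar>f u - g u\<bar> \<le> sqrt Lam"
      using Fclass_bounds[OF f lam, of u] Fclass_bounds[OF g lam, of u] by simp
  qed
  then have "\<bar>f (p /\<^sub>R norm p) - g (p /\<^sub>R norm p)\<bar> \<le> supdist f g"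
    unfolding supdist_def by (rule cSUP_upper[OF polar_f(2)])
  then have "norm p * \<bar>f (p /\<^sub>R norm p) - g (p /\<^sub>R norm p)\<bar> \<le> norm p * supdist f g"
    by (rule mult_left_mono) simp
  moreover have "\<bar>f p - g p\<bar> = norm p * \<bar>f (p /\<^sub>R norm p) - g (p /\<^sub>R norm p)\<bar>"
    by (simp only: polar_f(1) polar_g(1) right_diff_distrib[symmetric] abs_mult abs_norm_cancel)
  ultimately show ?thesis by simp
qed (simp add: Fclass_0[OF f] Fclass_0[OF g])

lemma eval_measurable_Fmeas:
  assumes "0 \<le> lam"
  shows "(\<lambda>\<psi>. \<psi> p) \<in> borel_measurable (Fmeas lam Lam)"
proof (rule borel_measurable_iff_greater[THEN iffD2], rule allI)
  fix c :: real
  let ?U = "{\<psi> \<in> Fclass lam Lam. c < \<psi> p}"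
  have "?U \<in> Fopen lam Lam" unfolding Fopen_def
  proof (intro CollectI conjI ballI)
    fix f assume f: "f \<in> ?U"
    show "\<exists>\<epsilon>>0. \<forall>g\<in>Fclass lam Lam. supdist f g < \<epsilon> \<longrightarrow> g \<in> ?U"
    proof (intro exI[of _ "(f p - c) / (norm p + 1)"] conjI ballI impI)
      show "0 < (f p - c) / (norm p + 1)"
        using f by (intro divide_pos_pos) (auto intro: add_nonneg_pos)
      fix g assume g: "g \<in> Fclass lam Lam" "supdist f g < (f p - c) / (norm p + 1)"
      have "\<bar>f p - g p\<bar> \<le> norm p * supdist f g"
        using f g assms by (intro Fclass_diff_le_supdist) auto
      also have "\<dots> \<le> norm p * ((f p - c) / (norm p + 1))" using g(2) by (intro mult_left_mono) auto
      also have "\<dots> < f p - c"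
      proof -
        have "0 < norm p + 1" by (intro add_nonneg_pos) auto
        then show ?thesis using f by (simp add: pos_divide_less_eq distrib_left mult.commute)
      qed
      finally show "g \<in> ?U" using g(1) by auto
    qed
  qed auto
  then show "{w \<in> space (Fmeas lam Lam). c < w p} \<in> sets (Fmeas lam Lam)"
    unfolding space_Fmeas sets_Fmeas by (rule sigma_sets.Basic)
qed

lemma borel_measurable_pair_if_continuous:
  fixes F :: "'x \<Rightarrow> 'p::{second_countable_topology, metric_space} \<Rightarrow> real"
  assumes F: "\<And>p. (\<lambda>x. F x p) \<in> borel_measurable N" and cont: "\<And>x. x \<in> space N \<Longrightarrow> continuous_on UNIV (F x)"
    and X [measurable]: "X \<in> M \<rightarrow>\<^sub>M N" and P [measurable]: "P \<in> borel_measurable M"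
  shows "(\<lambda>z. F (X z) (P z)) \<in> borel_measurable M"
proof -
  obtain S :: "nat \<Rightarrow> 'p \<Rightarrow> 'p" where S: "\<And>i. simple_function borel (S i)" "\<And>p. (\<lambda>i. S i p) \<longlonglongrightarrow> p"
    using borel_measurable_implies_sequence_metric[of "\<lambda>p::'p. p" borel undefined] by auto
  show ?thesis
  proof (rule borel_measurable_LIMSEQ_metric)
    fix i
    have "S i \<in> borel \<rightarrow>\<^sub>M count_space (range (S i))"
      using S(1)[of i] unfolding simple_function_def by (subst measurable_count_space_eq2) auto
    then have "(\<lambda>z. S i (P z)) \<in> M \<rightarrow>\<^sub>M count_space (range (S i))" by (rule measurable_compose[OF P])
    moreover have "countable (range (S i))"
      using S(1)[of i] by (simp add: simple_function_def countable_finite)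
    ultimately show "(\<lambda>z. F (X z) (S i (P z))) \<in> borel_measurable M"
      by (rule measurable_compose_countable'[where f="\<lambda>p z. F (X z) p", OF measurable_compose[OF X F]])
  next
    fix z assume "z \<in> space M"
    then have "isCont (F (X z)) (P z)"
      using cont[OF measurable_space[OF X]] by (simp add: continuous_on_eq_continuous_at)
    then show "(\<lambda>i. F (X z) (S i (P z))) \<longlonglongrightarrow> F (X z) (P z)"
      by (rule isCont_tendsto_compose[OF _ S(2)])
  qed
qed

section \<open>Minimal energies\<close>

locale medium = frame e B for e :: "'d::euclidean_space" and B +
  fixes M :: "'w measure" and \<Phi> :: "'w \<Rightarrow> 'd \<Rightarrow> real" and \<tau> :: "'d \<Rightarrow> 'w \<Rightarrow> 'w"
    and W :: "real \<Rightarrow> real" and q :: "real \<Rightarrow> real" and lam Lam :: real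
  assumes lam_pos: "0 < lam" and Lam_pos: "0 < Lam"
    and P: "prob_space M"
    and Phi_meas: "\<Phi> \<in> M \<rightarrow>\<^sub>M Fmeas lam Lam"
    and tau_meas: "(\<lambda>(x, \<omega>). \<tau> x \<omega>) \<in> (borel \<Otimes>\<^sub>M M) \<rightarrow>\<^sub>M M"
    and tau_add: "\<And>x y \<omega>. \<omega> \<in> space M \<Longrightarrow> \<tau> (x + y) \<omega> = \<tau> x (\<tau> y \<omega>)"
    and tau_0: "\<And>\<omega>. \<omega> \<in> space M \<Longrightarrow> \<tau> 0 \<omega> = \<omega>"
    and tau_pres: "\<And>x. distr M M (\<tau> x) = M"
    and W_cont: "continuous_on {-1..1} W"
    and W_nonneg: "\<And>s. s \<in> {-1..1} \<Longrightarrow> 0 \<le> W s"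
    and q_smooth: "smooth_fn q"
    and q_range: "\<And>s. -1 \<le> q s \<and> q s \<le> 1"
    and q_energy: "(\<integral>\<^sup>+ s. ennreal (Lam / 2 * (deriv q s)\<^sup>2 + W (q s)) \<partial>lborel) < \<infinity>"
begin

lemma tau_space: "\<omega> \<in> space M \<Longrightarrow> \<tau> x \<omega> \<in> space M"
  using measurable_space[OF tau_meas, of "(x, \<omega>)"] by (simp add: space_pair_measure)

lemma tau_measurable [measurable]: "\<tau> x \<in> M \<rightarrow>\<^sub>M M"
  using measurable_compose[OF measurable_Pair1' tau_meas, of x] by simp

lemma Phi_class: "\<omega> \<in> space M \<Longrightarrow> \<Phi> \<omega> \<in> Fclass lam Lam"
  using measurable_space[OF Phi_meas] by (simp add: space_Fmeas)

lemma Phi_tau_measurable: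
  assumes [measurable]: "X \<in> N \<rightarrow>\<^sub>M borel" "S \<in> N \<rightarrow>\<^sub>M M" and P: "P \<in> borel_measurable N"
  shows "(\<lambda>z. \<Phi> (\<tau> (X z) (S z)) (P z)) \<in> borel_measurable N"
proof (rule borel_measurable_pair_if_continuous[where F=\<Phi> and N=M, OF _ _ _ P])
  show "(\<lambda>\<omega>. \<Phi> \<omega> p) \<in> borel_measurable M" for p
    using lam_pos by (intro measurable_compose[OF Phi_meas] eval_measurable_Fmeas) simp
  show "continuous_on UNIV (\<Phi> \<omega>)" if "\<omega> \<in> space M" for \<omega>
    using Phi_class[OF that] by (intro convex_on_continuous) (auto simp: Fclass_def)
  have "(\<lambda>z. (X z, S z)) \<in> N \<rightarrow>\<^sub>M borel \<Otimes>\<^sub>M M" by measurable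
  from measurable_compose[OF this tau_meas] show "(\<lambda>z. \<tau> (X z) (S z)) \<in> N \<rightarrow>\<^sub>M M" by simp
qed

definition W_ext :: "real \<Rightarrow> real" where "W_ext s = W (max (-1) (min 1 s))"

lemma W_ext_eq: "s \<in> {-1..1} \<Longrightarrow> W_ext s = W s" by (simp add: W_ext_def)

lemma W_ext_nonneg: "0 \<le> W_ext s" unfolding W_ext_def by (rule W_nonneg) auto

lemma W_ext_continuous: "continuous_on UNIV W_ext"
  unfolding W_ext_def[abs_def]
  by (rule continuous_on_compose2[OF W_cont]) (auto intro!: continuous_intros)

lemma W_ext_measurable [measurable]: "W_ext \<in> borel_measurable borel"
  by (rule borel_measurable_continuous_onI[OF W_ext_continuous])

lemma W_perturb:
  assumes \<eta>: "0 < \<eta>"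
  shows "\<exists>K\<ge>0. \<forall>s\<in>{-1..1}. \<forall>s'\<in>{-1..1}. W s' \<le> W s + \<eta> + K * (s' - s)\<^sup>2"
proof -
  have "bounded (W ` {-1..1})" by (intro compact_imp_bounded compact_continuous_image W_cont) simp
  then obtain C where "\<forall>w\<in>W ` {-1..1}. norm w \<le> C" unfolding bounded_iff by (elim exE)
  then have C: "\<bar>W s\<bar> \<le> C" if "s \<in> {-1..1}" for s using that by simp
  have C_nonneg: "0 \<le> C" using C[of 0] by simp
  have "uniformly_continuous_on {-1..1} W" by (intro compact_uniformly_continuous W_cont) simp
  then obtain d where d: "0 < d" "\<And>s s'. s \<in> {-1..1} \<Longrightarrow> s' \<in> {-1..1} \<Longrightarrow> dist s' s < d \<Longrightarrow> dist (W s') (W s) < \<eta>"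
    using \<eta> unfolding uniformly_continuous_on_def by blast
  show ?thesis
  proof (intro exI[of _ "C / d\<^sup>2"] conjI ballI)
    show "0 \<le> C / d\<^sup>2" using C_nonneg by simp
    fix s s' :: real assume s: "s \<in> {-1..1}" "s' \<in> {-1..1}"
    show "W s' \<le> W s + \<eta> + C / d\<^sup>2 * (s' - s)\<^sup>2"
    proof (cases "dist s' s < d")
      case True
      then have "\<bar>W s' - W s\<bar> < \<eta>" using d(2)[OF s] by (simp add: dist_real_def)
      moreover have "0 \<le> C / d\<^sup>2 * (s' - s)\<^sup>2" using C_nonneg by simp
      ultimately show ?thesis by linarith
    next
      case False
      then have "d\<^sup>2 \<le> (s' - s)\<^sup>2"
        using d(1) by (intro abs_le_square_iff[THEN iffD1]) (auto simp: dist_real_def)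
      then have "C * 1 \<le> C * ((s' - s)\<^sup>2 / d\<^sup>2)" using C_nonneg d(1) by (intro mult_left_mono) auto
      then show ?thesis using C[OF s(2)] \<eta> W_nonneg[OF s(1)] by simp
    qed
  qed
qed

lemma Phi_sq_le:
  assumes "\<omega> \<in> space M"
  shows "(\<Phi> (\<tau> x \<omega>) p)\<^sup>2 \<le> Lam * (norm p)\<^sup>2"
proof -
  note bounds = Fclass_bounds[OF Phi_class[OF tau_space[OF assms]] less_imp_le[OF lam_pos], of x p]
  have "(\<Phi> (\<tau> x \<omega>) p)\<^sup>2 \<le> (sqrt Lam * norm p)\<^sup>2" using bounds by (intro power_mono) auto
  also have "\<dots> = Lam * (norm p)\<^sup>2" using Lam_pos by (simp add: power_mult_distrib)
  finally show ?thesis .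
qed

lemma sq_le_weighted_sum:
  fixes a b c t :: real
  assumes "0 \<le> a" "a \<le> b + c" "0 < t"
  shows "a\<^sup>2 \<le> (1 + t) * b\<^sup>2 + (1 + 1 / t) * c\<^sup>2"
proof -
  have "0 \<le> (t * b - c)\<^sup>2 / t" using assms(3) by simp
  also have "\<dots> = t * b\<^sup>2 - 2 * b * c + 1 / t * c\<^sup>2"
    using assms(3) by (simp add: power2_eq_square field_simps)
  finally have "(b + c)\<^sup>2 \<le> (1 + t) * b\<^sup>2 + (1 + 1 / t) * c\<^sup>2"
    by (simp add: power2_sum algebra_simps)
  moreover have "a\<^sup>2 \<le> (b + c)\<^sup>2" using assms by (intro power_mono)
  ultimately show ?thesis by linarith
qed

lemma Phi_sq_perturb:
  assumes \<omega>: "\<omega> \<in> space M" and t: "0 < t"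
  shows "(\<Phi> (\<tau> x \<omega>) p')\<^sup>2 \<le> (1 + t) * (\<Phi> (\<tau> x \<omega>) p)\<^sup>2 + (1 + 1 / t) * (Lam * (norm (p' - p))\<^sup>2)"
proof -
  let ?\<phi> = "\<Phi> (\<tau> x \<omega>)"
  note cls = Phi_class[OF tau_space[OF \<omega>], of x]
  have "(?\<phi> p')\<^sup>2 \<le> (1 + t) * (?\<phi> p)\<^sup>2 + (1 + 1 / t) * (?\<phi> (p' - p))\<^sup>2"
    using Fclass_triangle[OF cls, of p "p' - p"] Fclass_bounds(1)[OF cls, of p'] lam_pos t
    by (intro sq_le_weighted_sum) auto
  also have "\<dots> \<le> (1 + t) * (?\<phi> p)\<^sup>2 + (1 + 1 / t) * (Lam * (norm (p' - p))\<^sup>2)"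
    using t by (intro add_left_mono mult_left_mono Phi_sq_le[OF \<omega>]) auto
  finally show ?thesis .
qed

lemma integrand_perturb:
  assumes t: "0 < t"
  shows "\<exists>K\<ge>0. \<forall>\<omega>\<in>space M. \<forall>s\<in>{-1..1}. \<forall>s'\<in>{-1..1}. \<forall>x p p'.
      1 / 2 * (\<Phi> (\<tau> x \<omega>) p')\<^sup>2 + W s'
      \<le> (1 + t) * (1 / 2 * (\<Phi> (\<tau> x \<omega>) p)\<^sup>2 + W s) + t + K * ((s' - s)\<^sup>2 + (norm (p' - p))\<^sup>2)"
proof -
  obtain K where K: "0 \<le> K" "\<And>s s'. s \<in> {-1..1} \<Longrightarrow> s' \<in> {-1..1} \<Longrightarrow> W s' \<le> W s + t + K * (s' - s)\<^sup>2"
    using W_perturb[OF t] by blast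
  define L where "L = (1 + 1 / t) * (Lam / 2)"
  have L: "0 \<le> L" using t Lam_pos by (simp add: L_def)
  show ?thesis
  proof (intro exI[of _ "K + L"] conjI ballI allI)
    fix \<omega> x p p' and s s' :: real assume \<omega>: "\<omega> \<in> space M" and s: "s \<in> {-1..1}" "s' \<in> {-1..1}"
    have "1 / 2 * (\<Phi> (\<tau> x \<omega>) p')\<^sup>2 \<le> (1 + t) * (1 / 2 * (\<Phi> (\<tau> x \<omega>) p)\<^sup>2) + L * (norm (p' - p))\<^sup>2"
      using Phi_sq_perturb[OF \<omega> t, of x p' p] by (simp add: L_def)
    moreover have "0 \<le> t * W s" "0 \<le> L * (s' - s)\<^sup>2" "0 \<le> K * (norm (p' - p))\<^sup>2"
      using t K(1) L W_nonneg[OF s(1)] by auto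
    ultimately show "1 / 2 * (\<Phi> (\<tau> x \<omega>) p')\<^sup>2 + W s'
        \<le> (1 + t) * (1 / 2 * (\<Phi> (\<tau> x \<omega>) p)\<^sup>2 + W s) + t + (K + L) * ((s' - s)\<^sup>2 + (norm (p' - p))\<^sup>2)"
      using K(2)[OF s] unfolding distrib_left distrib_right mult_1 by linarith
  qed (use K(1) L in simp)
qed

abbreviation qe :: "'d \<Rightarrow> real" where "qe x \<equiv> q (x \<bullet> e)"
abbreviation dqe :: "'d \<Rightarrow> real" where "dqe x \<equiv> deriv q (x \<bullet> e)"

lemma qe_smooth: "smooth_fn (\<lambda>x. qe x)"
  by (rule smooth_fn_comp[OF q_smooth smooth_fn_inner])

lemma qe_grad: "grad_fn (\<lambda>x. qe x) x = dqe x *\<^sub>R e"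
proof -
  have "grad_fn (\<lambda>x. x \<bullet> e) x = e"
    by (rule grad_fn_eqI) (auto intro!: derivative_eq_intros simp: inner_commute)
  then show ?thesis by (simp add: grad_fn_comp[OF q_smooth smooth_fn_inner])
qed

lemma qe_H1_measurable: "open D \<Longrightarrow> H1_measurable D (\<lambda>x. qe x) (\<lambda>x. dqe x *\<^sub>R e)"
  using H1_measurable_smooth[OF _ qe_smooth, of D]
  unfolding qe_grad[abs_def] by (simp add: borel_open)

definition profile_density :: "real \<Rightarrow> real" where
  "profile_density t = Lam / 2 * (deriv q t)\<^sup>2 + W_ext (q t)"

definition line_measure :: "real measure" where
  "line_measure = density lborel (\<lambda>t. ennreal (profile_density t))"

definition profile_measure :: "'d measure" where
  "profile_measure = density lborel (\<lambda>x. ennreal (profile_density (x \<bullet> e)))"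

lemma profile_density_nonneg: "0 \<le> profile_density t"
  unfolding profile_density_def using Lam_pos W_ext_nonneg by (intro add_nonneg_nonneg) auto

lemma q_measurable [measurable]: "q \<in> borel_measurable borel" "deriv q \<in> borel_measurable borel"
  using smooth_fn_borel_measurable[OF q_smooth] smooth_fn_borel_measurable[OF smooth_fn_deriv[OF q_smooth]] .

lemma profile_density_measurable [measurable]: "profile_density \<in> borel_measurable borel"
  unfolding profile_density_def[abs_def] by measurable

lemma profile_density_finite: "(\<integral>\<^sup>+t. ennreal (profile_density t) \<partial>lborel) < \<infinity>"
  using q_energy q_range unfolding profile_density_def by (simp add: W_ext_eq)

lemma sets_profile_measures [simp, measurable_cong]:
  "sets line_measure = sets borel" "sets profile_measure = sets borel"
  by (simp_all add: line_measure_def profile_measure_def)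

sublocale line: finite_measure line_measure
proof (rule finite_measureI)
  show "emeasure line_measure (space line_measure) \<noteq> \<infinity>"
    using profile_density_finite by (simp add: line_measure_def emeasure_density)
qed

lemma emeasure_profile_measure:
  "U \<in> sets borel \<Longrightarrow> emeasure profile_measure U
  = (\<integral>\<^sup>+x. ennreal (profile_density (x \<bullet> e)) * indicator U x \<partial>lebesgue)"
  unfolding profile_measure_def nn_integral_completion by (rule emeasure_density) simp_all

lemma emeasure_profile_measure_cylinder:
  assumes "H \<in> sets borel" "y \<bullet> e = 0"
  shows "emeasure profile_measure (cylinder y \<rho> H) = cross_volume (prism 0 \<rho>) * emeasure line_measure H"
proof -
  have [measurable]: "H \<in> sets borel" by (rule assms)
  have "emeasure profile_measure (cylinder y \<rho> H)
      = (\<integral>\<^sup>+x. indicator (prism y \<rho>) x * (ennreal (profile_density (x \<bullet> e + 0)) * indicator H (x \<bullet> e + 0)) \<partial>lborel)"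
    unfolding profile_measure_def cylinder_eq_prism_Int[of y \<rho> H]
    by (subst emeasure_density, measurable, intro nn_integral_cong) (auto simp: indicator_def)
  also have "\<dots> = cross_volume (prism y \<rho>) * (\<integral>\<^sup>+t. ennreal (profile_density t) * indicator H t \<partial>lborel)"
    by (rule nn_integral_eq_cross_volume_mult[where g="\<lambda>_. 0" and F="\<lambda>t. ennreal (profile_density t) * indicator H t"])
        (auto simp: prism_translate_e)
  finally show ?thesis
    by (simp add: line_measure_def emeasure_density cross_volume_prism_eq[OF assms(2)])
qed

lemma emeasure_profile_measure_cylinder_finite:
  assumes "H \<in> sets borel" "y \<bullet> e = 0"
  shows "emeasure profile_measure (cylinder y \<rho> H) < \<infinity>"
  using cross_volume_prism_finite[of \<rho>]
  by (simp add: emeasure_profile_measure_cylinder[OF assms] ennreal_mult_eq_top_iff flip: less_top)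

definition competitors :: "'d set \<Rightarrow> (('d \<Rightarrow> real) \<times> ('d \<Rightarrow> 'd)) set" where
  "competitors D = {(w, G). H10 D w G \<and> (\<forall>x\<in>D. -1 \<le> qe x + w x \<and> qe x + w x \<le> 1)}"

definition energy_density :: "'w \<Rightarrow> 'd set \<Rightarrow> ('d \<Rightarrow> real) \<Rightarrow> ('d \<Rightarrow> 'd) \<Rightarrow> 'd \<Rightarrow> real" where
  "energy_density \<omega> D w G x =
      indicator D x * (1 / 2 * (\<Phi> (\<tau> x \<omega>) (dqe x *\<^sub>R e + G x))\<^sup>2 + W (qe x + w x))"

definition competitor_energy :: "'w \<Rightarrow> 'd set \<Rightarrow> ('d \<Rightarrow> real) \<Rightarrow> ('d \<Rightarrow> 'd) \<Rightarrow> ennreal" where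
  "competitor_energy \<omega> D w G = (\<integral>\<^sup>+x. ennreal (energy_density \<omega> D w G x) \<partial>lebesgue)"

definition min_energy :: "'w \<Rightarrow> 'd set \<Rightarrow> ennreal" where
  "min_energy \<omega> D = (INF (w, G)\<in>competitors D. competitor_energy \<omega> D w G)"

lemma competitorsD:
  assumes "(w, G) \<in> competitors D"
  shows "H10 D w G" "H1_measurable D w G" "\<And>x. x \<in> D \<Longrightarrow> qe x + w x \<in> {-1..1}"
  using assms by (auto simp: competitors_def H10D(1))

lemma energy_density_measurable [measurable]:
  assumes \<omega>: "\<omega> \<in> space M" and D: "open D" and wG: "(w, G) \<in> competitors D"
  shows "energy_density \<omega> D w G \<in> borel_measurable lebesgue"
proof -
  let ?u = "\<lambda>x. indicator D x * (qe x + w x)" and ?G = "\<lambda>x. indicator D x *\<^sub>R (dqe x *\<^sub>R e + G x)"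
  have [measurable]: "?u \<in> borel_measurable lebesgue" "?G \<in> borel_measurable lebesgue"
    using H1_measurable_add[OF qe_H1_measurable[OF D] competitorsD(2)[OF wG]]
    by (auto simp: H1_measurable_def)
  have [measurable]: "D \<in> sets lebesgue" using D by (simp add: borel_open)
  have [measurable]: "(\<lambda>x. x) \<in> lebesgue \<rightarrow>\<^sub>M (borel :: 'd measure)"
    by (rule measurable_completion) simp
  have [measurable]: "(\<lambda>x. \<Phi> (\<tau> x \<omega>) (?G x)) \<in> borel_measurable lebesgue"
    using \<omega> by (intro Phi_tau_measurable measurable_const) measurable
  have "energy_density \<omega> D w G x = indicator D x * (1 / 2 * (\<Phi> (\<tau> x \<omega>) (?G x))\<^sup>2 + W_ext (?u x))"
    for x
    using W_ext_eq[OF competitorsD(3)[OF wG, of x]]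
    by (cases "x \<in> D") (simp_all add: energy_density_def)
  then have "energy_density \<omega> D w G = (\<lambda>x. indicator D x * (1 / 2 * (\<Phi> (\<tau> x \<omega>) (?G x))\<^sup>2 + W_ext (?u x)))" ..
  then show ?thesis by simp
qed

lemma profile_energy_density_le:
  assumes "\<omega> \<in> space M"
  shows "1 / 2 * (\<Phi> (\<tau> x \<omega>) (dqe x *\<^sub>R e))\<^sup>2 + W (qe x) \<le> profile_density (x \<bullet> e)"
  using Phi_sq_le[OF assms, of x "dqe x *\<^sub>R e"] norm_e q_range[of "x \<bullet> e"]
  by (simp add: profile_density_def W_ext_eq)

lemma min_energy_le: "(w, G) \<in> competitors D \<Longrightarrow> min_energy \<omega> D \<le> competitor_energy \<omega> D w G"
  unfolding min_energy_def by (rule INF_lower2[of "(w, G)"]) auto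

lemma obtain_almost_minimizer:
  assumes "min_energy \<omega> D < \<infinity>" "0 < \<epsilon>"
  obtains w G where "(w, G) \<in> competitors D" "competitor_energy \<omega> D w G < min_energy \<omega> D + ennreal \<epsilon>"
proof -
  have "min_energy \<omega> D < min_energy \<omega> D + ennreal \<epsilon>"
    using assms by (cases "min_energy \<omega> D") (auto simp flip: ennreal_plus intro: ennreal_lessI)
  then obtain p where "p \<in> competitors D" "(case p of (w, G) \<Rightarrow> competitor_energy \<omega> D w G) < min_energy \<omega> D + ennreal \<epsilon>"
    unfolding min_energy_def INF_less_iff by (elim bexE)
  then show thesis using that by (cases p) simp
qed

lemma min_energy_add_geI:
  assumes "\<And>w G. (w, G) \<in> competitors D \<Longrightarrow> a \<le> competitor_energy \<omega> D w G + c"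
  shows "a \<le> min_energy \<omega> D + c"
proof (cases "min_energy \<omega> D < \<infinity>")
  case True
  show ?thesis
  proof (rule ennreal_le_epsilon)
    fix \<epsilon> :: real assume "0 < \<epsilon>"
    then obtain w G where wG: "(w, G) \<in> competitors D" "competitor_energy \<omega> D w G < min_energy \<omega> D + ennreal \<epsilon>"
      using obtain_almost_minimizer[OF True] by blast
    have "a \<le> competitor_energy \<omega> D w G + c" by (rule assms[OF wG(1)])
    also have "\<dots> \<le> min_energy \<omega> D + ennreal \<epsilon> + c" by (intro add_right_mono less_imp_le wG(2))
    finally show "a \<le> min_energy \<omega> D + c + ennreal \<epsilon>" by (simp only: ac_simps)
  qed
qed (simp add: not_less top_unique)

end

definition glue :: "'i set \<Rightarrow> ('i \<Rightarrow> 'a set) \<Rightarrow> ('i \<Rightarrow> 'a \<Rightarrow> 'b::real_vector) \<Rightarrow> 'a \<Rightarrow> 'b" where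
  "glue I D f x = (\<Sum>i\<in>I. indicator (D i) x *\<^sub>R f i x)"

lemma glue_inside:
  assumes "finite I" "disjoint_family_on D I" "i \<in> I" "x \<in> D i"
  shows "glue I D f x = f i x"
proof -
  have "glue I D f x = (\<Sum>j\<in>I. if j = i then f i x else 0)"
    using assms
    unfolding glue_def disjoint_family_on_def by (intro sum.cong refl) (auto simp: indicator_def)
  then show ?thesis using assms by simp
qed

lemma glue_outside: "x \<notin> (\<Union>i\<in>I. D i) \<Longrightarrow> glue I D f x = 0"
  unfolding glue_def by (auto intro!: sum.neutral)

lemma H10_glue:
  assumes "finite I" "open U" "\<And>i. i \<in> I \<Longrightarrow> open (D i)" "\<And>i. i \<in> I \<Longrightarrow> D i \<subseteq> U"
    "\<And>i. i \<in> I \<Longrightarrow> H10 (D i) (w i) (G i)"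
  shows "H10 U (glue I D w) (glue I D G)"
  using assms(1,3-5)
proof (induction I rule: finite_induct)
  case empty
  then show ?case using H10_zero[OF assms(2)] by (simp add: glue_def[abs_def])
next
  case (insert i I)
  have "H10 U (\<lambda>x. indicator (D i) x * w i x) (\<lambda>x. indicator (D i) x *\<^sub>R G i x)"
    using insert.prems by (intro H10_extend assms(2)) auto
  moreover have "H10 U (glue I D w) (glue I D G)" using insert.prems by (intro insert.IH) auto
  ultimately show ?case
    unfolding glue_def[abs_def] sum.insert[OF insert.hyps] real_scaleR_def
    by (rule H10_add[OF assms(2)])
qed

context medium
begin

lemma competitors_glue:
  assumes I: "finite I" and U: "open U" and D: "\<And>i. i \<in> I \<Longrightarrow> open (D i)" "\<And>i. i \<in> I \<Longrightarrow> D i \<subseteq> U"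
    and disj: "disjoint_family_on D I" and wG: "\<And>i. i \<in> I \<Longrightarrow> (w i, G i) \<in> competitors (D i)"
  shows "(glue I D w, glue I D G) \<in> competitors U"
proof -
  have "H10 U (glue I D w) (glue I D G)" using competitorsD(1)[OF wG] by (intro H10_glue I U D)
  moreover have "qe x + glue I D w x \<in> {-1..1}" for x
  proof (cases "x \<in> (\<Union>i\<in>I. D i)")
    case True
    then obtain i where i: "i \<in> I" "x \<in> D i" by blast
    show ?thesis using competitorsD(3)[OF wG i(2), OF i(1)] by (simp add: glue_inside[OF I disj i])
  next
    case False
    then show ?thesis using q_range by (simp add: glue_outside)
  qed
  ultimately show ?thesis by (simp add: competitors_def)
qed

lemma competitor_energy_glue_le:
  assumes \<omega>: "\<omega> \<in> space M" and I: "finite I" and U: "open U"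
    and D: "\<And>i. i \<in> I \<Longrightarrow> open (D i)" "\<And>i. i \<in> I \<Longrightarrow> D i \<subseteq> U"
    and disj: "disjoint_family_on D I" and wG: "\<And>i. i \<in> I \<Longrightarrow> (w i, G i) \<in> competitors (D i)"
  shows "competitor_energy \<omega> U (glue I D w) (glue I D G)
      \<le> (\<Sum>i\<in>I. competitor_energy \<omega> (D i) (w i) (G i)) + emeasure profile_measure (U - (\<Union>i\<in>I. D i))"
proof -
  let ?R = "U - (\<Union>i\<in>I. D i)" and ?g = "energy_density \<omega> U (glue I D w) (glue I D G)"
    and ?f = "\<lambda>i. energy_density \<omega> (D i) (w i) (G i)"
  have R: "?R \<in> sets borel" using U D I by (intro sets.Diff sets.finite_UN) (auto intro: borel_open)
  have f: "?f i \<in> borel_measurable lebesgue" if "i \<in> I" for i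
    by (rule energy_density_measurable[OF \<omega> D(1)[OF that] wG[OF that]])
  have density_meas: "(\<lambda>x. ennreal (profile_density (x \<bullet> e)) * indicator ?R x) \<in> borel_measurable lebesgue"
    by (intro measurable_completion borel_measurable_times_ennreal borel_measurable_indicator) (use R in simp_all)
  have "ennreal (?g x) \<le> (\<Sum>i\<in>I. ennreal (?f i x)) + ennreal (profile_density (x \<bullet> e)) * indicator ?R x" for x
  proof (cases "x \<in> (\<Union>i\<in>I. D i)")
    case True
    then obtain i where i: "i \<in> I" "x \<in> D i" by blast
    then have "x \<in> U" using D(2) by blast
    then have "?g x = ?f i x" using i by (simp add: energy_density_def glue_inside[OF I disj i])
    also have "ennreal (?f i x) \<le> (\<Sum>i\<in>I. ennreal (?f i x))"
      by (rule member_le_sum[OF i(1) _ I]) simp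
    finally show ?thesis by (rule add_increasing2[rotated]) simp
  next
    case False
    have "?g x \<le> profile_density (x \<bullet> e) * indicator ?R x"
      using profile_energy_density_le[OF \<omega>, of x] False
      by (cases "x \<in> U") (simp_all add: energy_density_def glue_outside)
    then have "ennreal (?g x) \<le> ennreal (profile_density (x \<bullet> e) * indicator ?R x)"
      by (rule ennreal_leI)
    also have "\<dots> = ennreal (profile_density (x \<bullet> e)) * indicator ?R x" by (simp add: indicator_def)
    finally have "ennreal (?g x) \<le> ennreal (profile_density (x \<bullet> e)) * indicator ?R x" .
    then show ?thesis by (rule add_increasing[rotated]) simp
  qed
  then have "competitor_energy \<omega> U (glue I D w) (glue I D G)
      \<le> (\<integral>\<^sup>+x. (\<Sum>i\<in>I. ennreal (?f i x)) + ennreal (profile_density (x \<bullet> e)) * indicator ?R x \<partial>lebesgue)"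
    unfolding competitor_energy_def by (intro nn_integral_mono)
  also have "\<dots> = (\<integral>\<^sup>+x. (\<Sum>i\<in>I. ennreal (?f i x)) \<partial>lebesgue) + emeasure profile_measure ?R"
    unfolding emeasure_profile_measure[OF R]
    using f by (intro nn_integral_add density_meas borel_measurable_sum) auto
  also have "(\<integral>\<^sup>+x. (\<Sum>i\<in>I. ennreal (?f i x)) \<partial>lebesgue) = (\<Sum>i\<in>I. competitor_energy \<omega> (D i) (w i) (G i))"
    unfolding competitor_energy_def using f by (intro nn_integral_sum) auto
  finally show ?thesis .
qed

lemma min_energy_subadditive:
  assumes \<omega>: "\<omega> \<in> space M" and I: "finite I" and U: "open U"
    and D: "\<And>i. i \<in> I \<Longrightarrow> open (D i)" "\<And>i. i \<in> I \<Longrightarrow> D i \<subseteq> U" and disj: "disjoint_family_on D I"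
  shows "min_energy \<omega> U \<le> (\<Sum>i\<in>I. min_energy \<omega> (D i)) + emeasure profile_measure (U - (\<Union>i\<in>I. D i))"
proof (cases "(\<Sum>i\<in>I. min_energy \<omega> (D i)) = \<top>")
  case False
  let ?R = "U - (\<Union>i\<in>I. D i)"
  show ?thesis
  proof (rule ennreal_le_epsilon)
    fix \<epsilon> :: real assume \<epsilon>: "0 < \<epsilon>"
    define \<delta> where "\<delta> = \<epsilon> / (card I + 1)"
    have \<delta>: "0 < \<delta>" using \<epsilon> by (simp add: \<delta>_def)
    have "\<exists>w G. (w, G) \<in> competitors (D i) \<and> competitor_energy \<omega> (D i) w G
      \<le> min_energy \<omega> (D i) + ennreal \<delta>" if "i \<in> I" for i
    proof -
      have "min_energy \<omega> (D i) < \<infinity>" using False I that by (auto simp: less_top)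
      then show ?thesis by (rule obtain_almost_minimizer[OF _ \<delta>]) (blast intro: less_imp_le)
    qed
    then obtain w G where wG: "\<And>i. i \<in> I \<Longrightarrow> (w i, G i) \<in> competitors (D i)"
      and near_optimal: "\<And>i. i \<in> I \<Longrightarrow> competitor_energy \<omega> (D i) (w i) (G i)
        \<le> min_energy \<omega> (D i) + ennreal \<delta>" by metis
    have "min_energy \<omega> U \<le> competitor_energy \<omega> U (glue I D w) (glue I D G)"
      by (rule min_energy_le[OF competitors_glue[OF I U D disj wG]])
    also have "\<dots> \<le> (\<Sum>i\<in>I. competitor_energy \<omega> (D i) (w i) (G i)) + emeasure profile_measure ?R"
      by (rule competitor_energy_glue_le[OF \<omega> I U D disj wG])
    also have "(\<Sum>i\<in>I. competitor_energy \<omega> (D i) (w i) (G i)) \<le> (\<Sum>i\<in>I. min_energy \<omega> (D i) + ennreal \<delta>)"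
      by (rule sum_mono[OF near_optimal])
    also have "\<dots> = (\<Sum>i\<in>I. min_energy \<omega> (D i)) + of_nat (card I) * ennreal \<delta>"
      by (simp add: sum.distrib)
    also have "of_nat (card I) * ennreal \<delta> \<le> ennreal \<epsilon>"
    proof -
      have "of_nat (card I) * ennreal \<delta> = ennreal (real (card I) * \<delta>)"
        using \<delta> by (simp add: ennreal_of_nat_eq_real_of_nat ennreal_mult')
      also have "\<dots> \<le> ennreal \<epsilon>" using \<epsilon> by (intro ennreal_leI) (simp add: \<delta>_def field_simps)
      finally show ?thesis .
    qed
    finally show "min_energy \<omega> U \<le> (\<Sum>i\<in>I. min_energy \<omega> (D i)) + emeasure profile_measure ?R + ennreal \<epsilon>"
      by (simp add: ac_simps add_mono)
  qed
qed simp

lemma min_energy_le_profile_energy: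
  assumes "\<omega> \<in> space M" "open D"
  shows "min_energy \<omega> D \<le> emeasure profile_measure D"
  using min_energy_subadditive[OF assms(1) _ assms(2), of "{} :: nat set" "\<lambda>_. {}"]
  by (simp add: disjoint_family_on_def)

lemma min_energy_translate_le:
  assumes \<omega>: "\<omega> \<in> space M" and y: "y \<bullet> e = 0" and D: "open D"
  shows "min_energy (\<tau> y \<omega>) {x. x + y \<in> D} \<le> min_energy \<omega> D"
  unfolding min_energy_def[of \<omega> D]
proof (rule INF_greatest, clarify)
  fix w G assume wG: "(w, G) \<in> competitors D"
  let ?D = "{x. x + y \<in> D}"
  have "H10 ?D (\<lambda>x. w (x + y)) (\<lambda>x. G (x + y))" by (rule H10_translate[OF D competitorsD(1)[OF wG]])
  then have "(\<lambda>x. w (x + y), \<lambda>x. G (x + y)) \<in> competitors ?D"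
    using competitorsD(3)[OF wG] y by (force simp: competitors_def inner_add_left)
  then have "min_energy (\<tau> y \<omega>) ?D \<le> competitor_energy (\<tau> y \<omega>) ?D (\<lambda>x. w (x + y)) (\<lambda>x. G (x + y))"
    by (rule min_energy_le)
  also have "\<dots> = (\<integral>\<^sup>+x. ennreal (energy_density \<omega> D w G (x + y)) \<partial>lebesgue)"
    unfolding competitor_energy_def using y tau_add[OF \<omega>, of _ y]
    by (simp add: energy_density_def inner_add_left indicator_def)
  also have "\<dots> = competitor_energy \<omega> D w G"
    unfolding competitor_energy_def
    by (intro nn_integral_lebesgue_translate measurable_compose[OF energy_density_measurable[OF \<omega> D wG]] measurable_ennreal)
  finally show "min_energy (\<tau> y \<omega>) ?D \<le> competitor_energy \<omega> D w G" .
qed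

lemma min_energy_cylinder_translate:
  assumes \<omega>: "\<omega> \<in> space M" and y: "y \<bullet> e = 0" and H: "open H"
  shows "min_energy (\<tau> y \<omega>) (cylinder 0 \<rho> H) = min_energy \<omega> (cylinder y \<rho> H)"
proof (rule antisym)
  show "min_energy (\<tau> y \<omega>) (cylinder 0 \<rho> H) \<le> min_energy \<omega> (cylinder y \<rho> H)"
    using min_energy_translate_le[OF \<omega> y open_cylinder[OF H, of y \<rho>]]
    by (simp add: cylinder_translate[OF y])
  have y': "(- y) \<bullet> e = 0" using y by simp
  have "\<tau> (- y) (\<tau> y \<omega>) = \<omega>" using tau_add[OF \<omega>, of "- y" y] tau_0[OF \<omega>] by simp
  then show "min_energy \<omega> (cylinder y \<rho> H) \<le> min_energy (\<tau> y \<omega>) (cylinder 0 \<rho> H)"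
    using min_energy_translate_le[OF tau_space[OF \<omega>] y' open_cylinder[OF H, of 0 \<rho>], of y]
    by (simp only: cylinder_translate[OF y'] diff_0 minus_minus)
qed

lemma INF_competitors_eq_min_energy:
  assumes "\<And>w G. H10 D w G \<Longrightarrow> K (\<lambda>x. qe x + w x) (\<lambda>x. dqe x *\<^sub>R e + G x)"
  shows "(INF uG \<in> {(u, G). K u G \<and> (\<forall>x\<in>D. -1 \<le> u x \<and> u x \<le> 1) \<and>
        H10 D (\<lambda>x. u x - qe x) (\<lambda>x. G x - dqe x *\<^sub>R e)}. energy \<Phi> \<tau> W \<omega> D (fst uG) (snd uG)) = min_energy \<omega> D"
    (is "(INF uG \<in> ?S. _) = _")
proof -
  have "?S = (\<lambda>(w, G). (\<lambda>x. qe x + w x, \<lambda>x. dqe x *\<^sub>R e + G x)) ` competitors D"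
  proof (intro equalityI subsetI)
    fix p assume p: "p \<in> ?S"
    let ?w = "\<lambda>x. fst p x - qe x" and ?G = "\<lambda>x. snd p x - dqe x *\<^sub>R e"
    have "(?w, ?G) \<in> competitors D" using p by (auto simp: competitors_def)
    moreover have "p = (\<lambda>x. qe x + ?w x, \<lambda>x. dqe x *\<^sub>R e + ?G x)" by (simp add: prod_eq_iff)
    ultimately show "p \<in> (\<lambda>(w, G). (\<lambda>x. qe x + w x, \<lambda>x. dqe x *\<^sub>R e + G x)) ` competitors D"
      by (intro image_eqI[where x="(?w, ?G)"]) simp_all
  qed (use assms in \<open>auto simp: competitors_def\<close>)
  then show ?thesis
    by (simp add: min_energy_def competitor_energy_def energy_density_def energy_def image_image case_prod_unfold)
qed

lemma phi_fin_eq_min_energy: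
  assumes "Bf e = B"
  shows "phi_fin \<Phi> \<tau> W q Bf \<omega> e R h = min_energy \<omega> (cylinder 0 (R / 2) {-h<..<h})"
proof -
  have cyl: "cyl Bf e R h = cylinder 0 (R / 2) {-h<..<h}"
    using assms by (auto simp: cyl_def cylinder_def abs_less_iff)
  have D: "cylinder 0 (R / 2) {-h<..<h} \<in> sets lebesgue" "bounded (cylinder 0 (R / 2) {-h<..<h})"
    by (simp_all add: bounded_cylinder)
  have "H1 (cylinder 0 (R / 2) {-h<..<h}) (\<lambda>x. qe x) (\<lambda>x. dqe x *\<^sub>R e)"
    using H1_smooth[OF D(1) qe_smooth H1_norm_sq_smooth_finite[OF D(2) qe_smooth]]
    unfolding qe_grad .
  then show ?thesis unfolding phi_fin_def Let_def cyl
    using D(1) by (intro INF_competitors_eq_min_energy H1_add) (simp_all add: H10_def)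
qed

lemma phi_inf_eq_min_energy:
  assumes "Bf e = B"
  shows "phi_inf \<Phi> \<tau> W q Bf \<omega> e R = min_energy \<omega> (prism 0 (R / 2))"
proof -
  have cyl: "cyl_inf Bf e R = prism 0 (R / 2)" using assms by (auto simp: cyl_inf_def cylinder_def)
  have D: "prism 0 (R / 2) \<in> sets lebesgue" by simp
  then have "H1loc (prism 0 (R / 2)) (\<lambda>x. qe x) (\<lambda>x. dqe x *\<^sub>R e)"
    using H1loc_smooth[OF _ qe_smooth] unfolding qe_grad by blast
  then show ?thesis unfolding phi_inf_def Let_def cyl
    using D by (intro INF_competitors_eq_min_energy H1loc_add) (simp_all add: H10_def H1_def)
qed

end

lemma smooth_fn_affine_comp:
  fixes a :: "'a::euclidean_space"
  assumes "smooth_fn (p :: real \<Rightarrow> real)"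
  shows "smooth_fn (\<lambda>x. p (c + k * (x \<bullet> a)))"
    "grad_fn (\<lambda>x. p (c + k * (x \<bullet> a))) x = (k * deriv p (c + k * (x \<bullet> a))) *\<^sub>R a"
proof -
  have affine: "smooth_fn (\<lambda>x. c + k * (x \<bullet> a))"
    by (intro smooth_fn_add smooth_fn_mult smooth_fn_const smooth_fn_inner)
  show "smooth_fn (\<lambda>x. p (c + k * (x \<bullet> a)))" by (rule smooth_fn_comp[OF assms affine])
  have "grad_fn (\<lambda>x. c + k * (x \<bullet> a)) x = k *\<^sub>R a"
    by (rule grad_fn_eqI) (auto intro!: derivative_eq_intros simp: inner_commute)
  then show "grad_fn (\<lambda>x. p (c + k * (x \<bullet> a))) x = (k * deriv p (c + k * (x \<bullet> a))) *\<^sub>R a"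
    by (simp add: grad_fn_comp[OF assms affine] mult.commute)
qed

definition plateau :: "real \<Rightarrow> real \<Rightarrow> 'a::euclidean_space \<Rightarrow> 'a \<Rightarrow> real" where
  "plateau k h a x = smooth_step ((1 + k * h) + (- k) * (x \<bullet> a)) * smooth_step ((1 + k * h) + k * (x \<bullet> a))"

lemma smooth_fn_plateau: "smooth_fn (plateau k h a)"
  unfolding plateau_def[abs_def]
  by (intro smooth_fn_mult smooth_fn_affine_comp smooth_fn_smooth_step)

lemma plateau_bounds: "0 \<le> plateau k h a x" "plateau k h a x \<le> 1"
  unfolding plateau_def using smooth_step_bounds by (auto intro: mult_nonneg_nonneg mult_le_one)

lemma plateau_eq_1: "0 < k \<Longrightarrow> \<bar>x \<bullet> a\<bar> \<le> h \<Longrightarrow> plateau k h a x = 1"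
proof -
  assume k: "0 < k" and h: "\<bar>x \<bullet> a\<bar> \<le> h"
  have "k * (x \<bullet> a) \<le> k * h" "k * (- (x \<bullet> a)) \<le> k * h" using k h by (intro mult_left_mono; simp)+
  then show ?thesis unfolding plateau_def by (simp add: smooth_step_eq_1)
qed

lemma plateau_eq_0: "0 < k \<Longrightarrow> h + 1 / k \<le> \<bar>x \<bullet> a\<bar> \<Longrightarrow> plateau k h a x = 0"
proof -
  assume k: "0 < k" and h: "h + 1 / k \<le> \<bar>x \<bullet> a\<bar>"
  have "k * (h + 1 / k) \<le> k * \<bar>x \<bullet> a\<bar>" using k h by (intro mult_left_mono) auto
  then have "k * h + 1 \<le> k * \<bar>x \<bullet> a\<bar>" using k by (simp add: distrib_left)
  then show ?thesis unfolding plateau_def by (cases "0 \<le> x \<bullet> a") (simp_all add: smooth_step_eq_0)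
qed

lemma plateau_grad:
  "grad_fn (plateau k h a) x =
    (smooth_step ((1 + k * h) + (- k) * (x \<bullet> a)) * (k * deriv smooth_step ((1 + k * h) + k * (x \<bullet> a)))
      + smooth_step ((1 + k * h) + k * (x \<bullet> a)) * ((- k) * deriv smooth_step ((1 + k * h) + (- k) * (x \<bullet> a)))) *\<^sub>R a"
  unfolding plateau_def[abs_def]
  by (subst grad_fn_mult) (intro smooth_fn_affine_comp smooth_fn_smooth_step, intro smooth_fn_affine_comp smooth_fn_smooth_step,
      simp only: smooth_fn_affine_comp(2)[OF smooth_fn_smooth_step] scaleR_scaleR scaleR_left_distrib[symmetric])

lemma plateau_grad_eq_0: "0 < k \<Longrightarrow> \<bar>x \<bullet> a\<bar> < h \<Longrightarrow> grad_fn (plateau k h a) x = 0"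
proof -
  assume k: "0 < k" and h: "\<bar>x \<bullet> a\<bar> < h"
  have "k * (x \<bullet> a) < k * h" "k * (- (x \<bullet> a)) < k * h"
    using k h by (intro mult_strict_left_mono; simp)+
  then show ?thesis unfolding plateau_grad by (simp add: smooth_step_deriv_eq_0)
qed

lemma plateau_grad_bound:
  assumes L: "\<And>t. \<bar>deriv smooth_step t\<bar> \<le> L" and k: "0 < k" and a: "norm a = 1"
  shows "norm (grad_fn (plateau k h a) x) \<le> 2 * k * L"
proof -
  have term_le: "\<bar>smooth_step s * (k' * deriv smooth_step t)\<bar> \<le> k * L" if "\<bar>k'\<bar> = k" for s t k'
  proof -
    have "\<bar>smooth_step s * (k' * deriv smooth_step t)\<bar> = \<bar>smooth_step s\<bar> * (k * \<bar>deriv smooth_step t\<bar>)"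
      using that by (simp add: abs_mult)
    also have "\<dots> \<le> 1 * (k * L)" using k L smooth_step_bounds by (intro mult_mono) auto
    finally show ?thesis by simp
  qed
  let ?A = "smooth_step ((1 + k * h) + (- k) * (x \<bullet> a)) * (k * deriv smooth_step ((1 + k * h) + k * (x \<bullet> a)))"
  let ?C = "smooth_step ((1 + k * h) + k * (x \<bullet> a)) * ((- k) * deriv smooth_step ((1 + k * h) + (- k) * (x \<bullet> a)))"
  have "\<bar>?A\<bar> \<le> k * L" "\<bar>?C\<bar> \<le> k * L" using k by (intro term_le; simp)+
  then have "\<bar>?A + ?C\<bar> \<le> 2 * k * L" by linarith
  then show ?thesis unfolding plateau_grad norm_scaleR a by simp
qed

lemma test_fn_mult_restrict:
  assumes \<psi>: "test_fn D \<psi>" and \<eta>: "smooth_fn \<eta>" and K: "closed K" "\<And>x. x \<notin> K \<Longrightarrow> \<eta> x = 0" "D \<inter> K \<subseteq> D'"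
  shows "test_fn D' (\<lambda>x. \<eta> x * \<psi> x)"
proof (rule test_fnI)
  show "smooth_fn (\<lambda>x. \<eta> x * \<psi> x)" using \<psi> by (intro smooth_fn_mult[OF \<eta>]) (simp add: test_fn_def)
  show "compact (tsupport \<psi> \<inter> K)"
    using \<psi> K(1) by (intro compact_Int_closed) (auto simp: test_fn_def)
  show "tsupport \<psi> \<inter> K \<subseteq> D'" using \<psi> K(3) by (auto simp: test_fn_def)
  show "\<eta> x * \<psi> x = 0" if "x \<notin> tsupport \<psi> \<inter> K" for x
    using that K(2)[of x] frechet_derivative_outside_tsupport(2)[of x \<psi>] by auto
qed

lemma nn_integral_tail_tendsto_0:
  fixes f :: "'a::euclidean_space \<Rightarrow> ennreal"
  assumes f: "f \<in> borel_measurable lebesgue" and fin: "(\<integral>\<^sup>+x. f x \<partial>lebesgue) < \<infinity>"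
  shows "((\<lambda>h. \<integral>\<^sup>+x. f x * indicator {x. h \<le> \<bar>x \<bullet> a\<bar>} x \<partial>lebesgue) \<longlongrightarrow> 0) at_top"
proof (rule tendsto_at_topI_sequentially)
  fix h :: "nat \<Rightarrow> real" assume h: "filterlim h at_top sequentially"
  have "(\<lambda>n. \<integral>\<^sup>+x. f x * indicator {x. h n \<le> \<bar>x \<bullet> a\<bar>} x \<partial>lebesgue) \<longlonglongrightarrow> (\<integral>\<^sup>+(x::'a). 0 \<partial>lebesgue)"
  proof (rule nn_integral_dominated_convergence[where w=f])
    have "{x. h n \<le> \<bar>x \<bullet> a\<bar>} \<in> sets lebesgue" for n
      using borel_closed[OF closed_Collect_le[of "\<lambda>_. h n" "\<lambda>x. \<bar>x \<bullet> a\<bar>"]]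
      by (simp add: continuous_intros)
    then show "(\<lambda>x. f x * indicator {x. h n \<le> \<bar>x \<bullet> a\<bar>} x) \<in> borel_measurable lebesgue" for n
      by (intro borel_measurable_times_ennreal f borel_measurable_indicator)
    show "AE x in lebesgue. f x * indicator {x. h n \<le> \<bar>x \<bullet> a\<bar>} x \<le> f x" for n
      by (intro AE_I2) (auto simp: indicator_def)
    show "AE x in lebesgue. (\<lambda>n. f x * indicator {x. h n \<le> \<bar>x \<bullet> a\<bar>} x) \<longlonglongrightarrow> 0"
    proof (rule AE_I2, rule tendsto_eventually)
      show "\<forall>\<^sub>F n in sequentially. f x * indicator {x. h n \<le> \<bar>x \<bullet> a\<bar>} x = 0" for x
        using filterlim_at_top_dense[THEN iffD1, OF h, rule_format, of "\<bar>x \<bullet> a\<bar>"]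
        by eventually_elim simp
    qed
  qed (use f fin in auto)
  then show "(\<lambda>n. \<integral>\<^sup>+x. f x * indicator {x. h n \<le> \<bar>x \<bullet> a\<bar>} x \<partial>lebesgue) \<longlonglongrightarrow> 0" by simp
qed

lemma (in frame) emeasure_cylinder_layer_le:
  "emeasure lborel (cylinder 0 \<rho> {t. h - 2 \<le> \<bar>t\<bar> \<and> \<bar>t\<bar> \<le> h}) \<le> cross_volume (prism 0 \<rho>) * 4"
proof -
  let ?H = "{t::real. h - 2 \<le> \<bar>t\<bar> \<and> \<bar>t\<bar> \<le> h}"
  have [measurable]: "?H \<in> sets borel" by measurable
  have "emeasure lborel (cylinder 0 \<rho> ?H)
    = (\<integral>\<^sup>+x. indicator (prism 0 \<rho>) x * indicator ?H (x \<bullet> e + 0) \<partial>lborel)"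
    unfolding cylinder_eq_prism_Int[of 0 \<rho> ?H]
    by (subst nn_integral_indicator[symmetric], measurable, intro nn_integral_cong) (auto simp: indicator_def)
  also have "\<dots> = cross_volume (prism 0 \<rho>) * (\<integral>\<^sup>+t. indicator ?H t \<partial>lborel)"
    by (rule nn_integral_eq_cross_volume_mult[where g="\<lambda>_. 0" and F="indicator ?H"]) (auto simp: prism_translate_e)
  also have "(\<integral>\<^sup>+t. indicator ?H t \<partial>lborel) \<le> emeasure lborel ({- h..2 - h} \<union> {h - 2..h})"
    by (simp, intro emeasure_mono) auto
  also have "\<dots> \<le> emeasure lborel {- h..2 - h} + emeasure lborel {h - 2..h}"
    by (rule emeasure_subadditive) auto
  also have "\<dots> = 4" by simp
  finally show ?thesis by (simp add: mult_left_mono)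
qed

context medium
begin

abbreviation cutoff :: "real \<Rightarrow> 'd \<Rightarrow> real" where "cutoff h \<equiv> plateau 1 (h - 2) e"

definition truncated :: "real \<Rightarrow> ('d \<Rightarrow> real) \<Rightarrow> 'd \<Rightarrow> real" where
  "truncated h w x = cutoff h x * w x"

definition truncated_grad :: "real \<Rightarrow> ('d \<Rightarrow> real) \<Rightarrow> ('d \<Rightarrow> 'd) \<Rightarrow> 'd \<Rightarrow> 'd" where
  "truncated_grad h w G x = cutoff h x *\<^sub>R G x + w x *\<^sub>R grad_fn (cutoff h) x"

lemma cutoff_grad_bound: "\<exists>L. \<forall>h x. norm (grad_fn (cutoff h) x) \<le> L"
proof -
  obtain L where "\<And>t. \<bar>deriv smooth_step t\<bar> \<le> L" using smooth_step_deriv_bound by blast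
  then have "norm (grad_fn (cutoff h) x) \<le> 2 * 1 * L" for h x
    by (intro plateau_grad_bound norm_e) simp_all
  then show ?thesis by blast
qed

lemma truncated_sq_le:
  "\<exists>K\<ge>0. \<forall>h w G x. (truncated h w x)\<^sup>2 + (norm (truncated_grad h w G x))\<^sup>2 \<le> K * ((w x)\<^sup>2 + (norm (G x))\<^sup>2)"
proof -
  obtain L where L: "\<And>h x. norm (grad_fn (cutoff h) x) \<le> L" using cutoff_grad_bound by blast
  have "\<bar>cutoff h x\<bar> \<le> 1" for h x using plateau_bounds[of 1 "h - 2" e x] by simp
  then have "(truncated h w x)\<^sup>2 + (norm (truncated_grad h w G x))\<^sup>2
    \<le> (2 * 1\<^sup>2 + 2 * L\<^sup>2) * ((w x)\<^sup>2 + (norm (G x))\<^sup>2)" for h w G x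
    unfolding truncated_def truncated_grad_def by (rule product_rule_sq_le[OF _ L])
  then show ?thesis by (intro exI[of _ "2 * 1\<^sup>2 + 2 * L\<^sup>2"]) simp
qed

lemma competitors_truncated:
  assumes wG: "(w, G) \<in> competitors (prism 0 \<rho>)"
  shows "(truncated h w, truncated_grad h w G) \<in> competitors (cylinder 0 \<rho> {-h<..<h})"
proof -
  let ?D = "prism 0 \<rho>" and ?C = "cylinder 0 \<rho> {-h<..<h}" and ?\<theta> = "cutoff h"
  have D: "open ?D" by (rule open_cylinder) simp
  have sub: "?C \<subseteq> ?D" by (rule cylinder_subset) auto
  have \<theta>: "0 \<le> ?\<theta> x" "?\<theta> x \<le> 1" for x by (rule plateau_bounds)+
  obtain L where L: "\<And>h x. norm (grad_fn (cutoff h) x) \<le> L" using cutoff_grad_bound by blast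
  have "H10 ?C (truncated h w) (truncated_grad h w G)"
    unfolding truncated_def[abs_def] truncated_grad_def[abs_def]
  proof (rule H10_mult[OF D _ sub competitorsD(1)[OF wG] _ _ L])
    show "open ?C" by (rule open_cylinder) simp
    show smooth: "smooth_fn ?\<theta>" by (rule smooth_fn_plateau)
    show "\<bar>?\<theta> x\<bar> \<le> 1" for x using \<theta>[of x] by simp
    fix \<psi> assume \<psi>: "test_fn ?D \<psi>"
    show "test_fn ?C (\<lambda>x. ?\<theta> x * \<psi> x)"
    proof (rule test_fn_mult_restrict[OF \<psi> smooth])
      show "closed {x. \<bar>x \<bullet> e\<bar> \<le> h - 1}" by (intro closed_Collect_le continuous_intros)
      show "?\<theta> x = 0" if "x \<notin> {x. \<bar>x \<bullet> e\<bar> \<le> h - 1}" for x using that by (intro plateau_eq_0) auto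
      show "?D \<inter> {x. \<bar>x \<bullet> e\<bar> \<le> h - 1} \<subseteq> ?C" by (auto simp: cylinder_def)
    qed
  qed
  moreover have "qe x + truncated h w x \<in> {-1..1}" if "x \<in> ?D" for x
  proof -
    have "(1 - ?\<theta> x) *\<^sub>R qe x + ?\<theta> x *\<^sub>R (qe x + w x) \<in> {-1..1}"
      using competitorsD(3)[OF wG that] q_range[of "x \<bullet> e"] \<theta>[of x]
      by (intro convexD[OF convex_closed_interval]) auto
    moreover have "(1 - ?\<theta> x) *\<^sub>R qe x + ?\<theta> x *\<^sub>R (qe x + w x) = qe x + truncated h w x"
      by (simp add: truncated_def algebra_simps)
    ultimately show ?thesis by (simp only:)
  qed
  ultimately show ?thesis using sub by (force simp: competitors_def)
qed

definition truncation_error :: "real \<Rightarrow> real \<Rightarrow> real \<Rightarrow> ('d \<Rightarrow> real) \<Rightarrow> ('d \<Rightarrow> 'd) \<Rightarrow> 'd \<Rightarrow> real" where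
  "truncation_error t C \<rho> w G x = (1 + t) * (profile_density (x \<bullet> e) * indicator (prism 0 \<rho>) x)
      + C * (indicator (prism 0 \<rho>) x * ((w x)\<^sup>2 + (norm (G x))\<^sup>2))"

lemma truncation_error_nonneg: "0 \<le> t \<Longrightarrow> 0 \<le> C \<Longrightarrow> 0 \<le> truncation_error t C \<rho> w G x"
  unfolding truncation_error_def
  using profile_density_nonneg by (intro add_nonneg_nonneg mult_nonneg_nonneg) auto

lemma truncation_error_integrable:
  assumes wG: "(w, G) \<in> competitors (prism 0 \<rho>)" and t: "0 \<le> t" and C: "0 \<le> C"
  shows "truncation_error t C \<rho> w G \<in> borel_measurable lebesgue" "(\<integral>\<^sup>+x. ennreal (truncation_error t C \<rho> w G x) \<partial>lebesgue) < \<infinity>"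
proof -
  let ?D = "prism 0 \<rho>" and ?s = "\<lambda>x. indicator (prism 0 \<rho>) x * ((w x)\<^sup>2 + (norm (G x))\<^sup>2)"
  have [measurable]: "(\<lambda>x. profile_density (x \<bullet> e) * indicator ?D x) \<in> borel_measurable lebesgue"
    by (rule measurable_completion) measurable
  have [measurable]: "?s \<in> borel_measurable lebesgue"
    by (rule H1_measurable_sq(3)[OF competitorsD(2)[OF wG]])
  show "truncation_error t C \<rho> w G \<in> borel_measurable lebesgue"
    unfolding truncation_error_def[abs_def] by measurable
  have "ennreal (truncation_error t C \<rho> w G x)
      = ennreal (1 + t) * ennreal (profile_density (x \<bullet> e) * indicator ?D x)
      + ennreal C * ennreal (?s x)" for x
    using t C profile_density_nonneg by (simp add: truncation_error_def ennreal_mult')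
  then have "(\<integral>\<^sup>+x. ennreal (truncation_error t C \<rho> w G x) \<partial>lebesgue)
      = ennreal (1 + t) * (\<integral>\<^sup>+x. ennreal (profile_density (x \<bullet> e) * indicator ?D x) \<partial>lebesgue)
      + ennreal C * H1_norm_sq ?D w G"
    unfolding H1_norm_sq_def by (simp add: nn_integral_add nn_integral_cmult del: ennreal_plus)
  also have "(\<integral>\<^sup>+x. ennreal (profile_density (x \<bullet> e) * indicator ?D x) \<partial>lebesgue)
    = emeasure profile_measure ?D"
    by (subst emeasure_profile_measure) (auto intro!: nn_integral_cong simp: indicator_def)
  also have "ennreal (1 + t) * \<dots> + ennreal C * H1_norm_sq ?D w G < \<infinity>"
    using emeasure_profile_measure_cylinder_finite[of UNIV 0 \<rho>] H10D(2)[OF competitorsD(1)[OF wG]]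
    by (simp add: ennreal_mult_less_top)
  finally show "(\<integral>\<^sup>+x. ennreal (truncation_error t C \<rho> w G x) \<partial>lebesgue) < \<infinity>" .
qed

abbreviation cutoff_layer :: "real \<Rightarrow> real \<Rightarrow> 'd set" where
  "cutoff_layer \<rho> h \<equiv> cylinder 0 \<rho> {s. h - 2 \<le> \<bar>s\<bar> \<and> \<bar>s\<bar> \<le> h}"

lemma energy_density_truncated_inner:
  assumes "\<bar>x \<bullet> e\<bar> < h - 2"
  shows "energy_density \<omega> (cylinder 0 \<rho> {-h<..<h}) (truncated h w) (truncated_grad h w G) x
    = energy_density \<omega> (prism 0 \<rho>) w G x"
proof -
  have "x \<in> cylinder 0 \<rho> {-h<..<h} \<longleftrightarrow> x \<in> prism 0 \<rho>" using assms by (auto simp: cylinder_def)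
  then show ?thesis
    using assms
    by (simp add: energy_density_def truncated_def truncated_grad_def plateau_eq_1 plateau_grad_eq_0 indicator_def)
qed

lemma energy_density_truncated_le_error:
  assumes t: "0 < t"
  shows "\<exists>C\<ge>0. \<forall>\<omega>\<in>space M. \<forall>\<rho> w G h. \<forall>x\<in>cylinder 0 \<rho> {-h<..<h}. (w, G) \<in> competitors (prism 0 \<rho>) \<longrightarrow>
      energy_density \<omega> (cylinder 0 \<rho> {-h<..<h}) (truncated h w) (truncated_grad h w G) x
      \<le> truncation_error t C \<rho> w G x + t"
proof -
  obtain K where K: "0 \<le> K" "\<And>\<omega> s s' x p p'. \<omega> \<in> space M \<Longrightarrow> s \<in> {-1..1} \<Longrightarrow> s' \<in> {-1..1} \<Longrightarrow>
      1 / 2 * (\<Phi> (\<tau> x \<omega>) p')\<^sup>2 + W s'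
      \<le> (1 + t) * (1 / 2 * (\<Phi> (\<tau> x \<omega>) p)\<^sup>2 + W s) + t + K * ((s' - s)\<^sup>2 + (norm (p' - p))\<^sup>2)"
    using integrand_perturb[OF t] by blast
  obtain K' where K': "0 \<le> K'" "\<And>h w G x. (truncated h w x)\<^sup>2 + (norm (truncated_grad h w G x))\<^sup>2
    \<le> K' * ((w x)\<^sup>2 + (norm (G x))\<^sup>2)"
    using truncated_sq_le by blast
  show ?thesis
  proof (intro exI[of _ "K * K'"] conjI ballI allI impI)
    show "0 \<le> K * K'" using K(1) K'(1) by simp
    fix \<omega> \<rho> w G h x assume \<omega>: "\<omega> \<in> space M" and x: "x \<in> cylinder 0 \<rho> {-h<..<h}" and wG: "(w, G) \<in> competitors (prism 0 \<rho>)"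
    let ?w = "truncated h w" and ?G = "truncated_grad h w G"
    have "energy_density \<omega> (cylinder 0 \<rho> {-h<..<h}) ?w ?G x
        \<le> (1 + t) * (1 / 2 * (\<Phi> (\<tau> x \<omega>) (dqe x *\<^sub>R e))\<^sup>2 + W (qe x)) + t + K * ((?w x)\<^sup>2 + (norm (?G x))\<^sup>2)"
      using K(2)[OF \<omega>, of "qe x" "qe x + ?w x" x "dqe x *\<^sub>R e + ?G x" "dqe x *\<^sub>R e"] q_range x
        competitorsD(3)[OF competitors_truncated[OF wG] x] by (simp add: energy_density_def)
    also have "\<dots> \<le> (1 + t) * profile_density (x \<bullet> e) + t + K * (K' * ((w x)\<^sup>2 + (norm (G x))\<^sup>2))"
      using profile_energy_density_le[OF \<omega>, of x] t K(1) K'(2)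
      by (intro add_mono mult_left_mono) auto
    also have "\<dots> = truncation_error t (K * K') \<rho> w G x + t"
      using x by (simp add: truncation_error_def mult.assoc cylinder_def)
    finally show "energy_density \<omega> (cylinder 0 \<rho> {-h<..<h}) ?w ?G x
      \<le> truncation_error t (K * K') \<rho> w G x + t" .
  qed
qed

lemma energy_density_truncated_le:
  assumes t: "0 < t"
  shows "\<exists>C\<ge>0. \<forall>\<omega>\<in>space M. \<forall>\<rho> w G h x. (w, G) \<in> competitors (prism 0 \<rho>) \<longrightarrow>
      energy_density \<omega> (cylinder 0 \<rho> {-h<..<h}) (truncated h w) (truncated_grad h w G) x
      \<le> energy_density \<omega> (prism 0 \<rho>) w G x
        + truncation_error t C \<rho> w G x * indicator {x. h - 2 \<le> \<bar>x \<bullet> e\<bar>} x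
        + t * indicator (cutoff_layer \<rho> h) x"
proof -
  obtain C where C: "0 \<le> C" and error: "\<And>\<omega> \<rho> w G h x. \<omega> \<in> space M \<Longrightarrow> x \<in> cylinder 0 \<rho> {-h<..<h} \<Longrightarrow> (w, G) \<in> competitors (prism 0 \<rho>) \<Longrightarrow>
      energy_density \<omega> (cylinder 0 \<rho> {-h<..<h}) (truncated h w) (truncated_grad h w G) x
      \<le> truncation_error t C \<rho> w G x + t"
    using energy_density_truncated_le_error[OF t] by blast
  show ?thesis
  proof (intro exI[of _ C] conjI ballI allI impI C)
    fix \<omega> \<rho> w G h x assume \<omega>: "\<omega> \<in> space M" and wG: "(w, G) \<in> competitors (prism 0 \<rho>)"
    let ?D = "prism 0 \<rho>" and ?H = "cylinder 0 \<rho> {-h<..<h}" and ?w = "truncated h w" and ?G = "truncated_grad h w G"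
    have nonneg: "0 \<le> energy_density \<omega> ?D w G x" "0 \<le> truncation_error t C \<rho> w G x"
      using W_nonneg[OF competitorsD(3)[OF wG]] truncation_error_nonneg[OF less_imp_le[OF t] C]
      by (simp_all add: energy_density_def indicator_def)
    consider (outer) "x \<notin> ?H" | (inner) "\<bar>x \<bullet> e\<bar> < h - 2" | (layer) "x \<in> ?H" "h - 2 \<le> \<bar>x \<bullet> e\<bar>"
      by linarith
    then show "energy_density \<omega> ?H ?w ?G x \<le> energy_density \<omega> ?D w G x
        + truncation_error t C \<rho> w G x * indicator {x. h - 2 \<le> \<bar>x \<bullet> e\<bar>} x
        + t * indicator (cutoff_layer \<rho> h) x"
    proof cases
      case outer
      then have "energy_density \<omega> ?H ?w ?G x = 0" by (simp add: energy_density_def)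
      then show ?thesis using nonneg t by (simp add: indicator_def)
    next
      case inner
      then show ?thesis using nonneg t by (simp add: energy_density_truncated_inner)
    next
      case layer
      then have "x \<in> cutoff_layer \<rho> h" by (auto simp: cylinder_def abs_less_iff)
      then show ?thesis using error[OF \<omega> layer(1) wG] nonneg(1) layer(2) by simp
    qed
  qed
qed

lemma competitor_energy_truncated_le:
  assumes \<omega>: "\<omega> \<in> space M" and wG: "(w, G) \<in> competitors (prism 0 \<rho>)" and t: "0 < t"
  obtains C where "0 \<le> C" "\<And>h. competitor_energy \<omega> (cylinder 0 \<rho> {-h<..<h}) (truncated h w) (truncated_grad h w G)
      \<le> competitor_energy \<omega> (prism 0 \<rho>) w G
      + ((\<integral>\<^sup>+x. ennreal (truncation_error t C \<rho> w G x) * indicator {x. h - 2 \<le> \<bar>x \<bullet> e\<bar>} x \<partial>lebesgue)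
        + ennreal t * emeasure lborel (cutoff_layer \<rho> h))"
proof -
  let ?D = "prism 0 \<rho>"
  obtain C where C: "0 \<le> C" and density_le: "\<And>h x. energy_density \<omega> (cylinder 0 \<rho> {-h<..<h}) (truncated h w) (truncated_grad h w G) x
      \<le> energy_density \<omega> ?D w G x + truncation_error t C \<rho> w G x * indicator {x. h - 2 \<le> \<bar>x \<bullet> e\<bar>} x
      + t * indicator (cutoff_layer \<rho> h) x"
    using energy_density_truncated_le[OF t] \<omega> wG by blast
  show thesis
  proof (rule that[OF C])
    fix h :: real
    let ?far = "{x. h - 2 \<le> \<bar>x \<bullet> e\<bar>}" and ?f = "energy_density \<omega> ?D w G" and ?k = "truncation_error t C \<rho> w G"
    have [measurable]: "?f \<in> borel_measurable lebesgue" "cutoff_layer \<rho> h \<in> sets lebesgue" "?far \<in> sets lebesgue" "?k \<in> borel_measurable lebesgue"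
      using energy_density_measurable[OF \<omega> open_cylinder[OF open_UNIV] wG] truncation_error_integrable(1)[OF wG less_imp_le[OF t] C]
        borel_closed[OF closed_Collect_le[of "\<lambda>_. h - 2" "\<lambda>x. \<bar>x \<bullet> e\<bar>"]]
        by (simp_all add: continuous_intros)
    have "ennreal (energy_density \<omega> (cylinder 0 \<rho> {-h<..<h}) (truncated h w) (truncated_grad h w G) x)
        \<le> ennreal (?f x) + (ennreal (?k x) * indicator ?far x + ennreal t * indicator (cutoff_layer \<rho> h) x)" for x
    proof -
      have "ennreal (energy_density \<omega> (cylinder 0 \<rho> {-h<..<h}) (truncated h w) (truncated_grad h w G) x)
          \<le> ennreal (?f x) + ennreal (?k x * indicator ?far x) + ennreal (t * indicator (cutoff_layer \<rho> h) x)"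
        by (intro order_trans[OF ennreal_leI[OF density_le] order_trans[OF ennreal_add_le]] add_right_mono ennreal_add_le)
      also have "\<dots> = ennreal (?f x) + (ennreal (?k x) * indicator ?far x + ennreal t * indicator (cutoff_layer \<rho> h) x)"
        by (simp add: indicator_def add.assoc)
      finally show ?thesis .
    qed
    then have "competitor_energy \<omega> (cylinder 0 \<rho> {-h<..<h}) (truncated h w) (truncated_grad h w G)
        \<le> (\<integral>\<^sup>+x. ennreal (?f x) + (ennreal (?k x) * indicator ?far x + ennreal t * indicator (cutoff_layer \<rho> h) x) \<partial>lebesgue)"
      unfolding competitor_energy_def by (intro nn_integral_mono)
    also have "\<dots> = competitor_energy \<omega> ?D w G
      + ((\<integral>\<^sup>+x. ennreal (?k x) * indicator ?far x \<partial>lebesgue) + ennreal t * emeasure lborel (cutoff_layer \<rho> h))"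
      unfolding competitor_energy_def
      by (simp add: nn_integral_add nn_integral_cmult_indicator del: ennreal_plus)
    finally show "competitor_energy \<omega> (cylinder 0 \<rho> {-h<..<h}) (truncated h w) (truncated_grad h w G) \<le> \<dots>" .
  qed
qed

lemma min_energy_cutoff:
  assumes \<omega>: "\<omega> \<in> space M" and wG: "(w, G) \<in> competitors (prism 0 \<rho>)" and \<epsilon>: "0 < \<epsilon>"
  shows "\<forall>\<^sub>F h in at_top. min_energy \<omega> (cylinder 0 \<rho> {-h<..<h})
    \<le> competitor_energy \<omega> (prism 0 \<rho>) w G + ennreal \<epsilon>"
proof -
  define v where "v = enn2real (cross_volume (prism 0 \<rho>) * 4)"
  have v: "cross_volume (prism 0 \<rho>) * 4 = ennreal v" "0 \<le> v"
    using cross_volume_prism_finite[of \<rho>] by (simp_all add: v_def ennreal_mult_less_top)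
  define t where "t = \<epsilon> / (2 * (v + 1))"
  have t: "0 < t" "t * v \<le> \<epsilon> / 2" using \<epsilon> v(2) by (simp_all add: t_def field_simps)
  obtain C where C: "0 \<le> C" and energy_le: "\<And>h. competitor_energy \<omega> (cylinder 0 \<rho> {-h<..<h}) (truncated h w) (truncated_grad h w G)
      \<le> competitor_energy \<omega> (prism 0 \<rho>) w G
      + ((\<integral>\<^sup>+x. ennreal (truncation_error t C \<rho> w G x) * indicator {x. h - 2 \<le> \<bar>x \<bullet> e\<bar>} x \<partial>lebesgue)
        + ennreal t * emeasure lborel (cutoff_layer \<rho> h))"
    using competitor_energy_truncated_le[OF \<omega> wG t(1)] by blast
  let ?tail = "\<lambda>h. \<integral>\<^sup>+x. ennreal (truncation_error t C \<rho> w G x) * indicator {x. h \<le> \<bar>x \<bullet> e\<bar>} x \<partial>lebesgue"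
  have "(?tail \<longlongrightarrow> 0) at_top"
    using truncation_error_integrable[OF wG less_imp_le[OF t(1)] C]
    by (intro nn_integral_tail_tendsto_0 measurable_compose[OF _ measurable_ennreal])
  then have "((\<lambda>h. ?tail (h - 2)) \<longlongrightarrow> 0) at_top" by (rule filterlim_compose) real_asymp
  then have "\<forall>\<^sub>F h in at_top. ?tail (h - 2) < ennreal (\<epsilon> / 2)"
    by (rule order_tendstoD(2)) (use \<epsilon> in simp)
  then show ?thesis
  proof eventually_elim
    case (elim h)
    have "min_energy \<omega> (cylinder 0 \<rho> {-h<..<h})
      \<le> competitor_energy \<omega> (cylinder 0 \<rho> {-h<..<h}) (truncated h w) (truncated_grad h w G)"
      by (rule min_energy_le[OF competitors_truncated[OF wG]])
    also have "\<dots> \<le> competitor_energy \<omega> (prism 0 \<rho>) w G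
      + (?tail (h - 2) + ennreal t * emeasure lborel (cutoff_layer \<rho> h))" by (rule energy_le)
    also have "\<dots> \<le> competitor_energy \<omega> (prism 0 \<rho>) w G + (ennreal (\<epsilon> / 2) + ennreal t * ennreal v)"
      using elim emeasure_cylinder_layer_le[of \<rho> h]
      unfolding v(1) by (intro add_left_mono add_mono mult_left_mono) simp_all
    also have "ennreal (\<epsilon> / 2) + ennreal t * ennreal v \<le> ennreal \<epsilon>"
      using t v(2) \<epsilon> by (simp flip: ennreal_mult ennreal_plus)
    finally show ?case by (simp add: add_left_mono)
  qed
qed

lemma line_measure_tail_tendsto_0: "((\<lambda>h. emeasure line_measure (- {-h<..<h})) \<longlongrightarrow> 0) at_top"
proof -
  have "emeasure line_measure (- {-h<..<h})
    = (\<integral>\<^sup>+t. ennreal (profile_density t) * indicator {t. h \<le> \<bar>t \<bullet> 1\<bar>} t \<partial>lebesgue)" for h :: real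
    unfolding line_measure_def nn_integral_completion
    by (subst emeasure_density, measurable, intro nn_integral_cong) (auto simp: indicator_def abs_less_iff)
  moreover have "(\<lambda>t. ennreal (profile_density t)) \<in> borel_measurable lebesgue"
    by (rule measurable_completion) measurable
  ultimately show ?thesis
    using nn_integral_tail_tendsto_0[of "\<lambda>t. ennreal (profile_density t)" 1] profile_density_finite
    by (simp only: nn_integral_completion)
qed

lemma min_energy_cylinder_tendsto:
  assumes \<omega>: "\<omega> \<in> space M"
  shows "((\<lambda>h. min_energy \<omega> (cylinder 0 \<rho> {-h<..<h})) \<longlongrightarrow> min_energy \<omega> (prism 0 \<rho>)) at_top"
proof (rule tendsto_iff_Liminf_eq_Limsup[THEN iffD2])
  let ?m = "\<lambda>h. min_energy \<omega> (cylinder 0 \<rho> {-h<..<h})"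
  have upper: "Limsup at_top ?m \<le> min_energy \<omega> (prism 0 \<rho>)"
    unfolding min_energy_def[of \<omega> "prism 0 \<rho>"]
  proof (rule INF_greatest, clarify)
    fix w G assume wG: "(w, G) \<in> competitors (prism 0 \<rho>)"
    show "Limsup at_top ?m \<le> competitor_energy \<omega> (prism 0 \<rho>) w G"
      by (rule ennreal_le_epsilon) (intro Limsup_bounded min_energy_cutoff[OF \<omega> wG])
  qed
  have "min_energy \<omega> (prism 0 \<rho>)
    \<le> ?m h + cross_volume (prism 0 \<rho>) * emeasure line_measure (- {-h<..<h})" for h
  proof -
    have "min_energy \<omega> (prism 0 \<rho>) \<le> ?m h + emeasure profile_measure (prism 0 \<rho> - cylinder 0 \<rho> {-h<..<h})"
      using min_energy_subadditive[OF \<omega>, of "{()}" "prism 0 \<rho>" "\<lambda>_. cylinder 0 \<rho> {-h<..<h}"]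
      by (simp add: open_cylinder cylinder_subset disjoint_family_on_def)
    also have "prism 0 \<rho> - cylinder 0 \<rho> {-h<..<h} = cylinder 0 \<rho> (- {-h<..<h})"
      by (auto simp: cylinder_def)
    finally show ?thesis by (simp add: emeasure_profile_measure_cylinder)
  qed
  moreover have "((\<lambda>h. cross_volume (prism 0 \<rho>) * emeasure line_measure (- {-h<..<h})) \<longlongrightarrow> cross_volume (prism 0 \<rho>) * 0) at_top"
    using cross_volume_prism_finite
    by (intro ennreal_tendsto_cmult line_measure_tail_tendsto_0) simp
  ultimately have "Liminf at_top (\<lambda>_::real. min_energy \<omega> (prism 0 \<rho>)) \<le> Liminf at_top ?m"
    by (intro Liminf_comp_le_Liminf[OF filterlim_ident always_eventually]) simp_all
  then have lower: "min_energy \<omega> (prism 0 \<rho>) \<le> Liminf at_top ?m" by (simp add: Liminf_const)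
  have "Liminf at_top ?m \<le> Limsup at_top ?m" by (rule Liminf_le_Limsup) simp
  then show "Liminf at_top ?m = min_energy \<omega> (prism 0 \<rho>) \<and> Limsup at_top ?m = min_energy \<omega> (prism 0 \<rho>)"
    using upper lower by (meson antisym order_trans)
qed simp

end

lemma grad_fn_prod_bound:
  assumes "finite I" "\<And>i. i \<in> I \<Longrightarrow> smooth_fn (f i)" "\<And>i. i \<in> I \<Longrightarrow> \<bar>f i x\<bar> \<le> 1"
    "\<And>i. i \<in> I \<Longrightarrow> norm (grad_fn (f i) x) \<le> K"
  shows "norm (grad_fn (\<lambda>x. \<Prod>i\<in>I. f i x) x) \<le> real (card I) * K"
  using assms
proof (induction I rule: finite_induct)
  case empty
  have "grad_fn (\<lambda>x. \<Prod>i\<in>{}. f i x) x = 0" by (simp add: grad_fn_def)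
  then show ?case by simp
next
  case (insert i I)
  let ?P = "\<lambda>x. \<Prod>i\<in>I. f i x"
  have smooth: "smooth_fn (f i)" "smooth_fn ?P"
    using insert.prems(1) insert.hyps(1) by (auto intro!: smooth_fn_prod)
  have P_le: "\<bar>?P x\<bar> \<le> 1" unfolding abs_prod by (rule prod_le_1) (use insert.prems(2) in auto)
  have "grad_fn (\<lambda>x. \<Prod>i\<in>insert i I. f i x) x = f i x *\<^sub>R grad_fn ?P x + ?P x *\<^sub>R grad_fn (f i) x"
    unfolding prod.insert[OF insert.hyps] by (rule grad_fn_mult[OF smooth])
  then have "norm (grad_fn (\<lambda>x. \<Prod>i\<in>insert i I. f i x) x)
    \<le> \<bar>f i x\<bar> * norm (grad_fn ?P x) + \<bar>?P x\<bar> * norm (grad_fn (f i) x)"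
    using norm_triangle_ineq[of "f i x *\<^sub>R grad_fn ?P x" "?P x *\<^sub>R grad_fn (f i) x"]
    by (simp only: norm_scaleR)
  also have "\<dots> \<le> 1 * (real (card I) * K) + 1 * K"
    using insert.prems insert.IH P_le by (intro add_mono mult_mono) auto
  finally show ?case using insert.hyps by (simp add: algebra_simps)
qed

lemma sq_increment_le_nn_integral:
  fixes f f' :: "real \<Rightarrow> real"
  assumes f: "\<And>r. (f has_real_derivative f' r) (at r)" and cont: "continuous_on UNIV f'"
  shows "ennreal ((f 1 - f 0)\<^sup>2) \<le> (\<integral>\<^sup>+r. ennreal ((f' r)\<^sup>2) * indicator {0..1} r \<partial>lborel)"
proof -
  have [measurable]: "f' \<in> borel_measurable borel"
    by (rule borel_measurable_continuous_onI[OF cont])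
  have int: "integrable lborel (\<lambda>r. f' r * indicator {0..1} r)"
    using borel_integrable_atLeastAtMost'[OF continuous_on_subset[OF cont], of 0 1]
    by (simp add: set_integrable_def mult.commute)
  have "f 1 - f 0 = (\<integral>r. f' r * indicator {0..1} r \<partial>lborel)"
    using integral_FTC_Icc_real[of 0 1 f f'] f cont by (simp add: continuous_on_eq_continuous_at)
  then have "ennreal \<bar>f 1 - f 0\<bar> \<le> (\<integral>\<^sup>+r. ennreal \<bar>f' r * indicator {0..1} r\<bar> \<partial>lborel)"
    using integral_norm_bound_ennreal[OF int] by simp
  also have "\<dots> = (\<integral>\<^sup>+r. (ennreal \<bar>f' r\<bar> * indicator {0..1} r) * indicator {0..1} r \<partial>lborel)"
    by (intro nn_integral_cong) (auto simp: indicator_def)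
  finally have "(ennreal \<bar>f 1 - f 0\<bar>)\<^sup>2
    \<le> (\<integral>\<^sup>+r. (ennreal \<bar>f' r\<bar> * indicator {0..1} r) * indicator {0..1} r \<partial>lborel)\<^sup>2"
    by (rule power_mono) simp
  also have "\<dots> \<le> (\<integral>\<^sup>+r. (ennreal \<bar>f' r\<bar> * indicator {0..1} r)\<^sup>2 \<partial>lborel) * (\<integral>\<^sup>+r. (indicator {0..1::real} r)\<^sup>2 \<partial>lborel)"
    by (rule Cauchy_Schwarz_nn_integral) measurable
  also have "(\<integral>\<^sup>+r. (indicator {0..1::real} r)\<^sup>2 \<partial>lborel) = (\<integral>\<^sup>+r. indicator {0..1::real} r \<partial>lborel)"
    by (intro nn_integral_cong) (auto simp: indicator_def)
  also have "\<dots> = 1" by simp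
  also have "(\<integral>\<^sup>+r. (ennreal \<bar>f' r\<bar> * indicator {0..1} r)\<^sup>2 \<partial>lborel)
    = (\<integral>\<^sup>+r. ennreal ((f' r)\<^sup>2) * indicator {0..1} r \<partial>lborel)"
    by (intro nn_integral_cong) (auto simp: indicator_def ennreal_power)
  finally show ?thesis by (simp add: ennreal_power)
qed

context medium
begin

lemma q_increment_sq_le:
  "ennreal ((q (a + \<sigma>) - q a)\<^sup>2) \<le> (\<integral>\<^sup>+r. ennreal ((\<sigma> * deriv q (a + \<sigma> * r))\<^sup>2) * indicator {0..1} r \<partial>lborel)"
proof -
  have "((\<lambda>r. q (a + \<sigma> * r)) has_real_derivative \<sigma> * deriv q (a + \<sigma> * r)) (at r)" for r
  proof -
    have "((\<lambda>r. a + \<sigma> * r) has_real_derivative \<sigma>) (at r)" by (auto intro!: derivative_eq_intros)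
    from DERIV_chain2[OF smooth_fn_has_real_derivative[OF q_smooth] this] show ?thesis
      by (simp add: mult.commute)
  qed
  moreover have "continuous_on UNIV (\<lambda>r. \<sigma> * deriv q (a + \<sigma> * r))"
    by (intro continuous_intros continuous_on_compose2[OF smooth_fn_continuous[OF smooth_fn_deriv[OF q_smooth], of UNIV]]) auto
  ultimately show ?thesis using sq_increment_le_nn_integral[of "\<lambda>r. q (a + \<sigma> * r)"] by simp
qed

lemma q_deriv_sq_finite: "(\<integral>\<^sup>+t. ennreal ((deriv q t)\<^sup>2) \<partial>lborel) < \<infinity>"
proof -
  have "(deriv q t)\<^sup>2 \<le> 2 / Lam * profile_density t" for t
    using Lam_pos W_ext_nonneg[of "q t"] by (simp add: profile_density_def field_simps)
  then have "(\<integral>\<^sup>+t. ennreal ((deriv q t)\<^sup>2) \<partial>lborel)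
    \<le> (\<integral>\<^sup>+t. ennreal (2 / Lam) * ennreal (profile_density t) \<partial>lborel)"
    using Lam_pos by (intro nn_integral_mono) (auto simp flip: ennreal_mult' intro: ennreal_leI)
  also have "\<dots> = ennreal (2 / Lam) * (\<integral>\<^sup>+t. ennreal (profile_density t) \<partial>lborel)"
    by (rule nn_integral_cmult) measurable
  also have "\<dots> < \<infinity>" using profile_density_finite by (simp add: ennreal_mult_less_top)
  finally show ?thesis .
qed

definition lateral_cutoff :: "real \<Rightarrow> 'd \<Rightarrow> real" where "lateral_cutoff \<rho> x = (\<Prod>b\<in>B. plateau 2 \<rho> b x)"

lemma lateral_cutoff_smooth: "smooth_fn (lateral_cutoff \<rho>)"
  unfolding lateral_cutoff_def[abs_def] using finite_B by (intro smooth_fn_prod smooth_fn_plateau)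

lemma lateral_cutoff_measurable [measurable]: "lateral_cutoff \<rho> \<in> borel_measurable borel"
  by (rule smooth_fn_borel_measurable[OF lateral_cutoff_smooth])

lemma lateral_cutoff_bounds: "0 \<le> lateral_cutoff \<rho> x" "lateral_cutoff \<rho> x \<le> 1"
  unfolding lateral_cutoff_def using plateau_bounds by (auto intro!: prod_nonneg prod_le_1)

lemma lateral_cutoff_translate_e: "lateral_cutoff \<rho> (x + t *\<^sub>R e) = lateral_cutoff \<rho> x"
  unfolding lateral_cutoff_def plateau_def
  by (intro prod.cong refl) (simp add: inner_add_left e_inner_B)

lemma lateral_cutoff_eq_1: "x \<in> prism 0 \<rho> \<Longrightarrow> lateral_cutoff \<rho> x = 1"
  unfolding lateral_cutoff_def
  by (intro prod.neutral ballI plateau_eq_1) (auto simp: cylinder_def intro: less_imp_le)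

lemma lateral_cutoff_eq_0: "b \<in> B \<Longrightarrow> \<rho> + 1 / 2 \<le> \<bar>x \<bullet> b\<bar> \<Longrightarrow> lateral_cutoff \<rho> x = 0"
  unfolding lateral_cutoff_def using finite_B by (intro prod_zero bexI[of _ b] plateau_eq_0) auto

lemma lateral_cutoff_grad_le:
  assumes "\<And>b. b \<in> B \<Longrightarrow> norm (grad_fn (plateau 2 \<rho> b) x) \<le> K"
  shows "norm (grad_fn (lateral_cutoff \<rho>) x) \<le> real (card B) * K"
  unfolding lateral_cutoff_def[abs_def]
proof (rule grad_fn_prod_bound[OF finite_B smooth_fn_plateau _ assms])
  show "\<bar>plateau 2 \<rho> b x\<bar> \<le> 1" for b using plateau_bounds[of 2 \<rho> b x] by simp
qed

lemma lateral_cutoff_grad_eq_0: "x \<in> prism 0 \<rho> \<Longrightarrow> grad_fn (lateral_cutoff \<rho>) x = 0"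
  using lateral_cutoff_grad_le[of \<rho> x 0] by (simp add: cylinder_def plateau_grad_eq_0)

lemma lateral_cutoff_grad_bound: "\<exists>L\<ge>0. \<forall>\<rho> x. norm (grad_fn (lateral_cutoff \<rho>) x) \<le> L"
proof -
  obtain L where L: "\<And>t. \<bar>deriv smooth_step t\<bar> \<le> L" using smooth_step_deriv_bound by blast
  have "0 \<le> L" using L[of 0] by simp
  moreover have "norm (grad_fn (lateral_cutoff \<rho>) x) \<le> real (card B) * (2 * 2 * L)" for \<rho> x
    by (intro lateral_cutoff_grad_le plateau_grad_bound[OF L] B_norm) simp
  ultimately show ?thesis by (intro exI[of _ "real (card B) * (2 * 2 * L)"]) auto
qed

text \<open>Convex combinations of \<open>q\<close> and its translate need not have finite potential energy; bending
  the argument of \<open>q\<close> by \<open>s * lateral_cutoff \<rho> x\<close> does not change the integral over lines parallel to \<open>e\<close>.\<close>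

definition bent_height :: "real \<Rightarrow> real \<Rightarrow> 'd \<Rightarrow> real" where
  "bent_height s \<rho> x = x \<bullet> e + s * lateral_cutoff \<rho> x"

abbreviation bent_profile :: "real \<Rightarrow> real \<Rightarrow> 'd \<Rightarrow> real" where
  "bent_profile s \<rho> x \<equiv> q (bent_height s \<rho> x)"

lemma bent_height_smooth: "smooth_fn (bent_height s \<rho>)"
  unfolding bent_height_def[abs_def]
  by (intro smooth_fn_add smooth_fn_inner smooth_fn_mult smooth_fn_const lateral_cutoff_smooth)

lemma bent_profile_smooth: "smooth_fn (bent_profile s \<rho>)"
  by (rule smooth_fn_comp[OF q_smooth bent_height_smooth])

lemma bent_height_measurable [measurable]: "bent_height s \<rho> \<in> borel_measurable borel"
  by (rule smooth_fn_borel_measurable[OF bent_height_smooth])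

lemma bent_height_0: "bent_height 0 \<rho> x = x \<bullet> e"
  by (simp add: bent_height_def)

lemma bent_profile_grad:
  "grad_fn (bent_profile s \<rho>) x = deriv q (bent_height s \<rho> x) *\<^sub>R (e + s *\<^sub>R grad_fn (lateral_cutoff \<rho>) x)"
proof -
  have "(bent_height s \<rho> has_derivative (\<bullet>) (e + s *\<^sub>R grad_fn (lateral_cutoff \<rho>) x)) (at x)"
    unfolding bent_height_def[abs_def]
    using smooth_fn_has_derivative_grad[OF lateral_cutoff_smooth, of \<rho> x]
    by (auto intro!: derivative_eq_intros simp: inner_add_left inner_add_right inner_commute fun_eq_iff)
  then show ?thesis by (simp add: grad_fn_comp[OF q_smooth bent_height_smooth] grad_fn_eqI)
qed

lemma bent_profile_grad_sq_le:
  "\<exists>C\<ge>1. \<forall>\<rho> x. (norm (grad_fn (bent_profile s \<rho>) x))\<^sup>2 \<le> C * (deriv q (bent_height s \<rho> x))\<^sup>2"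
proof -
  obtain L where L: "0 \<le> L" "\<And>\<rho> x. norm (grad_fn (lateral_cutoff \<rho>) x) \<le> L"
    using lateral_cutoff_grad_bound by blast
  show ?thesis
  proof (intro exI[of _ "(1 + \<bar>s\<bar> * L)\<^sup>2"] conjI allI)
    show "1 \<le> (1 + \<bar>s\<bar> * L)\<^sup>2" using L(1) by (simp add: one_le_power)
    fix \<rho> x
    have "norm (e + s *\<^sub>R grad_fn (lateral_cutoff \<rho>) x) \<le> 1 + \<bar>s\<bar> * L"
      using norm_triangle_ineq[of e "s *\<^sub>R grad_fn (lateral_cutoff \<rho>) x"] norm_e mult_left_mono[OF L(2)[of \<rho> x], of "\<bar>s\<bar>"] by simp
    then have "(norm (e + s *\<^sub>R grad_fn (lateral_cutoff \<rho>) x))\<^sup>2 \<le> (1 + \<bar>s\<bar> * L)\<^sup>2"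
      by (intro power_mono) auto
    from mult_right_mono[OF this, of "(deriv q (bent_height s \<rho> x))\<^sup>2"]
    show "(norm (grad_fn (bent_profile s \<rho>) x))\<^sup>2 \<le> (1 + \<bar>s\<bar> * L)\<^sup>2 * (deriv q (bent_height s \<rho> x))\<^sup>2"
      unfolding bent_profile_grad norm_scaleR power_mult_distrib by (simp add: mult.commute)
  qed
qed

lemma nn_integral_bent_height:
  assumes [measurable]: "F \<in> borel_measurable borel" "U \<in> sets borel" and U: "\<And>x t. x + t *\<^sub>R e \<in> U \<longleftrightarrow> x \<in> U"
  shows "(\<integral>\<^sup>+x. indicator U x * F (bent_height s \<rho> x) \<partial>lborel) = cross_volume U * (\<integral>\<^sup>+t. F t \<partial>lborel)"
  unfolding bent_height_def
  by (rule nn_integral_eq_cross_volume_mult[where g="\<lambda>x. s * lateral_cutoff \<rho> x"]) (auto simp: lateral_cutoff_translate_e U)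

lemma bent_profile_diff_sq_le:
  "(\<integral>\<^sup>+x. indicator (prism 0 \<rho>') x * ennreal ((bent_profile s \<rho> x - qe x)\<^sup>2) \<partial>lborel)
    \<le> ennreal (s\<^sup>2) * (cross_volume (prism 0 \<rho>') * (\<integral>\<^sup>+t. ennreal ((deriv q t)\<^sup>2) \<partial>lborel))"
proof -
  let ?D = "prism 0 \<rho>'" and ?i = "indicator {0..1} :: real \<Rightarrow> ennreal"
  let ?f = "\<lambda>r x. ennreal (s\<^sup>2) * (?i r * (indicator ?D x * ennreal ((deriv q (bent_height (s * r) \<rho> x))\<^sup>2)))"
  have "(\<integral>\<^sup>+x. indicator ?D x * ennreal ((bent_profile s \<rho> x - qe x)\<^sup>2) \<partial>lborel)
    \<le> (\<integral>\<^sup>+x. (\<integral>\<^sup>+r. ?f r x \<partial>lborel) \<partial>lborel)"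
  proof (rule nn_integral_mono)
    fix x
    let ?\<sigma> = "s * lateral_cutoff \<rho> x"
    have "(?\<sigma> * deriv q (x \<bullet> e + ?\<sigma> * r))\<^sup>2 \<le> s\<^sup>2 * (deriv q (bent_height (s * r) \<rho> x))\<^sup>2" for r
    proof -
      have "(lateral_cutoff \<rho> x)\<^sup>2 \<le> 1"
        using lateral_cutoff_bounds[of \<rho> x] by (simp add: power_le_one)
      then have "?\<sigma>\<^sup>2 \<le> s\<^sup>2" by (simp add: power_mult_distrib mult_left_le)
      then have "?\<sigma>\<^sup>2 * (deriv q (bent_height (s * r) \<rho> x))\<^sup>2
        \<le> s\<^sup>2 * (deriv q (bent_height (s * r) \<rho> x))\<^sup>2" by (rule mult_right_mono) simp
      moreover have "x \<bullet> e + ?\<sigma> * r = bent_height (s * r) \<rho> x" by (simp add: bent_height_def)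
      ultimately show ?thesis by (simp only: power_mult_distrib[of ?\<sigma>])
    qed
    then have "indicator ?D x * (ennreal ((?\<sigma> * deriv q (x \<bullet> e + ?\<sigma> * r))\<^sup>2) * ?i r) \<le> ?f r x" for r
      by (auto simp: indicator_def ennreal_leI simp flip: ennreal_mult)
    moreover have "indicator ?D x * ennreal ((bent_profile s \<rho> x - qe x)\<^sup>2)
        \<le> indicator ?D x * (\<integral>\<^sup>+r. ennreal ((?\<sigma> * deriv q (x \<bullet> e + ?\<sigma> * r))\<^sup>2) * ?i r \<partial>lborel)"
      unfolding bent_height_def by (intro mult_left_mono q_increment_sq_le) simp
    ultimately show "indicator ?D x * ennreal ((bent_profile s \<rho> x - qe x)\<^sup>2) \<le> (\<integral>\<^sup>+r. ?f r x \<partial>lborel)"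
      by (subst (asm) nn_integral_cmult[symmetric]) (measurable, erule order_trans, intro nn_integral_mono)
  qed
  also have "\<dots> = (\<integral>\<^sup>+r. (\<integral>\<^sup>+x. ?f r x \<partial>lborel) \<partial>lborel)"
    unfolding bent_height_def by (rule lborel_pair.Fubini'[symmetric]) measurable
  also have "\<dots> = (\<integral>\<^sup>+r. ennreal (s\<^sup>2) * (cross_volume ?D * (\<integral>\<^sup>+t. ennreal ((deriv q t)\<^sup>2) \<partial>lborel)) * ?i r \<partial>lborel)"
    by (intro nn_integral_cong)
        (simp add: nn_integral_cmult nn_integral_bent_height[where F="\<lambda>t. ennreal ((deriv q t)\<^sup>2)"] prism_translate_e ac_simps)
  also have "\<dots> = ennreal (s\<^sup>2) * (cross_volume ?D * (\<integral>\<^sup>+t. ennreal ((deriv q t)\<^sup>2) \<partial>lborel))"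
    by (simp add: nn_integral_cmult_indicator)
  finally show ?thesis .
qed

lemma bent_profile_diff_grad:
  "grad_fn (\<lambda>x. bent_profile s \<rho> x - qe x) x = grad_fn (bent_profile s \<rho>) x - dqe x *\<^sub>R e"
  using has_derivative_diff[OF smooth_fn_has_derivative_grad[OF bent_profile_smooth[of s \<rho>], of x] smooth_fn_has_derivative_grad[OF qe_smooth, of x]]
  by (intro grad_fn_eqI) (simp add: qe_grad inner_diff_left)

lemma bent_profile_diff_H1_norm_sq_finite:
  "H1_norm_sq (prism 0 \<rho>') (\<lambda>x. bent_profile s \<rho> x - qe x) (grad_fn (\<lambda>x. bent_profile s \<rho> x - qe x)) < \<infinity>"
proof -
  let ?D = "prism 0 \<rho>'" and ?p = "\<lambda>x. bent_profile s \<rho> x - qe x"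
    and ?f = "\<lambda>r x. indicator (prism 0 \<rho>') x * ennreal ((deriv q (bent_height r \<rho> x))\<^sup>2)"
  let ?Q = "cross_volume ?D * (\<integral>\<^sup>+t. ennreal ((deriv q t)\<^sup>2) \<partial>lborel)"
  obtain C where C: "1 \<le> C" "\<And>x. (norm (grad_fn (bent_profile s \<rho>) x))\<^sup>2
    \<le> C * (deriv q (bent_height s \<rho> x))\<^sup>2"
    using bent_profile_grad_sq_le by blast
  have [measurable]: "?p \<in> borel_measurable borel" by measurable
  have Q: "?Q < \<infinity>"
    using cross_volume_prism_finite q_deriv_sq_finite by (simp add: ennreal_mult_less_top)
  have f: "(\<integral>\<^sup>+x. ?f r x \<partial>lborel) = ?Q" for r
    by (rule nn_integral_bent_height) (auto simp: prism_translate_e)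
  have "ennreal (indicator ?D x * ((?p x)\<^sup>2 + (norm (grad_fn ?p x))\<^sup>2))
      \<le> indicator ?D x * ennreal ((?p x)\<^sup>2) + (ennreal (2 * C) * ?f s x + 2 * ?f 0 x)" for x
  proof (cases "x \<in> ?D")
    case True
    have "(norm (grad_fn ?p x))\<^sup>2 \<le> 2 * (norm (grad_fn (bent_profile s \<rho>) x))\<^sup>2
      + 2 * (norm (- dqe x *\<^sub>R e))\<^sup>2"
      using norm_sq_add_le[of "grad_fn (bent_profile s \<rho>) x" "- dqe x *\<^sub>R e"]
      by (simp add: bent_profile_diff_grad)
    also have "\<dots> \<le> 2 * C * (deriv q (bent_height s \<rho> x))\<^sup>2 + 2 * (deriv q (bent_height 0 \<rho> x))\<^sup>2"
      using C(2)[of x] norm_e by (simp add: bent_height_0)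
    finally have "ennreal ((?p x)\<^sup>2 + (norm (grad_fn ?p x))\<^sup>2)
        \<le> ennreal ((?p x)\<^sup>2 + (2 * C * (deriv q (bent_height s \<rho> x))\<^sup>2 + 2 * (deriv q (bent_height 0 \<rho> x))\<^sup>2))"
      by (intro ennreal_leI add_left_mono)
    then show ?thesis using True C(1) by (simp add: ennreal_mult')
  qed simp
  then have "H1_norm_sq ?D ?p (grad_fn ?p) \<le> (\<integral>\<^sup>+x. indicator ?D x * ennreal ((?p x)\<^sup>2) + (ennreal (2 * C) * ?f s x + 2 * ?f 0 x) \<partial>lborel)"
    unfolding H1_norm_sq_def nn_integral_completion by (intro nn_integral_mono)
  also have "\<dots> = (\<integral>\<^sup>+x. indicator ?D x * ennreal ((?p x)\<^sup>2) \<partial>lborel) + (ennreal (2 * C) * ?Q + 2 * ?Q)"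
    by (simp add: nn_integral_add nn_integral_cmult f)
  also have "\<dots> \<le> ennreal (s\<^sup>2) * ?Q + (ennreal (2 * C) * ?Q + 2 * ?Q)"
    by (intro add_right_mono bent_profile_diff_sq_le)
  also have "\<dots> < \<infinity>" using Q by (simp add: ennreal_mult_less_top)
  finally show ?thesis .
qed

lemma bent_profile_diff_test_fn:
  "test_fn (prism 0 (\<rho> + 1)) (\<lambda>x. plateau 1 (real n) e x * (bent_profile s \<rho> x - qe x))"
proof (rule test_fnI)
  let ?K = "{x. \<bar>x \<bullet> e\<bar> \<le> real n + 1} \<inter> (\<Inter>b\<in>B. {x. \<bar>x \<bullet> b\<bar> \<le> \<rho> + 1 / 2})"
  show "smooth_fn (\<lambda>x. plateau 1 (real n) e x * (bent_profile s \<rho> x - qe x))"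
    by (intro smooth_fn_mult smooth_fn_plateau smooth_fn_diff bent_profile_smooth qe_smooth)
  have "closed ?K" by (intro closed_Int closed_INT ballI closed_Collect_le continuous_intros)
  moreover have "?K \<subseteq> cylinder 0 (\<rho> + 1) {- (real n + 2)<..<real n + 2}"
    by (auto simp: cylinder_def abs_le_iff) (force simp: abs_le_iff)+
  then have "bounded ?K" by (rule bounded_subset[OF bounded_cylinder, rotated]) simp
  ultimately show "compact ?K" by (simp add: compact_eq_bounded_closed)
  show "?K \<subseteq> prism 0 (\<rho> + 1)" by (force simp: cylinder_def)
  show "plateau 1 (real n) e x * (bent_profile s \<rho> x - qe x) = 0" if x: "x \<notin> ?K" for x
  proof (cases "\<bar>x \<bullet> e\<bar> \<le> real n + 1")
    case True
    then obtain b where "b \<in> B" "\<rho> + 1 / 2 < \<bar>x \<bullet> b\<bar>" using x by (auto simp: not_le)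
    then have "lateral_cutoff \<rho> x = 0" by (intro lateral_cutoff_eq_0) auto
    then show ?thesis by (simp add: bent_height_def)
  next
    case False
    then have "plateau 1 (real n) e x = 0" by (intro plateau_eq_0) auto
    then show ?thesis by simp
  qed
qed

lemma bent_profile_diff_H10:
  "H10 (prism 0 (\<rho> + 1)) (\<lambda>x. bent_profile s \<rho> x - qe x) (grad_fn (\<lambda>x. bent_profile s \<rho> x - qe x))"
proof -
  obtain L where L: "\<And>t. \<bar>deriv smooth_step t\<bar> \<le> L" using smooth_step_deriv_bound by blast
  show ?thesis
  proof (rule H10_smooth[where \<eta>="\<lambda>n. plateau 1 (real n) e" and L="2 * 1 * L"])
    show "open (prism 0 (\<rho> + 1))" by (rule open_cylinder) simp
    show "\<bar>plateau 1 (real n) e x\<bar> \<le> 1" for n x using plateau_bounds[of 1 "real n" e x] by simp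
    show "norm (grad_fn (plateau 1 (real n) e) x) \<le> 2 * 1 * L" for n x
      by (rule plateau_grad_bound[OF L _ norm_e]) simp
    show "\<forall>\<^sub>F n in sequentially. plateau 1 (real n) e x = 1 \<and> grad_fn (plateau 1 (real n) e) x = 0"
      for x
      using filterlim_at_top_dense[THEN iffD1, OF filterlim_real_sequentially, rule_format, of "\<bar>x \<bullet> e\<bar>"]
      by eventually_elim (simp add: plateau_eq_1 plateau_grad_eq_0)
  qed (intro smooth_fn_diff bent_profile_smooth qe_smooth bent_profile_diff_H1_norm_sq_finite smooth_fn_plateau bent_profile_diff_test_fn)+
qed

definition bent_competitor :: "real \<Rightarrow> real \<Rightarrow> ('d \<Rightarrow> real) \<Rightarrow> 'd \<Rightarrow> real" where
  "bent_competitor s \<rho> w x = (bent_profile s \<rho> x - qe x) + indicator (prism 0 \<rho>) x * w (x + s *\<^sub>R e)"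

definition bent_competitor_grad :: "real \<Rightarrow> real \<Rightarrow> ('d \<Rightarrow> 'd) \<Rightarrow> 'd \<Rightarrow> 'd" where
  "bent_competitor_grad s \<rho> G x =
      grad_fn (\<lambda>x. bent_profile s \<rho> x - qe x) x + indicator (prism 0 \<rho>) x *\<^sub>R G (x + s *\<^sub>R e)"

lemma bent_competitor_inside:
  assumes "x \<in> prism 0 \<rho>"
  shows "qe x + bent_competitor s \<rho> w x = qe (x + s *\<^sub>R e) + w (x + s *\<^sub>R e)"
    "dqe x *\<^sub>R e + bent_competitor_grad s \<rho> G x = dqe (x + s *\<^sub>R e) *\<^sub>R e + G (x + s *\<^sub>R e)"
proof -
  have "bent_height s \<rho> x = (x + s *\<^sub>R e) \<bullet> e"
    using lateral_cutoff_eq_1[OF assms] by (simp add: bent_height_def inner_add_left)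
  then show "qe x + bent_competitor s \<rho> w x = qe (x + s *\<^sub>R e) + w (x + s *\<^sub>R e)"
    "dqe x *\<^sub>R e + bent_competitor_grad s \<rho> G x = dqe (x + s *\<^sub>R e) *\<^sub>R e + G (x + s *\<^sub>R e)"
    using assms lateral_cutoff_grad_eq_0[OF assms]
    by (simp_all add: bent_competitor_def bent_competitor_grad_def bent_profile_diff_grad bent_profile_grad)
qed

lemma bent_competitor_outside:
  assumes "x \<notin> prism 0 \<rho>"
  shows "qe x + bent_competitor s \<rho> w x = bent_profile s \<rho> x"
    "dqe x *\<^sub>R e + bent_competitor_grad s \<rho> G x = grad_fn (bent_profile s \<rho>) x"
  using assms by (simp_all add: bent_competitor_def bent_competitor_grad_def bent_profile_diff_grad)

lemma competitors_bent:
  assumes wG: "(w, G) \<in> competitors (prism 0 \<rho>)"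
  shows "(bent_competitor s \<rho> w, bent_competitor_grad s \<rho> G) \<in> competitors (prism 0 (\<rho> + 1))"
proof -
  let ?D = "prism 0 \<rho>" and ?D' = "prism 0 (\<rho> + 1)"
  have D: "open ?D" "open ?D'" by (rule open_cylinder, simp)+
  have sub: "?D \<subseteq> ?D'" by (rule cylinder_subset) auto
  have "H10 ?D (\<lambda>x. w (x + s *\<^sub>R e)) (\<lambda>x. G (x + s *\<^sub>R e))"
    using H10_translate[OF D(1) competitorsD(1)[OF wG], of "s *\<^sub>R e"]
    by (simp add: prism_translate_e)
  then have "H10 ?D' (\<lambda>x. indicator ?D x * w (x + s *\<^sub>R e)) (\<lambda>x. indicator ?D x *\<^sub>R G (x + s *\<^sub>R e))"
    by (rule H10_extend[OF D(2,1) sub])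
  then have "H10 ?D' (bent_competitor s \<rho> w) (bent_competitor_grad s \<rho> G)"
    unfolding bent_competitor_def[abs_def] bent_competitor_grad_def[abs_def]
    by (rule H10_add[OF D(2) bent_profile_diff_H10])
  moreover have "qe x + bent_competitor s \<rho> w x \<in> {-1..1}" for x
  proof (cases "x \<in> ?D")
    case True
    then have "x + s *\<^sub>R e \<in> ?D" by (simp only: prism_translate_e)
    from competitorsD(3)[OF wG this] show ?thesis by (simp only: bent_competitor_inside(1)[OF True])
  next
    case False
    then show ?thesis using q_range by (simp add: bent_competitor_outside(1))
  qed
  ultimately show ?thesis by (simp add: competitors_def)
qed

lemma energy_density_bent_le:
  "\<exists>C\<ge>0. \<forall>\<omega>\<in>space M. \<forall>\<rho> w G x. energy_density (\<tau> (s *\<^sub>R e) \<omega>) (prism 0 (\<rho> + 1)) (bent_competitor s \<rho> w) (bent_competitor_grad s \<rho> G) x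
      \<le> energy_density \<omega> (prism 0 \<rho>) w G (x + s *\<^sub>R e)
        + C * (indicator (prism 0 (\<rho> + 1) - prism 0 \<rho>) x * profile_density (bent_height s \<rho> x))"
proof -
  obtain C where C: "1 \<le> C" "\<And>\<rho> x. (norm (grad_fn (bent_profile s \<rho>) x))\<^sup>2
    \<le> C * (deriv q (bent_height s \<rho> x))\<^sup>2"
    using bent_profile_grad_sq_le by blast
  show ?thesis
  proof (intro exI[of _ C] conjI ballI allI)
    fix \<omega> \<rho> w G x assume \<omega>: "\<omega> \<in> space M"
    let ?D = "prism 0 \<rho>" and ?D' = "prism 0 (\<rho> + 1)" and ?t = "bent_height s \<rho> x"
      and ?f = "energy_density (\<tau> (s *\<^sub>R e) \<omega>) (prism 0 (\<rho> + 1)) (bent_competitor s \<rho> w) (bent_competitor_grad s \<rho> G) x"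
    have sub: "?D \<subseteq> ?D'" by (rule cylinder_subset) auto
    have shift: "x + s *\<^sub>R e \<in> ?D \<longleftrightarrow> x \<in> ?D" by (rule prism_translate_e)
    consider (inside) "x \<in> ?D" "x \<in> ?D'" | (ring) "x \<in> ?D'" "x \<notin> ?D" | (outside) "x \<notin> ?D'" "x \<notin> ?D"
      using sub by blast
    then show "?f \<le> energy_density \<omega> ?D w G (x + s *\<^sub>R e) + C * (indicator (?D' - ?D) x * profile_density ?t)"
    proof cases
      case inside
      then show ?thesis
        using tau_add[OF \<omega>, of x "s *\<^sub>R e"] shift
        by (simp add: energy_density_def bent_competitor_inside)
    next
      case ring
      have "?f = 1 / 2 * (\<Phi> (\<tau> x (\<tau> (s *\<^sub>R e) \<omega>)) (grad_fn (bent_profile s \<rho>) x))\<^sup>2 + W (q ?t)"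
        using ring by (simp add: energy_density_def bent_competitor_outside)
      also have "\<dots> \<le> 1 / 2 * (Lam * (C * (deriv q ?t)\<^sup>2)) + 1 * W_ext (q ?t)"
        using order_trans[OF Phi_sq_le[OF tau_space[OF \<omega>]] mult_left_mono[OF C(2)]] Lam_pos q_range[of ?t] by (simp add: W_ext_eq)
      also have "\<dots> \<le> 1 / 2 * (Lam * (C * (deriv q ?t)\<^sup>2)) + C * W_ext (q ?t)"
        using C(1) W_ext_nonneg by (intro add_left_mono mult_right_mono)
      also have "\<dots> = C * profile_density ?t" by (simp add: profile_density_def algebra_simps)
      finally show ?thesis using ring shift by (simp add: energy_density_def[of \<omega> ?D])
    next
      case outside
      then show ?thesis using shift by (simp add: energy_density_def)
    qed
  qed (use C(1) in simp)
qed

lemma nn_integral_profile_density_bent: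
  "(\<integral>\<^sup>+x. indicator (prism 0 (\<rho> + 1) - prism 0 \<rho>) x * ennreal (profile_density (bent_height s \<rho> x)) \<partial>lebesgue)
      = emeasure profile_measure (prism 0 (\<rho> + 1) - prism 0 \<rho>)"
  using nn_integral_bent_height[of "\<lambda>t. ennreal (profile_density t)" "prism 0 (\<rho> + 1) - prism 0 \<rho>" s \<rho>]
    nn_integral_bent_height[of "\<lambda>t. ennreal (profile_density t)" "prism 0 (\<rho> + 1) - prism 0 \<rho>" 0 \<rho>]
  by (simp add: prism_translate_e bent_height_0 emeasure_profile_measure nn_integral_completion mult.commute)

lemma min_energy_translate_e_le:
  "\<exists>C\<ge>0. \<forall>\<omega>\<in>space M. \<forall>\<rho>. min_energy (\<tau> (s *\<^sub>R e) \<omega>) (prism 0 (\<rho> + 1))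
      \<le> min_energy \<omega> (prism 0 \<rho>) + ennreal C * emeasure profile_measure (prism 0 (\<rho> + 1) - prism 0 \<rho>)"
proof -
  obtain C where C: "0 \<le> C" and density_le: "\<And>\<omega> \<rho> w G x. \<omega> \<in> space M \<Longrightarrow>
      energy_density (\<tau> (s *\<^sub>R e) \<omega>) (prism 0 (\<rho> + 1)) (bent_competitor s \<rho> w) (bent_competitor_grad s \<rho> G) x
      \<le> energy_density \<omega> (prism 0 \<rho>) w G (x + s *\<^sub>R e)
        + C * (indicator (prism 0 (\<rho> + 1) - prism 0 \<rho>) x * profile_density (bent_height s \<rho> x))"
    using energy_density_bent_le by blast
  show ?thesis
  proof (intro exI[of _ C] conjI ballI allI C)
    fix \<omega> \<rho> assume \<omega>: "\<omega> \<in> space M"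
    let ?D = "prism 0 \<rho>" and ?D' = "prism 0 (\<rho> + 1)" and ?\<omega> = "\<tau> (s *\<^sub>R e) \<omega>"
    let ?ring = "\<lambda>x. indicator (?D' - ?D) x * ennreal (profile_density (bent_height s \<rho> x))"
    have D: "open ?D" by (rule open_cylinder) simp
    have ring: "?ring \<in> borel_measurable lebesgue" by (rule measurable_completion) measurable
    have "min_energy ?\<omega> ?D' \<le> competitor_energy \<omega> ?D w G + ennreal C * emeasure profile_measure (?D' - ?D)"
      if wG: "(w, G) \<in> competitors ?D" for w G
    proof -
      let ?f = "\<lambda>x. ennreal (energy_density \<omega> ?D w G x)"
      have f: "?f \<in> borel_measurable lebesgue"
        using energy_density_measurable[OF \<omega> D wG] by measurable
      have "min_energy ?\<omega> ?D' \<le> competitor_energy ?\<omega> ?D' (bent_competitor s \<rho> w) (bent_competitor_grad s \<rho> G)"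
        by (rule min_energy_le[OF competitors_bent[OF wG]])
      also have "\<dots> \<le> (\<integral>\<^sup>+x. ?f (x + s *\<^sub>R e) + ennreal C * ?ring x \<partial>lebesgue)"
        unfolding competitor_energy_def
      proof (rule nn_integral_mono)
        fix x
        have "ennreal C * ?ring x = ennreal (C * (indicator (?D' - ?D) x * profile_density (bent_height s \<rho> x)))"
          using C by (simp add: indicator_def ennreal_mult')
        then show "ennreal (energy_density ?\<omega> ?D' (bent_competitor s \<rho> w) (bent_competitor_grad s \<rho> G) x)
            \<le> ?f (x + s *\<^sub>R e) + ennreal C * ?ring x"
          using order_trans[OF ennreal_leI[OF density_le[OF \<omega>]] ennreal_add_le] by simp
      qed
      also have "\<dots> = (\<integral>\<^sup>+x. ?f (x + s *\<^sub>R e) \<partial>lebesgue) + ennreal C * (\<integral>\<^sup>+x. ?ring x \<partial>lebesgue)"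
        by (simp only: nn_integral_add[OF measurable_compose[OF lebesgue_translate(1) f] borel_measurable_times_ennreal[OF borel_measurable_const ring]]
            nn_integral_cmult[OF ring])
      also have "(\<integral>\<^sup>+x. ?f (x + s *\<^sub>R e) \<partial>lebesgue) = competitor_energy \<omega> ?D w G"
        unfolding competitor_energy_def by (rule nn_integral_lebesgue_translate[OF f])
      finally show ?thesis unfolding nn_integral_profile_density_bent .
    qed
    then show "min_energy ?\<omega> ?D' \<le> min_energy \<omega> ?D + ennreal C * emeasure profile_measure (?D' - ?D)"
      by (rule min_energy_add_geI)
  qed
qed

end
section \<open>Measurability of the minimal energy\<close>

text \<open>A countable family of step functions, indexed by a mesh \<open>k\<close> and a list of values: the value at
  \<open>x\<close> is selected by the first point of a fixed dense sequence at distance less than \<open>1 / (k + 1)\<close>.\<close>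

definition dense_seq :: "nat \<Rightarrow> 'a::second_countable_topology" where
  "dense_seq = (SOME c. \<forall>U. open U \<and> U \<noteq> {} \<longrightarrow> (\<exists>i. c i \<in> U))"

lemma dense_seq_in_open:
  fixes U :: "'a::second_countable_topology set"
  assumes "open U" "U \<noteq> {}"
  obtains i where "dense_seq i \<in> U"
proof -
  obtain C :: "'a set" where C: "countable C" "\<And>U. open U \<Longrightarrow> U \<noteq> {} \<Longrightarrow> \<exists>d\<in>C. d \<in> U"
    using countable_dense_exists by blast
  have "\<forall>V. open V \<and> V \<noteq> {} \<longrightarrow> (\<exists>i. from_nat_into C i \<in> V)"
  proof (intro allI impI)
    fix V :: "'a set" assume "open V \<and> V \<noteq> {}"
    then obtain d where "d \<in> C" "d \<in> V" using C(2) by blast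
    then show "\<exists>i. from_nat_into C i \<in> V" using from_nat_into_surj[OF C(1)] by metis
  qed
  from someI[of "\<lambda>c. \<forall>V. open V \<and> V \<noteq> {} \<longrightarrow> (\<exists>i. c i \<in> V)", OF this]
  have "\<forall>V. open V \<and> V \<noteq> {} \<longrightarrow> (\<exists>i. dense_seq i \<in> (V :: 'a set))" unfolding dense_seq_def .
  from spec[OF this, of U] show thesis using assms that by (elim impE exE) simp_all
qed

definition cell_index :: "nat \<Rightarrow> 'a::euclidean_space \<Rightarrow> nat" where
  "cell_index k x = (LEAST i. dist x (dense_seq i) < 1 / real (Suc k))"

definition step_fn :: "nat \<times> nat list \<Rightarrow> 'a::euclidean_space \<Rightarrow> 'b::second_countable_topology" where
  "step_fn p x = dense_seq (if cell_index (fst p) x < length (snd p) then snd p ! cell_index (fst p) x else 0)"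

lemma cell_index_dist: "dist x (dense_seq (cell_index k x)) < 1 / real (Suc k)"
proof -
  obtain i where "dense_seq i \<in> ball x (1 / real (Suc k))"
    by (rule dense_seq_in_open[of "ball x (1 / real (Suc k))"]) auto
  then have "dist x (dense_seq i) < 1 / real (Suc k)" by simp
  then show ?thesis unfolding cell_index_def by (rule LeastI)
qed

lemma cell_index_bounded:
  assumes "bounded D"
  obtains m where "\<And>x. x \<in> D \<Longrightarrow> cell_index k x < m"
proof -
  have compact: "compact (closure D)" using assms by (simp add: compact_closure)
  have cover: "closure D \<subseteq> (\<Union>i\<in>UNIV. ball (dense_seq i) (1 / real (Suc k)))"
    using cell_index_dist by (force simp: dist_commute)
  obtain I where I: "I \<subseteq> UNIV" "finite I" "closure D \<subseteq> (\<Union>i\<in>I. ball (dense_seq i) (1 / real (Suc k)))"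
    by (rule compactE_image[OF compact _ cover]) auto
  obtain m where m: "\<And>i. i \<in> I \<Longrightarrow> i < m" using I(2) by (meson finite_nat_set_iff_bounded)
  have "cell_index k x < m" if "x \<in> D" for x
  proof -
    have "x \<in> closure D" using that closure_subset by blast
    then obtain i where i: "i \<in> I" "dist x (dense_seq i) < 1 / real (Suc k)"
      using I(3) by (auto simp: dist_commute)
    then have "cell_index k x \<le> i" unfolding cell_index_def by (intro Least_le)
    then show ?thesis using m[OF i(1)] by simp
  qed
  then show thesis by (rule that)
qed

lemma step_fn_measurable [measurable]: "step_fn p \<in> borel_measurable borel"
proof -
  have "cell_index k \<in> borel \<rightarrow>\<^sub>M count_space UNIV" for k :: nat
    unfolding cell_index_def[abs_def] by measurable
  from measurable_compose[OF this, of "\<lambda>i. dense_seq (if i < length (snd p) then snd p ! i else 0)" borel "fst p"]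
  show ?thesis unfolding step_fn_def[abs_def] by simp
qed

lemma step_fn_uniform_approx:
  fixes F :: "'a::euclidean_space \<Rightarrow> 'b::{metric_space, second_countable_topology}"
  assumes cont: "continuous_on UNIV F" and D: "bounded D" and \<epsilon>: "0 < \<epsilon>"
  obtains p where "\<And>x. x \<in> D \<Longrightarrow> dist (F x) (step_fn p x) < \<epsilon>"
proof -
  obtain R where R: "\<And>x. x \<in> D \<Longrightarrow> norm x \<le> R" using D unfolding bounded_iff by blast
  let ?K = "cball (0::'a) (R + 1)"
  have "uniformly_continuous_on ?K F"
    using cont by (intro compact_uniformly_continuous) (auto intro: continuous_on_subset)
  then obtain d where d: "0 < d" "\<And>x y. x \<in> ?K \<Longrightarrow> y \<in> ?K \<Longrightarrow> dist y x < d \<Longrightarrow> dist (F y) (F x) < \<epsilon> / 2"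
    using half_gt_zero[OF \<epsilon>] unfolding uniformly_continuous_on_def by blast
  obtain k where k: "1 / real (Suc k) < min d 1"
    using d(1) reals_Archimedean[of "min d 1"] by (auto simp: inverse_eq_divide)
  obtain m where m: "\<And>x. x \<in> D \<Longrightarrow> cell_index k x < m" using cell_index_bounded[OF D] by blast
  have "\<exists>j. dist (F (dense_seq i)) (dense_seq j) < \<epsilon> / 2" for i
  proof -
    obtain j where "dense_seq j \<in> ball (F (dense_seq i)) (\<epsilon> / 2)"
      by (rule dense_seq_in_open[of "ball (F (dense_seq i)) (\<epsilon> / 2)"]) (use \<epsilon> in auto)
    then show ?thesis by auto
  qed
  then obtain J where J: "\<And>i. dist (F (dense_seq i)) (dense_seq (J i)) < \<epsilon> / 2" by metis
  have "dist (F x) (step_fn (k, map J [0..<m]) x) < \<epsilon>" if x: "x \<in> D" for x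
  proof -
    let ?y = "dense_seq (cell_index k x) :: 'a"
    have step: "step_fn (k, map J [0..<m]) x = dense_seq (J (cell_index k x))"
      using m[OF x] by (simp add: step_fn_def)
    have y: "dist ?y x < d" "dist x ?y < 1"
      using cell_index_dist[of x k] k unfolding min_less_iff_conj dist_commute[of ?y] by linarith+
    have "norm ?y \<le> norm x + dist x ?y"
      using norm_triangle_ineq4[of x "x - ?y"] by (simp add: dist_norm)
    then have "dist (F ?y) (F x) < \<epsilon> / 2" using R[OF x] y by (intro d(2)) auto
    then show ?thesis unfolding step using J by (rule dist_triangle_half_r)
  qed
  then show thesis by (rule that)
qed

abbreviation step_value :: "nat \<times> nat list \<Rightarrow> 'a::euclidean_space \<Rightarrow> real" where
  "step_value p x \<equiv> fst (step_fn p x :: real \<times> 'a)"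

abbreviation step_slope :: "nat \<times> nat list \<Rightarrow> 'a::euclidean_space \<Rightarrow> 'a" where
  "step_slope p x \<equiv> snd (step_fn p x :: real \<times> 'a)"

lemma H1_measurable_step_fn: "D \<in> sets lebesgue \<Longrightarrow> H1_measurable D (\<lambda>x. step_value p x) (\<lambda>x. step_slope p x)"
proof -
  assume [measurable]: "D \<in> sets lebesgue"
  have [measurable]: "(\<lambda>x. step_value p x) \<in> borel_measurable lebesgue" "(\<lambda>x. step_slope p x) \<in> borel_measurable lebesgue"
    using measurable_compose[OF step_fn_measurable[of p] borel_measurable_continuous_onI[of fst]]
      measurable_compose[OF step_fn_measurable[of p] borel_measurable_continuous_onI[of snd]]
    by (auto intro!: measurable_completion simp: continuous_on_fst continuous_on_snd continuous_on_id)
  show ?thesis unfolding H1_measurable_def by (intro conjI; measurable)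
qed

lemma smooth_fn_step_fn_approx:
  fixes \<psi> :: "'a::euclidean_space \<Rightarrow> real"
  assumes \<psi>: "smooth_fn \<psi>" and D: "bounded D" "open D" and \<delta>: "0 < \<delta>"
  shows "\<exists>p. H1_norm_sq D (\<lambda>x. \<psi> x - step_value p x) (\<lambda>x. grad_fn \<psi> x - step_slope p x) \<le> ennreal \<delta>"
proof -
  define vol where "vol = enn2real (emeasure lborel D)"
  have vol: "emeasure lborel D = ennreal vol" "0 \<le> vol"
    using emeasure_bounded_finite[OF D(1)] by (simp_all add: vol_def ennreal_enn2real_if less_top)
  define \<epsilon> where "\<epsilon> = sqrt (\<delta> / (vol + 1))"
  have \<epsilon>: "0 < \<epsilon>" "\<epsilon>\<^sup>2 * vol \<le> \<delta>" using \<delta> vol(2) by (simp_all add: \<epsilon>_def field_simps)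
  have "continuous_on UNIV (\<lambda>x. (\<psi> x, grad_fn \<psi> x))"
    by (intro continuous_intros smooth_fn_continuous grad_fn_continuous \<psi>)
  then obtain p where p: "\<And>x. x \<in> D \<Longrightarrow> dist (\<psi> x, grad_fn \<psi> x) (step_fn p x) < \<epsilon>"
    using step_fn_uniform_approx[OF _ D(1) \<epsilon>(1)] by blast
  have "(\<psi> x - step_value p x)\<^sup>2 + (norm (grad_fn \<psi> x - step_slope p x))\<^sup>2 \<le> \<epsilon>\<^sup>2" if "x \<in> D" for x
  proof -
    have "(\<psi> x - step_value p x)\<^sup>2 + (norm (grad_fn \<psi> x - step_slope p x))\<^sup>2
      = (dist (\<psi> x, grad_fn \<psi> x) (step_fn p x))\<^sup>2"
      by (simp add: dist_prod_def dist_norm)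
    also have "\<dots> \<le> \<epsilon>\<^sup>2" using p[OF that] by (intro power_mono) auto
    finally show ?thesis .
  qed
  then have "H1_norm_sq D (\<lambda>x. \<psi> x - step_value p x) (\<lambda>x. grad_fn \<psi> x - step_slope p x)
    \<le> (\<integral>\<^sup>+x. ennreal (\<epsilon>\<^sup>2) * indicator D x \<partial>lebesgue)"
    unfolding H1_norm_sq_def
    by (intro nn_integral_mono) (auto simp: indicator_def intro: ennreal_leI simp del: ennreal_plus)
  also have "\<dots> = ennreal (\<epsilon>\<^sup>2 * vol)"
    using D(2) vol by (simp add: nn_integral_completion nn_integral_cmult_indicator ennreal_mult)
  also have "\<dots> \<le> ennreal \<delta>" using \<epsilon>(2) by (rule ennreal_leI)
  finally show ?thesis by blast
qed

lemma ennreal_two_quarters: "0 \<le> \<delta> \<Longrightarrow> 2 * ennreal (\<delta> / 4) + 2 * ennreal (\<delta> / 4) = ennreal \<delta>"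
  using ennreal_mult[of 2 "\<delta> / 4", symmetric] by (simp flip: ennreal_plus)

lemma countable_dense_subset:
  fixes d :: "'a \<Rightarrow> 'p::countable \<Rightarrow> ennreal" and d' :: "'a \<Rightarrow> 'a \<Rightarrow> ennreal"
  assumes approx: "\<And>a \<delta>. a \<in> S \<Longrightarrow> 0 < \<delta> \<Longrightarrow> \<exists>p. d a p \<le> ennreal \<delta>"
    and triangle: "\<And>a a' p. a \<in> S \<Longrightarrow> a' \<in> S \<Longrightarrow> d' a a' \<le> 2 * d a p + 2 * d a' p"
  obtains A where "countable A" "A \<subseteq> S" "\<And>a \<delta>. a \<in> S \<Longrightarrow> 0 < \<delta> \<Longrightarrow> \<exists>a'\<in>A. d' a a' \<le> ennreal \<delta>"
proof -
  let ?near = "\<lambda>(p, n::nat) a. a \<in> S \<and> d a p \<le> ennreal (1 / real (Suc n))"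
  define A where "A = (\<lambda>i. SOME a. ?near i a) ` {i. \<exists>a. ?near i a}"
  have near: "?near i (SOME a. ?near i a)" if "?near i a" for i a using that by (rule someI)
  show thesis
  proof (rule that)
    show "countable A" unfolding A_def by (intro countable_image countableI_type)
    show "A \<subseteq> S" using near by (force simp: A_def)
    fix a and \<delta> :: real assume a: "a \<in> S" and \<delta>: "0 < \<delta>"
    obtain n where n: "1 / real (Suc n) < \<delta> / 4"
      using \<delta> reals_Archimedean[of "\<delta> / 4"] by (auto simp: inverse_eq_divide)
    obtain p where p: "d a p \<le> ennreal (1 / real (Suc n))"
      using approx[OF a, of "1 / real (Suc n)"] by auto
    let ?a' = "SOME a'. ?near (p, n) a'"
    have a': "?near (p, n) ?a'" using near[of "(p, n)" a] a p by simp
    have "d' a ?a' \<le> 2 * d a p + 2 * d ?a' p" using triangle[OF a] a' by blast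
    also have "\<dots> \<le> 2 * ennreal (\<delta> / 4) + 2 * ennreal (\<delta> / 4)"
      using p a' order_trans[OF _ ennreal_leI[OF less_imp_le[OF n]]]
      by (intro add_mono mult_left_mono) auto
    also have "\<dots> = ennreal \<delta>" using \<delta> by (intro ennreal_two_quarters) simp
    finally have "d' a ?a' \<le> ennreal \<delta>" .
    moreover have "?a' \<in> A" unfolding A_def by (rule image_eqI[of _ _ "(p, n)"]) (use a p in auto)
    ultimately show "\<exists>a'\<in>A. d' a a' \<le> ennreal \<delta>" by (rule bexI)
  qed
qed

lemma completion_ex_borel_measurable_euclidean:
  fixes G :: "'a \<Rightarrow> 'b::euclidean_space"
  assumes "G \<in> borel_measurable (completion M)"
  shows "\<exists>G'\<in>borel_measurable M. AE x in M. G x = G' x"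
proof -
  have "\<exists>g\<in>borel_measurable M. AE x in M. G x \<bullet> b = g x" for b
    by (intro completion_ex_borel_measurable_real borel_measurable_inner[OF assms borel_measurable_const])
  then obtain g where g: "\<And>b. g b \<in> borel_measurable M" "\<And>b. AE x in M. G x \<bullet> b = g b x" by metis
  have "AE x in M. \<forall>b\<in>Basis. G x \<bullet> b = g b x" using g(2) by (intro AE_finite_allI) auto
  then have "AE x in M. G x = (\<Sum>b\<in>Basis. g b x *\<^sub>R b)"
  proof eventually_elim
    case (elim x)
    have "G x = (\<Sum>b\<in>Basis. (G x \<bullet> b) *\<^sub>R b)" by (simp add: euclidean_representation)
    also have "\<dots> = (\<Sum>b\<in>Basis. g b x *\<^sub>R b)" using elim by (intro sum.cong) auto
    finally show ?case .
  qed
  moreover have "(\<lambda>x. \<Sum>b\<in>Basis. g b x *\<^sub>R b) \<in> borel_measurable M" using g(1) by measurable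
  ultimately show ?thesis by (rule bexI)
qed

context medium
begin

lemma competitors_separable:
  assumes D: "open D" "bounded D"
  obtains A where "countable A" "A \<subseteq> competitors D"
    "\<And>w G \<delta>. (w, G) \<in> competitors D \<Longrightarrow> 0 < \<delta> \<Longrightarrow>
      \<exists>(w', G')\<in>A. H1_norm_sq D (\<lambda>x. w x - w' x) (\<lambda>x. G x - G' x) \<le> ennreal \<delta>"
proof -
  let ?d = "\<lambda>a p. H1_norm_sq D (\<lambda>x. fst a x - step_value p x) (\<lambda>x. snd a x - step_slope p x)"
    and ?d' = "\<lambda>a a'. H1_norm_sq D (\<lambda>x. fst a x - fst a' x) (\<lambda>x. snd a x - snd a' x)"
  have D': "D \<in> sets lebesgue" using D by (simp add: borel_open)
  have meas: "H1_measurable D (\<lambda>x. fst a x - step_value p x) (\<lambda>x. snd a x - step_slope p x)"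
    if "a \<in> competitors D" for a p
    using competitorsD(2)[of "fst a" "snd a"] that
    by (intro H1_measurable_diff H1_measurable_step_fn D') simp
  obtain A where A: "countable A" "A \<subseteq> competitors D" "\<And>a \<delta>. a \<in> competitors D \<Longrightarrow> 0 < \<delta> \<Longrightarrow> \<exists>a'\<in>A. ?d' a a' \<le> ennreal \<delta>"
  proof (rule countable_dense_subset[of "competitors D" ?d ?d'])
    fix a and \<delta> :: real assume a: "a \<in> competitors D" and \<delta>: "0 < \<delta>"
    obtain \<psi> where \<psi>: "\<And>n. test_fn D (\<psi> n)" and
      lim: "(\<lambda>n. H1_norm_sq D (\<lambda>x. fst a x - \<psi> n x) (\<lambda>x. snd a x - grad_fn (\<psi> n) x)) \<longlonglongrightarrow> 0"
      using H10_obtain_approximation[OF D(1) competitorsD(1), of "fst a" "snd a"] a by auto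
    have "\<forall>\<^sub>F n in sequentially. H1_norm_sq D (\<lambda>x. fst a x - \<psi> n x) (\<lambda>x. snd a x - grad_fn (\<psi> n) x) < ennreal (\<delta> / 4)"
      using \<delta> by (intro order_tendstoD(2)[OF lim]) auto
    then obtain n where n: "H1_norm_sq D (\<lambda>x. fst a x - \<psi> n x) (\<lambda>x. snd a x - grad_fn (\<psi> n) x) < ennreal (\<delta> / 4)"
      by (auto simp: eventually_sequentially)
    have smooth: "smooth_fn (\<psi> n)" using \<psi> by (auto simp: test_fn_def)
    obtain p where p: "H1_norm_sq D (\<lambda>x. \<psi> n x - step_value p x) (\<lambda>x. grad_fn (\<psi> n) x - step_slope p x) \<le> ennreal (\<delta> / 4)"
      using smooth_fn_step_fn_approx[OF smooth D(2,1), of "\<delta> / 4"] \<delta> by auto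
    have "?d a p \<le> 2 * H1_norm_sq D (\<lambda>x. fst a x - \<psi> n x) (\<lambda>x. snd a x - grad_fn (\<psi> n) x)
        + 2 * H1_norm_sq D (\<lambda>x. \<psi> n x - step_value p x) (\<lambda>x. grad_fn (\<psi> n) x - step_slope p x)"
      using H1_norm_sq_add_le[of D "\<lambda>x. fst a x - \<psi> n x" "\<lambda>x. snd a x - grad_fn (\<psi> n) x"
          "\<lambda>x. \<psi> n x - step_value p x" "\<lambda>x. grad_fn (\<psi> n) x - step_slope p x"] competitorsD(2)[of "fst a" "snd a"] a
      by (simp add: H1_measurable_diff H1_measurable_smooth H1_measurable_step_fn D' smooth)
    also have "\<dots> \<le> 2 * ennreal (\<delta> / 4) + 2 * ennreal (\<delta> / 4)"
      using n p by (intro add_mono mult_left_mono) auto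
    also have "\<dots> = ennreal \<delta>" using \<delta> by (intro ennreal_two_quarters) simp
    finally show "\<exists>p. ?d a p \<le> ennreal \<delta>" by blast
  next
    show "?d' a a' \<le> 2 * ?d a p + 2 * ?d a' p"
      if "a \<in> competitors D" "a' \<in> competitors D" for a a' p
      using H1_norm_sq_diff_le[OF meas[OF that(1)] meas[OF that(2)], of p p] by simp
  qed blast
  show thesis by (rule that[OF A(1,2)]) (use A(3) in \<open>force simp: case_prod_unfold\<close>)
qed

lemma competitor_energy_measurable:
  assumes D: "open D" and wG: "(w, G) \<in> competitors D"
  shows "(\<lambda>\<omega>. competitor_energy \<omega> D w G) \<in> borel_measurable M"
proof -
  let ?u = "\<lambda>x. indicator D x * (qe x + w x)" and ?G = "\<lambda>x. indicator D x *\<^sub>R (dqe x *\<^sub>R e + G x)"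
  have uG: "?u \<in> borel_measurable lebesgue" "?G \<in> borel_measurable lebesgue"
    using H1_measurable_add[OF qe_H1_measurable[OF D] competitorsD(2)[OF wG]]
    by (auto simp: H1_measurable_def)
  obtain u' where u': "u' \<in> borel_measurable lborel" "AE x in lborel. ?u x = u' x"
    using completion_ex_borel_measurable_real[OF uG(1)] by blast
  obtain G' where G': "G' \<in> borel_measurable lborel" "AE x in lborel. ?G x = G' x"
    using completion_ex_borel_measurable_euclidean[OF uG(2)] by blast
  have [measurable]: "u' \<in> borel_measurable borel" "G' \<in> borel_measurable borel" "D \<in> sets borel"
    using u'(1) G'(1) D by (auto simp: borel_open)
  let ?f = "\<lambda>\<omega> x. ennreal (indicator D x * (1 / 2 * (\<Phi> (\<tau> x \<omega>) (G' x))\<^sup>2 + W_ext (u' x)))"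
  have "competitor_energy \<omega> D w G = (\<integral>\<^sup>+x. ?f \<omega> x \<partial>lborel)" for \<omega>
    unfolding competitor_energy_def nn_integral_completion
  proof (rule nn_integral_cong_AE)
    show "AE x in lborel. ennreal (energy_density \<omega> D w G x) = ?f \<omega> x"
      using u'(2) G'(2)
    proof eventually_elim
      case (elim x)
      show ?case
      proof (cases "x \<in> D")
        case True
        then have "u' x = qe x + w x" "G' x = dqe x *\<^sub>R e + G x" using elim by auto
        then show ?thesis
          using True W_ext_eq[OF competitorsD(3)[OF wG True]] by (simp add: energy_density_def)
      qed (simp add: energy_density_def)
    qed
  qed
  moreover have "(\<lambda>\<omega>. \<integral>\<^sup>+x. ?f \<omega> x \<partial>lborel) \<in> borel_measurable M"
  proof (rule sigma_finite_measure.borel_measurable_nn_integral[OF sigma_finite_lborel])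
    have [measurable]: "(\<lambda>z. \<Phi> (\<tau> (snd z) (fst z)) (G' (snd z))) \<in> borel_measurable (M \<Otimes>\<^sub>M lborel)"
      by (intro Phi_tau_measurable) measurable
    show "(\<lambda>(\<omega>, x). ?f \<omega> x) \<in> borel_measurable (M \<Otimes>\<^sub>M lborel)"
      unfolding case_prod_unfold by measurable
  qed
  ultimately show ?thesis by simp
qed

lemma competitor_energy_perturb:
  assumes t: "0 < t"
  obtains K where "0 \<le> K" "\<And>\<omega> D w G w' G'. \<omega> \<in> space M \<Longrightarrow> open D \<Longrightarrow> (w, G) \<in> competitors D \<Longrightarrow> (w', G') \<in> competitors D \<Longrightarrow>
      competitor_energy \<omega> D w' G'
      \<le> ennreal (1 + t) * competitor_energy \<omega> D w G + ennreal t * emeasure lborel D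
        + ennreal K * H1_norm_sq D (\<lambda>x. w x - w' x) (\<lambda>x. G x - G' x)"
proof -
  obtain K where K: "0 \<le> K" "\<And>\<omega> s s' x p p'. \<omega> \<in> space M \<Longrightarrow> s \<in> {-1..1} \<Longrightarrow> s' \<in> {-1..1} \<Longrightarrow>
      1 / 2 * (\<Phi> (\<tau> x \<omega>) p')\<^sup>2 + W s'
      \<le> (1 + t) * (1 / 2 * (\<Phi> (\<tau> x \<omega>) p)\<^sup>2 + W s) + t + K * ((s' - s)\<^sup>2 + (norm (p' - p))\<^sup>2)"
    using integrand_perturb[OF t] by blast
  show thesis
  proof (rule that[OF K(1)])
    fix \<omega> D w G w' G' assume \<omega>: "\<omega> \<in> space M" and D: "open D" and wG: "(w, G) \<in> competitors D" "(w', G') \<in> competitors D"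
    let ?f = "energy_density \<omega> D w G" and ?s = "\<lambda>x. indicator D x * ((w x - w' x)\<^sup>2 + (norm (G x - G' x))\<^sup>2)"
    have [measurable]: "?f \<in> borel_measurable lebesgue" "?s \<in> borel_measurable lebesgue" "D \<in> sets lebesgue"
      using energy_density_measurable[OF \<omega> D wG(1)] H1_measurable_sq(3)[OF H1_measurable_diff[OF competitorsD(2)[OF wG(1)] competitorsD(2)[OF wG(2)]]] D
      by (auto simp: borel_open)
    have "ennreal (energy_density \<omega> D w' G' x)
      \<le> ennreal (1 + t) * ennreal (?f x) + (ennreal t * indicator D x + ennreal K * ennreal (?s x))"
      for x
    proof (cases "x \<in> D")
      case True
      have "energy_density \<omega> D w' G' x \<le> (1 + t) * ?f x + (t + K * ?s x)"
        using K(2)[OF \<omega> competitorsD(3)[OF wG(1) True] competitorsD(3)[OF wG(2) True], of x "dqe x *\<^sub>R e + G' x" "dqe x *\<^sub>R e + G x"] True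
        by (simp add: energy_density_def power2_commute norm_minus_commute)
      then have "ennreal (energy_density \<omega> D w' G' x)
        \<le> ennreal ((1 + t) * ?f x) + (ennreal t + ennreal (K * ?s x))"
        by (intro order_trans[OF ennreal_leI order_trans[OF ennreal_add_le add_left_mono[OF ennreal_add_le]]])
      then show ?thesis using True t K(1) by (simp add: ennreal_mult' del: ennreal_plus)
    qed (simp add: energy_density_def)
    then have "competitor_energy \<omega> D w' G'
        \<le> (\<integral>\<^sup>+x. ennreal (1 + t) * ennreal (?f x) + (ennreal t * indicator D x + ennreal K * ennreal (?s x)) \<partial>lebesgue)"
      unfolding competitor_energy_def by (intro nn_integral_mono)
    also have "\<dots> = ennreal (1 + t) * competitor_energy \<omega> D w G + (ennreal t * emeasure lebesgue D
        + ennreal K * H1_norm_sq D (\<lambda>x. w x - w' x) (\<lambda>x. G x - G' x))"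
      unfolding competitor_energy_def H1_norm_sq_def
      by (simp add: nn_integral_add nn_integral_cmult nn_integral_cmult_indicator del: ennreal_plus)
    finally show "competitor_energy \<omega> D w' G'
      \<le> ennreal (1 + t) * competitor_energy \<omega> D w G + ennreal t * emeasure lborel D
        + ennreal K * H1_norm_sq D (\<lambda>x. w x - w' x) (\<lambda>x. G x - G' x)"
        using D by (simp add: add.assoc)
  qed
qed

lemma competitor_energy_approx:
  assumes \<omega>: "\<omega> \<in> space M" and D: "open D" "bounded D" and wG: "(w, G) \<in> competitors D" and \<epsilon>: "0 < \<epsilon>"
  obtains \<delta> where "0 < \<delta>" "\<And>w' G'. (w', G') \<in> competitors D \<Longrightarrow> H1_norm_sq D (\<lambda>x. w x - w' x) (\<lambda>x. G x - G' x) \<le> ennreal \<delta> \<Longrightarrow>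
      competitor_energy \<omega> D w' G' \<le> competitor_energy \<omega> D w G + ennreal \<epsilon>"
proof (cases "competitor_energy \<omega> D w G")
  case (real E)
  define vol where "vol = enn2real (emeasure lborel D)"
  have vol: "emeasure lborel D = ennreal vol" "0 \<le> vol"
    using emeasure_bounded_finite[OF D(2)] by (auto simp: vol_def ennreal_enn2real_if less_top)
  have bound: "0 < \<epsilon> / (2 * (s + 1))" "\<epsilon> / (2 * (s + 1)) * s \<le> \<epsilon> / 2" if "0 \<le> s" for s
    using \<epsilon> that by (simp_all add: field_simps)
  define t where "t = \<epsilon> / (2 * (E + vol + 1))"
  have t: "0 < t" "t * (E + vol) \<le> \<epsilon> / 2"
    using bound[of "E + vol"] real(1) vol(2) by (simp_all add: t_def)
  show thesis
  proof (rule competitor_energy_perturb[OF t(1)])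
    fix K :: real assume K: "0 \<le> K" and perturb: "\<And>\<omega> D w G w' G'. \<omega> \<in> space M \<Longrightarrow> open D \<Longrightarrow> (w, G) \<in> competitors D \<Longrightarrow> (w', G') \<in> competitors D \<Longrightarrow>
        competitor_energy \<omega> D w' G'
        \<le> ennreal (1 + t) * competitor_energy \<omega> D w G + ennreal t * emeasure lborel D
          + ennreal K * H1_norm_sq D (\<lambda>x. w x - w' x) (\<lambda>x. G x - G' x)"
    define \<delta> where "\<delta> = \<epsilon> / (2 * (K + 1))"
    have \<delta>: "0 < \<delta>" "K * \<delta> \<le> \<epsilon> / 2" using bound[OF K] by (simp_all add: \<delta>_def mult.commute)
    show thesis
    proof (rule that[OF \<delta>(1)])
      fix w' G' assume w'G': "(w', G') \<in> competitors D" and close: "H1_norm_sq D (\<lambda>x. w x - w' x) (\<lambda>x. G x - G' x) \<le> ennreal \<delta>"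
      have "competitor_energy \<omega> D w' G'
        \<le> ennreal (1 + t) * ennreal E + ennreal t * ennreal vol + ennreal K * ennreal \<delta>"
        using perturb[OF \<omega> D(1) wG w'G']
        unfolding real(2) vol(1)
        by (rule order_trans) (intro add_left_mono mult_left_mono close, simp)
      also have "\<dots> = ennreal ((1 + t) * E + t * vol + K * \<delta>)" using t(1) real(1) vol(2) K \<delta>(1)
        by (simp only: ennreal_mult[symmetric] ennreal_plus[symmetric] mult_nonneg_nonneg add_nonneg_nonneg zero_le_one less_imp_le)
      also have "\<dots> \<le> ennreal (E + \<epsilon>)"
        using t(2) \<delta>(2) by (intro ennreal_leI) (simp add: algebra_simps)
      also have "\<dots> = competitor_energy \<omega> D w G + ennreal \<epsilon>" using real \<epsilon> by simp
      finally show "competitor_energy \<omega> D w' G' \<le> competitor_energy \<omega> D w G + ennreal \<epsilon>" .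
    qed
  qed
next
  case top
  show thesis by (rule that[of 1]) (simp_all add: top)
qed

lemma min_energy_measurable:
  assumes D: "open D" "bounded D"
  shows "(\<lambda>\<omega>. min_energy \<omega> D) \<in> borel_measurable M"
proof -
  obtain A where A: "countable A" "A \<subseteq> competitors D" and dense: "\<And>w G \<delta>. (w, G) \<in> competitors D \<Longrightarrow> 0 < \<delta> \<Longrightarrow>
      \<exists>(w', G')\<in>A. H1_norm_sq D (\<lambda>x. w x - w' x) (\<lambda>x. G x - G' x) \<le> ennreal \<delta>"
    using competitors_separable[OF D] by blast
  let ?I = "\<lambda>\<omega>. INF (w, G)\<in>A. competitor_energy \<omega> D w G"
  have "?I \<omega> = min_energy \<omega> D" if \<omega>: "\<omega> \<in> space M" for \<omega>
  proof (rule antisym)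
    show "min_energy \<omega> D \<le> ?I \<omega>" unfolding min_energy_def by (rule INF_superset_mono[OF A(2)]) auto
    show "?I \<omega> \<le> min_energy \<omega> D" unfolding min_energy_def
    proof (rule INF_greatest, clarify, rule ennreal_le_epsilon)
      fix w G and \<epsilon> :: real assume wG: "(w, G) \<in> competitors D" and "0 < \<epsilon>"
      then obtain \<delta> where \<delta>: "0 < \<delta>" "\<And>w' G'. (w', G') \<in> competitors D \<Longrightarrow> H1_norm_sq D (\<lambda>x. w x - w' x) (\<lambda>x. G x - G' x) \<le> ennreal \<delta> \<Longrightarrow>
          competitor_energy \<omega> D w' G' \<le> competitor_energy \<omega> D w G + ennreal \<epsilon>"
        using competitor_energy_approx[OF \<omega> D] by blast
      obtain w' G' where w'G': "(w', G') \<in> A" "H1_norm_sq D (\<lambda>x. w x - w' x) (\<lambda>x. G x - G' x) \<le> ennreal \<delta>"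
        using dense[OF wG \<delta>(1)] by blast
      have "?I \<omega> \<le> competitor_energy \<omega> D w' G'"
        using w'G'(1) by (intro INF_lower2[of "(w', G')"]) auto
      also have "\<dots> \<le> competitor_energy \<omega> D w G + ennreal \<epsilon>" using w'G' A(2) by (intro \<delta>(2)) auto
      finally show "?I \<omega> \<le> competitor_energy \<omega> D w G + ennreal \<epsilon>" .
    qed
  qed
  moreover have "?I \<in> borel_measurable M"
    using A(2)
    by (intro borel_measurable_INF[OF A(1)]) (auto intro!: competitor_energy_measurable[OF D(1)])
  ultimately show ?thesis using measurable_cong[of M ?I "\<lambda>\<omega>. min_energy \<omega> D" borel] by simp
qed

end

section \<open>Limits of quotients\<close>

lemma AE_ge_if_nn_integral_le:
  fixes f g :: "'a \<Rightarrow> ennreal"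
  assumes [measurable]: "f \<in> borel_measurable M" "g \<in> borel_measurable M"
    and le: "AE x in M. f x \<le> g x" and int: "(\<integral>\<^sup>+x. g x \<partial>M) \<le> (\<integral>\<^sup>+x. f x \<partial>M)" "(\<integral>\<^sup>+x. f x \<partial>M) \<noteq> \<infinity>"
  shows "AE x in M. g x \<le> f x"
proof -
  have "(\<integral>\<^sup>+x. g x - f x \<partial>M) = (\<integral>\<^sup>+x. g x \<partial>M) - (\<integral>\<^sup>+x. f x \<partial>M)"
    using le int(2) by (intro nn_integral_diff) auto
  also have "\<dots> = 0" using int by (simp add: diff_eq_0_iff_ennreal top.not_eq_extremum)
  finally have "AE x in M. g x - f x = 0" by (subst (asm) nn_integral_0_iff_AE) auto
  then show ?thesis by eventually_elim (simp add: diff_eq_0_iff_ennreal)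
qed

lemma
  fixes f :: "'a \<Rightarrow> 'b \<Rightarrow> 'c::{complete_linorder, dense_linorder, linorder_topology}"
  assumes f: "((\<lambda>(x, y). f x y) \<longlongrightarrow> L) (F \<times>\<^sub>F G)" and F: "F \<noteq> bot"
  shows tendsto_Limsup_if_tendsto_prod: "((\<lambda>y. Limsup F (\<lambda>x. f x y)) \<longlongrightarrow> L) G"
    and tendsto_Liminf_if_tendsto_prod: "((\<lambda>y. Liminf F (\<lambda>x. f x y)) \<longlongrightarrow> L) G"
proof -
  have Liminf_le: "Liminf F (\<lambda>x. f x y) \<le> Limsup F (\<lambda>x. f x y)" for y
    by (rule Liminf_le_Limsup[OF F])
  have below: "\<forall>\<^sub>F y in G. a < Liminf F (\<lambda>x. f x y)" if "a < L" for a
  proof -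
    obtain a' where a': "a < a'" "a' < L" using dense[OF \<open>a < L\<close>] by blast
    obtain P Q where PQ: "eventually P F" "eventually Q G" "\<And>x y. P x \<Longrightarrow> Q y \<Longrightarrow> a' < f x y"
      using order_tendstoD(1)[OF f a'(2)] by (auto simp: eventually_prod_filter)
    from PQ(2) show ?thesis
    proof eventually_elim
      case (elim y)
      have "a' \<le> Liminf F (\<lambda>x. f x y)"
        using PQ(1) by (intro Liminf_bounded eventually_mono[OF PQ(1)] less_imp_le PQ(3) elim)
      then show ?case by (rule less_le_trans[OF a'(1)])
    qed
  qed
  have above: "\<forall>\<^sub>F y in G. Limsup F (\<lambda>x. f x y) < a" if "L < a" for a
  proof -
    obtain a' where a': "L < a'" "a' < a" using dense[OF \<open>L < a\<close>] by blast
    obtain P Q where PQ: "eventually P F" "eventually Q G" "\<And>x y. P x \<Longrightarrow> Q y \<Longrightarrow> f x y < a'"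
      using order_tendstoD(2)[OF f a'(1)] by (auto simp: eventually_prod_filter)
    from PQ(2) show ?thesis
    proof eventually_elim
      case (elim y)
      have "Limsup F (\<lambda>x. f x y) \<le> a'"
        by (intro Limsup_bounded eventually_mono[OF PQ(1)] less_imp_le PQ(3) elim)
      then show ?case by (rule le_less_trans[OF _ a'(2)])
    qed
  qed
  show "((\<lambda>y. Limsup F (\<lambda>x. f x y)) \<longlongrightarrow> L) G"
  proof (rule order_tendstoI)
    show "\<forall>\<^sub>F y in G. a < Limsup F (\<lambda>x. f x y)" if "a < L" for a
      by (rule eventually_mono[OF below[OF that]]) (rule less_le_trans[OF _ Liminf_le])
  qed (rule above)
  show "((\<lambda>y. Liminf F (\<lambda>x. f x y)) \<longlongrightarrow> L) G"
  proof (rule order_tendstoI)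
    show "\<forall>\<^sub>F y in G. Liminf F (\<lambda>x. f x y) < a" if "L < a" for a
      by (rule eventually_mono[OF above[OF that]]) (rule le_less_trans[OF Liminf_le])
  qed (rule below)
qed

lemma box_ratio_tendsto_0:
  "(\<lambda>N. K * (1 - (2 * real N) ^ n / (2 * real (N + k)) ^ n)) \<longlonglongrightarrow> 0"
  "(\<lambda>N. K * ((2 * real (Suc N)) ^ n / (2 * real N) ^ n - 1)) \<longlonglongrightarrow> 0"
proof -
  have "(\<lambda>N. real N / real (N + k)) \<longlonglongrightarrow> 1" by real_asymp
  then have "(\<lambda>N. K * (1 - (real N / real (N + k)) ^ n)) \<longlonglongrightarrow> K * (1 - 1 ^ n)"
    by (intro tendsto_intros)
  moreover have "(real N / real (N + k)) ^ n = (2 * real N) ^ n / (2 * real (N + k)) ^ n" for N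
    by (subst power_divide[symmetric]) (simp del: of_nat_add)
  ultimately show "(\<lambda>N. K * (1 - (2 * real N) ^ n / (2 * real (N + k)) ^ n)) \<longlonglongrightarrow> 0"
    by (simp del: of_nat_add)
  have "(\<lambda>N. real (Suc N) / real N) \<longlonglongrightarrow> 1" by real_asymp
  then have "(\<lambda>N. K * ((real (Suc N) / real N) ^ n - 1)) \<longlonglongrightarrow> K * (1 ^ n - 1)"
    by (intro tendsto_intros)
  moreover have "(real (Suc N) / real N) ^ n = (2 * real (Suc N)) ^ n / (2 * real N) ^ n" for N
    by (subst power_divide[symmetric]) (simp del: of_nat_Suc)
  ultimately show "(\<lambda>N. K * ((2 * real (Suc N)) ^ n / (2 * real N) ^ n - 1)) \<longlonglongrightarrow> 0"
    by (simp del: of_nat_Suc)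
qed

lemma
  fixes x x' :: "nat \<Rightarrow> real"
  assumes x: "\<And>N. 0 \<le> x N" and x'_le: "\<And>N. x' (N + k) \<le> x N + K * ((2 * real (N + k)) ^ n - (2 * real N) ^ n)"
  shows limsup_shifted_quotient_le:
      "limsup (\<lambda>N. ennreal (x' N / (2 * real N) ^ n)) \<le> limsup (\<lambda>N. ennreal (x N / (2 * real N) ^ n))"
    and liminf_shifted_quotient_le:
      "liminf (\<lambda>N. ennreal (x' N / (2 * real N) ^ n)) \<le> liminf (\<lambda>N. ennreal (x N / (2 * real N) ^ n))"
proof -
  let ?f = "\<lambda>N. ennreal (x N / (2 * real N) ^ n)" and ?g = "\<lambda>N. ennreal (x' N / (2 * real N) ^ n)"
    and ?r = "\<lambda>N. K * (1 - (2 * real N) ^ n / (2 * real (N + k)) ^ n)"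
  have shifted: "\<forall>\<^sub>F N in sequentially. ?g (N + k) \<le> ?f N + ennreal (?r N)"
    using eventually_gt_at_top[of 0]
  proof eventually_elim
    case (elim N)
    let ?a = "(2 * real N) ^ n" and ?b = "(2 * real (N + k)) ^ n"
    have ab: "0 < ?a" "?a \<le> ?b" using elim by (simp, intro power_mono, simp_all)
    have "x' (N + k) / ?b \<le> (x N + K * (?b - ?a)) / ?b"
      using x'_le[of N] ab by (intro divide_right_mono) auto
    also have "\<dots> = x N / ?b + K * (1 - ?a / ?b)" using ab by (intro add_mult_diff_divide) linarith
    also have "\<dots> \<le> x N / ?a + K * (1 - ?a / ?b)"
      using ab x[of N] by (intro add_right_mono divide_left_mono) auto
    finally show ?case by (rule order_trans[OF ennreal_leI ennreal_add_le])
  qed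
  have r_lim: "(\<lambda>N. ennreal (?r N)) \<longlonglongrightarrow> 0"
    using tendsto_ennrealI[OF box_ratio_tendsto_0(1)[of K n k]] by (simp only: ennreal_0)
  have "limsup (\<lambda>N. ?g (N + k)) \<le> limsup ?f"
    by (rule Limsup_le_Limsup_comp[OF filterlim_ident shifted r_lim])
  then show "limsup ?g \<le> limsup ?f" by (simp only: limsup_shift_k[of ?g])
  show "liminf ?g \<le> liminf ?f"
    by (rule Liminf_comp_le_Liminf[OF filterlim_add_const_nat_at_top shifted r_lim])
qed

lemma
  fixes g v :: "real \<Rightarrow> real"
  assumes g: "\<And>\<rho>. 0 \<le> g \<rho>" and mono: "\<And>\<rho> \<rho>'. \<rho> \<le> \<rho>' \<Longrightarrow> g \<rho>' \<le> g \<rho> + (v \<rho>' - v \<rho>)"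
    and v_mono: "\<And>\<rho> \<rho>'. \<rho> \<le> \<rho>' \<Longrightarrow> v \<rho> \<le> v \<rho>'" and v: "\<And>N. v (real N) = c * (2 * real N) ^ n"
    and N: "real N \<le> R / 2" "R / 2 \<le> real (Suc N)" "1 \<le> N"
  shows quotient_le_lattice_quotient: "g (R / 2) / R ^ n
      \<le> g (real N) / (2 * real N) ^ n + c * ((2 * real (Suc N)) ^ n / (2 * real N) ^ n - 1)"
    and lattice_quotient_le_quotient: "g (real (Suc N)) / (2 * real (Suc N)) ^ n
      \<le> g (R / 2) / R ^ n + c * ((2 * real (Suc N)) ^ n / (2 * real N) ^ n - 1)"
proof -
  let ?a = "(2 * real N) ^ n" and ?b = "(2 * real (Suc N)) ^ n"
  have pos: "0 < ?a" "?a \<le> R ^ n" "R ^ n \<le> ?b" "0 < R ^ n"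
    using N power_mono[of "2 * real N" R n] power_mono[of R "2 * real (Suc N)" n] by simp_all
  have slack_nonneg: "0 \<le> c * (?b - ?a)"
    using v_mono[of "real N" "real (Suc N)"] v[of N] v[of "Suc N"] by (simp add: right_diff_distrib)
  have "g (R / 2) \<le> g (real N) + c * (?b - ?a)"
    using mono[OF N(1)] v_mono[OF N(2)] v[of N] v[of "Suc N"] by (simp add: right_diff_distrib)
  then have "g (R / 2) / R ^ n \<le> (g (real N) + c * (?b - ?a)) / ?a"
    using pos g slack_nonneg by (intro frac_le) auto
  also have "\<dots> = g (real N) / ?a + c * (?b / ?a - 1)"
    using pos by (intro add_mult_diff_divide) linarith
  finally show "g (R / 2) / R ^ n \<le> g (real N) / ?a + c * (?b / ?a - 1)" .
  have "g (real (Suc N)) \<le> g (R / 2) + c * (?b - ?a)"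
    using mono[OF N(2)] v_mono[OF N(1)] v[of N] v[of "Suc N"] by (simp add: right_diff_distrib)
  then have "g (real (Suc N)) / ?b \<le> (g (R / 2) + c * (?b - ?a)) / ?b"
    using pos by (intro divide_right_mono) auto
  also have "\<dots> = g (R / 2) / ?b + c * (?b - ?a) / ?b" by (rule add_divide_distrib)
  also have "\<dots> \<le> g (R / 2) / R ^ n + c * (?b - ?a) / ?a"
    using pos g slack_nonneg by (intro add_mono divide_left_mono) auto
  also have "c * (?b - ?a) / ?a = c * (?b / ?a - 1)"
    using add_mult_diff_divide(2)[OF less_imp_neq[OF pos(1), symmetric], of 0 c ?b] by simp
  finally show "g (real (Suc N)) / ?b \<le> g (R / 2) / R ^ n + c * (?b / ?a - 1)" .
qed

lemma
  fixes g v :: "real \<Rightarrow> real"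
  assumes g: "\<And>\<rho>. 0 \<le> g \<rho>" and mono: "\<And>\<rho> \<rho>'. \<rho> \<le> \<rho>' \<Longrightarrow> g \<rho>' \<le> g \<rho> + (v \<rho>' - v \<rho>)"
    and v_mono: "\<And>\<rho> \<rho>'. \<rho> \<le> \<rho>' \<Longrightarrow> v \<rho> \<le> v \<rho>'" and v: "\<And>N. v (real N) = c * (2 * real N) ^ n"
  shows Limsup_quotient_le_limsup:
      "Limsup at_top (\<lambda>R. ennreal (g (R / 2) / R ^ n)) \<le> limsup (\<lambda>N. ennreal (g (real N) / (2 * real N) ^ n))"
    and liminf_le_Liminf_quotient:
      "liminf (\<lambda>N. ennreal (g (real N) / (2 * real N) ^ n)) \<le> Liminf at_top (\<lambda>R. ennreal (g (R / 2) / R ^ n))"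
proof -
  let ?N = "\<lambda>R::real. nat \<lfloor>R / 2\<rfloor>" and ?r = "\<lambda>N. ennreal (c * ((2 * real (Suc N)) ^ n / (2 * real N) ^ n - 1))"
  have lim: "filterlim ?N sequentially at_top"
    by (rule filterlim_compose[OF filterlim_nat_sequentially]) real_asymp
  have "?r \<longlonglongrightarrow> 0" using tendsto_ennrealI[OF box_ratio_tendsto_0(2)[of c n]] by (simp only: ennreal_0)
  then have r_lim: "((\<lambda>R. ?r (?N R)) \<longlongrightarrow> 0) at_top" by (rule filterlim_compose[OF _ lim])
  have N: "real (?N R) \<le> R / 2" "R / 2 \<le> real (Suc (?N R))" "1 \<le> ?N R" if "2 \<le> R" for R
    using that by linarith+
  have upper: "\<forall>\<^sub>F R in at_top. ennreal (g (R / 2) / R ^ n)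
      \<le> ennreal (g (real (?N R)) / (2 * real (?N R)) ^ n) + ?r (?N R)"
    using eventually_ge_at_top[of 2]
  proof eventually_elim
    case (elim R)
    show ?case
      by (rule order_trans[OF ennreal_leI[OF quotient_le_lattice_quotient[of g v, OF g mono v_mono v N[OF elim]]] ennreal_add_le])
  qed
  show "Limsup at_top (\<lambda>R. ennreal (g (R / 2) / R ^ n))
    \<le> limsup (\<lambda>N. ennreal (g (real N) / (2 * real N) ^ n))"
    by (rule Limsup_le_Limsup_comp[OF lim upper r_lim])
  have lower: "\<forall>\<^sub>F R in at_top. ennreal (g (real (Suc (?N R))) / (2 * real (Suc (?N R))) ^ n)
      \<le> ennreal (g (R / 2) / R ^ n) + ?r (?N R)"
    using eventually_ge_at_top[of 2]
  proof eventually_elim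
    case (elim R)
    show ?case
      by (rule order_trans[OF ennreal_leI[OF lattice_quotient_le_quotient[of g v, OF g mono v_mono v N[OF elim]]] ennreal_add_le])
  qed
  show "liminf (\<lambda>N. ennreal (g (real N) / (2 * real N) ^ n))
    \<le> Liminf at_top (\<lambda>R. ennreal (g (R / 2) / R ^ n))"
    by (rule Liminf_comp_le_Liminf[OF filterlim_compose[OF filterlim_Suc lim] lower r_lim])
qed

section \<open>The energy of cells\<close>

context medium
begin

interpretation prob_space M by (rule P)

definition cell_energy :: "'w \<Rightarrow> 'd \<Rightarrow> real \<Rightarrow> real set \<Rightarrow> real" where
  "cell_energy \<omega> y \<rho> H = enn2real (min_energy \<omega> (cylinder y \<rho> H))"

definition cell_profile_energy :: "real \<Rightarrow> real set \<Rightarrow> real" where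
  "cell_profile_energy \<rho> H = cross_section_volume \<rho> * measure line_measure H"

definition unit_profile_energy :: "real set \<Rightarrow> real" where
  "unit_profile_energy H = unit_cross_volume * measure line_measure H"

lemma cell_energy_nonneg: "0 \<le> cell_energy \<omega> y \<rho> H"
  and cell_profile_energy_nonneg: "0 \<le> cell_profile_energy \<rho> H"
  and unit_profile_energy_nonneg: "0 \<le> unit_profile_energy H"
  by (simp_all add: cell_energy_def cell_profile_energy_def unit_profile_energy_def cross_section_volume_nonneg unit_cross_volume_nonneg)

lemma ennreal_cell_profile_energy:
  assumes "H \<in> sets borel" "y \<bullet> e = 0"
  shows "ennreal (cell_profile_energy \<rho> H) = emeasure profile_measure (cylinder y \<rho> H)"
  by (simp add: cell_profile_energy_def emeasure_profile_measure_cylinder[OF assms] ennreal_cross_section_volume[symmetric]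
      line.emeasure_eq_measure ennreal_mult cross_section_volume_nonneg)

lemma ennreal_cell_energy:
  assumes "\<omega> \<in> space M" "open H" "y \<bullet> e = 0"
  shows "ennreal (cell_energy \<omega> y \<rho> H) = min_energy \<omega> (cylinder y \<rho> H)"
proof -
  have "min_energy \<omega> (cylinder y \<rho> H) \<le> ennreal (cell_profile_energy \<rho> H)"
    using min_energy_le_profile_energy[OF assms(1) open_cylinder[OF assms(2)]] assms
    by (simp add: ennreal_cell_profile_energy borel_open)
  then have "min_energy \<omega> (cylinder y \<rho> H) < \<infinity>" by (rule order_le_less_trans) simp
  then show ?thesis by (simp add: cell_energy_def)
qed

lemma cell_profile_energy_nat: "cell_profile_energy (real N) H
  = unit_profile_energy H * (2 * real N) ^ card B"
  by (simp add: cell_profile_energy_def unit_profile_energy_def cross_section_volume_nat)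

lemma cell_profile_energy_mono: "\<rho> \<le> \<rho>' \<Longrightarrow> cell_profile_energy \<rho> H \<le> cell_profile_energy \<rho>' H"
  unfolding cell_profile_energy_def by (intro mult_right_mono cross_section_volume_mono) simp_all

lemma emeasure_profile_measure_uncovered:
  assumes I: "finite I" and H: "open H" and y: "y \<bullet> e = 0"
    and K: "\<And>i. i \<in> I \<Longrightarrow> open (K i)" "\<And>i. i \<in> I \<Longrightarrow> c i \<bullet> e = 0"
      "\<And>i. i \<in> I \<Longrightarrow> cylinder (c i) (r i) (K i) \<subseteq> cylinder y \<rho> H"
    and disj: "disjoint_family_on (\<lambda>i. cylinder (c i) (r i) (K i)) I"
  shows "emeasure profile_measure (cylinder y \<rho> H - (\<Union>i\<in>I. cylinder (c i) (r i) (K i)))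
      = ennreal (cell_profile_energy \<rho> H - (\<Sum>i\<in>I. cell_profile_energy (r i) (K i)))"
    and "(\<Sum>i\<in>I. cell_profile_energy (r i) (K i)) \<le> cell_profile_energy \<rho> H"
proof -
  let ?D = "cylinder y \<rho> H" and ?U = "\<Union>i\<in>I. cylinder (c i) (r i) (K i)" and ?s = "\<Sum>i\<in>I. cell_profile_energy (r i) (K i)"
  have cyl: "cylinder (c i) (r i) (K i) \<in> sets profile_measure" if "i \<in> I" for i
    using K(1)[OF that] by (simp add: borel_open)
  then have U: "?U \<in> sets profile_measure" using I by (intro sets.finite_UN) auto
  have D: "?D \<in> sets profile_measure" "emeasure profile_measure ?D = ennreal (cell_profile_energy \<rho> H)"
    using H by (simp_all add: borel_open ennreal_cell_profile_energy[OF _ y])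
  have sub: "?U \<subseteq> ?D" using K(3) by blast
  have s_nonneg: "0 \<le> ?s" by (intro sum_nonneg cell_profile_energy_nonneg)
  have "emeasure profile_measure ?U = (\<Sum>i\<in>I. emeasure profile_measure (cylinder (c i) (r i) (K i)))"
    using cyl by (intro sum_emeasure[symmetric] I disj) auto
  also have "\<dots> = (\<Sum>i\<in>I. ennreal (cell_profile_energy (r i) (K i)))"
    using K by (intro sum.cong refl ennreal_cell_profile_energy[symmetric]) auto
  also have "\<dots> = ennreal ?s" by (rule sum_ennreal) (rule cell_profile_energy_nonneg)
  finally have U_eq: "emeasure profile_measure ?U = ennreal ?s" .
  show "?s \<le> cell_profile_energy \<rho> H"
    using emeasure_mono[OF sub D(1)]
    unfolding U_eq D(2) by (simp add: cell_profile_energy_nonneg ennreal_le_iff)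
  have "emeasure profile_measure (?D - ?U) = emeasure profile_measure ?D - emeasure profile_measure ?U"
    using U_eq by (intro emeasure_Diff U D(1) sub) simp
  then show "emeasure profile_measure (?D - ?U) = ennreal (cell_profile_energy \<rho> H - ?s)"
    unfolding U_eq D(2) using s_nonneg by (simp add: ennreal_minus)
qed

lemma cell_energy_subadditive:
  assumes \<omega>: "\<omega> \<in> space M" and I: "finite I" and H: "open H" and y: "y \<bullet> e = 0"
    and K: "\<And>i. i \<in> I \<Longrightarrow> open (K i)" "\<And>i. i \<in> I \<Longrightarrow> c i \<bullet> e = 0"
      "\<And>i. i \<in> I \<Longrightarrow> cylinder (c i) (r i) (K i) \<subseteq> cylinder y \<rho> H"
    and disj: "disjoint_family_on (\<lambda>i. cylinder (c i) (r i) (K i)) I"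
  shows "cell_energy \<omega> y \<rho> H \<le> (\<Sum>i\<in>I. cell_energy \<omega> (c i) (r i) (K i))
      + (cell_profile_energy \<rho> H - (\<Sum>i\<in>I. cell_profile_energy (r i) (K i)))"
proof -
  let ?D = "\<lambda>i. cylinder (c i) (r i) (K i)"
  let ?s = "\<Sum>i\<in>I. cell_energy \<omega> (c i) (r i) (K i)" and ?t = "cell_profile_energy \<rho> H - (\<Sum>i\<in>I. cell_profile_energy (r i) (K i))"
  have uncovered: "emeasure profile_measure (cylinder y \<rho> H - (\<Union>i\<in>I. ?D i)) = ennreal ?t" "0 \<le> ?t"
    using emeasure_profile_measure_uncovered[OF I H y K disj] by simp_all
  have s_nonneg: "0 \<le> ?s" by (intro sum_nonneg cell_energy_nonneg)
  have "ennreal (cell_energy \<omega> y \<rho> H) = min_energy \<omega> (cylinder y \<rho> H)"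
    by (rule ennreal_cell_energy[OF \<omega> H y])
  also have "\<dots> \<le> (\<Sum>i\<in>I. min_energy \<omega> (?D i)) + emeasure profile_measure (cylinder y \<rho> H - (\<Union>i\<in>I. ?D i))"
    using K
    by (intro min_energy_subadditive[OF \<omega> I open_cylinder[OF H] _ _ disj] open_cylinder) auto
  also have "(\<Sum>i\<in>I. min_energy \<omega> (?D i)) = (\<Sum>i\<in>I. ennreal (cell_energy \<omega> (c i) (r i) (K i)))"
    using K by (intro sum.cong refl ennreal_cell_energy[OF \<omega>, symmetric]) auto
  also have "\<dots> = ennreal ?s" by (rule sum_ennreal) (rule cell_energy_nonneg)
  also have "ennreal ?s + emeasure profile_measure (cylinder y \<rho> H - (\<Union>i\<in>I. ?D i)) = ennreal (?s + ?t)"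
    unfolding uncovered(1) using s_nonneg uncovered(2) by (intro ennreal_plus[symmetric]) auto
  finally show ?thesis using s_nonneg uncovered(2) by (subst (asm) ennreal_le_iff) auto
qed

lemma cell_energy_mono:
  assumes "\<omega> \<in> space M" "open H" "open K" "K \<subseteq> H" "y \<bullet> e = 0" "y' \<bullet> e = 0"
    "\<And>b. b \<in> B \<Longrightarrow> \<bar>(y' - y) \<bullet> b\<bar> + \<rho> \<le> \<rho>'"
  shows "cell_energy \<omega> y \<rho>' H \<le> cell_energy \<omega> y' \<rho> K + (cell_profile_energy \<rho>' H - cell_profile_energy \<rho> K)"
  using cell_energy_subadditive[of \<omega> "{()}" H y "\<lambda>_. K" "\<lambda>_. y'" "\<lambda>_. \<rho>" \<rho>'] assms cylinder_subset[OF assms(7,4)]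
  by (simp add: disjoint_family_on_def)

lemma cell_energy_le: "\<omega> \<in> space M \<Longrightarrow> open H \<Longrightarrow> y \<bullet> e = 0 \<Longrightarrow> cell_energy \<omega> y \<rho> H \<le> cell_profile_energy \<rho> H"
  using cell_energy_subadditive[of \<omega> "{}" H y] by (simp add: disjoint_family_on_def)

lemma cell_energy_translate:
  "\<omega> \<in> space M \<Longrightarrow> y \<bullet> e = 0 \<Longrightarrow> open H \<Longrightarrow> cell_energy (\<tau> y \<omega>) 0 \<rho> H = cell_energy \<omega> y \<rho> H"
  by (simp only: cell_energy_def min_energy_cylinder_translate)

abbreviation window :: "real \<Rightarrow> real set" where "window h \<equiv> {- h<..<h}"

lemma cell_energy_measurable_window [measurable]: "(\<lambda>\<omega>. cell_energy \<omega> 0 \<rho> (window h)) \<in> borel_measurable M"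
proof -
  have "(\<lambda>\<omega>. min_energy \<omega> (cylinder 0 \<rho> (window h))) \<in> borel_measurable M"
    by (intro min_energy_measurable open_cylinder bounded_cylinder) auto
  then show ?thesis unfolding cell_energy_def by measurable
qed

lemma cell_energy_tendsto:
  assumes \<omega>: "\<omega> \<in> space M"
  shows "(\<lambda>n. cell_energy \<omega> 0 \<rho> (window (real n))) \<longlonglongrightarrow> cell_energy \<omega> 0 \<rho> UNIV"
proof -
  have "(\<lambda>n. min_energy \<omega> (cylinder 0 \<rho> (window (real n)))) \<longlonglongrightarrow> min_energy \<omega> (prism 0 \<rho>)"
    by (rule filterlim_compose[OF min_energy_cylinder_tendsto[OF \<omega>] filterlim_real_sequentially])
  then have "(\<lambda>n. min_energy \<omega> (cylinder 0 \<rho> (window (real n)))) \<longlonglongrightarrow> ennreal (cell_energy \<omega> 0 \<rho> UNIV)"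
    by (simp only: ennreal_cell_energy[OF \<omega> open_UNIV inner_zero_left])
  from tendsto_enn2real[OF this cell_energy_nonneg] show ?thesis
    by (simp only: cell_energy_def[of \<omega> 0 \<rho> "window _"])
qed

lemma cell_energy_measurable_UNIV [measurable]: "(\<lambda>\<omega>. cell_energy \<omega> 0 \<rho> UNIV) \<in> borel_measurable M"
  by (rule borel_measurable_LIMSEQ_real[OF cell_energy_tendsto]) measurable

definition tail_energy :: "real \<Rightarrow> real" where "tail_energy h = 3 ^ card B * unit_profile_energy (- window h)"

lemma tail_energy_tendsto_0: "(tail_energy \<longlongrightarrow> 0) at_top"
proof -
  have "((\<lambda>h. measure line_measure (- window h)) \<longlongrightarrow> 0) at_top"
    using tendsto_enn2real[OF line_measure_tail_tendsto_0[folded ennreal_0]]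
    by (simp add: measure_def)
  then have "((\<lambda>h. 3 ^ card B * (unit_cross_volume * measure line_measure (- window h))) \<longlongrightarrow> 3 ^ card B * (unit_cross_volume * 0)) at_top"
    by (intro tendsto_intros)
  then show ?thesis by (simp add: tail_energy_def[abs_def] unit_profile_energy_def)
qed

lemma cell_profile_energy_tail_le:
  assumes R: "1 \<le> R" and H: "H \<in> sets borel"
  shows "cell_profile_energy (R / 2) H - cell_profile_energy (R / 2) (window h) \<le> tail_energy h * R ^ card B"
proof -
  let ?N = "nat \<lfloor>R / 2\<rfloor> + 1" and ?m = "measure line_measure"
  have "?m H \<le> ?m (window h \<union> - window h)" using H by (intro line.finite_measure_mono) auto
  also have "\<dots> \<le> ?m (window h) + ?m (- window h)" by (rule measure_Un_le) auto
  finally have "cell_profile_energy (R / 2) H - cell_profile_energy (R / 2) (window h)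
    \<le> cell_profile_energy (R / 2) (- window h)"
    using mult_left_mono[of "?m H" "?m (window h) + ?m (- window h)" "cross_section_volume (R / 2)"]
    by (simp add: cell_profile_energy_def cross_section_volume_nonneg distrib_left)
  also have "\<dots> \<le> cell_profile_energy (real ?N) (- window h)"
    by (rule cell_profile_energy_mono) linarith
  also have "\<dots> = unit_profile_energy (- window h) * (2 * real ?N) ^ card B"
    by (rule cell_profile_energy_nat)
  also have "\<dots> \<le> unit_profile_energy (- window h) * (3 * R) ^ card B"
  proof (rule mult_left_mono[OF power_mono unit_profile_energy_nonneg])
    show "2 * real ?N \<le> 3 * R" using R of_nat_floor[of "R / 2"] by simp
  qed simp
  finally show ?thesis by (simp add: tail_energy_def power_mult_distrib mult_ac)
qed

lemma normalised_cell_energy_tail_le: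
  assumes "\<omega> \<in> space M" "1 \<le> R" "open H" "window h \<subseteq> H"
  shows "cell_energy \<omega> 0 (R / 2) H / R ^ card B
    \<le> cell_energy \<omega> 0 (R / 2) (window h) / R ^ card B + tail_energy h"
proof -
  have "cell_energy \<omega> 0 (R / 2) H
    \<le> cell_energy \<omega> 0 (R / 2) (window h)
    + (cell_profile_energy (R / 2) H - cell_profile_energy (R / 2) (window h))"
    using assms by (intro cell_energy_mono) auto
  also have "\<dots> \<le> cell_energy \<omega> 0 (R / 2) (window h) + tail_energy h * R ^ card B"
    using assms by (intro add_left_mono cell_profile_energy_tail_le borel_open)
  finally have "cell_energy \<omega> 0 (R / 2) H / R ^ card B
    \<le> (cell_energy \<omega> 0 (R / 2) (window h) + tail_energy h * R ^ card B) / R ^ card B"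
    using assms(2) by (intro divide_right_mono) auto
  then show ?thesis using assms(2) by (simp add: add_divide_distrib)
qed

lemma lattice_action_tau: "lattice_action M (\<lambda>z. \<tau> (lattice_point z)) B"
proof (intro_locales, unfold_locales)
  show "finite B" by (rule finite_B)
  show "\<tau> (lattice_point z) \<in> M \<rightarrow>\<^sub>M M" "distr M M (\<tau> (lattice_point z)) = M" for z
    by (rule tau_measurable tau_pres)+
  fix z z' x assume x: "x \<in> space M"
  show "\<tau> (lattice_point (\<lambda>b. z b + z' b)) x = \<tau> (lattice_point z) (\<tau> (lattice_point z') x)"
    using tau_add[OF x] by (simp add: lattice_point_add)
  show "\<tau> (lattice_point (\<lambda>_. 0)) x = x" using tau_0[OF x] by (simp add: lattice_point_def)
  assume "\<And>b. b \<in> B \<Longrightarrow> z b = z' b"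
  then have "lattice_point z = lattice_point z'"
    unfolding lattice_point_def by (intro sum.cong) auto
  then show "\<tau> (lattice_point z) x = \<tau> (lattice_point z') x" by simp
qed

lemma cube_packing_cylinders:
  assumes I: "cube_packing B N I"
  shows "i \<in> I \<Longrightarrow> cylinder (lattice_point (fst i)) (real (snd i)) H \<subseteq> cylinder 0 (real N) H"
    and "disjoint_family_on (\<lambda>i. cylinder (lattice_point (fst i)) (real (snd i)) H) I"
proof -
  assume i: "i \<in> I"
  show "cylinder (lattice_point (fst i)) (real (snd i)) H \<subseteq> cylinder 0 (real N) H"
  proof (rule cylinder_subset)
    fix b assume b: "b \<in> B"
    have "\<bar>fst i b\<bar> + int (snd i) \<le> int N" using I i b by (auto simp: cube_packing_def)
    then have "real_of_int (\<bar>fst i b\<bar> + int (snd i)) \<le> real_of_int (int N)"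
      by (simp only: of_int_le_iff)
    then show "\<bar>(lattice_point (fst i) - 0) \<bullet> b\<bar> + real (snd i) \<le> real N"
      using lattice_point_inner[OF b] by simp
  qed simp
next
  show "disjoint_family_on (\<lambda>i. cylinder (lattice_point (fst i)) (real (snd i)) H) I"
    unfolding disjoint_family_on_def
  proof (intro ballI impI)
    fix i j assume "i \<in> I" "j \<in> I" "i \<noteq> j"
    then have "separated_cubes B i j" using I by (auto simp: cube_packing_def pairwise_def)
    then obtain b where b: "b \<in> B" "int (snd i + snd j) \<le> \<bar>fst i b - fst j b\<bar>"
      by (auto simp: separated_cubes_def case_prod_unfold)
    from b(2) have "real_of_int (int (snd i + snd j)) \<le> real_of_int \<bar>fst i b - fst j b\<bar>"
      by (simp only: of_int_le_iff)
    then show "cylinder (lattice_point (fst i)) (real (snd i)) H \<inter> cylinder (lattice_point (fst j)) (real (snd j)) H = {}"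
      using lattice_point_inner[OF b(1)]
      by (intro cylinder_disjoint[OF b(1)]) (simp add: inner_diff_left)
  qed
qed

lemma subadditive_process_cell_energy:
  assumes H: "open H" and meas: "\<And>N. (\<lambda>\<omega>. cell_energy \<omega> 0 (real N) H) \<in> borel_measurable M"
  shows "subadditive_process M (\<lambda>z. \<tau> (lattice_point z)) B (\<lambda>N \<omega>. cell_energy \<omega> 0 (real N) H) (unit_profile_energy H)"
proof (rule subadditive_process.intro[OF lattice_action_tau], unfold_locales)
  show "cell_energy \<omega> 0 (real N) H \<le> unit_profile_energy H * (2 * real N) ^ card B"
    if "\<omega> \<in> space M" for N \<omega>
    using cell_energy_le[OF that H, of 0 "real N"] by (simp add: cell_profile_energy_nat)
  fix \<omega> N and I :: "(('d \<Rightarrow> int) \<times> nat) set"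
  assume \<omega>: "\<omega> \<in> space M" and I: "cube_packing B N I"
  have "cell_energy \<omega> 0 (real N) H \<le> (\<Sum>i\<in>I. cell_energy \<omega> (lattice_point (fst i)) (real (snd i)) H)
      + (cell_profile_energy (real N) H - (\<Sum>i\<in>I. cell_profile_energy (real (snd i)) H))"
    using I
    by (intro cell_energy_subadditive \<omega> H cube_packing_cylinders[OF I] lattice_point_inner_e) (simp_all add: cube_packing_def)
  also have "(\<Sum>i\<in>I. cell_energy \<omega> (lattice_point (fst i)) (real (snd i)) H)
      = (\<Sum>i\<in>I. cell_energy (\<tau> (lattice_point (fst i)) \<omega>) 0 (real (snd i)) H)"
    by (simp only: cell_energy_translate[OF \<omega> lattice_point_inner_e H])
  finally show "cell_energy \<omega> 0 (real N) H \<le> (\<Sum>(z, r)\<in>I. cell_energy (\<tau> (lattice_point z) \<omega>) 0 (real r) H)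
      + unit_profile_energy H * ((2 * real N) ^ card B - (\<Sum>(z, r)\<in>I. (2 * real r) ^ card B))"
    by (simp add: case_prod_beta cell_profile_energy_nat right_diff_distrib sum_distrib_left)
qed (rule meas unit_profile_energy_nonneg cell_energy_nonneg)+

lemmas prism_process = subadditive_process_cell_energy[OF open_UNIV cell_energy_measurable_UNIV]
lemmas window_process = subadditive_process_cell_energy[OF open_greaterThanLessThan cell_energy_measurable_window]

section \<open>The limit\<close>

abbreviation cell_average :: "real set \<Rightarrow> nat \<Rightarrow> 'w \<Rightarrow> real" where
  "cell_average H N \<omega> \<equiv> cell_energy \<omega> 0 (real N) H / (2 * real N) ^ card B"

definition upper :: "real set \<Rightarrow> 'w \<Rightarrow> ennreal" where
  "upper H \<omega> = limsup (\<lambda>N. ennreal (cell_average H N \<omega>))"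

definition lower :: "real set \<Rightarrow> 'w \<Rightarrow> ennreal" where
  "lower H \<omega> = liminf (\<lambda>N. ennreal (cell_average H N \<omega>))"

definition upper_tail :: "'w \<Rightarrow> ennreal" where
  "upper_tail \<omega> = (INF h::nat. upper (window (real h)) \<omega> + ennreal (tail_energy (real h)))"

lemma upper_measurable [measurable]:
  "upper (window h) \<in> borel_measurable M" "upper UNIV \<in> borel_measurable M" "lower UNIV \<in> borel_measurable M"
  "upper_tail \<in> borel_measurable M"
proof -
  show window: "upper (window h) \<in> borel_measurable M" for h unfolding upper_def by measurable
  show "upper UNIV \<in> borel_measurable M" "lower UNIV \<in> borel_measurable M"
    unfolding upper_def lower_def by measurable
  show "upper_tail \<in> borel_measurable M" unfolding upper_tail_def
    using window by (intro borel_measurable_INF borel_measurable_add borel_measurable_const) auto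
qed

lemma upper_lower_tau_orth_le:
  assumes \<omega>: "\<omega> \<in> space M" and x: "x \<bullet> e = 0" and H: "open H"
  shows "upper H (\<tau> x \<omega>) \<le> upper H \<omega>" "lower H (\<tau> x \<omega>) \<le> lower H \<omega>"
proof -
  define k where "k = nat \<lceil>norm x\<rceil>"
  have k: "\<bar>x \<bullet> b\<bar> \<le> real k" if "b \<in> B" for b
    using Cauchy_Schwarz_ineq2[of x b] B_norm[OF that] by (simp add: k_def) linarith
  have cell_energy_le: "cell_energy (\<tau> x \<omega>) 0 (real (N + k)) H
      \<le> cell_energy \<omega> 0 (real N) H
      + unit_profile_energy H * ((2 * real (N + k)) ^ card B - (2 * real N) ^ card B)" for N
  proof -
    have "cell_energy (\<tau> x \<omega>) 0 (real (N + k)) H = cell_energy \<omega> x (real (N + k)) H"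
      by (rule cell_energy_translate[OF \<omega> x H])
    also have "\<dots> \<le> cell_energy \<omega> 0 (real N) H
      + (cell_profile_energy (real (N + k)) H - cell_profile_energy (real N) H)"
      using k x by (intro cell_energy_mono[OF \<omega> H H]) (auto simp: inner_minus_left)
    finally show ?thesis by (simp only: cell_profile_energy_nat right_diff_distrib)
  qed
  show "upper H (\<tau> x \<omega>) \<le> upper H \<omega>"
    unfolding upper_def by (rule limsup_shifted_quotient_le[OF cell_energy_nonneg cell_energy_le])
  show "lower H (\<tau> x \<omega>) \<le> lower H \<omega>"
    unfolding lower_def by (rule liminf_shifted_quotient_le[OF cell_energy_nonneg cell_energy_le])
qed

lemma upper_tau_e_le:
  assumes \<omega>: "\<omega> \<in> space M"
  shows "upper UNIV (\<tau> (s *\<^sub>R e) \<omega>) \<le> upper UNIV \<omega>"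
proof -
  obtain C where C: "0 \<le> C" "\<And>\<rho>. min_energy (\<tau> (s *\<^sub>R e) \<omega>) (prism 0 (\<rho> + 1))
      \<le> min_energy \<omega> (prism 0 \<rho>) + ennreal C * emeasure profile_measure (prism 0 (\<rho> + 1) - prism 0 \<rho>)"
    using min_energy_translate_e_le[of s] \<omega> by blast
  have "cell_energy (\<tau> (s *\<^sub>R e) \<omega>) 0 (real (N + 1)) UNIV
      \<le> cell_energy \<omega> 0 (real N) UNIV
      + C * unit_profile_energy UNIV * ((2 * real (N + 1)) ^ card B - (2 * real N) ^ card B)" for N
  proof -
    let ?t = "cell_profile_energy (real N + 1) UNIV - cell_profile_energy (real N) UNIV"
    have t: "0 \<le> ?t" using cell_profile_energy_mono[of "real N" "real N + 1" UNIV] by simp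
    have "prism 0 (real N) \<subseteq> prism 0 (real N + 1)" by (rule cylinder_subset) auto
    then have ring: "emeasure profile_measure (prism 0 (real N + 1) - prism 0 (real N)) = ennreal ?t"
      using emeasure_profile_measure_uncovered(1)[of "{()}" UNIV 0 "\<lambda>_. UNIV" "\<lambda>_. 0" "\<lambda>_. real N"]
      by (simp add: disjoint_family_on_def)
    have "ennreal (cell_energy (\<tau> (s *\<^sub>R e) \<omega>) 0 (real N + 1) UNIV)
      \<le> ennreal (cell_energy \<omega> 0 (real N) UNIV) + ennreal C * ennreal ?t"
      using C(2)[of "real N"] by (simp add: ring ennreal_cell_energy \<omega> tau_space)
    also have "\<dots> = ennreal (cell_energy \<omega> 0 (real N) UNIV + C * ?t)"
      using C(1) t by (simp add: ennreal_mult' ennreal_plus cell_energy_nonneg)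
    finally have "cell_energy (\<tau> (s *\<^sub>R e) \<omega>) 0 (real N + 1) UNIV \<le> cell_energy \<omega> 0 (real N) UNIV + C * ?t"
      using C(1) t cell_energy_nonneg by (subst (asm) ennreal_le_iff) auto
    then show ?thesis
      using cell_profile_energy_nat[of N UNIV] cell_profile_energy_nat[of "N + 1" UNIV]
      by (simp add: right_diff_distrib mult.assoc add.commute)
  qed
  then show ?thesis unfolding upper_def by (rule limsup_shifted_quotient_le[OF cell_energy_nonneg])
qed

lemma invariant_eq_if_le:
  fixes f :: "'w \<Rightarrow> ennreal"
  assumes f_le: "\<And>x \<omega>. x \<in> S \<Longrightarrow> \<omega> \<in> space M \<Longrightarrow> f (\<tau> x \<omega>) \<le> f \<omega>" and S: "x \<in> S" "- x \<in> S" and \<omega>: "\<omega> \<in> space M"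
  shows "f (\<tau> x \<omega>) = f \<omega>"
proof (rule antisym[OF f_le[OF S(1) \<omega>]])
  have "\<tau> (- x) (\<tau> x \<omega>) = \<omega>" using tau_add[OF \<omega>, of "- x" x] tau_0[OF \<omega>] by simp
  then show "f \<omega> \<le> f (\<tau> x \<omega>)" using f_le[OF S(2) tau_space[OF \<omega>, of x]] by simp
qed

lemma upper_UNIV_tau: "\<omega> \<in> space M \<Longrightarrow> upper UNIV (\<tau> x \<omega>) = upper UNIV \<omega>"
proof (rule invariant_eq_if_le[where S=UNIV and x=x])
  fix x \<omega> assume \<omega>: "\<omega> \<in> space M"
  let ?y = "x - (x \<bullet> e) *\<^sub>R e"
  have y_orth: "?y \<bullet> e = 0" by (simp add: inner_diff_left)
  have "\<tau> x \<omega> = \<tau> ?y (\<tau> ((x \<bullet> e) *\<^sub>R e) \<omega>)" using tau_add[OF \<omega>, of ?y "(x \<bullet> e) *\<^sub>R e"] by simp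
  then show "upper UNIV (\<tau> x \<omega>) \<le> upper UNIV \<omega>"
    using upper_lower_tau_orth_le(1)[OF tau_space[OF \<omega>] y_orth open_UNIV] upper_tau_e_le[OF \<omega>]
    by (simp only:) (rule order_trans)
qed auto

lemma
  assumes \<omega>: "\<omega> \<in> space M" and x: "x \<bullet> e = 0"
  shows lower_tau_orth: "open H \<Longrightarrow> lower H (\<tau> x \<omega>) = lower H \<omega>"
    and upper_tail_tau_orth: "upper_tail (\<tau> x \<omega>) = upper_tail \<omega>"
proof -
  show "lower H (\<tau> x \<omega>) = lower H \<omega>" if "open H" for H
    by (rule invariant_eq_if_le[where S="{x. x \<bullet> e = 0}"]) (use upper_lower_tau_orth_le(2) that x \<omega> in auto)
  have "upper (window h) (\<tau> x \<omega>) = upper (window h) \<omega>" for h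
    by (rule invariant_eq_if_le[where S="{x. x \<bullet> e = 0}"]) (use upper_lower_tau_orth_le(1) x \<omega> in auto)
  then show "upper_tail (\<tau> x \<omega>) = upper_tail \<omega>" unfolding upper_tail_def by simp
qed

lemma upper_UNIV_le_upper_tail:
  assumes \<omega>: "\<omega> \<in> space M"
  shows "upper UNIV \<omega> \<le> upper_tail \<omega>"
  unfolding upper_tail_def
proof (rule INF_greatest)
  fix h :: nat
  have "\<forall>\<^sub>F N in sequentially. ennreal (cell_average UNIV N \<omega>)
    \<le> ennreal (cell_average (window (real h)) N \<omega>) + ennreal (tail_energy (real h))"
    using eventually_ge_at_top[of 1]
  proof eventually_elim
    case (elim N)
    then show ?case using normalised_cell_energy_tail_le[OF \<omega>, of "2 * real N" UNIV "real h"]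
      by (intro order_trans[OF ennreal_leI ennreal_add_le]) simp
  qed
  then have "upper UNIV \<omega> \<le> limsup (\<lambda>N. ennreal (cell_average (window (real h)) N \<omega>) + ennreal (tail_energy (real h)))"
    unfolding upper_def by (rule Limsup_mono)
  also have "\<dots> \<le> limsup (\<lambda>N. ennreal (cell_average (window (real h)) N \<omega>))
    + limsup (\<lambda>_::nat. ennreal (tail_energy (real h)))"
    by (rule Limsup_ennreal_add_le)
  finally show "upper UNIV \<omega> \<le> upper (window (real h)) \<omega> + ennreal (tail_energy (real h))"
    by (simp add: upper_def Limsup_const)
qed

definition rate :: real where
  "rate = (INF k\<in>{1..}. (\<integral>\<omega>. cell_energy \<omega> 0 (real k) UNIV \<partial>M) / (2 * real k) ^ card B)"

lemma rate_nonneg: "0 \<le> rate"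
  unfolding rate_def
  by (intro cINF_greatest divide_nonneg_nonneg integral_nonneg) (auto simp: cell_energy_nonneg)

lemma rate_mult_le: "1 \<le> k \<Longrightarrow> rate * (2 * real k) ^ card B \<le> (\<integral>\<omega>. cell_energy \<omega> 0 (real k) UNIV \<partial>M)"
proof -
  assume k: "1 \<le> k"
  have "rate \<le> (\<integral>\<omega>. cell_energy \<omega> 0 (real k) UNIV \<partial>M) / (2 * real k) ^ card B"
    unfolding rate_def
    by (rule cINF_lower) (use k in \<open>auto intro!: bdd_belowI2[of _ 0] divide_nonneg_nonneg integral_nonneg simp: cell_energy_nonneg\<close>)
  then show ?thesis using k by (simp add: pos_le_divide_eq)
qed

lemma nn_integral_cell_average:
  "(\<integral>\<^sup>+\<omega>. ennreal (cell_average UNIV k \<omega>) \<partial>M)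
  = ennreal ((\<integral>\<omega>. cell_energy \<omega> 0 (real k) UNIV \<partial>M) / (2 * real k) ^ card B)"
proof -
  have "(\<integral>\<^sup>+\<omega>. ennreal (cell_average UNIV k \<omega>) \<partial>M) = ennreal (\<integral>\<omega>. cell_average UNIV k \<omega> \<partial>M)"
    using subadditive_process.X_integrable[OF prism_process, of k]
    by (intro nn_integral_eq_integral integrable_divide_zero) (auto intro!: AE_I2 simp: cell_energy_nonneg)
  then show ?thesis by simp
qed

lemma nn_integral_window_average_tendsto:
  assumes k: "1 \<le> k"
  shows "(\<lambda>n. \<integral>\<^sup>+\<omega>. ennreal (cell_average (window (real n)) k \<omega>) \<partial>M)
    \<longlonglongrightarrow> (\<integral>\<^sup>+\<omega>. ennreal (cell_average UNIV k \<omega>) \<partial>M)"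
proof (rule nn_integral_dominated_convergence[where w="\<lambda>_. ennreal (unit_profile_energy UNIV)"])
  show "AE \<omega> in M. (\<lambda>n. ennreal (cell_average (window (real n)) k \<omega>)) \<longlonglongrightarrow> ennreal (cell_average UNIV k \<omega>)"
    using k by (intro AE_I2 tendsto_ennrealI tendsto_divide cell_energy_tendsto tendsto_const) auto
  have "unit_profile_energy (window (real n)) \<le> unit_profile_energy UNIV" for n
    unfolding unit_profile_energy_def
    by (intro mult_left_mono line.finite_measure_mono) (auto simp: unit_cross_volume_nonneg)
  then show "AE \<omega> in M. ennreal (cell_average (window (real n)) k \<omega>)
    \<le> ennreal (unit_profile_energy UNIV)" for n
    using subadditive_process.average_bounds[OF window_process]
    by (intro AE_I2 ennreal_leI) (blast intro: order_trans)
  show "(\<integral>\<^sup>+\<omega>. ennreal (unit_profile_energy UNIV) \<partial>M) < \<infinity>" by (simp add: emeasure_space_1)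
qed measurable

lemma nn_integral_upper_tail_le_average:
  assumes k: "1 \<le> k"
  shows "(\<integral>\<^sup>+\<omega>. upper_tail \<omega> \<partial>M) \<le> (\<integral>\<^sup>+\<omega>. ennreal (cell_average UNIV k \<omega>) \<partial>M)"
proof (rule LIMSEQ_le_const)
  let ?I = "\<lambda>h::nat. \<integral>\<^sup>+\<omega>. ennreal (cell_average (window (real h)) k \<omega>) \<partial>M"
  have "(\<lambda>h. ennreal (tail_energy (real h))) \<longlonglongrightarrow> ennreal 0"
    by (intro tendsto_ennrealI filterlim_compose[OF tail_energy_tendsto_0 filterlim_real_sequentially])
  from tendsto_add[OF nn_integral_window_average_tendsto[OF k] this]
  show "(\<lambda>h. ?I h + ennreal (tail_energy (real h))) \<longlonglongrightarrow> (\<integral>\<^sup>+\<omega>. ennreal (cell_average UNIV k \<omega>) \<partial>M)"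
    by simp
  have "(\<integral>\<^sup>+\<omega>. upper_tail \<omega> \<partial>M) \<le> ?I h + ennreal (tail_energy (real h))" for h
  proof -
    have "(\<integral>\<^sup>+\<omega>. upper_tail \<omega> \<partial>M) \<le> (\<integral>\<^sup>+\<omega>. upper (window (real h)) \<omega> + ennreal (tail_energy (real h)) \<partial>M)"
      unfolding upper_tail_def by (intro nn_integral_mono INF_lower) simp
    also have "\<dots> = (\<integral>\<^sup>+\<omega>. upper (window (real h)) \<omega> \<partial>M) + ennreal (tail_energy (real h))"
      by (subst nn_integral_add) (auto simp: emeasure_space_1)
    also have "\<dots> \<le> ?I h + ennreal (tail_energy (real h))"
      unfolding upper_def
      by (intro add_right_mono subadditive_process.nn_integral_limsup_le[OF window_process k])
    finally show ?thesis .
  qed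
  then show "\<exists>N. \<forall>h\<ge>N. (\<integral>\<^sup>+\<omega>. upper_tail \<omega> \<partial>M) \<le> ?I h + ennreal (tail_energy (real h))" by blast
qed

lemma nn_integral_upper_tail_le: "(\<integral>\<^sup>+\<omega>. upper_tail \<omega> \<partial>M) \<le> ennreal rate"
proof -
  let ?t = "\<integral>\<^sup>+\<omega>. upper_tail \<omega> \<partial>M"
  have mean_ge: "?t \<le> ennreal ((\<integral>\<omega>. cell_energy \<omega> 0 (real k) UNIV \<partial>M) / (2 * real k) ^ card B)"
    if "1 \<le> k" for k
    using nn_integral_upper_tail_le_average[OF that] by (simp only: nn_integral_cell_average)
  have "enn2real ?t \<le> rate"
    unfolding rate_def
  proof (rule cINF_greatest)
    fix k :: nat assume "k \<in> {1..}"
    then show "enn2real ?t \<le> (\<integral>\<omega>. cell_energy \<omega> 0 (real k) UNIV \<partial>M) / (2 * real k) ^ card B"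
      using mean_ge[of k]
      by (intro enn2real_leI divide_nonneg_nonneg integral_nonneg) (auto simp: cell_energy_nonneg)
  qed auto
  then have "ennreal (enn2real ?t) \<le> ennreal rate" by (rule ennreal_leI)
  moreover have "?t < \<top>" using mean_ge[of 1] by (rule order_le_less_trans) simp_all
  ultimately show ?thesis by simp
qed

lemma rate_le_nn_integral_upper: "ennreal rate \<le> (\<integral>\<^sup>+\<omega>. upper UNIV \<omega> \<partial>M)"
proof -
  have "\<forall>\<^sub>F N in sequentially. ennreal rate \<le> (\<integral>\<^sup>+\<omega>. ennreal (cell_average UNIV N \<omega>) \<partial>M)"
    using eventually_ge_at_top[of 1]
  proof eventually_elim
    case (elim N)
    show ?case
      unfolding nn_integral_cell_average
      using rate_mult_le[OF elim] elim by (intro ennreal_leI) (simp add: pos_le_divide_eq)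
  qed
  then have "ennreal rate \<le> liminf (\<lambda>N. \<integral>\<^sup>+\<omega>. ennreal (cell_average UNIV N \<omega>) \<partial>M)"
    by (rule Liminf_bounded)
  also have "\<dots> \<le> limsup (\<lambda>N. \<integral>\<^sup>+\<omega>. ennreal (cell_average UNIV N \<omega>) \<partial>M)"
    by (rule Liminf_le_Limsup) simp
  also have "\<dots> \<le> (\<integral>\<^sup>+\<omega>. upper UNIV \<omega> \<partial>M)" unfolding upper_def
  proof (rule nn_integral_limsup[where w="\<lambda>_. ennreal (unit_profile_energy UNIV)"])
    show "AE \<omega> in M. ennreal (cell_average UNIV N \<omega>) \<le> ennreal (unit_profile_energy UNIV)" for N
      using subadditive_process.average_bounds[OF prism_process] by (intro AE_I2 ennreal_leI) blast
    show "(\<integral>\<^sup>+\<omega>. ennreal (unit_profile_energy UNIV) \<partial>M) < \<infinity>" by (simp add: emeasure_space_1)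
  qed measurable
  finally show ?thesis .
qed

lemma AE_rate_le_upper:
  assumes ergodic: "\<And>E. E \<in> sets M \<Longrightarrow> (\<forall>x. \<tau> x -` E \<inter> space M = E) \<Longrightarrow> measure M E = 0 \<or> measure M E = 1"
  shows "AE \<omega> in M. ennreal rate \<le> upper UNIV \<omega>"
proof -
  let ?E = "{\<omega> \<in> space M. upper UNIV \<omega> < ennreal rate}"
  have E: "?E \<in> sets M" by measurable
  have "\<forall>x. \<tau> x -` ?E \<inter> space M = ?E" using upper_UNIV_tau tau_space by auto
  with ergodic[OF E] consider "measure M ?E = 0" | "measure M ?E = 1" by blast
  then show ?thesis
  proof cases
    assume "measure M ?E = 0"
    then show ?thesis using prob_Collect_eq_0[OF E] by (simp add: not_less)
  next
    assume "measure M ?E = 1"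
    then have upper_less: "AE \<omega> in M. upper UNIV \<omega> < ennreal rate"
      using prob_Collect_eq_1[OF E] by simp
    show ?thesis
    proof (rule AE_ge_if_nn_integral_le)
      show "AE \<omega> in M. upper UNIV \<omega> \<le> ennreal rate"
        using upper_less by eventually_elim (rule less_imp_le)
      show "(\<integral>\<^sup>+\<omega>. ennreal rate \<partial>M) \<le> (\<integral>\<^sup>+\<omega>. upper UNIV \<omega> \<partial>M)"
        using rate_le_nn_integral_upper by (simp add: emeasure_space_1)
      have "(\<integral>\<^sup>+\<omega>. upper UNIV \<omega> \<partial>M) \<le> (\<integral>\<^sup>+\<omega>. ennreal rate \<partial>M)"
        using upper_less by (intro nn_integral_mono_AE) (auto elim!: eventually_mono)
      then show "(\<integral>\<^sup>+\<omega>. upper UNIV \<omega> \<partial>M) \<noteq> \<infinity>" by (auto simp: emeasure_space_1 top_unique)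
    qed measurable
  qed
qed

definition typical_event :: "'w set" where
  "typical_event = {\<omega> \<in> space M. ennreal rate \<le> lower UNIV \<omega> \<and> upper_tail \<omega> \<le> ennreal rate}"

lemma typical_event_measurable [measurable]: "typical_event \<in> sets M"
  unfolding typical_event_def by measurable

lemma typical_event_in_Sigma_e: "typical_event \<in> Sigma_e M \<tau> e"
proof -
  have "\<tau> x -` typical_event \<inter> space M = typical_event" if "x \<bullet> e = 0" for x
    using lower_tau_orth[OF _ that open_UNIV] upper_tail_tau_orth[OF _ that] tau_space
    by (auto simp: typical_event_def)
  then show ?thesis unfolding Sigma_e_def by (intro sigma_sets.Basic) simp
qed

lemma measure_typical_event:
  assumes ergodic: "\<And>E. E \<in> sets M \<Longrightarrow> (\<forall>x. \<tau> x -` E \<inter> space M = E) \<Longrightarrow> measure M E = 0 \<or> measure M E = 1"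
  shows "measure M typical_event = 1"
proof -
  have rate_le: "AE \<omega> in M. ennreal rate \<le> upper UNIV \<omega>" by (rule AE_rate_le_upper) (rule ergodic)
  have tail_le: "AE \<omega> in M. upper_tail \<omega> \<le> ennreal rate"
  proof (rule AE_ge_if_nn_integral_le)
    show "AE \<omega> in M. ennreal rate \<le> upper_tail \<omega>"
      using rate_le AE_space by eventually_elim (rule order_trans[OF _ upper_UNIV_le_upper_tail])
    show "(\<integral>\<^sup>+\<omega>. upper_tail \<omega> \<partial>M) \<le> (\<integral>\<^sup>+\<omega>. ennreal rate \<partial>M)"
      using nn_integral_upper_tail_le by (simp add: emeasure_space_1)
    show "(\<integral>\<^sup>+\<omega>. ennreal rate \<partial>M) \<noteq> \<infinity>" by (simp add: emeasure_space_1)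
  qed measurable
  then have "AE \<omega> in M. upper UNIV \<omega> \<le> ennreal rate"
    using AE_space by eventually_elim (rule order_trans[OF upper_UNIV_le_upper_tail])
  then have "AE \<omega> in M. ennreal rate \<le> lower UNIV \<omega>"
    unfolding upper_def lower_def
    by (intro subadditive_process.AE_liminf_ge[OF prism_process] rate_nonneg rate_mult_le)
  with tail_le have "AE \<omega> in M. ennreal rate \<le> lower UNIV \<omega> \<and> upper_tail \<omega> \<le> ennreal rate"
    by eventually_elim simp
  then show ?thesis
    using typical_event_measurable unfolding typical_event_def by (simp add: prob_Collect_eq_1)
qed

lemma cell_energy_radius_mono:
  "\<omega> \<in> space M \<Longrightarrow> open H \<Longrightarrow> \<rho> \<le> \<rho>' \<Longrightarrow>
    cell_energy \<omega> 0 \<rho>' H \<le> cell_energy \<omega> 0 \<rho> H + (cell_profile_energy \<rho>' H - cell_profile_energy \<rho> H)"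
  by (rule cell_energy_mono) auto

lemma Limsup_normalised_cell_energy_le:
  assumes "\<omega> \<in> space M" "open H"
  shows "Limsup at_top (\<lambda>R. ennreal (cell_energy \<omega> 0 (R / 2) H / R ^ card B)) \<le> upper H \<omega>"
  unfolding upper_def
  by (rule Limsup_quotient_le_limsup[OF cell_energy_nonneg cell_energy_radius_mono[OF assms] cell_profile_energy_mono cell_profile_energy_nat])

lemma lower_le_Liminf_normalised_cell_energy:
  assumes "\<omega> \<in> space M" "open H"
  shows "lower H \<omega> \<le> Liminf at_top (\<lambda>R. ennreal (cell_energy \<omega> 0 (R / 2) H / R ^ card B))"
  unfolding lower_def
  by (rule liminf_le_Liminf_quotient[OF cell_energy_nonneg cell_energy_radius_mono[OF assms] cell_profile_energy_mono cell_profile_energy_nat])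

lemma normalised_prism_energy_tendsto:
  assumes "\<omega> \<in> typical_event"
  shows "((\<lambda>R. ennreal (cell_energy \<omega> 0 (R / 2) UNIV / R ^ card B)) \<longlongrightarrow> ennreal rate) at_top"
proof (rule tendsto_iff_Liminf_eq_Limsup[THEN iffD2])
  let ?f = "\<lambda>R. ennreal (cell_energy \<omega> 0 (R / 2) UNIV / R ^ card B)"
  have \<omega>: "\<omega> \<in> space M" using assms by (simp add: typical_event_def)
  have "ennreal rate \<le> Liminf at_top ?f"
    using assms lower_le_Liminf_normalised_cell_energy[OF \<omega> open_UNIV]
    by (auto simp: typical_event_def)
  moreover have "Limsup at_top ?f \<le> ennreal rate"
    using assms Limsup_normalised_cell_energy_le[OF \<omega> open_UNIV] upper_UNIV_le_upper_tail[OF \<omega>]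
    by (auto simp: typical_event_def)
  moreover have "Liminf at_top ?f \<le> Limsup at_top ?f" by (rule Liminf_le_Limsup) simp
  ultimately show "Liminf at_top ?f = ennreal rate \<and> Limsup at_top ?f = ennreal rate"
    by (meson antisym order_trans)
qed simp

lemma normalised_energy_le_window:
  assumes "\<omega> \<in> space M" and "1 \<le> R" "open H" "window h \<subseteq> H"
  shows "ennreal (cell_energy \<omega> 0 (R / 2) H / R ^ card B)
      \<le> ennreal (cell_energy \<omega> 0 (R / 2) (window h) / R ^ card B) + ennreal (tail_energy h)"
  by (rule order_trans[OF ennreal_leI[OF normalised_cell_energy_tail_le[OF assms]] ennreal_add_le])

lemma eventually_normalised_window_energy_gt:
  assumes typical: "\<omega> \<in> typical_event" and a: "a < ennreal rate"
  shows "\<forall>\<^sub>F (R, h) in at_top \<times>\<^sub>F at_top. a < ennreal (cell_energy \<omega> 0 (R / 2) (window h) / R ^ card B)"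
proof -
  obtain a' where a': "a < a'" "a' < ennreal rate" using dense a by blast
  have "((\<lambda>h. a + ennreal (tail_energy h)) \<longlongrightarrow> a + ennreal 0) at_top"
    by (intro tendsto_intros tendsto_ennrealI tail_energy_tendsto_0)
  then have "\<forall>\<^sub>F h in at_top. a + ennreal (tail_energy h) < a'"
    using a'(1) by (intro order_tendstoD(2)) simp_all
  moreover have "\<forall>\<^sub>F R in at_top. 1 \<le> R \<and> a' < ennreal (cell_energy \<omega> 0 (R / 2) UNIV / R ^ card B)"
    using eventually_ge_at_top order_tendstoD(1)[OF normalised_prism_energy_tendsto[OF typical] a'(2)] by (rule eventually_conj)
  ultimately have "\<forall>\<^sub>F p in at_top \<times>\<^sub>F at_top. (1 \<le> fst p \<and> a' < ennreal (cell_energy \<omega> 0 (fst p / 2) UNIV / fst p ^ card B))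
      \<and> a + ennreal (tail_energy (snd p)) < a'" by (intro eventually_prodI)
  then show ?thesis
  proof eventually_elim
    case (elim p)
    have "a + ennreal (tail_energy (snd p)) < a'" using elim by blast
    also have "a' < ennreal (cell_energy \<omega> 0 (fst p / 2) UNIV / fst p ^ card B)" using elim by blast
    also have "\<dots> \<le> ennreal (cell_energy \<omega> 0 (fst p / 2) (window (snd p)) / fst p ^ card B)
      + ennreal (tail_energy (snd p))"
      using typical elim by (intro normalised_energy_le_window) (auto simp: typical_event_def)
    finally have "a < ennreal (cell_energy \<omega> 0 (fst p / 2) (window (snd p)) / fst p ^ card B)"
      by (meson add_right_mono not_le)
    then show ?case by (simp add: case_prod_unfold)
  qed
qed

lemma eventually_normalised_window_energy_lt:
  assumes typical: "\<omega> \<in> typical_event" and a: "ennreal rate < a"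
  shows "\<forall>\<^sub>F (R, h) in at_top \<times>\<^sub>F at_top. ennreal (cell_energy \<omega> 0 (R / 2) (window h) / R ^ card B) < a"
proof -
  let ?f = "\<lambda>R h. ennreal (cell_energy \<omega> 0 (R / 2) (window h) / R ^ card B)"
  have \<omega>: "\<omega> \<in> space M" using typical by (simp add: typical_event_def)
  have "upper_tail \<omega> < a" using typical a by (auto simp: typical_event_def)
  then obtain h\<^sub>0 :: nat where h\<^sub>0: "upper (window (real h\<^sub>0)) \<omega> + ennreal (tail_energy (real h\<^sub>0)) < a"
    unfolding upper_tail_def INF_less_iff by blast
  have "Limsup at_top (\<lambda>R. ?f R (real h\<^sub>0) + ennreal (tail_energy (real h\<^sub>0)))
      \<le> Limsup at_top (\<lambda>R. ?f R (real h\<^sub>0)) + Limsup at_top (\<lambda>_::real. ennreal (tail_energy (real h\<^sub>0)))"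
    by (rule Limsup_ennreal_add_le)
  also have "\<dots> \<le> upper (window (real h\<^sub>0)) \<omega> + ennreal (tail_energy (real h\<^sub>0))"
    using Limsup_normalised_cell_energy_le[OF \<omega> open_greaterThanLessThan]
    by (simp add: Limsup_const add_right_mono)
  also note h\<^sub>0
  finally have "\<forall>\<^sub>F R in at_top. ?f R (real h\<^sub>0) + ennreal (tail_energy (real h\<^sub>0)) < a"
    by (rule Limsup_lessD)
  with eventually_ge_at_top have "\<forall>\<^sub>F R in at_top. 1
    \<le> R \<and> ?f R (real h\<^sub>0) + ennreal (tail_energy (real h\<^sub>0)) < a" by (rule eventually_conj)
  then have "\<forall>\<^sub>F p in at_top \<times>\<^sub>F at_top. (1 \<le> fst p \<and> ?f (fst p) (real h\<^sub>0) + ennreal (tail_energy (real h\<^sub>0)) < a) \<and> real h\<^sub>0 \<le> snd p"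
    by (intro eventually_prodI eventually_ge_at_top)
  then show ?thesis
  proof eventually_elim
    case (elim p)
    then have "?f (fst p) (snd p) \<le> ?f (fst p) (real h\<^sub>0) + ennreal (tail_energy (real h\<^sub>0))"
      by (intro normalised_energy_le_window \<omega>) auto
    also have "\<dots> < a" using elim by blast
    finally have "?f (fst p) (snd p) < a" .
    then show ?case by (simp add: case_prod_unfold)
  qed
qed

lemma normalised_window_energy_tendsto:
  assumes "\<omega> \<in> typical_event"
  shows "((\<lambda>(R, h). ennreal (cell_energy \<omega> 0 (R / 2) (window h) / R ^ card B)) \<longlongrightarrow> ennreal rate) (at_top \<times>\<^sub>F at_top)"
  using eventually_normalised_window_energy_gt[OF assms] eventually_normalised_window_energy_lt[OF assms]
  by (auto intro!: order_tendstoI simp: case_prod_unfold)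

lemma powr_mult_min_energy:
  assumes "0 < R" "\<omega> \<in> space M" "open H"
  shows "ennreal (R powr (1 - real DIM('d))) * min_energy \<omega> (cylinder 0 (R / 2) H)
    = ennreal (cell_energy \<omega> 0 (R / 2) H / R ^ card B)"
proof -
  have "1 - real DIM('d) = - real (card B)"
    using card_B by (simp add: of_nat_diff DIM_positive Suc_leI)
  then have "R powr (1 - real DIM('d)) = 1 / R ^ card B"
    using assms(1) by (simp only: powr_minus powr_realpow inverse_eq_divide)
  then show ?thesis
    using assms(1)
    by (simp add: cell_energy_nonneg flip: ennreal_mult ennreal_cell_energy[OF assms(2,3) inner_zero_left])
qed

lemma phi_inf_tendsto:
  assumes "Bf e = B" "\<omega> \<in> typical_event"
  shows "((\<lambda>R. ennreal (R powr (1 - real DIM('d))) * phi_inf \<Phi> \<tau> W q Bf \<omega> e R) \<longlongrightarrow> ennreal rate) at_top"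
proof (rule Lim_transform_eventually[OF normalised_prism_energy_tendsto[OF assms(2)]])
  show "\<forall>\<^sub>F R in at_top. ennreal (cell_energy \<omega> 0 (R / 2) UNIV / R ^ card B)
      = ennreal (R powr (1 - real DIM('d))) * phi_inf \<Phi> \<tau> W q Bf \<omega> e R"
    using eventually_gt_at_top[of 0]
  proof eventually_elim
    case (elim R)
    then show ?case
      using assms by (simp add: phi_inf_eq_min_energy powr_mult_min_energy typical_event_def)
  qed
qed

lemma phi_fin_tendsto:
  assumes "Bf e = B" "\<omega> \<in> typical_event"
  shows "((\<lambda>(R, h). ennreal (R powr (1 - real DIM('d))) * phi_fin \<Phi> \<tau> W q Bf \<omega> e R h) \<longlongrightarrow> ennreal rate) (at_top \<times>\<^sub>F at_top)"
proof (rule Lim_transform_eventually[OF normalised_window_energy_tendsto[OF assms(2)]])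
  have "\<forall>\<^sub>F p in (at_top :: real filter) \<times>\<^sub>F (at_top :: real filter). 0 < fst p \<and> True"
    by (intro eventually_prodI eventually_gt_at_top) simp
  then show "\<forall>\<^sub>F p in at_top \<times>\<^sub>F at_top. (case p of (R, h) \<Rightarrow> ennreal (cell_energy \<omega> 0 (R / 2) (window h) / R ^ card B))
      = (case p of (R, h) \<Rightarrow> ennreal (R powr (1 - real DIM('d))) * phi_fin \<Phi> \<tau> W q Bf \<omega> e R h)"
  proof eventually_elim
    case (elim p)
    then show ?case
      using assms
      by (simp add: phi_fin_eq_min_energy powr_mult_min_energy typical_event_def case_prod_unfold)
  qed
qed

theorem phi_limits:
  fixes \<kappa> :: real
  assumes Bf: "Bf e = B" and \<omega>: "\<omega> \<in> typical_event" and \<kappa>: "0 < \<kappa>"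
  defines "f \<equiv> \<lambda>R h. ennreal (R powr (1 - real DIM('d))) * phi_fin \<Phi> \<tau> W q Bf \<omega> e R h"
  shows "((\<lambda>R. ennreal (R powr (1 - real DIM('d))) * phi_inf \<Phi> \<tau> W q Bf \<omega> e R) \<longlongrightarrow> ennreal rate) at_top"
    "((\<lambda>h. Limsup at_top (\<lambda>R. f R h)) \<longlongrightarrow> ennreal rate) at_top"
    "((\<lambda>h. Liminf at_top (\<lambda>R. f R h)) \<longlongrightarrow> ennreal rate) at_top"
    "((\<lambda>R. f R (\<kappa> * R)) \<longlongrightarrow> ennreal rate) at_top"
proof -
  have lim: "((\<lambda>(R, h). f R h) \<longlongrightarrow> ennreal rate) (at_top \<times>\<^sub>F at_top)"
    unfolding f_def by (rule phi_fin_tendsto[where Bf=Bf, OF Bf \<omega>])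
  show "((\<lambda>h. Limsup at_top (\<lambda>R. f R h)) \<longlongrightarrow> ennreal rate) at_top"
    by (rule tendsto_Limsup_if_tendsto_prod[OF lim]) simp
  show "((\<lambda>h. Liminf at_top (\<lambda>R. f R h)) \<longlongrightarrow> ennreal rate) at_top"
    by (rule tendsto_Liminf_if_tendsto_prod[OF lim]) simp
  have "filterlim (\<lambda>R. (R, \<kappa> * R)) (at_top \<times>\<^sub>F at_top) at_top"
    using \<kappa>
    by (intro filterlim_Pair filterlim_ident filterlim_tendsto_pos_mult_at_top[OF tendsto_const])
  from filterlim_compose[OF lim this] show "((\<lambda>R. f R (\<kappa> * R)) \<longlongrightarrow> ennreal rate) at_top" by simp
qed (rule phi_inf_tendsto[where Bf=Bf, OF Bf \<omega>])

end

theorem theorem1p2: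
  fixes M :: "'w measure"
    and \<Phi> :: "'w \<Rightarrow> 'd::euclidean_space \<Rightarrow> real"
    and \<tau> :: "'d \<Rightarrow> 'w \<Rightarrow> 'w"
    and W :: "real \<Rightarrow> real" and q :: "real \<Rightarrow> real"
    and B :: "'d \<Rightarrow> 'd set"
    and lam Lam :: real
  assumes lam_pos: "0 < lam" and Lam_pos: "0 < Lam"
    and P: "prob_space M"
    and Phi_meas: "\<Phi> \<in> M \<rightarrow>\<^sub>M Fmeas lam Lam"
    and tau_meas: "(\<lambda>(x, \<omega>). \<tau> x \<omega>) \<in> (borel \<Otimes>\<^sub>M M) \<rightarrow>\<^sub>M M"
    and tau_add: "\<And>x y \<omega>. \<omega> \<in> space M \<Longrightarrow> \<tau> (x + y) \<omega> = \<tau> x (\<tau> y \<omega>)"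
    and tau_0: "\<And>\<omega>. \<omega> \<in> space M \<Longrightarrow> \<tau> 0 \<omega> = \<omega>"
    and tau_pres: "\<And>x. distr M M (\<tau> x) = M"
    and ergodic: "\<And>E. E \<in> sets M \<Longrightarrow> (\<forall>x. \<tau> x -` E \<inter> space M = E) \<Longrightarrow>
                    measure M E = 0 \<or> measure M E = 1"
    and W_cont: "continuous_on {-1..1} W"
    and W_nonneg: "\<And>s. s \<in> {-1..1} \<Longrightarrow> 0 \<le> W s"
    and W_zero: "\<And>s. s \<in> {-1..1} \<Longrightarrow> W s = 0 \<longleftrightarrow> s = -1 \<or> s = 1"
    and q_smooth: "smooth_fn q"
    and q_range: "\<And>s. -1 \<le> q s \<and> q s \<le> 1"
    and q_energy: "(\<integral>\<^sup>+ s. ennreal (Lam / 2 * (deriv q s)\<^sup>2 + W (q s)) \<partial>lborel) < \<infinity>"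
    and q_top: "(q \<longlongrightarrow> 1) at_top" and q_bot: "(q \<longlongrightarrow> -1) at_bot"
    and B_basis: "\<And>e. e \<in> sphere 0 1 \<Longrightarrow> finite (B e) \<and> card (B e) = DIM('d) - 1 \<and>
                    (\<forall>b\<in>B e. norm b = 1 \<and> b \<bullet> e = 0) \<and>
                    (\<forall>b\<in>B e. \<forall>b'\<in>B e. b \<noteq> b' \<longrightarrow> b \<bullet> b' = 0)"
  shows "\<forall>e\<in>sphere (0::'d) 1. \<exists>\<phi>e::real. \<exists>\<Omega>e \<in> Sigma_e M \<tau> e. measure M \<Omega>e = 1 \<and>
     (\<forall>\<omega>\<in>\<Omega>e. \<forall>\<kappa>>0.
        ((\<lambda>R. ennreal (R powr (1 - real DIM('d))) * phi_inf \<Phi> \<tau> W q B \<omega> e R)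
            \<longlongrightarrow> ennreal \<phi>e) at_top \<and>
        ((\<lambda>h. Limsup at_top (\<lambda>R. ennreal (R powr (1 - real DIM('d))) * phi_fin \<Phi> \<tau> W q B \<omega> e R h))
            \<longlongrightarrow> ennreal \<phi>e) at_top \<and>
        ((\<lambda>h. Liminf at_top (\<lambda>R. ennreal (R powr (1 - real DIM('d))) * phi_fin \<Phi> \<tau> W q B \<omega> e R h))
            \<longlongrightarrow> ennreal \<phi>e) at_top \<and>
        ((\<lambda>R. ennreal (R powr (1 - real DIM('d))) * phi_fin \<Phi> \<tau> W q B \<omega> e R (\<kappa> * R))
            \<longlongrightarrow> ennreal \<phi>e) at_top)"
proof (rule ballI, goal_cases)
  case (1 e)
  interpret medium e "B e" M \<Phi> \<tau> W q lam Lam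
  proof (intro medium.intro medium_axioms.intro)
    show "frame e (B e)" using 1 B_basis[OF 1] by (intro frame.intro) auto
  qed (fact lam_pos Lam_pos P Phi_meas tau_meas tau_add tau_0 tau_pres W_cont W_nonneg q_smooth q_range q_energy)+
  have "measure M typical_event = 1" by (rule measure_typical_event) (rule ergodic)
  then show ?case
    by (intro exI[of _ rate] bexI[OF _ typical_event_in_Sigma_e] conjI ballI allI impI phi_limits[where Bf=B, OF refl])
qed

end
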